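(* The algorithm described below returns a minimal set of representatives of the $R$-linear isomorphism classes in $\mathcal{L}(R,V)$, i.e. every module in $\mathcal{L}(R,V)$ is isomorphic to some module in the output list, and the modules in the output list are pairwise non-isomorphic.
   Context: Let $Z$ be a Dedekind domain with fraction field $Q$, let $K=K_1\oplus\ldots\oplus K_n$ be a direct sum of finite field extensions of $Q$, and let $\mathcal{O}=\mathcal{O}_1\oplus\ldots\oplus\mathcal{O}_n$ be the integral closure of $Z$ in $K$, assumed finitely generated as a $Z$-module. Fix strictly positive integers $s_1,\ldots,s_n$ and put $V=K_1^{s_1}\oplus\ldots\oplus K_n^{s_n}$ with component-wise diagonal $K$-action. Let $R$ be an order in $K$ (a subring which is a full-rank $Z$-lattice), with conductor $\mathfrak{f}=(R:\mathcal{O})=\{x\in K : x\mathcal{O}\subseteq R\}=\mathfrak{f}_1\oplus\ldots\oplus\mathfrak{f}_n$. Let $\mathcal{L}(R,V)$ be the category of sub-$R$-modules of $V$ which are full-rank $Z$-lattices in $V$. Assume: (A) each Picard group $\mathrm{Pic}(\mathcal{O}_i)$ is finite and computable; (B) for each fractional $\mathcal{O}$-ideal $I=I_1\oplus\ldots\oplus I_n$ the quotient $\mathcal{Q}(I)=\big(\bigoplus_i \mathcal{O}_i^{s_i-1}\oplus I_i\big)/\big(\bigoplus_i \mathfrak{f}_i^{s_i-1}\oplus \mathfrak{f}_iI_i\big)$ has finitely many sub-$R$-modules, which can be listed algorithmically; (C) there is an algorithm deciding whether two modules in $\mathcal{L}(R,V)$ are $R$-isomorphic. The algorithm: compute $\mathfrak{f}$;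 compute representatives $I^{(k)}$ of $\mathrm{Pic}(\mathcal{O})=\bigoplus_i\mathrm{Pic}(\mathcal{O}_i)$; form $\mathcal{Q}(\mathcal{O})$ with quotient map $q_\mathcal{O}$; list all sub-$R$-modules $\widetilde M$ of $\mathcal{Q}(\mathcal{O})$ with $\widetilde M\mathcal{O}=\mathcal{Q}(\mathcal{O})$; sieve the preimages $q_\mathcal{O}^{-1}(\widetilde M)$ up to $R$-isomorphism into a list $\mathcal{L}$; for each $k$, choose $I^{(k)}$ coprime to $\mathfrak{f}$, take the induced $R$-linear isomorphism $\widetilde\psi:\mathcal{Q}(\mathcal{O})\to\mathcal{Q}(I^{(k)})$ and append $q_{I^{(k)}}^{-1}(\widetilde\psi(q_\mathcal{O}(M)))$ for every $M\in\mathcal{L}$ to the output list. *)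

theory Defs
  imports
    "HOL-Computational_Algebra.Polynomial"
    "HOL-Library.Function_Algebras"
    "HOL-Library.Set_Algebras"
    "HOL.Hull"
begin

text \<open>
  Rings, ideals and lattices are subsets of one ambient commutative ring, the type \<open>'k\<close>,
  which is the algebra $K$. All of \<open>Z\<close>, \<open>Q\<close>, \<open>R\<close> and the integral closure are subsets of it.
\<close>

definition is_subring :: "'k::comm_ring_1 set \<Rightarrow> bool" where
  "is_subring S \<longleftrightarrow> 1 \<in> S \<and> (\<forall>x\<in>S. \<forall>y\<in>S. x - y \<in> S \<and> x * y \<in> S)"

text \<open>
  The scalar multiplication \<open>sc\<close> is a parameter: it is multiplication for submodules of $K$
  and \<open>smult\<close> below for submodules of $V$.
\<close>

definition submod :: "'k set \<Rightarrow> ('k \<Rightarrow> 'm \<Rightarrow> 'm) \<Rightarrow> 'm::comm_monoid_add set \<Rightarrow> bool" where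
  "submod S sc M \<longleftrightarrow>
     0 \<in> M \<and> (\<forall>x\<in>M. \<forall>y\<in>M. x + y \<in> M) \<and> (\<forall>r\<in>S. \<forall>x\<in>M. sc r x \<in> M)"

definition fin_gen :: "'k set \<Rightarrow> ('k \<Rightarrow> 'm \<Rightarrow> 'm) \<Rightarrow> 'm::comm_monoid_add set \<Rightarrow> bool" where
  "fin_gen S sc M \<longleftrightarrow> (\<exists>B. finite B \<and> M = submod S sc hull B)"

definition mod_iso :: "'k set \<Rightarrow> ('k \<Rightarrow> 'm \<Rightarrow> 'm) \<Rightarrow> 'm::comm_monoid_add set \<Rightarrow> 'm set \<Rightarrow> bool" where
  "mod_iso S sc M N \<longleftrightarrow> (\<exists>\<phi>. bij_betw \<phi> M N \<and>
     (\<forall>x\<in>M. \<forall>y\<in>M. \<phi> (x + y) = \<phi> x + \<phi> y) \<and> (\<forall>r\<in>S. \<forall>x\<in>M. \<phi> (sc r x) = sc r (\<phi> x)))"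

definition integral_over :: "'k::comm_ring_1 set \<Rightarrow> 'k \<Rightarrow> bool" where
  "integral_over Z x \<longleftrightarrow> (\<exists>p. lead_coeff p = 1 \<and> (\<forall>i. coeff p i \<in> Z) \<and> poly p x = 0)"

definition is_fraction_field :: "'k::comm_ring_1 set \<Rightarrow> 'k set \<Rightarrow> bool" where
  "is_fraction_field Z Q \<longleftrightarrow> is_subring Q \<and> Z \<subseteq> Q \<and>
     (\<forall>x\<in>Q. x \<noteq> 0 \<longrightarrow> (\<exists>y\<in>Q. x * y = 1)) \<and>
     (\<forall>x\<in>Q. \<exists>a\<in>Z. \<exists>b\<in>Z. b \<noteq> 0 \<and> b * x = a)"

definition is_ideal :: "'k::comm_ring_1 set \<Rightarrow> 'k set \<Rightarrow> bool" where
  "is_ideal Z I \<longleftrightarrow> I \<subseteq> Z \<and> submod Z (*) I"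

definition is_prime_ideal :: "'k::comm_ring_1 set \<Rightarrow> 'k set \<Rightarrow> bool" where
  "is_prime_ideal Z P \<longleftrightarrow> is_ideal Z P \<and> P \<noteq> Z \<and>
     (\<forall>a\<in>Z. \<forall>b\<in>Z. a * b \<in> P \<longrightarrow> a \<in> P \<or> b \<in> P)"

definition is_maximal_ideal :: "'k::comm_ring_1 set \<Rightarrow> 'k set \<Rightarrow> bool" where
  "is_maximal_ideal Z P \<longleftrightarrow> is_ideal Z P \<and> P \<noteq> Z \<and>
     (\<forall>J. is_ideal Z J \<longrightarrow> P \<subseteq> J \<longrightarrow> J = P \<or> J = Z)"

text \<open>\<open>Q\<close> is meant to be the fraction field of \<open>Z\<close>. Fields count as Dedekind domains.\<close>

definition dedekind_domain :: "'k::comm_ring_1 set \<Rightarrow> 'k set \<Rightarrow> bool" where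
  "dedekind_domain Z Q \<longleftrightarrow> is_subring Z \<and>
     (\<forall>a\<in>Z. \<forall>b\<in>Z. a * b = 0 \<longrightarrow> a = 0 \<or> b = 0) \<and>
     (\<forall>I. is_ideal Z I \<longrightarrow> fin_gen Z (*) I) \<and>
     (\<forall>x\<in>Q. integral_over Z x \<longrightarrow> x \<in> Z) \<and>
     (\<forall>P. is_prime_ideal Z P \<longrightarrow> P \<noteq> {0} \<longrightarrow> is_maximal_ideal Z P)"

definition full_lattice ::
    "'k set \<Rightarrow> 'k set \<Rightarrow> ('k \<Rightarrow> 'm \<Rightarrow> 'm) \<Rightarrow> 'm::comm_monoid_add set \<Rightarrow> 'm set \<Rightarrow> bool" where
  "full_lattice Z Q sc W L \<longleftrightarrow>
     L \<subseteq> W \<and> submod Z sc L \<and> fin_gen Z sc L \<and> submod Q sc hull L = W"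

text \<open>
  The decomposition of $K$ as a direct sum of fields is given by the unit elements \<open>e i\<close>
  (\<open>i < n\<close>) of its components; the component $K_i$ is the ideal generated by \<open>e i\<close>. For a
  subset \<open>I\<close> of $K$, \<open>proj (e i) I\<close> is the projection of \<open>I\<close> to $K_i$.
\<close>

definition proj :: "'k::comm_ring_1 \<Rightarrow> 'k set \<Rightarrow> 'k set" where
  "proj u I = (\<lambda>x. u * x) ` I"

definition sum_of_finite_extensions :: "'k::comm_ring_1 set \<Rightarrow> nat \<Rightarrow> (nat \<Rightarrow> 'k) \<Rightarrow> bool" where
  "sum_of_finite_extensions Q n e \<longleftrightarrow>
     (\<forall>i<n. \<forall>j<n. e i * e j = (if i = j then e i else 0)) \<and> (\<Sum>i<n. e i) = 1 \<and>
     (\<forall>i<n. e i \<noteq> 0 \<and>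
        (\<forall>x\<in>proj (e i) UNIV. x \<noteq> 0 \<longrightarrow> (\<exists>y\<in>proj (e i) UNIV. x * y = e i)) \<and>
        fin_gen Q (*) (proj (e i) UNIV))"

definition ideal_prod :: "'k::comm_ring_1 set \<Rightarrow> 'k set \<Rightarrow> 'k set" where
  "ideal_prod A B =
     {\<Sum>k<m. a k * b k | (m::nat) a b. \<forall>k<m. a k \<in> A \<and> b k \<in> B}"

text \<open>
  In the next four definitions \<open>A\<close> is a ring contained in the algebra \<open>proj u UNIV\<close>, whose unit
  element is \<open>u\<close>: either \<open>u = 1\<close> and the algebra is $K$, or \<open>u = e i\<close> and it is $K_i$.
\<close>

definition fractional_ideal ::
    "'k::comm_ring_1 set \<Rightarrow> 'k set \<Rightarrow> 'k \<Rightarrow> 'k set \<Rightarrow> 'k set \<Rightarrow> bool" where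
  "fractional_ideal Z Q u A I \<longleftrightarrow> submod A (*) I \<and> full_lattice Z Q (*) (proj u UNIV) I"

definition invertible_ideals ::
    "'k::comm_ring_1 set \<Rightarrow> 'k set \<Rightarrow> 'k \<Rightarrow> 'k set \<Rightarrow> 'k set set" where
  "invertible_ideals Z Q u A = {I. fractional_ideal Z Q u A I \<and>
     (\<exists>J. fractional_ideal Z Q u A J \<and> ideal_prod I J = A)}"

definition pic_rel ::
    "'k::comm_ring_1 set \<Rightarrow> 'k set \<Rightarrow> 'k \<Rightarrow> 'k set \<Rightarrow> ('k set \<times> 'k set) set" where
  "pic_rel Z Q u A = {(I, J). I \<in> invertible_ideals Z Q u A \<and> J \<in> invertible_ideals Z Q u A \<and>
     (\<exists>x\<in>proj u UNIV. \<exists>y\<in>proj u UNIV. x * y = u \<and> J = (\<lambda>z. x * z) ` I)}"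

definition Pic :: "'k::comm_ring_1 set \<Rightarrow> 'k set \<Rightarrow> 'k \<Rightarrow> 'k set \<Rightarrow> 'k set set set" where
  "Pic Z Q u A = invertible_ideals Z Q u A // pic_rel Z Q u A"

text \<open>
  Elements of $V$ are functions \<open>v\<close>, where \<open>v i j\<close> is the \<open>j\<close>-th coordinate (\<open>j < s i\<close>) in
  $K_i^{s_i}$, and \<open>v i j = 0\<close> outside the index range. As \<open>v i j\<close> lies in $K_i$, multiplying it by
  \<open>x\<close> is multiplying it by the \<open>i\<close>-th component of \<open>x\<close>.
\<close>

type_synonym 'k vec = "nat \<Rightarrow> nat \<Rightarrow> 'k"

definition smult :: "'k::comm_ring_1 \<Rightarrow> 'k vec \<Rightarrow> 'k vec" where
  "smult x v = (\<lambda>i j. x * v i j)"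

text \<open>The direct sum over \<open>i < n\<close> of $A_i^{s_i-1} \oplus B_i$.\<close>

definition block_sum ::
    "nat \<Rightarrow> (nat \<Rightarrow> nat) \<Rightarrow> (nat \<Rightarrow> 'k::comm_ring_1 set) \<Rightarrow> (nat \<Rightarrow> 'k set) \<Rightarrow> 'k vec set" where
  "block_sum n s A B = {v.
     (\<forall>i<n. (\<forall>j<s i - 1. v i j \<in> A i) \<and> v i (s i - 1) \<in> B i) \<and>
     (\<forall>i j. \<not> (i < n \<and> j < s i) \<longrightarrow> v i j = 0)}"

text \<open>
  Quotient modules by a submodule \<open>N\<close>: elements are the cosets \<open>v +o N\<close>, addition is addition of
  sets, zero is \<open>N\<close>. Adding \<open>N\<close> in \<open>coset_scale\<close> makes the result a full coset.
\<close>

definition coset_scale :: "'k::comm_ring_1 vec set \<Rightarrow> 'k \<Rightarrow> 'k vec set \<Rightarrow> 'k vec set" where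
  "coset_scale N x C = smult x ` C + N"

definition quot_submod ::
    "'k::comm_ring_1 set \<Rightarrow> 'k vec set \<Rightarrow> 'k vec set set \<Rightarrow> 'k vec set set \<Rightarrow> bool" where
  "quot_submod S N U W \<longleftrightarrow> W \<subseteq> U \<and> N \<in> W \<and> (\<forall>C\<in>W. \<forall>D\<in>W. C + D \<in> W) \<and>
     (\<forall>r\<in>S. \<forall>C\<in>W. coset_scale N r C \<in> W)"

primrec sieve :: "('m \<Rightarrow> 'm \<Rightarrow> bool) \<Rightarrow> 'm list \<Rightarrow> 'm list \<Rightarrow> 'm list" where
  "sieve t kept [] = kept"
| "sieve t kept (M # Ms) = sieve t (if \<exists>N\<in>set kept. t N M then kept else kept @ [M]) Ms"

locale order_setting =
  fixes Z Q :: "'k::comm_ring_1 set"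
    and n :: nat and e :: "nat \<Rightarrow> 'k" and s :: "nat \<Rightarrow> nat"
    and R :: "'k set"
  assumes dedekind: "dedekind_domain Z Q"
    and fraction_field: "is_fraction_field Z Q"
    and decomposition: "sum_of_finite_extensions Q n e"
    and integral_closure_fin_gen: "fin_gen Z (*) {x. integral_over Z x}"
    and s_pos: "\<And>i. i < n \<Longrightarrow> s i > 0"
    and R_subring: "is_subring R"
    and R_lattice: "full_lattice Z Q (*) UNIV R"
begin

definition Ocl :: "'k set" where
  "Ocl = {x. integral_over Z x}"

definition cond :: "'k set" where
  "cond = {x. \<forall>y\<in>Ocl. x * y \<in> R}"

definition V :: "'k vec set" where
  "V = block_sum n s (\<lambda>i. proj (e i) UNIV) (\<lambda>i. proj (e i) UNIV)"

definition lattices :: "'k vec set set" where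
  "lattices = {M. submod R smult M \<and> full_lattice Z Q smult V M}"

definition R_iso :: "'k vec set \<Rightarrow> 'k vec set \<Rightarrow> bool" where
  "R_iso M N \<longleftrightarrow> mod_iso R smult M N"

text \<open>\<open>Num I\<close> and \<open>Den I\<close> are the numerator and the denominator of $\mathcal{Q}(I)$.\<close>

definition Num :: "'k set \<Rightarrow> 'k vec set" where
  "Num I = block_sum n s (\<lambda>i. proj (e i) Ocl) (\<lambda>i. proj (e i) I)"

definition Den :: "'k set \<Rightarrow> 'k vec set" where
  "Den I = block_sum n s (\<lambda>i. proj (e i) cond)
     (\<lambda>i. ideal_prod (proj (e i) cond) (proj (e i) I))"

definition q :: "'k set \<Rightarrow> 'k vec \<Rightarrow> 'k vec set" where
  "q I v = v +o Den I"

definition Quot :: "'k set \<Rightarrow> 'k vec set set" where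
  "Quot I = q I ` Num I"

definition q_preimage :: "'k set \<Rightarrow> 'k vec set set \<Rightarrow> 'k vec set" where
  "q_preimage I W = {v \<in> Num I. q I v \<in> W}"

text \<open>
  The computability hypotheses are modelled by subroutines meeting a specification. Since they
  return lists, the specifications include the finiteness of each $\mathrm{Pic}(\mathcal{O}_i)$
  and of the set of submodules of each $\mathcal{Q}(I)$.
\<close>

definition pic_subroutine :: "(nat \<Rightarrow> 'k set list) \<Rightarrow> bool" where
  "pic_subroutine pic \<longleftrightarrow> (\<forall>i<n.
     set (pic i) \<subseteq> invertible_ideals Z Q (e i) (proj (e i) Ocl) \<and>
     (\<forall>C\<in>Pic Z Q (e i) (proj (e i) Ocl). \<exists>!k. k < length (pic i) \<and> pic i ! k \<in> C))"

definition submods_subroutine :: "('k set \<Rightarrow> 'k vec set set list) \<Rightarrow> bool" where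
  "submods_subroutine subm \<longleftrightarrow> (\<forall>I. fractional_ideal Z Q 1 Ocl I \<longrightarrow>
     set (subm I) = {W. quot_submod R (Den I) (Quot I) W})"

definition iso_subroutine :: "('k vec set \<Rightarrow> 'k vec set \<Rightarrow> bool) \<Rightarrow> bool" where
  "iso_subroutine isot \<longleftrightarrow> (\<forall>M\<in>lattices. \<forall>N\<in>lattices. isot M N \<longleftrightarrow> R_iso M N)"

text \<open>The representatives of $\mathrm{Pic}(\mathcal{O}) = \bigoplus_i \mathrm{Pic}(\mathcal{O}_i)$
  are all direct sums of representatives of the $\mathrm{Pic}(\mathcal{O}_i)$.\<close>

definition direct_sum :: "'k set list \<Rightarrow> 'k set" where
  "direct_sum Is = {x. \<forall>i<n. e i * x \<in> Is ! i}"

definition pic_reps :: "(nat \<Rightarrow> 'k set list) \<Rightarrow> 'k set list" where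
  "pic_reps pic = map direct_sum (product_lists (map pic [0..<n]))"

definition base_list ::
    "('k set \<Rightarrow> 'k vec set set list) \<Rightarrow> ('k vec set \<Rightarrow> 'k vec set \<Rightarrow> bool) \<Rightarrow> 'k vec set list" where
  "base_list subm isot = sieve isot []
     (map (q_preimage Ocl)
       (filter (\<lambda>W. (quot_submod Ocl (Den Ocl) (Quot Ocl) hull W) = Quot Ocl) (subm Ocl)))"

definition coprime_to_cond :: "'k set \<Rightarrow> bool" where
  "coprime_to_cond I \<longleftrightarrow> I \<subseteq> Ocl \<and> I + cond = Ocl"

text \<open>
  For \<open>I\<close> coprime to the conductor, \<open>Num I \<subseteq> Num Ocl\<close> induces an isomorphism from \<open>Quot I\<close> to
  \<open>Quot Ocl\<close>; \<open>\<psi>\<close> is its inverse.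
\<close>

definition induced_iso :: "'k set \<Rightarrow> ('k vec set \<Rightarrow> 'k vec set) \<Rightarrow> bool" where
  "induced_iso I \<psi> \<longleftrightarrow> bij_betw \<psi> (Quot Ocl) (Quot I) \<and>
     (\<forall>C\<in>Quot Ocl. \<forall>D\<in>Quot Ocl. \<psi> (C + D) = \<psi> C + \<psi> D) \<and>
     (\<forall>r\<in>R. \<forall>C\<in>Quot Ocl. \<psi> (coset_scale (Den Ocl) r C) = coset_scale (Den I) r (\<psi> C)) \<and>
     (\<forall>v\<in>Num I. \<psi> (q Ocl v) = q I v)"

text \<open>
  The algorithm as a relation, since it leaves open which coprime ideal \<open>J\<close> in the class of each
  representative is chosen.
\<close>

definition algorithm_output ::
    "(nat \<Rightarrow> 'k set list) \<Rightarrow> ('k set \<Rightarrow> 'k vec set set list) \<Rightarrow>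
     ('k vec set \<Rightarrow> 'k vec set \<Rightarrow> bool) \<Rightarrow> 'k vec set list \<Rightarrow> bool" where
  "algorithm_output pic subm isot out \<longleftrightarrow> (\<exists>choices.
     list_all2 (\<lambda>I (J, \<psi>). (I, J) \<in> pic_rel Z Q 1 Ocl \<and> coprime_to_cond J \<and> induced_iso J \<psi>)
       (pic_reps pic) choices \<and>
     out = concat (map (\<lambda>(J, \<psi>).
       map (\<lambda>M. q_preimage J (\<psi> ` (q Ocl ` M))) (base_list subm isot)) choices))"

definition minimal_representatives :: "'k vec set list \<Rightarrow> bool" where
  "minimal_representatives out \<longleftrightarrow> set out \<subseteq> lattices \<and>
     (\<forall>M\<in>lattices. \<exists>N\<in>set out. R_iso M N) \<and>
     (\<forall>k<length out. \<forall>l<length out. k \<noteq> l \<longrightarrow> \<not> R_iso (out ! k) (out ! l))"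

end

end

theory Submission
  imports "Jordan_Normal_Form.Determinant" Defs
begin

text \<open>
  An isomorphism of lattices extends to a \<open>K\<close>-linear automorphism of \<open>V\<close>, hence to an isomorphism of
  the \<open>Ocl\<close>-modules they generate. By Steinitz' theorem such a module is isomorphic to \<open>Num I\<close> for an
  ideal \<open>I\<close> whose class in each component is unique, as it is read off from the determinant. So every
  lattice is isomorphic to some \<open>N\<close> with \<open>ohull N = Num J\<close> for exactly one of the chosen coprime
  ideals \<open>J\<close>. Such an \<open>N\<close> contains \<open>Den J\<close>, and \<open>N = M \<inter> Num J\<close> for \<open>M = N + Den Ocl\<close>, which is the
  module the algorithm obtains through the induced isomorphism.

  It remains to see that \<open>M \<inter> Num J\<close> and \<open>M' \<inter> Num J\<close> are isomorphic iff \<open>M\<close> and \<open>M'\<close> are. An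
  automorphism of \<open>Num J\<close> has unit determinant, and over the semilocal ring \<open>Ocl / cond\<close> a matrix of
  determinant one is a product of elementary matrices. These lift to elementary matrices with
  entries in any given ideal coprime to the conductor. Hence modulo the conductor every automorphism
  of \<open>Num J\<close> agrees with one of \<open>Num Ocl\<close>, and conversely.
\<close>

section \<open>Modules over a Noetherian subring\<close>

text \<open>No ideal of \<open>Ocl\<close> is ever factored, and the primes above the conductor are
  never enumerated. What is usually deduced from \<open>Ocl / cond\<close> being semilocal comes
  from descending chains: colon ideals reverse inclusions, so a chain of ideals above the conductor
  stabilises because the inverses ascend in a Noetherian module. This yields elements that act as
  indicators of sets of primes. As \<open>K\<close> has zero divisors, everything about ideals is
  proved for \<open>u * Ocl\<close> with an arbitrary idempotent \<open>u\<close>. The case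
  \<open>u = e i\<close> serves the components, the case \<open>u = 1\<close> the whole algebra. The
  obstacle in the comparison is that the matrix of an automorphism of \<open>block d J\<close> need
  not be integral, and that an integral matrix need not preserve \<open>block d J\<close>. The first
  defect is removed by multiplying the last column by some \<open>a\<close> in \<open>J\<close> with
  \<open>u - a\<close> in the conductor, the second by asking that all off-diagonal entries of a
  lift lie in \<open>J\<close>. The determinant of the changed matrix is a unit only up to the
  conductor, hence the form of the lifting theorem.\<close>

lemma is_subringD:
  assumes "is_subring S"
  shows "1 \<in> S" "0 \<in> S" "x \<in> S \<Longrightarrow> - x \<in> S" "x \<in> S \<Longrightarrow> y \<in> S \<Longrightarrow> x + y \<in> S"
    "x \<in> S \<Longrightarrow> y \<in> S \<Longrightarrow> x - y \<in> S" "x \<in> S \<Longrightarrow> y \<in> S \<Longrightarrow> x * y \<in> S"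
proof -
  show 1: "1 \<in> S" and 2: "x \<in> S \<Longrightarrow> y \<in> S \<Longrightarrow> x - y \<in> S" and "x \<in> S \<Longrightarrow> y \<in> S \<Longrightarrow> x * y \<in> S" for x y
    using assms by (auto simp: is_subring_def)
  have "1 - 1 \<in> S" using 1 2 by blast
  then show 0: "0 \<in> S" by simp
  have neg: "- x \<in> S" if "x \<in> S" for x using 2[OF 0 that] by simp
  then show "x \<in> S \<Longrightarrow> - x \<in> S" .
  show "x \<in> S \<Longrightarrow> y \<in> S \<Longrightarrow> x + y \<in> S" using 2[of x "- y"] neg[of y] by simp
qed

lemma is_subring_power: "is_subring S \<Longrightarrow> x \<in> S \<Longrightarrow> x ^ k \<in> S"
  by (induction k) (auto simp: is_subringD)

lemma is_subring_sum: "is_subring S \<Longrightarrow> (\<And>a. a \<in> A \<Longrightarrow> f a \<in> S) \<Longrightarrow> sum f A \<in> S"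
  by (induction A rule: infinite_finite_induct) (auto simp: is_subringD)

lemma is_subring_prod: "is_subring S \<Longrightarrow> (\<And>a. a \<in> A \<Longrightarrow> f a \<in> S) \<Longrightarrow> prod f A \<in> S"
  by (induction A rule: infinite_finite_induct) (auto simp: is_subringD)

lemma submodI:
  assumes "0 \<in> M" "\<And>x y. x \<in> M \<Longrightarrow> y \<in> M \<Longrightarrow> x + y \<in> M" "\<And>r x. r \<in> S \<Longrightarrow> x \<in> M \<Longrightarrow> sc r x \<in> M"
  shows "submod S sc M"
  using assms by (auto simp: submod_def)

lemma submodD:
  assumes "submod S sc M"
  shows "0 \<in> M" "x \<in> M \<Longrightarrow> y \<in> M \<Longrightarrow> x + y \<in> M" "r \<in> S \<Longrightarrow> x \<in> M \<Longrightarrow> sc r x \<in> M"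
  using assms by (auto simp: submod_def)

lemma submod_sum: "submod S sc M \<Longrightarrow> (\<And>a. a \<in> A \<Longrightarrow> f a \<in> M) \<Longrightarrow> sum f A \<in> M"
  by (induction A rule: infinite_finite_induct) (auto simp: submodD)

lemma submod_Inter: "Ball T (submod S sc) \<Longrightarrow> submod S sc (\<Inter>T)"
  by (auto simp: submod_def)

lemma submod_Int: "submod S sc M \<Longrightarrow> submod S sc N \<Longrightarrow> submod S sc (M \<inter> N)"
  by (auto simp: submod_def)

lemma submod_hull [simp]: "submod S sc (submod S sc hull B)"
  by (rule hull_in) (rule submod_Inter)

lemma submod_mono: "S \<subseteq> S' \<Longrightarrow> submod S' sc M \<Longrightarrow> submod S sc M"
  by (auto simp: submod_def)

text \<open>The module axioms are an assumption instead of an imported locale: the simplification rules of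
  the locale \<open>module\<close> loop when they are instantiated with multiplication.\<close>

locale subring_module =
  fixes sc :: "'k::comm_ring_1 \<Rightarrow> 'm::ab_group_add \<Rightarrow> 'm" and S :: "'k set"
  assumes module_sc: "Modules.module sc" and subring: "is_subring S"
begin

interpretation Modules.module sc by (rule module_sc)

lemma submod_neg: "submod S sc M \<Longrightarrow> x \<in> M \<Longrightarrow> - x \<in> M"
  using submodD(3)[of S sc M "-1" x] is_subringD(1,3)[OF subring] by simp

lemma submod_diff: "submod S sc M \<Longrightarrow> x \<in> M \<Longrightarrow> y \<in> M \<Longrightarrow> x - y \<in> M"
  using submodD(2)[of S sc M x "- y"] submod_neg by simp

lemma hull_empty: "submod S sc hull {} = {0}"
  by (rule hull_unique) (auto intro!: submodI dest: submodD(1))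

lemma submod_plus:
  assumes M: "submod S sc M" and N: "submod S sc N"
  shows "submod S sc (M + N)"
proof (rule submodI)
  show "0 \<in> M + N" using submodD(1)[OF M] submodD(1)[OF N] set_plus_intro[of 0 M 0 N] by simp
next
  fix x y assume "x \<in> M + N" "y \<in> M + N"
  then obtain a b c d where "x = a + b" "y = c + d" "a \<in> M" "c \<in> M" "b \<in> N" "d \<in> N"
    by (auto elim!: set_plus_elim)
  moreover have "a + b + (c + d) = (a + c) + (b + d)" by (simp add: algebra_simps)
  ultimately show "x + y \<in> M + N" using submodD(2)[OF M] submodD(2)[OF N] by (metis set_plus_intro)
next
  fix r x assume "r \<in> S" "x \<in> M + N"
  then show "sc r x \<in> M + N" using submodD(3)[OF M] submodD(3)[OF N]
    by (auto elim!: set_plus_elim simp: scale_right_distrib intro!: set_plus_intro)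
qed

lemma hull_insert:
  "submod S sc hull (insert b B) = {sc z b + v | z v. z \<in> S \<and> v \<in> submod S sc hull B}"
    (is "_ = ?H")
proof (rule hull_unique)
  note H = submodD[OF submod_hull[of S sc B]] and S = is_subringD[OF subring]
  have "sc 1 b + 0 \<in> ?H" using is_subringD(1)[OF subring] submodD(1)[OF submod_hull[of S sc B]] by blast
  moreover have "v \<in> ?H" if "v \<in> B" for v
  proof -
    have "sc 0 b + v \<in> ?H" using is_subringD(2)[OF subring] hull_inc[OF that] by blast
    then show ?thesis by simp
  qed
  ultimately show "insert b B \<subseteq> ?H" by auto
  show "submod S sc ?H"
  proof (rule submodI)
    have "sc 0 b + 0 \<in> ?H" using is_subringD(2)[OF subring] submodD(1)[OF submod_hull[of S sc B]] by blast
    then show "0 \<in> ?H" by simp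
  next
    fix x y assume "x \<in> ?H" "y \<in> ?H"
    then obtain z v z' v' where zv: "x = sc z b + v" "y = sc z' b + v'" "z \<in> S" "z' \<in> S"
      "v \<in> submod S sc hull B" "v' \<in> submod S sc hull B" by blast
    then have "x + y = sc (z + z') b + (v + v')" by (simp add: algebra_simps)
    then show "x + y \<in> ?H"
      using S(4)[OF zv(3,4)] H(2)[OF zv(5,6)] by blast
  next
    fix r x assume r: "r \<in> S" and "x \<in> ?H"
    then obtain z v where zv: "x = sc z b + v" "z \<in> S" "v \<in> submod S sc hull B" by blast
    then have "sc r x = sc (r * z) b + sc r v" by (simp add: algebra_simps)
    then show "sc r x \<in> ?H"
      using S(6)[OF r zv(2)] H(3)[OF r zv(3)] by blast
  qed
next
  fix T assume "insert b B \<subseteq> T" "submod S sc T"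
  moreover from this have "submod S sc hull B \<subseteq> T" by (intro hull_minimal) auto
  ultimately have "sc z b + v \<in> T" if "z \<in> S" "v \<in> submod S sc hull B" for z v
    using that submodD(2)[of S sc T "sc z b" v] submodD(3)[of S sc T z b] by blast
  then show "?H \<subseteq> T" by blast
qed

lemma hull_image_scale:
  "submod S sc hull (sc c ` B) = sc c ` (submod S sc hull B)"
proof (rule hull_unique)
  show "sc c ` B \<subseteq> sc c ` (submod S sc hull B)" by (auto intro: hull_inc)
  show "submod S sc (sc c ` (submod S sc hull B))"
  proof (rule submodI)
    show "0 \<in> sc c ` (submod S sc hull B)"
      using submodD(1)[OF submod_hull[of S sc B]] by (metis imageI scale_zero_right)
  next
    fix x y assume "x \<in> sc c ` (submod S sc hull B)" "y \<in> sc c ` (submod S sc hull B)"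
    then show "x + y \<in> sc c ` (submod S sc hull B)"
      by (auto simp: scale_right_distrib[symmetric] intro!: imageI submodD(2)[OF submod_hull[of S sc B]])
  next
    fix r x assume "r \<in> S" "x \<in> sc c ` (submod S sc hull B)"
    then obtain v where v: "x = sc c v" "v \<in> submod S sc hull B" by blast
    then have "sc r x = sc c (sc r v)" by (simp add: mult.commute)
    then show "sc r x \<in> sc c ` (submod S sc hull B)"
      using submodD(3)[OF submod_hull[of S sc B] \<open>r \<in> S\<close> v(2)] by blast
  qed
next
  fix T assume T: "sc c ` B \<subseteq> T" "submod S sc T"
  have "submod S sc hull B \<subseteq> {v. sc c v \<in> T}"
  proof (rule hull_minimal)
    show "submod S sc {v. sc c v \<in> T}"
    proof (rule submodI)
      fix r x assume "r \<in> S" "x \<in> {v. sc c v \<in> T}"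
      then show "sc r x \<in> {v. sc c v \<in> T}" using submodD(3)[OF T(2), of r "sc c x"] by (simp add: mult.commute)
    qed (use submodD[OF T(2)] in \<open>auto simp: scale_right_distrib\<close>)
  qed (use T in auto)
  then show "sc c ` (submod S sc hull B) \<subseteq> T" by auto
qed

lemma fin_gen_scale: "fin_gen S sc M \<Longrightarrow> fin_gen S sc (sc c ` M)"
  unfolding fin_gen_def by (metis finite_imageI hull_image_scale)

end

locale noetherian_module = subring_module +
  assumes noetherian: "\<And>I. is_ideal S I \<Longrightarrow> fin_gen S (*) I"
begin

interpretation Modules.module sc by (rule module_sc)

text \<open>The ideal of leading coefficients at \<open>b\<close>, as in Hilbert's basis theorem.
  \<open>N\<close> and \<open>H\<close> are kept arbitrary because the ideal is formed twice below,
  for a module and for its intersection with the hull of the lifted generators.\<close>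

lemma submod_leading:
  assumes N: "submod S sc N" and H: "submod S sc H"
  shows "submod S (*) {z \<in> S. \<exists>v\<in>H. sc z b + v \<in> N}" (is "submod S (*) ?I")
proof (rule submodI)
  note N = submodD[OF N] and H = submodD[OF H] and S = is_subringD[OF subring]
  have "sc 0 b + 0 \<in> N" using N(1) by simp
  then show "0 \<in> ?I" using S(2) H(1) by blast
next
  fix x y assume "x \<in> ?I" "y \<in> ?I"
  then obtain v w where vw: "x \<in> S" "y \<in> S" "v \<in> H" "w \<in> H" "sc x b + v \<in> N" "sc y b + w \<in> N"
    by blast
  have "sc (x + y) b + (v + w) = (sc x b + v) + (sc y b + w)" by (simp add: algebra_simps)
  then have "sc (x + y) b + (v + w) \<in> N" using submodD(2)[OF N vw(5,6)] by (simp only:)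
  then show "x + y \<in> ?I"
    using is_subringD(4)[OF subring vw(1,2)] submodD(2)[OF H vw(3,4)] by blast
next
  fix r x assume r: "r \<in> S" and "x \<in> ?I"
  then obtain v where v: "x \<in> S" "v \<in> H" "sc x b + v \<in> N" by blast
  have "sc (r * x) b + sc r v = sc r (sc x b + v)" by (simp add: algebra_simps)
  then have "sc (r * x) b + sc r v \<in> N" using submodD(3)[OF N r v(3)] by simp
  then show "r * x \<in> ?I"
    using is_subringD(6)[OF subring r v(1)] submodD(3)[OF H r v(2)] by blast
qed

text \<open>Induction on the generators of \<open>M\<close>: the leading coefficients of
  \<open>N\<close> at the new generator form a finitely generated ideal, lifts of its generators
  take care of them, and what remains of \<open>N\<close> lies in the hull of the old
  generators.\<close>

lemma fin_gen_submodule: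
  assumes "fin_gen S sc M" "submod S sc N" "N \<subseteq> M"
  shows "fin_gen S sc N"
proof -
  have "finite B \<Longrightarrow> submod S sc N \<Longrightarrow> N \<subseteq> submod S sc hull B \<Longrightarrow> fin_gen S sc N" for B N
  proof (induction B arbitrary: N rule: finite_induct)
    case empty
    then have "N = {0}" using submodD(1)[of S sc N] by (auto simp: hull_empty)
    then show ?case unfolding fin_gen_def by (metis finite.emptyI hull_empty)
  next
    case (insert b B)
    let ?H = "submod S sc hull B"
    define I where "I = {z \<in> S. \<exists>v\<in>?H. sc z b + v \<in> N}"
    have "is_ideal S I"
      unfolding is_ideal_def I_def using submod_leading[OF insert.prems(1) submod_hull] by blast
    then obtain C where C: "finite C" "I = submod S (*) hull C"
      using noetherian unfolding fin_gen_def by blast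
    have "\<forall>c\<in>C. \<exists>v. v \<in> ?H \<and> sc c b + v \<in> N"
    proof
      fix c assume "c \<in> C"
      then have "c \<in> I" unfolding C(2) by (rule hull_inc)
      then show "\<exists>v. v \<in> ?H \<and> sc c b + v \<in> N" by (auto simp: I_def)
    qed
    then obtain w where w: "\<forall>c\<in>C. w c \<in> ?H \<and> sc c b + w c \<in> N"
      using bchoice[of C "\<lambda>c v. v \<in> ?H \<and> sc c b + v \<in> N"] by blast
    have sub: "submod S sc (N \<inter> ?H)" using insert.prems(1) by (simp add: submod_Int)
    obtain D where D: "finite D" "N \<inter> ?H = submod S sc hull D"
      using insert.IH[OF sub Int_lower2] unfolding fin_gen_def by blast
    let ?G = "D \<union> (\<lambda>c. sc c b + w c) ` C"
    have "submod S sc hull ?G \<subseteq> N"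
    proof (rule hull_minimal)
      have "D \<subseteq> N" using D(2) hull_subset[of D "submod S sc"] by blast
      then show "?G \<subseteq> N" using w by auto
    qed (rule insert.prems(1))
    moreover have "N \<subseteq> submod S sc hull ?G"
    proof
      fix x assume x: "x \<in> N"
      then obtain z v where zv: "x = sc z b + v" "z \<in> S" "v \<in> ?H"
        using insert.prems(2) hull_insert by blast
      then have "z \<in> I" using x by (auto simp: I_def)
      \<comment> \<open>Instead of expanding \<open>z\<close> in the generators \<open>C\<close>,
        the coefficients attained inside the new hull are recognised as a submodule containing
        \<open>C\<close>.\<close>
      have "I \<subseteq> {z \<in> S. \<exists>v\<in>?H. sc z b + v \<in> N \<inter> submod S sc hull ?G}" (is "_ \<subseteq> ?I'")
        unfolding C(2)
      proof (rule hull_minimal)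
        have "C \<subseteq> I" unfolding C(2) by (rule hull_subset)
        then show "C \<subseteq> ?I'" using w hull_subset[of ?G "submod S sc"] unfolding I_def by blast
        have NG: "submod S sc (N \<inter> submod S sc hull ?G)"
          using insert.prems(1) by (simp add: submod_Int)
        show "submod S (*) ?I'" by (rule submod_leading[OF NG submod_hull])
      qed
      with \<open>z \<in> I\<close> obtain v' where v': "v' \<in> ?H" "sc z b + v' \<in> N" "sc z b + v' \<in> submod S sc hull ?G" by auto
      have "v - v' = x - (sc z b + v')" using zv by simp
      then have "v - v' \<in> N \<inter> ?H"
        using submod_diff[OF insert.prems(1) x v'(2)] submod_diff[OF submod_hull zv(3) v'(1)] by (simp only: Int_iff)
      then have "v - v' \<in> submod S sc hull ?G" using D(2) hull_mono[of D ?G "submod S sc"] by blast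
      moreover have "x = (v - v') + (sc z b + v')" using zv by simp
      ultimately show "x \<in> submod S sc hull ?G" using submodD(2)[OF submod_hull[of S sc ?G] _ v'(3)] by (simp only:)
    qed
    ultimately have "N = submod S sc hull ?G" by (rule subset_antisym[rotated])
    moreover have "finite ?G" using C(1) D(1) by simp
    ultimately show ?case unfolding fin_gen_def by blast
  qed
  moreover obtain B where "finite B" "M = submod S sc hull B" using assms(1) unfolding fin_gen_def by blast
  ultimately show ?thesis using assms(2,3) by simp
qed

text \<open>Zorn's lemma applies since the union of a chain is a submodule of \<open>M\<close>,
  hence finitely generated, and a finite set of generators already lies in one member of the
  chain.\<close>

lemma maximal_submodule_exists:
  assumes M: "fin_gen S sc M" and F: "\<F> \<noteq> {}" "\<And>N. N \<in> \<F> \<Longrightarrow> submod S sc N \<and> N \<subseteq> M"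
  obtains N where "N \<in> \<F>" "\<And>N'. N' \<in> \<F> \<Longrightarrow> N \<subseteq> N' \<Longrightarrow> N' = N"
proof -
  have "\<exists>M\<in>\<F>. \<forall>X\<in>\<F>. M \<subseteq> X \<longrightarrow> X = M"
  proof (rule subset_Zorn_nonempty[OF F(1)])
    fix \<C> assume C: "\<C> \<noteq> {}" "subset.chain \<F> \<C>"
    then have CF: "\<C> \<subseteq> \<F>" by (auto simp: subset_chain_def)
    have "submod S sc (\<Union>\<C>)"
    proof (rule submodI)
      obtain X where "X \<in> \<C>" using C(1) by blast
      then show "0 \<in> \<Union>\<C>" using CF F(2)[of X] submodD(1)[of S sc X] by auto
    next
      fix x y assume "x \<in> \<Union>\<C>" "y \<in> \<Union>\<C>"
      then obtain X Y where XY: "X \<in> \<C>" "Y \<in> \<C>" "x \<in> X" "y \<in> Y" by blast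
      then have "X \<subseteq> Y \<or> Y \<subseteq> X" using C(2) by (auto simp: subset_chain_def)
      then show "x + y \<in> \<Union>\<C>"
      proof
        assume "X \<subseteq> Y"
        then have "x + y \<in> Y" using XY CF F(2) by (intro submodD(2)[of S sc Y]) auto
        then show ?thesis using XY by blast
      next
        assume "Y \<subseteq> X"
        then have "x + y \<in> X" using XY CF F(2) by (intro submodD(2)[of S sc X]) auto
        then show ?thesis using XY by blast
      qed
    next
      fix r x assume "r \<in> S" "x \<in> \<Union>\<C>"
      then obtain X where X: "X \<in> \<C>" "x \<in> X" by blast
      then have "sc r x \<in> X" using \<open>r \<in> S\<close> CF F(2) by (intro submodD(3)[of S sc X]) auto
      then show "sc r x \<in> \<Union>\<C>" using X by blast
    qed
    moreover have "\<Union>\<C> \<subseteq> M" by (rule Union_least) (use CF F(2) in auto)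
    ultimately have "fin_gen S sc (\<Union>\<C>)" by (rule fin_gen_submodule[OF M])
    then obtain B where B: "finite B" "\<Union>\<C> = submod S sc hull B"
      unfolding fin_gen_def by auto
    then have "B \<subseteq> \<Union>\<C>" using hull_subset[of B "submod S sc"] by simp
    then obtain X where X: "X \<in> \<C>" "B \<subseteq> X"
      using finite_subset_Union_chain[OF B(1) _ C] by blast
    then have "submod S sc hull B \<subseteq> X" using CF F(2) by (intro hull_minimal) auto
    then have "\<Union>\<C> = X" using B(2) X(1) by blast
    then show "\<Union>\<C> \<in> \<F>" using X(1) CF by blast
  qed
  then show thesis using that by blast
qed

lemma ascending_chain_stabilises:
  assumes "fin_gen S sc M" and N: "\<And>k::nat. submod S sc (N k) \<and> N k \<subseteq> M" "\<And>k. N k \<subseteq> N (Suc k)"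
  obtains k where "N (Suc k) = N k"
proof -
  obtain X where X: "X \<in> range N" "\<And>N'. N' \<in> range N \<Longrightarrow> X \<subseteq> N' \<Longrightarrow> N' = X"
    by (rule maximal_submodule_exists[OF assms(1), of "range N"]) (use N(1) in auto)
  then obtain k where "X = N k" by blast
  then show thesis using X(2)[of "N (Suc k)"] N(2)[of k] that by blast
qed

end

section \<open>Lattices over the base ring\<close>

text \<open>Instantiated with \<open>K\<close> and with \<open>V\<close> as the module, so that
  fractional ideals and lattices share all arguments about denominators. The absence of zero
  divisors in \<open>Z\<close> makes products of denominators nonzero.\<close>

locale lattice_module = noetherian_module sc Z
  for sc :: "'k::comm_ring_1 \<Rightarrow> 'm::ab_group_add \<Rightarrow> 'm" and Z :: "'k set" +
  fixes Q :: "'k set"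
  assumes frac_field: "is_fraction_field Z Q"
    and domain: "\<And>a b. a \<in> Z \<Longrightarrow> b \<in> Z \<Longrightarrow> a * b = 0 \<Longrightarrow> a = 0 \<or> b = 0"
begin

interpretation Modules.module sc by (rule module_sc)

lemma Z_inverse: assumes "z \<in> Z - {0}" obtains w where "w \<in> Q" "z * w = 1"
  using assms frac_field unfolding is_fraction_field_def by blast

text \<open>The vectors that some nonzero element of \<open>Z\<close> carries into \<open>L\<close>
  are themselves a \<open>Q\<close>-submodule, which avoids any formula for the elements of the
  hull.\<close>

lemma denominators:
  assumes L: "submod Z sc L" and w: "w \<in> submod Q sc hull L"
  shows "\<exists>z\<in>Z - {0}. sc z w \<in> L"
proof -
  let ?D = "{w. \<exists>z\<in>Z - {0}. sc z w \<in> L}"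
  note S = is_subringD[OF subring]
  have one: "1 \<in> Z - {0}" using S(1) by simp
  have "submod Q sc hull L \<subseteq> ?D"
  proof (rule hull_minimal)
    show "L \<subseteq> ?D" using one by (auto intro!: bexI[of _ 1])
    show "submod Q sc ?D"
    proof (rule submodI)
      show "0 \<in> ?D" using one submodD(1)[OF L] by (auto intro!: bexI[of _ 1])
    next
      fix x y assume "x \<in> ?D" "y \<in> ?D"
      then obtain a b where ab: "a \<in> Z - {0}" "b \<in> Z - {0}" "sc a x \<in> L" "sc b y \<in> L" by blast
      have "sc (a * b) (x + y) = sc b (sc a x) + sc a (sc b y)" by (simp add: algebra_simps)
      moreover have "sc b (sc a x) \<in> L" "sc a (sc b y) \<in> L"
        using ab submodD(3)[OF L, of b "sc a x"] submodD(3)[OF L, of a "sc b y"] by auto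
      ultimately have "sc (a * b) (x + y) \<in> L" using submodD(2)[OF L] by simp
      moreover have "a * b \<in> Z - {0}" using ab domain S(6) by blast
      ultimately show "x + y \<in> ?D" by blast
    next
      fix r x assume r: "r \<in> Q" and "x \<in> ?D"
      then obtain a where a: "a \<in> Z - {0}" "sc a x \<in> L" by blast
      obtain c d where cd: "c \<in> Z" "d \<in> Z" "d \<noteq> 0" "d * r = c"
        using frac_field r unfolding is_fraction_field_def by blast
      have "sc (a * d) (sc r x) = sc c (sc a x)" using cd(4) by (simp add: algebra_simps)
      then have "sc (a * d) (sc r x) \<in> L" using submodD(3)[OF L cd(1) a(2)] by simp
      moreover have "a * d \<in> Z - {0}" using a cd domain S(6) by blast
      ultimately show "sc r x \<in> ?D" by blast
    qed
  qed
  then show ?thesis using w by blast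
qed

lemma hull_eqI:
  assumes "submod Q sc W" "L \<subseteq> W" "\<And>w. w \<in> W \<Longrightarrow> \<exists>z\<in>Z - {0}. sc z w \<in> L"
  shows "submod Q sc hull L = W"
proof
  show "submod Q sc hull L \<subseteq> W" by (rule hull_minimal) (use assms in auto)
  show "W \<subseteq> submod Q sc hull L"
  proof
    fix w assume "w \<in> W"
    then obtain z where z: "z \<in> Z - {0}" "sc z w \<in> L" using assms(3) by blast
    obtain y where y: "y \<in> Q" "z * y = 1" using Z_inverse[OF z(1)] .
    have "sc y (sc z w) \<in> submod Q sc hull L"
      by (rule submodD(3)[OF submod_hull y(1) hull_inc[OF z(2)]])
    moreover have "sc y (sc z w) = w" using y by (simp add: mult.commute)
    ultimately show "w \<in> submod Q sc hull L" by simp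
  qed
qed

lemma common_denominator:
  assumes M: "fin_gen Z sc M" and L: "submod Z sc L" and d: "\<And>m. m \<in> M \<Longrightarrow> \<exists>z\<in>Z - {0}. sc z m \<in> L"
  shows "\<exists>z\<in>Z - {0}. \<forall>m\<in>M. sc z m \<in> L"
proof -
  note S = is_subringD[OF subring]
  obtain B where B: "finite B" "M = submod Z sc hull B" using M unfolding fin_gen_def by blast
  have "finite B \<Longrightarrow> B \<subseteq> M \<Longrightarrow> \<exists>z\<in>Z - {0}. \<forall>m\<in>B. sc z m \<in> L" for B
  proof (induction B rule: finite_induct)
    case empty
    then show ?case using S(1) by (auto intro!: bexI[of _ 1])
  next
    case (insert b B)
    then obtain z where z: "z \<in> Z - {0}" "\<forall>m\<in>B. sc z m \<in> L" by blast
    obtain y where y: "y \<in> Z - {0}" "sc y b \<in> L" using d[of b] insert.prems by blast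
    have "sc (z * y) m \<in> L" if "m \<in> insert b B" for m
    proof (cases "m = b")
      case True
      then show ?thesis using submodD(3)[OF L, of z "sc y b"] y z by simp
    next
      case False
      then have "sc z m \<in> L" using z that by blast
      then show ?thesis using submodD(3)[OF L, of y "sc z m"] y z by (simp add: mult.commute)
    qed
    moreover have "z * y \<in> Z - {0}" using y(1) z(1) domain S(6) by blast
    ultimately show ?case by blast
  qed
  moreover have "B \<subseteq> M" unfolding B(2) by (rule hull_subset)
  ultimately obtain z where z: "z \<in> Z - {0}" "\<forall>m\<in>B. sc z m \<in> L" using B(1) by blast
  have "M \<subseteq> {m. sc z m \<in> L}" unfolding B(2)
  proof (rule hull_minimal)
    show "B \<subseteq> {m. sc z m \<in> L}" using z by blast
    show "submod Z sc {m. sc z m \<in> L}"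
    proof (rule submodI)
      fix r x assume "r \<in> Z" "x \<in> {m. sc z m \<in> L}"
      then show "sc r x \<in> {m. sc z m \<in> L}" using submodD(3)[OF L, of r "sc z x"] by (simp add: mult.commute)
    qed (use submodD[OF L] in \<open>auto simp: scale_right_distrib\<close>)
  qed
  then show ?thesis using z(1) by blast
qed

text \<open>Turns full rank and finite generation into commensurability with one known lattice, the
  form in which lattices are checked below. Finite generation comes back because \<open>L\<close> is
  isomorphic to its multiple by \<open>z\<close>, a submodule of the finitely generated
  \<open>L0\<close>.\<close>

lemma full_lattice_iff:
  assumes L0: "full_lattice Z Q sc W L0" and W: "submod Q sc W"
  shows "full_lattice Z Q sc W L \<longleftrightarrow> submod Z sc L \<and> L \<subseteq> W \<and>
    (\<exists>z\<in>Z - {0}. \<forall>x\<in>L0. sc z x \<in> L) \<and> (\<exists>z\<in>Z - {0}. \<forall>x\<in>L. sc z x \<in> L0)" (is "_ \<longleftrightarrow> ?r")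
proof
  note L0 = L0[unfolded full_lattice_def]
  assume L: "full_lattice Z Q sc W L"
  note L = L[unfolded full_lattice_def]
  have "\<exists>z\<in>Z - {0}. \<forall>x\<in>L0. sc z x \<in> L"
    by (rule common_denominator) (use L0 L denominators[of L] in auto)
  moreover have "\<exists>z\<in>Z - {0}. \<forall>x\<in>L. sc z x \<in> L0"
    by (rule common_denominator) (use L0 L denominators[of L0] in auto)
  ultimately show ?r using L by blast
next
  note L0 = L0[unfolded full_lattice_def]
  assume L: ?r
  then obtain y z where yz: "y \<in> Z - {0}" "z \<in> Z - {0}" "\<forall>x\<in>L0. sc y x \<in> L" "\<forall>x\<in>L. sc z x \<in> L0" by blast
  obtain w where w: "w \<in> Q" "z * w = 1" using Z_inverse[OF yz(2)] .
  have sub: "submod Z sc (sc z ` L)"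
  proof (rule submodI)
    fix r x assume "r \<in> Z" "x \<in> sc z ` L"
    then obtain v where v: "x = sc z v" "v \<in> L" by blast
    then have "sc r x = sc z (sc r v)" by (simp add: mult.commute)
    then show "sc r x \<in> sc z ` L" using submodD(3)[of Z sc L r v] L \<open>r \<in> Z\<close> v by blast
  next
    fix x y assume "x \<in> sc z ` L" "y \<in> sc z ` L"
    then show "x + y \<in> sc z ` L" using L submodD(2)[of Z sc L] by (auto simp: scale_right_distrib[symmetric])
  next
    have "0 = sc z 0" by simp
    then show "0 \<in> sc z ` L" using L submodD(1)[of Z sc L] by blast
  qed
  have "fin_gen Z sc (sc z ` L)"
    by (rule fin_gen_submodule[OF _ sub]) (use L0 yz in auto)
  then have "fin_gen Z sc (sc w ` sc z ` L)" by (rule fin_gen_scale)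
  moreover have "sc w ` sc z ` L = L" using w by (auto simp: image_image mult.commute[of w])
  ultimately have fg: "fin_gen Z sc L" by simp
  have "submod Q sc hull L = W"
  proof (rule hull_eqI[OF W])
    show "L \<subseteq> W" using L by blast
    fix v assume "v \<in> W"
    then obtain x where x: "x \<in> Z - {0}" "sc x v \<in> L0" using denominators[of L0 v] L0 by auto
    have "sc (y * x) v = sc y (sc x v)" by simp
    moreover have "sc y (sc x v) \<in> L" using yz x by blast
    ultimately have "sc (y * x) v \<in> L" by simp
    moreover have "y * x \<in> Z - {0}" using yz(1) x(1) domain is_subringD(6)[OF subring] by blast
    ultimately show "\<exists>z\<in>Z - {0}. sc z v \<in> L" by blast
  qed
  then show "full_lattice Z Q sc W L" unfolding full_lattice_def using L fg by blast
qed

end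

section \<open>The integral closure\<close>

context order_setting
begin

lemma Z_subring: "is_subring Z"
  and Z_domain: "a \<in> Z \<Longrightarrow> b \<in> Z \<Longrightarrow> a * b = 0 \<Longrightarrow> a = 0 \<or> b = 0"
  and Z_noetherian: "is_ideal Z I \<Longrightarrow> fin_gen Z (*) I"
  and Z_dim_one: "is_prime_ideal Z P \<Longrightarrow> P \<noteq> {0} \<Longrightarrow> is_maximal_ideal Z P"
  using dedekind unfolding dedekind_domain_def by blast+

sublocale K: lattice_module "(*) :: 'k \<Rightarrow> 'k \<Rightarrow> 'k" Z Q
proof (intro lattice_module.intro lattice_module_axioms.intro noetherian_module.intro
    noetherian_module_axioms.intro subring_module.intro)
  show "Modules.module ((*) :: 'k \<Rightarrow> 'k \<Rightarrow> 'k)" by unfold_locales (auto simp: algebra_simps)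
qed (use Z_subring Z_noetherian fraction_field Z_domain in blast)+

sublocale Vm: lattice_module "smult :: 'k \<Rightarrow> 'k vec \<Rightarrow> 'k vec" Z Q
proof (intro lattice_module.intro lattice_module_axioms.intro noetherian_module.intro
    noetherian_module_axioms.intro subring_module.intro)
  show "Modules.module (smult :: 'k \<Rightarrow> 'k vec \<Rightarrow> 'k vec)"
    by unfold_locales (auto simp: smult_def plus_fun_def algebra_simps)
qed (use Z_subring Z_noetherian fraction_field Z_domain in blast)+

lemmas Z_rules = is_subringD[OF Z_subring]

lemma nonzero_mult: "a \<in> Z - {0} \<Longrightarrow> b \<in> Z - {0} \<Longrightarrow> a * b \<in> Z - {0}"
  using Z_domain Z_rules(6) by blast

lemma one_nonzero: "1 \<in> Z - {0}"
  using Z_rules(1) by simp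

text \<open>The modules generated by \<open>m\<close>, \<open>x * m\<close>, ...,
  \<open>x ^ k * m\<close> ascend inside \<open>M\<close>; where the chain stops, the next power
  gives a monic relation. Only the multiple by \<open>m\<close> of the polynomial value vanishes,
  since \<open>m\<close> may be a zero divisor.\<close>

lemma annihilating_poly:
  assumes M: "fin_gen Z (*) M" and x: "\<And>k. x ^ k * m \<in> M" and sub: "submod Z (*) M"
  shows "\<exists>p. lead_coeff p = 1 \<and> (\<forall>i. coeff p i \<in> Z) \<and> poly p x * m = 0"
proof -
  define N where "N k = submod Z (*) hull ((\<lambda>i. x ^ i * m) ` {..k})" for k :: nat
  obtain k where k: "N (Suc k) = N k"
  proof (rule K.ascending_chain_stabilises[OF M, of N])
    fix k
    have "N k \<subseteq> M" unfolding N_def by (rule hull_minimal) (use x sub in auto)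
    then show "submod Z (*) (N k) \<and> N k \<subseteq> M" by (simp add: N_def)
    show "N k \<subseteq> N (Suc k)" unfolding N_def by (rule hull_mono) auto
  qed
  let ?P = "{poly p x * m | p. degree p \<le> k \<and> (\<forall>i. coeff p i \<in> Z)}"
  have "N k \<subseteq> ?P" unfolding N_def
  proof (rule hull_minimal)
    show "(\<lambda>i. x ^ i * m) ` {..k} \<subseteq> ?P"
    proof clarify
      fix i assume i: "i \<le> k"
      show "\<exists>p. x ^ i * m = poly p x * m \<and> degree p \<le> k \<and> (\<forall>i. coeff p i \<in> Z)"
        by (rule exI[of _ "monom 1 i"]) (use i Z_rules in \<open>auto simp: poly_monom degree_monom_eq\<close>)
    qed
    show "submod Z (*) ?P"
    proof (rule submodI)
      show "0 \<in> ?P" using Z_rules(2) by (auto intro!: exI[of _ 0])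
    next
      fix a b assume "a \<in> ?P" "b \<in> ?P"
      then obtain p r where "a = poly p x * m" "degree p \<le> k" "\<forall>i. coeff p i \<in> Z"
        "b = poly r x * m" "degree r \<le> k" "\<forall>i. coeff r i \<in> Z" by blast
      then show "a + b \<in> ?P" using Z_rules(4)
        by (auto intro!: exI[of _ "p + r"] degree_add_le simp: algebra_simps)
    next
      fix c a assume "c \<in> Z" "a \<in> ?P"
      then obtain p where "a = poly p x * m" "degree p \<le> k" "\<forall>i. coeff p i \<in> Z" by blast
      then show "c * a \<in> ?P" using Z_rules(6) \<open>c \<in> Z\<close>
        by (auto intro!: exI[of _ "Polynomial.smult c p"] order.trans[OF degree_smult_le] simp: algebra_simps)
    qed
  qed
  moreover have "x ^ Suc k * m \<in> N (Suc k)" unfolding N_def by (rule hull_inc) blast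
  ultimately obtain p where p: "x ^ Suc k * m = poly p x * m" "degree p \<le> k" "\<forall>i. coeff p i \<in> Z"
    using k by blast
  let ?q = "- p + monom 1 (Suc k)"
  have "degree (- p) < degree (monom (1::'k) (Suc k))" using p(2) by (simp add: degree_monom_eq)
  then have "lead_coeff ?q = lead_coeff (monom (1::'k) (Suc k))" by (rule lead_coeff_add_le)
  then have "lead_coeff ?q = 1" by (simp only: lead_coeff_monom)
  moreover have "\<forall>i. coeff ?q i \<in> Z"
  proof
    fix i
    have "coeff (monom (1::'k) (Suc k)) i \<in> Z" using Z_rules(1,2) by simp
    then show "coeff ?q i \<in> Z" using p(3) Z_rules(3)[of "coeff p i"] Z_rules(4) by (simp only: coeff_add coeff_minus)
  qed
  moreover have "poly ?q x * m = 0" using p(1) by (simp add: poly_monom algebra_simps)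
  ultimately show ?thesis by blast
qed

lemma integral_if_powers:
  assumes "fin_gen Z (*) M" "submod Z (*) M" "\<And>k. x ^ k \<in> M"
  shows "x \<in> Ocl"
  using annihilating_poly[OF assms(1) _ assms(2), of x 1] assms(3) by (auto simp: Ocl_def integral_over_def)

lemma fin_gen_hull: "finite B \<Longrightarrow> fin_gen Z (*) (submod Z (*) hull B)"
  unfolding fin_gen_def by blast

lemma Ocl_fin_gen: "fin_gen Z (*) Ocl"
  using integral_closure_fin_gen by (simp add: Ocl_def)

text \<open>Closure of the integral elements under addition is read off from the hypothesis that
  they form the hull of a finite set; only products require an argument.\<close>

lemma Ocl_submod_Z: "submod Z (*) Ocl"
proof -
  obtain B where "Ocl = submod Z (*) hull B" using Ocl_fin_gen unfolding fin_gen_def by blast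
  then show ?thesis by (simp only: submod_hull)
qed

lemma powers_in_hull:
  assumes "x \<in> Ocl"
  shows "\<exists>m. \<forall>k. x ^ k \<in> submod Z (*) hull ((\<lambda>i. x ^ i) ` {..<m::nat})"
proof -
  obtain p where p: "lead_coeff p = 1" "\<And>i. coeff p i \<in> Z" "poly p x = 0"
    using assms unfolding Ocl_def integral_over_def by blast
  let ?m = "degree p"
  let ?H = "submod Z (*) hull ((\<lambda>i. x ^ i) ` {..<?m})"
  have "x ^ k \<in> ?H" for k
  proof (induction k rule: less_induct)
    case (less k)
    show ?case
    proof (cases "k < ?m")
      case True
      then show ?thesis by (intro hull_inc) auto
    next
      case False
      have "0 = (\<Sum>i\<le>?m. coeff p i * x ^ i)" using p(3) by (simp add: poly_altdef)
      also have "\<dots> = (\<Sum>i<?m. coeff p i * x ^ i) + x ^ ?m"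
        using p(1) by (simp add: lessThan_Suc_atMost[symmetric])
      finally have "x ^ ?m = (\<Sum>i<?m. (- coeff p i) * x ^ i)" by (simp add: sum_negf eq_neg_iff_add_eq_0 add.commute)
      moreover have "x ^ k = x ^ (k - ?m) * x ^ ?m" using False by (simp flip: power_add)
      ultimately have "x ^ k = (\<Sum>i<?m. (- coeff p i) * x ^ (i + (k - ?m)))"
        by (simp add: sum_distrib_left power_add algebra_simps)
      moreover have "(- coeff p i) * x ^ (i + (k - ?m)) \<in> ?H" if "i < ?m" for i
        by (rule submodD(3)[OF submod_hull]) (use less.IH[of "i + (k - ?m)"] that False Z_rules(3) p(2) in auto)
      ultimately show ?thesis using submod_sum[OF submod_hull] by (metis (no_types, lifting) lessThan_iff)
    qed
  qed
  then show ?thesis by blast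
qed

text \<open>All powers of \<open>x * y\<close> lie in the module spanned by the finitely many
  products of low powers of \<open>x\<close> and of \<open>y\<close>; the two factors are reduced
  one after the other.\<close>

lemma Ocl_mult:
  assumes "x \<in> Ocl" "y \<in> Ocl"
  shows "x * y \<in> Ocl"
proof -
  obtain m m' :: nat where m: "\<And>k. x ^ k \<in> submod Z (*) hull ((\<lambda>i. x ^ i) ` {..<m})"
      "\<And>k. y ^ k \<in> submod Z (*) hull ((\<lambda>i. y ^ i) ` {..<m'})"
    using powers_in_hull assms by meson
  let ?M = "submod Z (*) hull ((\<lambda>(i,j). x ^ i * y ^ j) ` ({..<m} \<times> {..<m'}))"
  note M = submodD[OF submod_hull[of Z "(*)" "(\<lambda>(i,j). x ^ i * y ^ j) ` ({..<m} \<times> {..<m'})"]]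
  have 1: "x ^ k * y ^ j \<in> ?M" if j: "j < m'" for k j
  proof -
    have "submod Z (*) hull ((\<lambda>i. x ^ i) ` {..<m}) \<subseteq> {v. v * y ^ j \<in> ?M}"
    proof (rule hull_minimal)
      show "(\<lambda>i. x ^ i) ` {..<m} \<subseteq> {v. v * y ^ j \<in> ?M}" using j by (auto intro!: hull_inc)
      show "submod Z (*) {v. v * y ^ j \<in> ?M}"
      proof (rule submodI)
        fix r v assume "r \<in> Z" "v \<in> {v. v * y ^ j \<in> ?M}"
        then show "r * v \<in> {v. v * y ^ j \<in> ?M}" using M(3)[of r "v * y ^ j"] by (simp add: mult.assoc)
      qed (use M in \<open>auto simp: algebra_simps\<close>)
    qed
    then show ?thesis using m(1)[of k] by blast
  qed
  have 2: "x ^ k * y ^ l \<in> ?M" for k l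
  proof -
    have "submod Z (*) hull ((\<lambda>i. y ^ i) ` {..<m'}) \<subseteq> {v. x ^ k * v \<in> ?M}"
    proof (rule hull_minimal)
      show "(\<lambda>i. y ^ i) ` {..<m'} \<subseteq> {v. x ^ k * v \<in> ?M}" using 1 by auto
      show "submod Z (*) {v. x ^ k * v \<in> ?M}"
      proof (rule submodI)
        fix r v assume "r \<in> Z" "v \<in> {v. x ^ k * v \<in> ?M}"
        then show "r * v \<in> {v. x ^ k * v \<in> ?M}" using M(3)[of r "x ^ k * v"] by (simp add: ac_simps)
      qed (use M in \<open>auto simp: algebra_simps\<close>)
    qed
    then show ?thesis using m(2)[of l] by blast
  qed
  show ?thesis
    by (rule integral_if_powers[of ?M]) (auto intro!: fin_gen_hull 2 simp: power_mult_distrib)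
qed

lemma one_Ocl: "1 \<in> Ocl"
  unfolding Ocl_def integral_over_def
  by (rule CollectI, rule exI[of _ "[:-1, 1:]"]) (auto simp: coeff_pCons Z_rules split: nat.splits)

lemma Ocl_subring: "is_subring Ocl"
proof -
  have "x - y \<in> Ocl" if "x \<in> Ocl" "y \<in> Ocl" for x y
    using K.submod_diff[OF Ocl_submod_Z that] .
  then show ?thesis using Ocl_mult one_Ocl unfolding is_subring_def by blast
qed

lemmas Ocl_rules = is_subringD[OF Ocl_subring]

lemma Z_sub_Ocl: "Z \<subseteq> Ocl"
  using submodD(3)[OF Ocl_submod_Z _ one_Ocl] by auto

lemmas R_rules = is_subringD[OF R_subring]

lemma R_submod_Z: "submod Z (*) R" and R_fin_gen: "fin_gen Z (*) R" and R_hull: "submod Q (*) hull R = UNIV"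
  using R_lattice unfolding full_lattice_def by auto

lemma Z_sub_R: "Z \<subseteq> R"
  using submodD(3)[OF R_submod_Z _ R_rules(1)] by auto

lemma R_sub_Ocl: "R \<subseteq> Ocl"
  using integral_if_powers[OF R_fin_gen R_submod_Z] is_subring_power[OF R_subring] by blast

lemma denominator_R: "\<exists>z\<in>Z - {0}. z * x \<in> R"
  using K.denominators[OF R_submod_Z, of x] R_hull by blast

lemma denominator_Ocl: "\<exists>z\<in>Z - {0}. z * x \<in> Ocl"
  using denominator_R R_sub_Ocl by blast

lemma idempotent_Ocl: "u * u = u \<Longrightarrow> u \<in> Ocl"
proof -
  assume u: "u * u = u"
  show ?thesis unfolding Ocl_def integral_over_def
    by (rule CollectI, rule exI[of _ "[:0, -1, 1:]"])
       (use u in \<open>auto simp: coeff_pCons Z_rules algebra_simps split: nat.splits\<close>)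
qed

lemma proj_UNIV_iff: "u * u = u \<Longrightarrow> x \<in> proj u UNIV \<longleftrightarrow> u * x = x"
  unfolding proj_def by (auto simp: mult.assoc[symmetric]) (metis rangeI)

lemma proj_Ocl_iff: "u * u = u \<Longrightarrow> x \<in> proj u Ocl \<longleftrightarrow> x \<in> Ocl \<and> u * x = x"
  unfolding proj_def using Ocl_mult idempotent_Ocl by (auto simp: mult.assoc[symmetric]) (metis imageI)

section \<open>Fractional ideals of a component\<close>

abbreviation frac :: "'k \<Rightarrow> 'k set \<Rightarrow> bool" where
  "frac u I \<equiv> fractional_ideal Z Q u (proj u Ocl) I"

lemma proj_submod: "submod S (*) A \<Longrightarrow> submod S (*) (proj u A)"
  unfolding proj_def
proof (rule submodI)
  assume A: "submod S (*) A"
  have "0 = u * 0" by simp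
  then show "0 \<in> (*) u ` A" using submodD(1)[OF A] by blast
next
  fix x y assume A: "submod S (*) A" and "x \<in> (*) u ` A" "y \<in> (*) u ` A"
  then obtain a b where "x = u * a" "y = u * b" "a \<in> A" "b \<in> A" by blast
  then have "x + y = u * (a + b)" "a + b \<in> A" using submodD(2)[OF A] by (auto simp: algebra_simps)
  then show "x + y \<in> (*) u ` A" by blast
next
  fix r x assume A: "submod S (*) A" and r: "r \<in> S" and "x \<in> (*) u ` A"
  then obtain a where "x = u * a" "a \<in> A" by blast
  then have "r * x = u * (r * a)" "r * a \<in> A" using submodD(3)[OF A r] by (auto simp: algebra_simps)
  then show "r * x \<in> (*) u ` A" by blast
qed

lemma proj_Ocl_lattice:
  assumes u: "u * u = u"
  shows "full_lattice Z Q (*) (proj u UNIV) (proj u Ocl)"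
  unfolding full_lattice_def
proof (intro conjI)
  show "proj u Ocl \<subseteq> proj u UNIV" by (auto simp: proj_def)
  show "submod Z (*) (proj u Ocl)" by (rule proj_submod[OF Ocl_submod_Z])
  show "fin_gen Z (*) (proj u Ocl)" using K.fin_gen_scale[OF Ocl_fin_gen] by (simp add: proj_def)
  show "submod Q (*) hull proj u Ocl = proj u UNIV"
  proof (rule K.hull_eqI)
    show "submod Q (*) (proj u UNIV)" by (rule proj_submod) (auto intro: submodI)
    show "proj u Ocl \<subseteq> proj u UNIV" by (auto simp: proj_def)
    fix w assume "w \<in> proj u UNIV"
    then have uw: "u * w = w" using u proj_UNIV_iff by blast
    obtain z where "z \<in> Z - {0}" "z * w \<in> Ocl" using denominator_Ocl by blast
    moreover have "u * (z * w) = z * w" using uw by (metis mult.left_commute)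
    ultimately show "\<exists>z\<in>Z - {0}. z * w \<in> proj u Ocl" using proj_Ocl_iff[OF u] by blast
  qed
qed

text \<open>A module over \<open>u * Ocl\<close> inside the component is the same as an
  \<open>Ocl\<close>-module on which \<open>u\<close> acts as the identity; the last two conjuncts
  express commensurability with \<open>u * Ocl\<close>. This is the working form of a fractional
  ideal.\<close>

lemma frac_iff:
  assumes u: "u * u = u"
  shows "frac u I \<longleftrightarrow> submod Ocl (*) I \<and> (\<forall>x\<in>I. u * x = x) \<and>
    (\<exists>z\<in>Z - {0}. z * u \<in> I) \<and> (\<exists>z\<in>Z - {0}. \<forall>x\<in>I. z * x \<in> Ocl)" (is "_ \<longleftrightarrow> ?r")
proof -
  have W: "submod Q (*) (proj u UNIV)" by (rule proj_submod) (auto intro: submodI)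
  note iff = K.full_lattice_iff[OF proj_Ocl_lattice[OF u] W, of I]
  show ?thesis
  proof
    assume "frac u I"
    then have sub: "submod (proj u Ocl) (*) I" and L: "full_lattice Z Q (*) (proj u UNIV) I"
      by (auto simp: fractional_ideal_def)
    have uI: "\<forall>x\<in>I. u * x = x" using L iff proj_UNIV_iff[OF u] by blast
    have "submod Ocl (*) I"
    proof (rule submodI)
      fix r x assume r: "r \<in> Ocl" and x: "x \<in> I"
      have "u * r \<in> proj u Ocl" using r by (auto simp: proj_def)
      then have "(u * r) * x \<in> I" using submodD(3)[OF sub _ x] by blast
      moreover have "(u * r) * x = r * x" using uI x by (metis mult.assoc mult.commute)
      ultimately show "r * x \<in> I" by simp
    qed (use submodD[OF sub] in auto)
    moreover have "u \<in> proj u Ocl" using proj_Ocl_iff[OF u] idempotent_Ocl u by blast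
    ultimately show ?r using L uI unfolding iff using proj_Ocl_iff[OF u] by blast
  next
    assume r: ?r
    then obtain y z where yz: "y \<in> Z - {0}" "z \<in> Z - {0}" "y * u \<in> I" "\<forall>x\<in>I. z * x \<in> Ocl" by blast
    have sub: "submod Ocl (*) I" and uI: "\<forall>x\<in>I. u * x = x" using r by auto
    have "submod (proj u Ocl) (*) I"
      by (rule submod_mono[OF _ sub]) (use proj_Ocl_iff[OF u] in blast)
    moreover have "submod Z (*) I" by (rule submod_mono[OF Z_sub_Ocl sub])
    moreover have "I \<subseteq> proj u UNIV" using uI proj_UNIV_iff[OF u] by blast
    moreover have "y * x \<in> I" if "x \<in> proj u Ocl" for x
    proof -
      have "x * (y * u) \<in> I" using submodD(3)[OF sub _ yz(3)] that proj_Ocl_iff[OF u] by blast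
      moreover have "x * (y * u) = y * x" using that proj_Ocl_iff[OF u] by (metis mult.commute mult.left_commute)
      ultimately show ?thesis by simp
    qed
    moreover have "z * x \<in> proj u Ocl" if "x \<in> I" for x
      using that yz(4) uI proj_Ocl_iff[OF u] by (metis mult.left_commute)
    ultimately show "frac u I" unfolding fractional_ideal_def iff using yz(1,2) by blast
  qed
qed

lemma fracD:
  assumes "u * u = u" "frac u I"
  shows "submod Ocl (*) I" "x \<in> I \<Longrightarrow> u * x = x" "\<exists>z\<in>Z - {0}. z * u \<in> I"
    "\<exists>z\<in>Z - {0}. \<forall>x\<in>I. z * x \<in> Ocl"
  using assms(2) unfolding frac_iff[OF assms(1)] by auto

lemma frac_fin_gen: "frac u I \<Longrightarrow> fin_gen Z (*) I"
  unfolding fractional_ideal_def full_lattice_def by blast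

lemma nonzero_Z_inverse: assumes "z \<in> Z - {0}" obtains w where "z * w = 1"
  using K.Z_inverse[OF assms] by blast

text \<open>The powers of \<open>x\<close> applied to one element \<open>z * u\<close> of
  \<open>I\<close> stay in the finitely generated \<open>I\<close>, which yields a monic
  relation.\<close>

lemma stable_integral:
  assumes u: "u * u = u" and I: "frac u I" and x: "u * x = x" "\<And>y. y \<in> I \<Longrightarrow> x * y \<in> I"
  shows "x \<in> Ocl"
proof -
  obtain z where z: "z \<in> Z - {0}" "z * u \<in> I" using fracD(3)[OF u I] by blast
  have "x ^ k * (z * u) \<in> I" for k
    by (induction k) (use z x(2) in \<open>auto simp: mult.assoc\<close>)
  then obtain p where p: "lead_coeff p = 1" "\<forall>i. coeff p i \<in> Z" "poly p x * (z * u) = 0"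
    using annihilating_poly[OF frac_fin_gen[OF I] _ submod_mono[OF Z_sub_Ocl fracD(1)[OF u I]]] by blast
  obtain w where w: "z * w = 1" using nonzero_Z_inverse[OF z(1)] .
  have "poly p x * u = poly p x * (z * u) * w" using w by (metis mult.commute mult.left_commute mult_1_right)
  then have 0: "poly p x * u = 0" using p(3) by simp
  \<comment> \<open>The relation holds only in the component of \<open>u\<close>; multiplying the
    polynomial by the variable turns it into one in \<open>K\<close>, because \<open>x\<close> lies
    in that component.\<close>
  have "poly (pCons 0 p) x = (poly p x * u) * x" using x(1) by simp (metis mult.assoc mult.commute)
  then have "poly (pCons 0 p) x = 0" using 0 by simp
  moreover have "lead_coeff (pCons 0 p) = 1" using p(1) by auto
  moreover have "\<forall>i. coeff (pCons 0 p) i \<in> Z" using p(2) Z_rules(2) by (auto simp: coeff_pCons split: nat.splits)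
  ultimately show ?thesis unfolding Ocl_def integral_over_def by blast
qed

end

section \<open>Products of ideals\<close>

lemma ideal_prod_mult: "a \<in> A \<Longrightarrow> b \<in> B \<Longrightarrow> a * b \<in> ideal_prod A B"
  unfolding ideal_prod_def
  by (rule CollectI, rule exI[of _ "1::nat"], rule exI[of _ "\<lambda>_. a"], rule exI[of _ "\<lambda>_. b"]) auto

lemma zero_in_ideal_prod: "0 \<in> ideal_prod A B"
  unfolding ideal_prod_def by (rule CollectI, rule exI[of _ "0::nat"]) auto

lemma sum_lessThan_add: "(\<Sum>k<m + m'. f k) = (\<Sum>k<m. f k) + (\<Sum>k<m'. f (m + k :: nat) :: 'a::comm_monoid_add)"
  by (induction m') (simp_all add: add.assoc)

lemma ideal_prodE:
  assumes "x \<in> ideal_prod A B"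
  obtains m a b where "x = (\<Sum>k<m::nat. a k * b k)" "\<forall>k<m. a k \<in> A \<and> b k \<in> B"
  using assms unfolding ideal_prod_def by blast

lemma ideal_prod_add:
  assumes "x \<in> ideal_prod A B" "y \<in> ideal_prod A B"
  shows "x + y \<in> ideal_prod A B"
proof -
  obtain m a b where 1: "x = (\<Sum>k<m::nat. a k * b k)" "\<forall>k<m. a k \<in> A \<and> b k \<in> B"
    using assms(1) unfolding ideal_prod_def by blast
  obtain m' a' b' where 2: "y = (\<Sum>k<m'::nat. a' k * b' k)" "\<forall>k<m'. a' k \<in> A \<and> b' k \<in> B"
    using assms(2) unfolding ideal_prod_def by blast
  let ?a = "\<lambda>k. if k < m then a k else a' (k - m)" and ?b = "\<lambda>k. if k < m then b k else b' (k - m)"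
  have "x + y = (\<Sum>k<m+m'. ?a k * ?b k)" unfolding sum_lessThan_add 1(1) 2(1) by simp
  moreover have "\<forall>k<m+m'. ?a k \<in> A \<and> ?b k \<in> B" using 1(2) 2(2) by auto
  ultimately show ?thesis unfolding ideal_prod_def
    by (intro CollectI exI[of _ "m + m'"] exI[of _ ?a] exI[of _ ?b] conjI)
qed

lemma ideal_prod_sub:
  assumes "0 \<in> S" "\<And>x y. x \<in> S \<Longrightarrow> y \<in> S \<Longrightarrow> x + y \<in> S" "\<And>a b. a \<in> A \<Longrightarrow> b \<in> B \<Longrightarrow> a * b \<in> S"
  shows "ideal_prod A B \<subseteq> S"
proof
  fix x assume "x \<in> ideal_prod A B"
  then obtain m a b where 1: "x = (\<Sum>k<m::nat. a k * b k)" "\<forall>k<m. a k \<in> A \<and> b k \<in> B"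
    unfolding ideal_prod_def by blast
  have "l \<le> m \<Longrightarrow> (\<Sum>k<l. a k * b k) \<in> S" for l
    by (induction l) (use assms 1(2) in auto)
  then show "x \<in> S" using 1(1) by blast
qed

lemma ideal_prod_submod:
  assumes "submod S (*) A"
  shows "submod S (*) (ideal_prod A B)"
proof (rule submodI)
  fix r x assume r: "r \<in> S" and x: "x \<in> ideal_prod A B"
  have "ideal_prod A B \<subseteq> {x. r * x \<in> ideal_prod A B}"
  proof (rule ideal_prod_sub)
    fix a b assume ab: "a \<in> A" "b \<in> B"
    have "(r * a) * b \<in> ideal_prod A B" using submodD(3)[OF assms r ab(1)] ab(2) by (rule ideal_prod_mult)
    then show "a * b \<in> {x. r * x \<in> ideal_prod A B}" by (simp add: mult.assoc)
  qed (auto simp: zero_in_ideal_prod distrib_left intro: ideal_prod_add)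
  then show "r * x \<in> ideal_prod A B" using x by blast
qed (auto simp: zero_in_ideal_prod intro: ideal_prod_add)

section \<open>Invertibility of fractional ideals\<close>

text \<open>The ideals of \<open>O = u * Ocl\<close> are treated as \<open>Ocl\<close>-modules, with the idempotent \<open>u\<close> as unit element.\<close>

locale idempotent_setting = order_setting +
  fixes u :: 'a
  assumes idem: "u * u = u"
begin

definition ideal :: "'a set \<Rightarrow> bool" where
  "ideal I \<longleftrightarrow> submod Ocl (*) I \<and> I \<subseteq> proj u Ocl"

definition prime_ideal :: "'a set \<Rightarrow> bool" where
  "prime_ideal P \<longleftrightarrow> ideal P \<and> u \<notin> P \<and>
     (\<forall>x\<in>proj u Ocl. \<forall>y\<in>proj u Ocl. x * y \<in> P \<longrightarrow> x \<in> P \<or> y \<in> P)"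

text \<open>The colon ideal of \<open>Ocl\<close> by \<open>I\<close> within the component. It
  exists for every \<open>I\<close>; by \<open>frac_invertible\<close> it is the inverse of a
  fractional ideal.\<close>

definition inv_ideal :: "'a set \<Rightarrow> 'a set" where
  "inv_ideal I = {x. u * x = x \<and> (\<forall>y\<in>I. x * y \<in> Ocl)}"

lemmas mem_O = proj_Ocl_iff[OF idem]

lemma u_Ocl: "u \<in> Ocl" by (rule idempotent_Ocl[OF idem])

lemma u_left: "u * x = x \<Longrightarrow> u * (r * x) = r * x"
  by (metis mult.left_commute)

lemma u_right: "u * x = x \<Longrightarrow> u * (x * r) = x * r"
  by (metis mult.assoc)

lemma submod_Ocl_diff: "submod Ocl (*) I \<Longrightarrow> x \<in> I \<Longrightarrow> y \<in> I \<Longrightarrow> x - y \<in> I"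
  using K.submod_diff submod_mono[OF Z_sub_Ocl] by blast

lemma idealD:
  assumes "ideal I"
  shows "submod Ocl (*) I" "x \<in> I \<Longrightarrow> x \<in> Ocl" "x \<in> I \<Longrightarrow> u * x = x" "0 \<in> I"
    "x \<in> I \<Longrightarrow> y \<in> I \<Longrightarrow> x + y \<in> I" "r \<in> Ocl \<Longrightarrow> x \<in> I \<Longrightarrow> r * x \<in> I" "r \<in> Ocl \<Longrightarrow> x \<in> I \<Longrightarrow> x * r \<in> I"
    "x \<in> I \<Longrightarrow> y \<in> I \<Longrightarrow> x - y \<in> I"
proof -
  show 1: "submod Ocl (*) I" using assms unfolding ideal_def by blast
  show "x \<in> I \<Longrightarrow> x \<in> Ocl" "x \<in> I \<Longrightarrow> u * x = x" using assms mem_O unfolding ideal_def by blast+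
  show "r \<in> Ocl \<Longrightarrow> x \<in> I \<Longrightarrow> x * r \<in> I" using submodD(3)[OF 1, of r x] by (simp add: mult.commute)
qed (use submodD[of Ocl "(*)" I] submod_Ocl_diff[of I] assms in \<open>auto simp: ideal_def\<close>)

lemma frac_integral_ideal: "frac u I \<Longrightarrow> I \<subseteq> Ocl \<Longrightarrow> ideal I"
  using fracD[OF idem] unfolding ideal_def using mem_O by blast

section \<open>Prime ideals of the maximal order\<close>

lemma maximal_ideal_exists:
  assumes "\<F> \<noteq> {}" "\<And>I. I \<in> \<F> \<Longrightarrow> ideal I"
  obtains I where "I \<in> \<F>" "\<And>J. J \<in> \<F> \<Longrightarrow> I \<subseteq> J \<Longrightarrow> J = I"
proof (rule K.maximal_submodule_exists[OF Ocl_fin_gen assms(1)])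
  fix N assume "N \<in> \<F>"
  then have "ideal N" by (rule assms(2))
  then show "submod Z (*) N \<and> N \<subseteq> Ocl" using submod_mono[OF Z_sub_Ocl] idealD(1,2) by blast
qed blast

lemma ideal_plus: "ideal I \<Longrightarrow> ideal J \<Longrightarrow> ideal (I + J)"
proof -
  assume I: "ideal I" and J: "ideal J"
  have "submod Ocl (*) (I + J)"
  proof (rule submodI)
    show "0 \<in> I + J" using set_plus_intro[OF idealD(4)[OF I] idealD(4)[OF J]] by simp
  next
    fix x y assume "x \<in> I + J" "y \<in> I + J"
    then obtain a b c d where "x = a + b" "y = c + d" "a \<in> I" "c \<in> I" "b \<in> J" "d \<in> J"
      by (auto elim!: set_plus_elim)
    then have "x + y = (a + c) + (b + d)" "a + c \<in> I" "b + d \<in> J" using idealD(5)[OF I] idealD(5)[OF J] by (auto simp: algebra_simps)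
    then show "x + y \<in> I + J" using set_plus_intro[of "a + c" I "b + d" J] by (simp only:)
  next
    fix r x assume "r \<in> Ocl" "x \<in> I + J"
    then obtain a b where "x = a + b" "a \<in> I" "b \<in> J" by (auto elim!: set_plus_elim)
    then have "r * x = r * a + r * b" "r * a \<in> I" "r * b \<in> J"
      using idealD(6)[OF I \<open>r \<in> Ocl\<close>] idealD(6)[OF J \<open>r \<in> Ocl\<close>] by (auto simp: distrib_left)
    then show "r * x \<in> I + J" by (simp add: set_plus_intro)
  qed
  moreover have "x \<in> proj u Ocl" if x: "x \<in> I + J" for x
  proof -
    obtain a b where ab: "x = a + b" "a \<in> I" "b \<in> J" using x unfolding set_plus_def by blast
    then show ?thesis using idealD(2,3)[OF I ab(2)] idealD(2,3)[OF J ab(3)] Ocl_rules(4) mem_O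
      by (simp add: distrib_left)
  qed
  ultimately show ?thesis unfolding ideal_def by blast
qed

lemma ideal_principal:
  assumes "a \<in> proj u Ocl"
  shows "ideal {r * a | r. r \<in> Ocl}"
  unfolding ideal_def
proof (intro conjI submodI subsetI)
  show "0 \<in> {r * a | r. r \<in> Ocl}" using Ocl_rules(2) by (auto intro!: exI[of _ 0])
next
  fix x y assume "x \<in> {r * a | r. r \<in> Ocl}" "y \<in> {r * a | r. r \<in> Ocl}"
  then obtain r t where "x = r * a" "y = t * a" "r \<in> Ocl" "t \<in> Ocl" by blast
  then have "x + y = (r + t) * a" "r + t \<in> Ocl" using Ocl_rules(4) by (auto simp: algebra_simps)
  then show "x + y \<in> {r * a | r. r \<in> Ocl}" by blast
next
  fix t x assume "t \<in> Ocl" "x \<in> {r * a | r. r \<in> Ocl}"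
  then obtain r where "x = r * a" "r \<in> Ocl" by blast
  then have "t * x = (t * r) * a" "t * r \<in> Ocl" using Ocl_rules(6) \<open>t \<in> Ocl\<close> by (auto simp: algebra_simps)
  then show "t * x \<in> {r * a | r. r \<in> Ocl}" by blast
next
  fix x assume "x \<in> {r * a | r. r \<in> Ocl}"
  then obtain r where "x = r * a" "r \<in> Ocl" by blast
  then show "x \<in> proj u Ocl" using assms Ocl_rules(6) u_left unfolding mem_O by blast
qed

lemma prime_ideal_above:
  assumes I: "ideal I" "u \<notin> I"
  obtains P where "prime_ideal P" "I \<subseteq> P"
proof -
  obtain P where P: "P \<in> {P. ideal P \<and> u \<notin> P \<and> I \<subseteq> P}"
      and max: "\<And>J. J \<in> {P. ideal P \<and> u \<notin> P \<and> I \<subseteq> P} \<Longrightarrow> P \<subseteq> J \<Longrightarrow> J = P"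
    by (rule maximal_ideal_exists[of "{P. ideal P \<and> u \<notin> P \<and> I \<subseteq> P}"]) (use I in auto)
  from P have iP: "ideal P" and uP: "u \<notin> P" and IP: "I \<subseteq> P" by auto
  have ext: "\<exists>p r. p \<in> P \<and> r \<in> Ocl \<and> u = p + r * x" if x: "x \<in> proj u Ocl" "x \<notin> P" for x
  proof -
    let ?J = "P + {r * x | r. r \<in> Ocl}"
    have J: "ideal ?J" by (rule ideal_plus[OF iP ideal_principal[OF x(1)]])
    have "0 * x \<in> {r * x | r. r \<in> Ocl}" "1 * x \<in> {r * x | r. r \<in> Ocl}" using Ocl_rules(1,2) by blast+
    then have 01: "0 \<in> {r * x | r. r \<in> Ocl}" "x \<in> {r * x | r. r \<in> Ocl}" by simp_all
    have "P \<subseteq> ?J" using set_plus_intro[OF _ 01(1), of _ P] by auto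
    moreover have "x \<in> ?J" using set_plus_intro[OF idealD(4)[OF iP] 01(2)] by simp
    ultimately have "u \<in> ?J" using max[of ?J] J IP x(2) by blast
    then show ?thesis by (auto elim!: set_plus_elim)
  qed
  have "x \<in> P \<or> y \<in> P" if xy: "x \<in> proj u Ocl" "y \<in> proj u Ocl" "x * y \<in> P" for x y
  proof (rule ccontr)
    assume "\<not> (x \<in> P \<or> y \<in> P)"
    then obtain p r p' r' where p: "p \<in> P" "r \<in> Ocl" "u = p + r * x" "p' \<in> P" "r' \<in> Ocl" "u = p' + r' * y"
      using ext xy by meson
    have "u = (p + r * x) * (p' + r' * y)" using p(3,6) idem by simp
    also have "\<dots> = p * (p' + r' * y) + r * x * p' + (r * r') * (x * y)" by (simp add: algebra_simps)
    finally have eq: "u = p * u + r * x * p' + (r * r') * (x * y)" using p(6) by simp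
    have "p * u \<in> P" using p(1) u_Ocl idealD(7)[OF iP] by blast
    moreover have "r * x * p' \<in> P" using p idealD(6)[OF iP] Ocl_rules(6) xy mem_O by blast
    moreover have "(r * r') * (x * y) \<in> P" using p xy idealD(6)[OF iP] Ocl_rules(6) by blast
    ultimately have "p * u + r * x * p' + (r * r') * (x * y) \<in> P" by (intro idealD(5)[OF iP])
    then have "u \<in> P" by (subst eq)
    then show False using uP by blast
  qed
  then have "prime_ideal P" unfolding prime_ideal_def using iP uP by blast
  then show thesis using that IP by blast
qed

lemma poly_Ocl: "(\<forall>i. coeff p i \<in> Ocl) \<Longrightarrow> x \<in> Ocl \<Longrightarrow> poly p x \<in> Ocl"
  unfolding poly_altdef by (intro is_subring_sum[OF Ocl_subring] Ocl_rules(6) is_subring_power[OF Ocl_subring]) auto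

text \<open>Dimension one passes from \<open>Z\<close> to its integral extension. The contraction
  \<open>p\<close> of \<open>P\<close> is prime, and nonzero thanks to \<open>z\<close>, hence
  maximal. For \<open>x\<close> in \<open>J\<close> but not in \<open>P\<close>, a monic relation of
  least degree modulo \<open>P\<close> has a constant term \<open>c\<close> outside
  \<open>p\<close>, while \<open>c * u\<close> is in \<open>J\<close>; together with
  \<open>p\<close> it generates \<open>Z\<close>.\<close>

lemma prime_ideal_maximal:
  assumes P: "prime_ideal P" and z: "z \<in> Z - {0}" "z * u \<in> P" and J: "ideal J" "P \<subseteq> J" "J \<noteq> P"
  shows "u \<in> J"
proof -
  have iP: "ideal P" and uP: "u \<notin> P" and
    prime: "\<And>x y. x \<in> proj u Ocl \<Longrightarrow> y \<in> proj u Ocl \<Longrightarrow> x * y \<in> P \<Longrightarrow> x \<in> P \<or> y \<in> P"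
    using P unfolding prime_ideal_def by blast+
  define p where "p = {y \<in> Z. y * u \<in> P}"
  have p_sub: "submod Z (*) p"
  proof (rule submodI)
    show "0 \<in> p" using Z_rules(2) idealD(4)[OF iP] by (simp add: p_def)
    show "x + y \<in> p" if "x \<in> p" "y \<in> p" for x y
      using that Z_rules(4) idealD(5)[OF iP] by (auto simp: p_def distrib_right)
    show "r * x \<in> p" if "r \<in> Z" "x \<in> p" for r x
      using that Z_rules(6) idealD(6)[OF iP] Z_sub_Ocl by (auto simp: p_def mult.assoc)
  qed
  have "is_prime_ideal Z p" unfolding is_prime_ideal_def is_ideal_def
  proof (intro conjI ballI impI)
    show "p \<subseteq> Z" by (auto simp: p_def)
    have "1 \<notin> p" using uP by (simp add: p_def)
    then show "p \<noteq> Z" using Z_rules(1) by blast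
    fix a b assume ab: "a \<in> Z" "b \<in> Z" "a * b \<in> p"
    have "(a * u) * (b * u) = (a * b) * (u * u)" by (simp only: ac_simps)
    then have "(a * u) * (b * u) \<in> P" using ab idem by (simp add: p_def)
    moreover have "a * u \<in> proj u Ocl" "b * u \<in> proj u Ocl"
      using ab Z_sub_Ocl u_Ocl Ocl_rules(6) u_left[OF idem] unfolding mem_O by blast+
    ultimately show "a \<in> p \<or> b \<in> p" using prime ab by (auto simp: p_def)
  qed (rule p_sub)
  moreover have "p \<noteq> {0}" using z by (auto simp: p_def)
  ultimately have max: "is_maximal_ideal Z p" by (rule Z_dim_one)
  obtain x where x: "x \<in> J" "x \<notin> P" using J by blast
  have xO: "x \<in> Ocl" "u * x = x" using idealD(2,3)[OF J(1) x(1)] .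
  define S where "S = {p. lead_coeff p = 1 \<and> (\<forall>i. coeff p i \<in> Z) \<and> poly p x * u \<in> P}"
  obtain p0 where "lead_coeff p0 = 1" "\<forall>i. coeff p0 i \<in> Z" "poly p0 x = 0"
    using xO(1) unfolding Ocl_def integral_over_def by blast
  then have "p0 \<in> S" using idealD(4)[OF iP] by (simp add: S_def)
  then obtain f where f: "f \<in> S" "\<And>g. g \<in> S \<Longrightarrow> degree f \<le> degree g"
    using ex_has_least_nat[of "\<lambda>f. f \<in> S" p0 degree] by blast
  obtain c g where fg: "f = pCons c g" by (cases f)
  have fS: "lead_coeff f = 1" "\<And>i. coeff f i \<in> Z" "poly f x * u \<in> P" using f(1) by (auto simp: S_def)
  have g0: "g \<noteq> 0"
  proof
    assume "g = 0"
    then have "c = 1" using fS(1) fg by simp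
    then show False using fS(3) uP \<open>g = 0\<close> fg by simp
  qed
  have cZ: "c \<in> Z" using fS(2)[of 0] fg by simp
  have gZ: "coeff g i \<in> Z" for i using fS(2)[of "Suc i"] fg by simp
  have g1: "lead_coeff g = 1" using fS(1) fg g0 by simp
  have split: "poly f x * u = c * u + x * (poly g x * u)" using fg by (simp add: algebra_simps)
  have gO: "poly g x * u \<in> proj u Ocl"
    using poly_Ocl[of g x] gZ Z_sub_Ocl xO u_Ocl Ocl_rules(6) u_left[OF idem] unfolding mem_O by blast
  \<comment> \<open>Otherwise \<open>x\<close> could be cancelled from the relation, as
    \<open>P\<close> is prime, which would lower the degree.\<close>
  have "c \<notin> p"
  proof
    assume "c \<in> p"
    then have "x * (poly g x * u) \<in> P" using split idealD(8)[OF iP fS(3), of "c * u"] by (simp add: p_def)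
    then have "poly g x * u \<in> P" using prime[of x] gO x(2) xO mem_O by blast
    then have "g \<in> S" using g1 gZ by (simp add: S_def)
    then show False using f(2)[of g] fg g0 by simp
  qed
  let ?I = "{y + w * c | y w. y \<in> p \<and> w \<in> Z}"
  have "is_ideal Z ?I" unfolding is_ideal_def
  proof (intro conjI submodI subsetI)
    show "x \<in> Z" if "x \<in> ?I" for x using that Z_rules(4,6) cZ by (auto simp: p_def)
    have "0 + 0 * c \<in> ?I" using submodD(1)[OF p_sub] Z_rules(2) by blast
    then show "0 \<in> ?I" by simp
  next
    fix a b assume "a \<in> ?I" "b \<in> ?I"
    then obtain y w y' w' where *: "a = y + w * c" "b = y' + w' * c" "y \<in> p" "y' \<in> p" "w \<in> Z" "w' \<in> Z" by blast
    then have "a + b = (y + y') + (w + w') * c" by (simp add: algebra_simps)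
    then show "a + b \<in> ?I" using submodD(2)[OF p_sub *(3,4)] Z_rules(4)[OF *(5,6)] by blast
  next
    fix r a assume r: "r \<in> Z" and "a \<in> ?I"
    then obtain y w where *: "a = y + w * c" "y \<in> p" "w \<in> Z" by blast
    then have "r * a = r * y + (r * w) * c" by (simp add: algebra_simps)
    then show "r * a \<in> ?I" using submodD(3)[OF p_sub r *(2)] Z_rules(6)[OF r *(3)] by blast
  qed
  moreover have "p \<subseteq> ?I"
  proof
    fix y assume "y \<in> p"
    then have "y + 0 * c \<in> ?I" using Z_rules(2) by blast
    then show "y \<in> ?I" by simp
  qed
  moreover have "?I \<noteq> p"
  proof -
    have "0 + 1 * c \<in> ?I" using Z_rules(1) submodD(1)[OF p_sub] by blast
    then show ?thesis using \<open>c \<notin> p\<close> by auto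
  qed
  ultimately have "?I = Z" using max unfolding is_maximal_ideal_def by blast
  then obtain y w where yw: "1 = y + w * c" "y \<in> p" "w \<in> Z" using Z_rules(1) by blast
  have "x * (poly g x * u) \<in> J" using gO mem_O idealD(7)[OF J(1) _ x(1)] by blast
  then have "poly f x * u - x * (poly g x * u) \<in> J" using fS(3) J(2) idealD(8)[OF J(1)] by blast
  then have "c * u \<in> J" using split by simp
  then have "w * (c * u) \<in> J" using idealD(6)[OF J(1)] yw(3) Z_sub_Ocl by blast
  moreover have "y * u \<in> J" using yw(2) J(2) by (auto simp: p_def)
  ultimately have "y * u + w * (c * u) \<in> J" by (intro idealD(5)[OF J(1)])
  moreover have "y * u + w * (c * u) = u" using yw(1) by (metis distrib_right mult.assoc mult_1_left)
  ultimately show "u \<in> J" by simp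
qed

text \<open>A conductor \<open>{x. x * c \<in> Ocl}\<close> that is maximal among those contained in \<open>P\<close> is prime, hence
  equal to \<open>P\<close>.\<close>

lemma prime_ideal_escape:
  assumes P: "prime_ideal P" and z: "z \<in> Z - {0}" "z * u \<in> P"
  obtains c where "u * c = c" "c \<notin> Ocl" "\<And>x. x \<in> P \<Longrightarrow> c * x \<in> Ocl"
proof -
  have iP: "ideal P" and uP: "u \<notin> P" and
    prime: "\<And>x y. x \<in> proj u Ocl \<Longrightarrow> y \<in> proj u Ocl \<Longrightarrow> x * y \<in> P \<Longrightarrow> x \<in> P \<or> y \<in> P"
    using P unfolding prime_ideal_def by blast+
  define col where "col c = {x \<in> proj u Ocl. x * c \<in> Ocl}" for c
  \<comment> \<open>Requiring \<open>z * c \<in> Ocl\<close> keeps \<open>z * u\<close> in every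
    conductor considered, so that \<open>prime_ideal_maximal\<close> applies to the maximal one once
    it is known to be prime.\<close>
  define adm where "adm c \<longleftrightarrow> u * c = c \<and> z * c \<in> Ocl \<and> col c \<subseteq> P" for c
  have col_ideal: "ideal (col c)" for c
    unfolding ideal_def
  proof (intro conjI submodI)
    show "0 \<in> col c" using Ocl_rules(2) by (simp add: col_def mem_O)
    show "x + y \<in> col c" if "x \<in> col c" "y \<in> col c" for x y
      using that Ocl_rules(4) by (auto simp: col_def mem_O algebra_simps)
    show "r * x \<in> col c" if "r \<in> Ocl" "x \<in> col c" for r x
      using that Ocl_rules(6)[of r x] Ocl_rules(6)[of r "x * c"] u_left[of x r] by (auto simp: col_def mem_O mult.assoc)
    show "col c \<subseteq> proj u Ocl" by (auto simp: col_def)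
  qed
  obtain w where w: "z * w = 1" using nonzero_Z_inverse[OF z(1)] .
  \<comment> \<open>With \<open>w\<close> the inverse of \<open>z\<close>, every element of this
    conductor is a multiple of \<open>z * u\<close> and hence in \<open>P\<close>; so the family is
    not empty.\<close>
  have "adm (w * u)" unfolding adm_def
  proof (intro conjI subsetI)
    show "u * (w * u) = w * u" by (rule u_left[OF idem])
    show "z * (w * u) \<in> Ocl" using w u_Ocl by (simp add: mult.assoc[symmetric])
    fix x assume "x \<in> col (w * u)"
    then have x: "u * x = x" "x * (w * u) \<in> Ocl" by (auto simp: col_def mem_O)
    have "(x * (w * u)) * (z * u) = (z * w) * ((u * u) * x)" by (simp only: ac_simps)
    then have "(x * (w * u)) * (z * u) = x" using w idem x by simp
    then show "x \<in> P" using idealD(6)[OF iP x(2) z(2)] by simp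
  qed
  then have ne: "col ` Collect adm \<noteq> {}" by blast
  obtain I where I: "I \<in> col ` Collect adm" "\<And>J. J \<in> col ` Collect adm \<Longrightarrow> I \<subseteq> J \<Longrightarrow> J = I"
    by (rule maximal_ideal_exists[OF ne]) (auto simp: col_ideal)
  from I(1) obtain c where "I = col c" and c: "adm c" by blast
  then have max: "col d = col c" if "adm d" "col c \<subseteq> col d" for d using I(2)[of "col d"] that by blast
  have zu: "z * u \<in> col c"
  proof -
    have "z * u \<in> proj u Ocl" using z Z_sub_Ocl u_Ocl Ocl_rules(6) u_left[OF idem] unfolding mem_O by blast
    moreover have "z * u * c = z * c" using c by (simp add: adm_def mult.assoc)
    ultimately show ?thesis using c by (simp add: col_def adm_def)
  qed
  have mono: "col c \<subseteq> col (c * t)" if "t \<in> Ocl" for t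
    using that Ocl_rules(6) by (auto simp: col_def mult.assoc[symmetric])
  have adm_mult: "u * (c * t) = c * t \<and> z * (c * t) \<in> Ocl" if "t \<in> Ocl" for t
    using c that Ocl_rules(6)[of "z * c" t] u_right[of c t] by (simp add: adm_def mult.assoc)
  have "prime_ideal (col c)" unfolding prime_ideal_def
  proof (intro conjI ballI impI)
    show "ideal (col c)" by (rule col_ideal)
    show "u \<notin> col c" using uP c by (auto simp: adm_def)
    fix x y assume xy: "x \<in> proj u Ocl" "y \<in> proj u Ocl" "x * y \<in> col c"
    show "x \<in> col c \<or> y \<in> col c"
    proof (cases "col (c * x) \<subseteq> P")
      case True
      then have "col (c * x) = col c" using max[of "c * x"] mono adm_mult xy(1) mem_O by (simp add: adm_def)
      moreover have "y \<in> col (c * x)" using xy by (simp add: col_def ac_simps)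
      ultimately show ?thesis by blast
    next
      case False
      then obtain t where t: "t \<in> proj u Ocl" "t * (c * x) \<in> Ocl" "t \<notin> P" by (auto simp: col_def)
      have "col (c * t) \<subseteq> P"
      proof
        fix y assume y: "y \<in> col (c * t)"
        then have yO: "y \<in> proj u Ocl" by (simp add: col_def)
        have "y * t * c \<in> Ocl" using y by (simp add: col_def ac_simps)
        moreover have "y * t \<in> proj u Ocl" using yO t(1) Ocl_rules(6) u_left unfolding mem_O by blast
        ultimately have "y * t \<in> P" using c by (auto simp: col_def adm_def)
        then show "y \<in> P" using prime[OF yO t(1)] t(3) by blast
      qed
      then have "col (c * t) = col c" using max[of "c * t"] mono adm_mult t(1) mem_O by (simp add: adm_def)
      moreover have "x \<in> col (c * t)" using xy t(2) by (simp add: col_def ac_simps)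
      ultimately show ?thesis by blast
    qed
  qed
  then have "P = col c" using prime_ideal_maximal[OF _ z(1) zu iP] c uP by (auto simp: adm_def)
  moreover have "c \<notin> Ocl"
  proof
    assume "c \<in> Ocl"
    then have "u \<in> col c" using u_Ocl idem Ocl_rules(6) by (simp add: col_def mem_O)
    then show False using c uP by (auto simp: adm_def)
  qed
  ultimately show thesis using that[of c] c by (auto simp: adm_def col_def mult.commute)
qed

text \<open>For a maximal counterexample \<open>I\<close>, an element \<open>c\<close> that is not
  integral but multiplies a prime above \<open>I\<close> into \<open>Ocl\<close> enlarges
  \<open>I\<close> to an integral ideal \<open>J\<close>; equality is excluded because
  \<open>c\<close> would then stabilise \<open>I\<close>. So \<open>J\<close> is invertible, and
  this makes \<open>I\<close> invertible.\<close>

lemma integral_ideal_invertible: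
  assumes I0: "frac u I0" "I0 \<subseteq> Ocl"
  shows "u \<in> ideal_prod I0 (inv_ideal I0)"
proof (rule ccontr)
  assume no: "u \<notin> ideal_prod I0 (inv_ideal I0)"
  let ?F = "{I. frac u I \<and> I \<subseteq> Ocl \<and> u \<notin> ideal_prod I (inv_ideal I)}"
  obtain I where I: "I \<in> ?F" and max: "\<And>J. J \<in> ?F \<Longrightarrow> I \<subseteq> J \<Longrightarrow> J = I"
    by (rule maximal_ideal_exists[of ?F]) (use I0 no frac_integral_ideal in auto)
  then have fI: "frac u I" and IO: "I \<subseteq> Ocl" and nI: "u \<notin> ideal_prod I (inv_ideal I)" by auto
  have iI: "ideal I" by (rule frac_integral_ideal[OF fI IO])
  have "u \<in> inv_ideal I" using idem idealD(2,3)[OF iI] by (simp add: inv_ideal_def)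
  then have "u \<notin> I" using nI ideal_prod_mult[of u I u "inv_ideal I"] idem by auto
  then obtain P where P: "prime_ideal P" "I \<subseteq> P" using prime_ideal_above[OF iI] by blast
  obtain z where z: "z \<in> Z - {0}" "z * u \<in> I" using fracD(3)[OF idem fI] by blast
  obtain c where c: "u * c = c" "c \<notin> Ocl" "\<And>x. x \<in> P \<Longrightarrow> c * x \<in> Ocl"
    using prime_ideal_escape[OF P(1) z(1)] z(2) P(2) by blast
  define J where "J = {i + c * j | i j. i \<in> I \<and> j \<in> I}"
  have IJ: "I \<subseteq> J"
  proof
    fix i assume "i \<in> I"
    then have "i + c * 0 \<in> J" unfolding J_def using idealD(4)[OF iI] by blast
    then show "i \<in> J" by simp
  qed
  have JO: "J \<subseteq> Ocl" using c(3) P(2) IO Ocl_rules(4) unfolding J_def by blast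
  have "frac u J" unfolding frac_iff[OF idem]
  proof (intro conjI submodI ballI)
    show "0 \<in> J" using IJ idealD(4)[OF iI] by blast
    show "\<exists>z\<in>Z - {0}. z * u \<in> J" using z IJ by blast
    show "\<exists>z\<in>Z - {0}. \<forall>x\<in>J. z * x \<in> Ocl" by (rule bexI[of _ 1]) (use JO one_nonzero in auto)
  next
    fix x y assume "x \<in> J" "y \<in> J"
    then obtain i j i' j' where *: "x = i + c * j" "y = i' + c * j'" "i \<in> I" "i' \<in> I" "j \<in> I" "j' \<in> I"
      unfolding J_def by blast
    then have "x + y = (i + i') + c * (j + j')" by (simp add: algebra_simps)
    then show "x + y \<in> J" unfolding J_def using idealD(5)[OF iI *(3,4)] idealD(5)[OF iI *(5,6)] by blast
  next
    fix r x assume r: "r \<in> Ocl" and "x \<in> J"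
    then obtain i j where *: "x = i + c * j" "i \<in> I" "j \<in> I" unfolding J_def by blast
    then have "r * x = r * i + c * (r * j)" by (simp add: algebra_simps)
    then show "r * x \<in> J" unfolding J_def using idealD(6)[OF iI r *(2)] idealD(6)[OF iI r *(3)] by blast
  next
    fix x assume "x \<in> J"
    then obtain i j where *: "x = i + c * j" "i \<in> I" "j \<in> I" unfolding J_def by blast
    then show "u * x = x" using idealD(3)[OF iI] u_right[OF c(1)] by (simp add: distrib_left)
  qed
  moreover have "J \<noteq> I"
  proof
    assume "J = I"
    have "c * y \<in> I" if "y \<in> I" for y
    proof -
      have "0 + c * y \<in> J" unfolding J_def using idealD(4)[OF iI] that by blast
      then show ?thesis using \<open>J = I\<close> by simp
    qed
    then show False using stable_integral[OF idem fI c(1)] c(2) by blast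
  qed
  ultimately have "u \<in> ideal_prod J (inv_ideal J)" using max[of J] IJ JO by blast
  \<comment> \<open>If \<open>b\<close> multiplies \<open>J\<close> into \<open>Ocl\<close>, then
    both \<open>b\<close> and \<open>c * b\<close> multiply \<open>I\<close> into
    \<open>Ocl\<close>.\<close>
  moreover have "ideal_prod J (inv_ideal J) \<subseteq> ideal_prod I (inv_ideal I)"
  proof (rule ideal_prod_sub)
    fix a b assume "a \<in> J" and b: "b \<in> inv_ideal J"
    then obtain i j where a: "a = i + c * j" "i \<in> I" "j \<in> I" unfolding J_def by blast
    have "b \<in> inv_ideal I" using b IJ unfolding inv_ideal_def by blast
    moreover have "c * b \<in> inv_ideal I"
    proof -
      have "c * y \<in> J" if "y \<in> I" for y
      proof -
        have "0 + c * y \<in> J" unfolding J_def using idealD(4)[OF iI] that by blast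
        then show ?thesis by simp
      qed
      then have "b * (c * y) \<in> Ocl" if "y \<in> I" for y using b that unfolding inv_ideal_def by blast
      then show ?thesis using u_right[OF c(1)] by (auto simp: inv_ideal_def ac_simps)
    qed
    ultimately have "i * b + j * (c * b) \<in> ideal_prod I (inv_ideal I)"
      using a by (intro ideal_prod_add ideal_prod_mult)
    then show "a * b \<in> ideal_prod I (inv_ideal I)" using a(1) by (simp add: algebra_simps)
  qed (auto simp: zero_in_ideal_prod intro: ideal_prod_add)
  ultimately show False using nI by blast
qed

section \<open>Passage from integral to fractional ideals\<close>

lemma frac_scale:
  assumes I: "frac u I" and x: "u * x = x" "u * y = y" "x * y = u"
  shows "frac u ((*) x ` I)"
proof -
  obtain z z' where z: "z \<in> Z - {0}" "z * u \<in> I" "z' \<in> Z - {0}" "\<forall>x\<in>I. z' * x \<in> Ocl"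
    using fracD(3,4)[OF idem I] by blast
  obtain d where d: "d \<in> Z - {0}" "d * x \<in> Ocl" using denominator_Ocl by blast
  obtain d' where d': "d' \<in> Z - {0}" "d' * y \<in> Ocl" using denominator_Ocl by blast
  note S = submodD[OF fracD(1)[OF idem I]]
  show ?thesis unfolding frac_iff[OF idem]
  proof (intro conjI submodI)
    have "0 = x * 0" by simp
    then show "0 \<in> (*) x ` I" using S(1) by blast
    show "a + b \<in> (*) x ` I" if "a \<in> (*) x ` I" "b \<in> (*) x ` I" for a b
      using that S(2) by (auto simp: distrib_left[symmetric])
    show "r * a \<in> (*) x ` I" if "r \<in> Ocl" "a \<in> (*) x ` I" for r a
      using that S(3) by (auto simp: mult.left_commute[of r x])
    show "\<forall>a\<in>(*) x ` I. u * a = a" using fracD(2)[OF idem I] u_left by auto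
    show "\<exists>z\<in>Z - {0}. z * u \<in> (*) x ` I"
    proof
      show "z * d' \<in> Z - {0}" using nonzero_mult z(1) d'(1) by blast
      have "(d' * y) * (z * u) \<in> I" using S(3) d'(2) z(2) by blast
      moreover have "x * ((d' * y) * (z * u)) = z * d' * ((x * y) * u)" by (simp only: ac_simps)
      then have "z * d' * u = x * ((d' * y) * (z * u))" using x(3) idem by simp
      ultimately show "z * d' * u \<in> (*) x ` I" by blast
    qed
    show "\<exists>z\<in>Z - {0}. \<forall>a\<in>(*) x ` I. z * a \<in> Ocl"
    proof
      show "z' * d \<in> Z - {0}" using nonzero_mult z(3) d(1) by blast
      have "z' * d * (x * a) \<in> Ocl" if "a \<in> I" for a
      proof -
        have "(d * x) * (z' * a) \<in> Ocl" using that z(4) d(2) Ocl_rules(6) by blast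
        then show ?thesis by (simp only: ac_simps)
      qed
      then show "\<forall>a\<in>(*) x ` I. z' * d * a \<in> Ocl" by blast
    qed
  qed
qed

lemma frac_invertible:
  assumes I: "frac u I"
  shows "u \<in> ideal_prod I (inv_ideal I)"
proof -
  obtain z where z: "z \<in> Z - {0}" "\<forall>x\<in>I. z * x \<in> Ocl" using fracD(4)[OF idem I] by blast
  obtain w where w: "z * w = 1" using nonzero_Z_inverse[OF z(1)] .
  let ?J = "(*) (z * u) ` I"
  have eq: "z * u * x = z * x" if "x \<in> I" for x using fracD(2)[OF idem I that] by (simp add: mult.assoc)
  have "frac u ?J"
  proof (rule frac_scale[OF I, of _ "w * u"])
    have "z * u * (w * u) = (z * w) * (u * u)" by (simp only: ac_simps)
    then show "z * u * (w * u) = u" using w idem by simp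
  qed (auto simp: u_left idem)
  moreover have "?J \<subseteq> Ocl" using z(2) eq by auto
  ultimately have "u \<in> ideal_prod ?J (inv_ideal ?J)" by (rule integral_ideal_invertible)
  moreover have "ideal_prod ?J (inv_ideal ?J) \<subseteq> ideal_prod I (inv_ideal I)"
  proof (rule ideal_prod_sub)
    fix a b assume "a \<in> ?J" and b: "b \<in> inv_ideal ?J"
    then obtain x where x: "x \<in> I" "a = z * x" using eq by auto
    have "b * (z * y) \<in> Ocl" if "y \<in> I" for y
    proof -
      have "b * (z * u * y) \<in> Ocl" using b that unfolding inv_ideal_def by blast
      then show ?thesis using eq[OF that] by simp
    qed
    then have "z * b \<in> inv_ideal I" using b u_left[of b z] by (auto simp: inv_ideal_def mult.commute mult.left_commute)
    then have "x * (z * b) \<in> ideal_prod I (inv_ideal I)" using x by (intro ideal_prod_mult)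
    then show "a * b \<in> ideal_prod I (inv_ideal I)" using x by (simp add: ac_simps)
  qed (auto simp: zero_in_ideal_prod intro: ideal_prod_add)
  ultimately show ?thesis by blast
qed

lemma inv_ideal_frac:
  assumes I: "frac u I"
  shows "frac u (inv_ideal I)"
proof -
  obtain z z' where z: "z \<in> Z - {0}" "z * u \<in> I" "z' \<in> Z - {0}" "\<forall>x\<in>I. z' * x \<in> Ocl"
    using fracD(3,4)[OF idem I] by blast
  show ?thesis unfolding frac_iff[OF idem]
  proof (intro conjI submodI)
    show "0 \<in> inv_ideal I" using Ocl_rules(2) by (simp add: inv_ideal_def)
    show "a + b \<in> inv_ideal I" if "a \<in> inv_ideal I" "b \<in> inv_ideal I" for a b
      using that Ocl_rules(4) by (auto simp: inv_ideal_def algebra_simps)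
    show "r * a \<in> inv_ideal I" if "r \<in> Ocl" "a \<in> inv_ideal I" for r a
      using that Ocl_rules(6) u_left by (auto simp: inv_ideal_def mult.assoc)
    show "\<forall>x\<in>inv_ideal I. u * x = x" by (simp add: inv_ideal_def)
    show "\<exists>z\<in>Z - {0}. z * u \<in> inv_ideal I"
    proof
      show "z' \<in> Z - {0}" by (rule z)
      show "z' * u \<in> inv_ideal I"
        using z(4) fracD(2)[OF idem I] u_left[OF idem] by (simp add: inv_ideal_def mult.assoc)
    qed
    show "\<exists>z\<in>Z - {0}. \<forall>x\<in>inv_ideal I. z * x \<in> Ocl"
    proof
      show "z \<in> Z - {0}" by (rule z)
      have "z * x \<in> Ocl" if "x \<in> inv_ideal I" for x
      proof -
        have "x * (z * u) \<in> Ocl" "u * x = x" using that z(2) by (auto simp: inv_ideal_def)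
        moreover have "x * (z * u) = z * (u * x)" by (simp only: ac_simps)
        ultimately show ?thesis by simp
      qed
      then show "\<forall>x\<in>inv_ideal I. z * x \<in> Ocl" by blast
    qed
  qed
qed

lemma ideal_prod_inv: 
  assumes I: "frac u I"
  shows "ideal_prod I (inv_ideal I) = proj u Ocl"
proof
  show "ideal_prod I (inv_ideal I) \<subseteq> proj u Ocl"
  proof (rule ideal_prod_sub)
    fix a b assume "a \<in> I" "b \<in> inv_ideal I"
    then have "b * a \<in> Ocl" "u * (a * b) = a * b" using u_left[of b a] by (auto simp: inv_ideal_def)
    then show "a * b \<in> proj u Ocl" unfolding mem_O by (simp add: mult.commute)
  qed (auto simp: mem_O Ocl_rules distrib_left)
  show "proj u Ocl \<subseteq> ideal_prod I (inv_ideal I)"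
  proof
    fix x assume "x \<in> proj u Ocl"
    then have x: "x \<in> Ocl" "u * x = x" using mem_O by auto
    have "x * u \<in> ideal_prod I (inv_ideal I)"
      using submodD(3)[OF ideal_prod_submod[OF fracD(1)[OF idem I]] x(1) frac_invertible[OF I]] .
    then show "x \<in> ideal_prod I (inv_ideal I)" using x(2) by (simp add: mult.commute)
  qed
qed

lemma invertible_ideals_eq: "invertible_ideals Z Q u (proj u Ocl) = {I. frac u I}"
  unfolding invertible_ideals_def using inv_ideal_frac ideal_prod_inv by blast

text \<open>Expand \<open>u\<close> in \<open>ideal_prod I (inv_ideal I)\<close> and multiply by
  \<open>x\<close>. Equality of inverses thus gives back equality of ideals, which is needed when a
  chain of inverses stops.\<close>

lemma double_inverse:
  assumes I: "frac u I" and x: "u * x = x" "\<And>y. y \<in> inv_ideal I \<Longrightarrow> x * y \<in> Ocl"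
  shows "x \<in> I"
proof -
  note S = submodD[OF fracD(1)[OF idem I]]
  have "ideal_prod I (inv_ideal I) \<subseteq> {v. x * v \<in> I}"
  proof (rule ideal_prod_sub)
    fix a b assume "a \<in> I" "b \<in> inv_ideal I"
    then have "(x * b) * a \<in> I" using x(2) S(3) by blast
    then show "a * b \<in> {v. x * v \<in> I}" by (simp add: ac_simps)
  qed (use S in \<open>auto simp: distrib_left\<close>)
  then have "x * u \<in> I" using frac_invertible[OF I] by blast
  then show ?thesis using x(1) by (simp add: mult.commute)
qed

end

section \<open>Approximation\<close>

context idempotent_setting
begin

lemma O_closed:
  "u \<in> proj u Ocl" "0 \<in> proj u Ocl" "x \<in> proj u Ocl \<Longrightarrow> y \<in> proj u Ocl \<Longrightarrow> x + y \<in> proj u Ocl"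
  "x \<in> proj u Ocl \<Longrightarrow> y \<in> proj u Ocl \<Longrightarrow> x - y \<in> proj u Ocl"
  "x \<in> proj u Ocl \<Longrightarrow> r \<in> Ocl \<Longrightarrow> r * x \<in> proj u Ocl"
  "x \<in> proj u Ocl \<Longrightarrow> r \<in> Ocl \<Longrightarrow> x * r \<in> proj u Ocl"
  unfolding mem_O using u_Ocl idem Ocl_rules u_left u_right by (auto simp: distrib_left right_diff_distrib)

lemma frac_O: "frac u (proj u Ocl)"
  unfolding frac_iff[OF idem]
proof (intro conjI submodI)
  show "\<exists>z\<in>Z - {0}. z * u \<in> proj u Ocl" by (rule bexI[of _ 1]) (use one_nonzero O_closed in auto)
  show "\<exists>z\<in>Z - {0}. \<forall>x\<in>proj u Ocl. z * x \<in> Ocl" by (rule bexI[of _ 1]) (use one_nonzero mem_O in auto)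
  show "\<forall>x\<in>proj u Ocl. u * x = x" using mem_O by blast
qed (auto intro: O_closed)

lemma frac_between: "frac u C \<Longrightarrow> C \<subseteq> I \<Longrightarrow> ideal I \<Longrightarrow> frac u I"
proof -
  assume C: "frac u C" "C \<subseteq> I" and I: "ideal I"
  have "\<exists>z\<in>Z - {0}. \<forall>x\<in>I. z * x \<in> Ocl"
    by (rule bexI[of _ 1]) (use idealD(2)[OF I] one_nonzero in auto)
  moreover have "\<exists>z\<in>Z - {0}. z * u \<in> I" using fracD(3)[OF idem C(1)] C(2) by blast
  ultimately show ?thesis unfolding frac_iff[OF idem] using idealD(1,3)[OF I] by blast
qed

text \<open>The ideals generated by \<open>C\<close> and \<open>a ^ k * u\<close> descend but
  contain \<open>C\<close>, so their inverses ascend inside the finitely generated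
  \<open>inv_ideal C\<close> and stop; \<open>double_inverse\<close> translates this back. In this
  respect the quotient by \<open>C\<close> behaves as an Artinian ring, without any prime
  factorisation.\<close>

lemma pi_regular:
  assumes C: "frac u C" "C \<subseteq> Ocl" and a: "a \<in> proj u Ocl"
  obtains k r where "r \<in> Ocl" "a ^ k * (u - r * a) \<in> C"
proof -
  have iC: "ideal C" by (rule frac_integral_ideal[OF C])
  define A where "A k = {r * (a ^ k * u) | r. r \<in> Ocl} + C" for k :: nat
  have aO: "a ^ k * u \<in> proj u Ocl" for k
    using a mem_O is_subring_power[OF Ocl_subring] O_closed by blast
  have Ai: "ideal (A k)" for k
    unfolding A_def by (rule ideal_plus[OF ideal_principal[OF aO] iC])
  have zero: "0 \<in> {r * (a ^ k * u) | r. r \<in> Ocl}" for k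
    using idealD(4)[OF ideal_principal[OF aO[of k]]] .
  have CA: "C \<subseteq> A k" for k
    using set_plus_intro[OF zero[of k], of _ C] unfolding A_def by auto
  have Af: "frac u (A k)" for k by (rule frac_between[OF C(1) CA Ai])
  have dec: "A (Suc k) \<subseteq> A k" for k
  proof
    fix x assume "x \<in> A (Suc k)"
    then obtain r c where "x = r * (a ^ Suc k * u) + c" "r \<in> Ocl" "c \<in> C"
      unfolding A_def by (auto elim!: set_plus_elim)
    then have "x = (r * a) * (a ^ k * u) + c" "r * a \<in> Ocl" "c \<in> C"
      using Ocl_rules(6) a mem_O by (auto simp: ac_simps)
    then show "x \<in> A k" unfolding A_def by (auto intro!: set_plus_intro)
  qed
  obtain k where k: "inv_ideal (A (Suc k)) = inv_ideal (A k)"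
  proof (rule K.ascending_chain_stabilises[OF frac_fin_gen[OF inv_ideal_frac[OF C(1)]], of "\<lambda>k. inv_ideal (A k)"])
    fix k
    have "submod Z (*) (inv_ideal (A k))"
      using fracD(1)[OF idem inv_ideal_frac[OF Af]] submod_mono[OF Z_sub_Ocl] by blast
    moreover have "inv_ideal (A k) \<subseteq> inv_ideal C" using CA unfolding inv_ideal_def by blast
    ultimately show "submod Z (*) (inv_ideal (A k)) \<and> inv_ideal (A k) \<subseteq> inv_ideal C" ..
    show "inv_ideal (A k) \<subseteq> inv_ideal (A (Suc k))" using dec unfolding inv_ideal_def by blast
  qed
  have "1 * (a ^ k * u) + 0 \<in> A k" unfolding A_def
    using Ocl_rules(1) idealD(4)[OF iC] by (intro set_plus_intro) blast+
  then have mem: "a ^ k * u \<in> A k" by simp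
  have "a ^ k * u \<in> A (Suc k)"
  proof (rule double_inverse[OF Af])
    show "u * (a ^ k * u) = a ^ k * u" using aO mem_O by blast
    show "a ^ k * u * y \<in> Ocl" if "y \<in> inv_ideal (A (Suc k))" for y
      using that k mem unfolding inv_ideal_def by (auto simp: mult.commute)
  qed
  then obtain r c where rc: "a ^ k * u = r * (a ^ Suc k * u) + c" "r \<in> Ocl" "c \<in> C"
    unfolding A_def by (auto elim!: set_plus_elim)
  have "u * a = a" using a mem_O by blast
  then have "a ^ Suc k * u = a ^ k * a" by (metis mult.commute mult.left_commute power_Suc)
  then have "a ^ k * (u - r * a) = c" using rc(1) by (simp add: algebra_simps)
  then show thesis using that rc by blast
qed

text \<open>The element \<open>t\<close> is an indicator on the primes containing \<open>C\<close>:
  it is congruent to \<open>u\<close> modulo those that contain \<open>B\<close>, and it lies in all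
  others, because it kills a power of each \<open>b\<close> modulo \<open>C\<close>. It is the
  product of the factors \<open>u - r * b\<close> from \<open>pi_regular\<close>.\<close>

lemma annihilator_mod:
  assumes C: "frac u C" "C \<subseteq> Ocl" and B: "finite B" "B \<subseteq> proj u Ocl"
  shows "\<exists>t\<in>proj u Ocl. (\<forall>X. ideal X \<longrightarrow> B \<subseteq> X \<longrightarrow> u - t \<in> X) \<and> (\<forall>b\<in>B. \<exists>m. t * b ^ m \<in> C)"
  using B
proof (induction B rule: finite_induct)
  case empty
  then show ?case using O_closed idealD(4) by (auto intro!: bexI[of _ u])
next
  case (insert b B)
  have iC: "ideal C" by (rule frac_integral_ideal[OF C])
  obtain t where t: "t \<in> proj u Ocl" "\<And>X. ideal X \<Longrightarrow> B \<subseteq> X \<Longrightarrow> u - t \<in> X" "\<And>b. b \<in> B \<Longrightarrow> \<exists>m. t * b ^ m \<in> C"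
    using insert by blast
  have b: "b \<in> proj u Ocl" using insert by blast
  obtain k r where kr: "r \<in> Ocl" "b ^ k * (u - r * b) \<in> C" using pi_regular[OF C b] .
  let ?v = "u - r * b"
  have v: "?v \<in> proj u Ocl" using O_closed b kr by blast
  have tO: "t \<in> Ocl" "u * t = t" and vO: "?v \<in> Ocl" using t(1) v mem_O by auto
  have "t * ?v \<in> proj u Ocl" using O_closed v tO by blast
  moreover have "u - t * ?v \<in> X" if "ideal X" "insert b B \<subseteq> X" for X
  proof -
    have "u - t * ?v = (u - t) + (t * r) * b" using tO(2) by (simp add: algebra_simps)
    moreover have "(t * r) * b \<in> X" using idealD(6)[OF that(1)] Ocl_rules(6)[OF tO(1) kr(1)] that(2) by blast
    moreover have "u - t \<in> X" using t(2)[OF that(1)] that(2) by blast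
    ultimately show ?thesis using idealD(5)[OF that(1), of "u - t" "(t * r) * b"] by (simp only:)
  qed
  moreover have "\<exists>m. t * ?v * b' ^ m \<in> C" if b': "b' \<in> insert b B" for b'
  proof (cases "b' = b")
    case True
    have "t * (b ^ k * ?v) \<in> C" by (rule idealD(6)[OF iC tO(1) kr(2)])
    moreover have "t * (b ^ k * ?v) = t * ?v * b ^ k" by (simp only: ac_simps)
    ultimately show ?thesis using True by metis
  next
    case False
    then obtain m where "t * b' ^ m \<in> C" using t(3)[of b'] b' by blast
    then have "?v * (t * b' ^ m) \<in> C" by (rule idealD(6)[OF iC vO])
    moreover have "?v * (t * b' ^ m) = t * ?v * b' ^ m" by (simp only: ac_simps)
    ultimately show ?thesis by metis
  qed
  ultimately show ?case by blast
qed

text \<open>Prime avoidance with the indicator \<open>t\<close> of the primes that contain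
  \<open>x * i\<close> for all \<open>i\<close> in \<open>I\<close>. Such a prime does not contain
  \<open>t\<close>, so the contribution of \<open>y\<close> remains visible; any other prime above
  \<open>C\<close> contains \<open>t\<close>, so that of \<open>x\<close> survives.\<close>

lemma prime_combination:
  assumes C: "frac u C" "C \<subseteq> Ocl" and I: "frac u I" and xy: "x \<in> inv_ideal I" "y \<in> inv_ideal I"
  shows "\<exists>t\<in>proj u Ocl. \<forall>P. prime_ideal P \<longrightarrow> C \<subseteq> P \<longrightarrow> (\<forall>i\<in>I. (x + t * y) * i \<in> P) \<longrightarrow>
    (\<forall>i\<in>I. x * i \<in> P \<and> y * i \<in> P)"
proof -
  have xyi: "x * i \<in> proj u Ocl" "y * i \<in> proj u Ocl" if "i \<in> I" for i
    using xy that unfolding inv_ideal_def mem_O using u_right by blast+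
  obtain B where B: "finite B" "(*) x ` I = submod Z (*) hull B"
    using K.fin_gen_scale[OF frac_fin_gen[OF I], of x] unfolding fin_gen_def by blast
  have BX: "B \<subseteq> (*) x ` I" unfolding B(2) by (rule hull_subset)
  then have BO: "B \<subseteq> proj u Ocl" using xyi by auto
  obtain t where t: "t \<in> proj u Ocl" "\<And>X. ideal X \<Longrightarrow> B \<subseteq> X \<Longrightarrow> u - t \<in> X" "\<And>b. b \<in> B \<Longrightarrow> \<exists>m. t * b ^ m \<in> C"
    using annihilator_mod[OF C B(1) BO] by blast
  have "(\<forall>i\<in>I. x * i \<in> P \<and> y * i \<in> P)" if P: "prime_ideal P" "C \<subseteq> P" "\<forall>i\<in>I. (x + t * y) * i \<in> P" for P
  proof -
    have iP: "ideal P" and uP: "u \<notin> P" and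
      prime: "\<And>x y. x \<in> proj u Ocl \<Longrightarrow> y \<in> proj u Ocl \<Longrightarrow> x * y \<in> P \<Longrightarrow> x \<in> P \<or> y \<in> P"
      using P(1) unfolding prime_ideal_def by blast+
    have xI: "x * i \<in> P" if "i \<in> I" for i
    proof (rule ccontr)
      assume "x * i \<notin> P"
      have "\<not> B \<subseteq> P"
      proof
        assume "B \<subseteq> P"
        then have "submod Z (*) hull B \<subseteq> P"
          using submod_mono[OF Z_sub_Ocl idealD(1)[OF iP]] by (intro hull_minimal)
        then show False using B(2) that \<open>x * i \<notin> P\<close> by blast
      qed
      then obtain b where b: "b \<in> B" "b \<notin> P" by blast
      have bO: "b \<in> proj u Ocl" using b BO by blast
      obtain m where "t * b ^ m \<in> C" using t(3) b by blast
      then have "t * b ^ m \<in> P" using P(2) by blast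
      then have "t \<in> P"
      proof (induction m)
        case (Suc m)
        have "t * b ^ m \<in> proj u Ocl"
          using O_closed(6)[OF t(1)] is_subring_power[OF Ocl_subring, of b m] bO mem_O by blast
        moreover have "(t * b ^ m) * b \<in> P" using Suc.prems by (simp add: ac_simps)
        ultimately have "t * b ^ m \<in> P" using prime[OF _ bO] b(2) by blast
        then show ?case by (rule Suc.IH)
      qed simp
      then have "(y * i) * t \<in> P" using idealD(6)[OF iP] xyi(2)[OF that] mem_O by blast
      then have "(x + t * y) * i - (y * i) * t \<in> P" using P(3) that idealD(8)[OF iP] by blast
      moreover have "(x + t * y) * i - (y * i) * t = x * i" by (simp add: algebra_simps)
      ultimately show False using \<open>x * i \<notin> P\<close> by simp
    qed
    moreover have "y * i \<in> P" if i: "i \<in> I" for i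
    proof -
      have "B \<subseteq> P" using BX xI by auto
      then have "u - t \<in> P" using t(2)[OF iP] by blast
      then have tP: "t \<notin> P" using idealD(5)[OF iP, of "u - t" t] uP by auto
      have "(x + t * y) * i - x * i \<in> P" using P(3) xI i idealD(8)[OF iP] by blast
      moreover have "(x + t * y) * i - x * i = t * (y * i)" by (simp add: algebra_simps)
      ultimately show ?thesis using prime[OF t(1) xyi(2)[OF i]] tP by simp
    qed
    ultimately show ?thesis by blast
  qed
  then show ?thesis using t(1) by blast
qed

text \<open>The case of two elements is iterated with the partial sum in the role of
  \<open>x\<close>. The normalisation \<open>t 0 = u\<close> allows the combination to be carried
  out by adding multiples of other rows to a pivot row.\<close>

lemma prime_combination_sum:
  assumes C: "frac u C" "C \<subseteq> Ocl" and I: "frac u I" and x: "\<And>k. k \<le> m \<Longrightarrow> x k \<in> inv_ideal I"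
  shows "\<exists>t. (\<forall>k. t k \<in> proj u Ocl) \<and> t 0 = u \<and> (\<forall>P. prime_ideal P \<longrightarrow> C \<subseteq> P \<longrightarrow>
    (\<forall>i\<in>I. (\<Sum>k\<le>m::nat. t k * x k) * i \<in> P) \<longrightarrow> (\<forall>k\<le>m. \<forall>i\<in>I. x k * i \<in> P))"
  using x
proof (induction m)
  case 0
  then have "u * x 0 = x 0" by (simp add: inv_ideal_def)
  then show ?case using O_closed by (intro exI[of _ "\<lambda>_. u"]) auto
next
  case (Suc m)
  have "\<And>k. k \<le> m \<Longrightarrow> x k \<in> inv_ideal I" using Suc.prems by simp
  from Suc.IH[OF this] obtain t where t: "\<forall>k. t k \<in> proj u Ocl" "t 0 = u"
    "\<forall>P. prime_ideal P \<longrightarrow> C \<subseteq> P \<longrightarrow> (\<forall>i\<in>I. (\<Sum>k\<le>m. t k * x k) * i \<in> P) \<longrightarrow> (\<forall>k\<le>m. \<forall>i\<in>I. x k * i \<in> P)"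
    by blast
  note S = fracD(1)[OF idem inv_ideal_frac[OF I]]
  have "(\<Sum>k\<le>m. t k * x k) \<in> inv_ideal I"
    by (rule submod_sum[OF S], rule submodD(3)[OF S]) (use t(1) mem_O Suc.prems in auto)
  from prime_combination[OF C I this Suc.prems[OF order.refl]] obtain t' where t': "t' \<in> proj u Ocl"
    "\<And>P. prime_ideal P \<Longrightarrow> C \<subseteq> P \<Longrightarrow> (\<forall>i\<in>I. ((\<Sum>k\<le>m. t k * x k) + t' * x (Suc m)) * i \<in> P) \<Longrightarrow>
      \<forall>i\<in>I. (\<Sum>k\<le>m. t k * x k) * i \<in> P \<and> x (Suc m) * i \<in> P"
    by blast
  let ?t = "t(Suc m := t')"
  have eq: "(\<Sum>k\<le>Suc m. ?t k * x k) = (\<Sum>k\<le>m. t k * x k) + t' * x (Suc m)" by simp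
  have "x k * i \<in> P" if P: "prime_ideal P" "C \<subseteq> P" "\<forall>i\<in>I. (\<Sum>k\<le>Suc m. ?t k * x k) * i \<in> P"
    and k: "k \<le> Suc m" "i \<in> I" for P k i
  proof (cases "k = Suc m")
    case True
    then show ?thesis using t'(2)[OF P(1,2) P(3)[unfolded eq]] k(2) by simp
  next
    case False
    have "\<forall>i\<in>I. (\<Sum>k\<le>m. t k * x k) * i \<in> P" using t'(2)[OF P(1,2) P(3)[unfolded eq]] by blast
    then have "\<forall>k\<le>m. \<forall>i\<in>I. x k * i \<in> P" using t(3) P(1,2) by blast
    then show ?thesis using False k by simp
  qed
  moreover have "\<forall>k. ?t k \<in> proj u Ocl" "?t 0 = u" using t t' by auto
  ultimately show ?case by blast
qed

lemma coprime_combination: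
  assumes C: "frac u C" "C \<subseteq> Ocl" and I: "frac u I" and x: "\<And>k. k \<le> m \<Longrightarrow> x k \<in> inv_ideal I"
    and cop: "\<And>P. prime_ideal P \<Longrightarrow> C \<subseteq> P \<Longrightarrow> \<exists>k\<le>m. \<exists>i\<in>I. x k * i \<notin> P"
  obtains t i c where "\<And>k. t k \<in> proj u Ocl" "t 0 = u" "i \<in> I" "c \<in> C" "u = (\<Sum>k\<le>m::nat. t k * x k) * i + c"
proof -
  obtain t where t: "\<forall>k. t k \<in> proj u Ocl" "t 0 = u"
    "\<forall>P. prime_ideal P \<longrightarrow> C \<subseteq> P \<longrightarrow> (\<forall>i\<in>I. (\<Sum>k\<le>m. t k * x k) * i \<in> P) \<longrightarrow> (\<forall>k\<le>m. \<forall>i\<in>I. x k * i \<in> P)"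
    using prime_combination_sum[OF C I, of m x, OF x] by blast
  let ?x = "\<Sum>k\<le>m. t k * x k"
  note S = fracD(1)[OF idem inv_ideal_frac[OF I]]
  have x': "?x \<in> inv_ideal I"
    by (rule submod_sum[OF S], rule submodD(3)[OF S]) (use t(1) mem_O x in auto)
  have iC: "ideal C" by (rule frac_integral_ideal[OF C])
  note SI = submodD[OF fracD(1)[OF idem I]]
  have iX: "ideal ((*) ?x ` I)" unfolding ideal_def
  proof (intro conjI submodI)
    have "0 = ?x * 0" by simp
    then show "0 \<in> (*) ?x ` I" using SI(1) by blast
    show "a + b \<in> (*) ?x ` I" if "a \<in> (*) ?x ` I" "b \<in> (*) ?x ` I" for a b
      using that SI(2) by (auto simp: distrib_left[symmetric])
    show "r * a \<in> (*) ?x ` I" if "r \<in> Ocl" "a \<in> (*) ?x ` I" for r a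
      using that SI(3) by (auto simp: mult.left_commute[of r ?x])
    show "(*) ?x ` I \<subseteq> proj u Ocl"
      using x' unfolding inv_ideal_def using u_right mem_O by blast
  qed
  have iD: "ideal ((*) ?x ` I + C)" by (rule ideal_plus[OF iX iC])
  have "u \<in> (*) ?x ` I + C"
  proof (rule ccontr)
    assume "u \<notin> (*) ?x ` I + C"
    then obtain P where P: "prime_ideal P" "(*) ?x ` I + C \<subseteq> P" using prime_ideal_above[OF iD] by blast
    have "C \<subseteq> P"
    proof
      fix c assume "c \<in> C"
      then have "0 + c \<in> (*) ?x ` I + C" using idealD(4)[OF iX] by (intro set_plus_intro)
      then show "c \<in> P" using P(2) by auto
    qed
    moreover have "\<forall>i\<in>I. ?x * i \<in> P"
    proof
      fix i assume "i \<in> I"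
      then have "?x * i + 0 \<in> (*) ?x ` I + C" using idealD(4)[OF iC] by (intro set_plus_intro) auto
      then show "?x * i \<in> P" using P(2) by auto
    qed
    ultimately have "\<forall>k\<le>m. \<forall>i\<in>I. x k * i \<in> P" "C \<subseteq> P" using t(3) P(1) by blast+
    then show False using cop[OF P(1)] by blast
  qed
  then obtain i c where "i \<in> I" "c \<in> C" "u = ?x * i + c" by (auto elim!: set_plus_elim)
  then show thesis using that[of t i c] t by blast
qed

text \<open>An expansion of \<open>u\<close> in \<open>I\<close> times its inverse supplies
  candidates: no prime can contain the products of \<open>I\<close> with all of them. The resulting
  \<open>x\<close> makes \<open>x * I\<close> integral and coprime to \<open>C\<close>, which serves
  both Steinitz' theorem and the choice of coprime class representatives.\<close>

lemma coprime_multiplier: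
  assumes C: "frac u C" "C \<subseteq> Ocl" and I: "frac u I"
  obtains x i c where "x \<in> inv_ideal I" "i \<in> I" "c \<in> C" "u = x * i + c"
proof -
  note S = fracD(1)[OF idem inv_ideal_frac[OF I]]
  obtain m a b where ab: "u = (\<Sum>k<m::nat. a k * b k)" "\<And>k. k < m \<Longrightarrow> a k \<in> I \<and> b k \<in> inv_ideal I"
    using frac_invertible[OF I] unfolding ideal_prod_def by blast
  show thesis
  proof (cases m)
    \<comment> \<open>An empty expansion forces \<open>u = 0\<close>, where everything is trivial;
      otherwise the range is written as \<open>k \<le> m'\<close> to fit
      \<open>coprime_combination\<close>.\<close>
    case 0
    then have "u = 0 * 0 + 0" using ab(1) by simp
    then show thesis using that[of 0 0 0] submodD(1)[OF S] submodD(1)[OF fracD(1)[OF idem I]]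
      submodD(1)[OF fracD(1)[OF idem C(1)]] by blast
  next
    case (Suc m')
    have b: "b k \<in> inv_ideal I" if "k \<le> m'" for k using ab(2)[of k] Suc that by simp
    obtain t i c where t: "\<And>k. t k \<in> proj u Ocl" "i \<in> I" "c \<in> C" "u = (\<Sum>k\<le>m'. t k * b k) * i + c"
    proof (rule coprime_combination[OF C I b])
      fix P assume P: "prime_ideal P" "C \<subseteq> P"
      show "\<exists>k\<le>m'. \<exists>i\<in>I. b k * i \<notin> P"
      proof (rule ccontr)
        assume no: "\<not> (\<exists>k\<le>m'. \<exists>i\<in>I. b k * i \<notin> P)"
        have "(\<Sum>k<m. a k * b k) \<in> P"
        proof (rule submod_sum[of Ocl "(*)"])
          show "submod Ocl (*) P" using P(1) unfolding prime_ideal_def ideal_def by blast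
          show "a k * b k \<in> P" if "k \<in> {..<m}" for k
            using no ab(2)[of k] that Suc by (auto simp: mult.commute[of "a k"])
        qed
        then show False using ab(1) P(1) unfolding prime_ideal_def by simp
      qed
    qed blast+
    have "(\<Sum>k\<le>m'. t k * b k) \<in> inv_ideal I"
      by (rule submod_sum[OF S], rule submodD(3)[OF S]) (use t(1) mem_O b in auto)
    then show thesis using that t by blast
  qed
qed

end

section \<open>Linear automorphisms\<close>

text \<open>The inverse is carried along explicitly and nothing is required outside
  \<open>W\<close>. Compositions, restrictions to components and reassembly then need no choice of
  inverses.\<close>

definition lin_pair :: "('k \<Rightarrow> 'm \<Rightarrow> 'm) \<Rightarrow> 'm::ab_group_add set \<Rightarrow> ('m \<Rightarrow> 'm) \<Rightarrow> ('m \<Rightarrow> 'm) \<Rightarrow> bool" where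
  "lin_pair sc W T T' \<longleftrightarrow> (\<forall>x\<in>W. T x \<in> W \<and> T' x \<in> W \<and> T' (T x) = x \<and> T (T' x) = x) \<and>
     (\<forall>x\<in>W. \<forall>y\<in>W. T (x + y) = T x + T y) \<and> (\<forall>c. \<forall>x\<in>W. T (sc c x) = sc c (T x))"

lemma lin_pairD:
  assumes "lin_pair sc W T T'"
  shows "x \<in> W \<Longrightarrow> T x \<in> W" "x \<in> W \<Longrightarrow> T' x \<in> W" "x \<in> W \<Longrightarrow> T' (T x) = x" "x \<in> W \<Longrightarrow> T (T' x) = x"
    "x \<in> W \<Longrightarrow> y \<in> W \<Longrightarrow> T (x + y) = T x + T y" "x \<in> W \<Longrightarrow> T (sc c x) = sc c (T x)"
  using assms unfolding lin_pair_def by blast+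

lemma lin_pair_sym:
  assumes T: "lin_pair sc W T T'"
    and W: "\<And>x y. x \<in> W \<Longrightarrow> y \<in> W \<Longrightarrow> x + y \<in> W" "\<And>c x. x \<in> W \<Longrightarrow> sc c x \<in> W"
  shows "lin_pair sc W T' T"
proof -
  note D = lin_pairD[OF T]
  have "T' (x + y) = T' x + T' y" if "x \<in> W" "y \<in> W" for x y
  proof -
    have "T' x + T' y = T' (T (T' x + T' y))" using that by (intro D(3)[symmetric] W D)
    also have "T (T' x + T' y) = x + y" using that by (simp add: D)
    finally show ?thesis by simp
  qed
  moreover have "T' (sc c x) = sc c (T' x)" if "x \<in> W" for c x
  proof -
    have "sc c (T' x) = T' (T (sc c (T' x)))" using that by (intro D(3)[symmetric] W D)
    also have "T (sc c (T' x)) = sc c x" using that by (simp add: D)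
    finally show ?thesis by simp
  qed
  ultimately show ?thesis unfolding lin_pair_def using D by blast
qed

lemma lin_pair_comp:
  assumes "lin_pair sc W T T'" "lin_pair sc W S S'"
  shows "lin_pair sc W (S \<circ> T) (T' \<circ> S')"
  using lin_pairD[OF assms(1)] lin_pairD[OF assms(2)] unfolding lin_pair_def by simp

section \<open>Lattices over the maximal order\<close>

definition scf :: "'k::comm_ring_1 \<Rightarrow> (nat \<Rightarrow> 'k) \<Rightarrow> nat \<Rightarrow> 'k" where
  "scf c f = (\<lambda>j. c * f j)"

context idempotent_setting
begin

definition W :: "nat \<Rightarrow> (nat \<Rightarrow> 'a) set" where
  "W d = {f. (\<forall>j<d. u * f j = f j) \<and> (\<forall>j\<ge>d. f j = 0)}"

definition block :: "nat \<Rightarrow> 'a set \<Rightarrow> (nat \<Rightarrow> 'a) set" where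
  "block d I = {f \<in> W d. (\<forall>j<d - 1. f j \<in> Ocl) \<and> f (d - 1) \<in> I}"

lemma W_all: "f \<in> W d \<Longrightarrow> u * f j = f j"
  unfolding W_def by (cases "j < d") auto

lemma W_closed: "f \<in> W d \<Longrightarrow> g \<in> W d \<Longrightarrow> f + g \<in> W d" "f \<in> W d \<Longrightarrow> scf c f \<in> W d"
  unfolding W_def scf_def using u_left by (auto simp: distrib_left)

lemma W_truncate: "f \<in> W (Suc d) \<Longrightarrow> f(d := 0) \<in> W d"
  unfolding W_def by auto

lemma W_zero: "f \<in> W (Suc d) \<Longrightarrow> f d = 0 \<Longrightarrow> f \<in> W d"
  using W_truncate[of f d] by (metis fun_upd_triv)

lemma W_extend: "g \<in> W d \<Longrightarrow> u * x = x \<Longrightarrow> g(d := x) \<in> W (Suc d)"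
  unfolding W_def by (auto simp: less_Suc_eq)

section \<open>Steinitz' theorem\<close>

lemma frac_prod:
  assumes I: "frac u I" and J: "frac u J"
  shows "frac u (ideal_prod I J)"
  unfolding frac_iff[OF idem]
proof (intro conjI)
  obtain z z' where z: "z \<in> Z - {0}" "z * u \<in> I" "z' \<in> Z - {0}" "\<forall>x\<in>I. z' * x \<in> Ocl"
    using fracD(3,4)[OF idem I] by blast
  obtain y y' where y: "y \<in> Z - {0}" "y * u \<in> J" "y' \<in> Z - {0}" "\<forall>x\<in>J. y' * x \<in> Ocl"
    using fracD(3,4)[OF idem J] by blast
  show "submod Ocl (*) (ideal_prod I J)" by (rule ideal_prod_submod[OF fracD(1)[OF idem I]])
  have "ideal_prod I J \<subseteq> {x. u * x = x}"
    by (rule ideal_prod_sub) (use fracD(2)[OF idem I] u_right in \<open>auto simp: distrib_left\<close>)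
  then show "\<forall>x\<in>ideal_prod I J. u * x = x" by blast
  have "(z * u) * (y * u) = (z * y) * (u * u)" by (simp only: ac_simps)
  then have "(z * y) * u \<in> ideal_prod I J" using ideal_prod_mult[OF z(2) y(2)] idem by simp
  then show "\<exists>z\<in>Z - {0}. z * u \<in> ideal_prod I J" using nonzero_mult[OF z(1) y(1)] by blast
  have "ideal_prod I J \<subseteq> {x. (z' * y') * x \<in> Ocl}"
  proof (rule ideal_prod_sub)
    fix a b assume "a \<in> I" "b \<in> J"
    then have "(z' * a) * (y' * b) \<in> Ocl" using z(4) y(4) Ocl_rules(6) by blast
    moreover have "(z' * a) * (y' * b) = (z' * y') * (a * b)" by (simp only: ac_simps)
    ultimately show "a * b \<in> {x. (z' * y') * x \<in> Ocl}" by simp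
  qed (auto simp: distrib_left Ocl_rules)
  then show "\<exists>z\<in>Z - {0}. \<forall>x\<in>ideal_prod I J. z * x \<in> Ocl" using nonzero_mult[OF z(3) y(3)] by blast
qed

lemma double_inverse_eq: "frac u I \<Longrightarrow> inv_ideal (inv_ideal I) = I"
proof
  assume I: "frac u I"
  show "inv_ideal (inv_ideal I) \<subseteq> I"
    using double_inverse[OF I] by (auto simp: inv_ideal_def)
  show "I \<subseteq> inv_ideal (inv_ideal I)"
    using fracD(2)[OF idem I] by (auto simp: inv_ideal_def mult.commute)
qed

text \<open>These are the entries of the matrix that identifies the direct sum of \<open>I\<close>
  and \<open>J\<close> with that of the maximal order and the product ideal. Here \<open>a\<close>
  is any \<open>z * u\<close> in \<open>I\<close> with \<open>z\<close> nonzero; the other entries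
  come from \<open>coprime_multiplier\<close> for the inverse of \<open>J\<close>, with
  \<open>a\<close> times the inverse of \<open>I\<close> as modulus.\<close>

lemma bezout_ideals:
  assumes I: "frac u I" and J: "frac u J"
  obtains a a' b b' where "a \<in> I" "a' \<in> inv_ideal I" "b \<in> J" "b' \<in> inv_ideal J" "a * a' + b * b' = u"
proof -
  obtain z where z: "z \<in> Z - {0}" "z * u \<in> I" using fracD(3)[OF idem I] by blast
  obtain w where w: "z * w = 1" using nonzero_Z_inverse[OF z(1)] .
  let ?C = "(*) (z * u) ` inv_ideal I"
  have "frac u ?C"
  proof (rule frac_scale[OF inv_ideal_frac[OF I], of _ "w * u"])
    have "z * u * (w * u) = (z * w) * (u * u)" by (simp only: ac_simps)
    then show "z * u * (w * u) = u" using w idem by simp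
  qed (auto simp: u_left idem)
  moreover have "?C \<subseteq> Ocl" using z(2) by (auto simp: inv_ideal_def mult.commute[of "z * u"])
  ultimately obtain x i c where x: "x \<in> inv_ideal (inv_ideal J)" "i \<in> inv_ideal J" "c \<in> ?C" "u = x * i + c"
    using coprime_multiplier[OF _ _ inv_ideal_frac[OF J]] by blast
  from x(3) obtain a' where a': "a' \<in> inv_ideal I" "c = (z * u) * a'" by blast
  have "z * u * a' + x * i = u" using x(4) a'(2) by (simp only: add.commute)
  moreover have "x \<in> J" using x(1) double_inverse_eq[OF J] by simp
  ultimately show thesis using that[OF z(2) a'(1) _ x(2)] by blast
qed

lemma coordinate_frac:
  assumes X: "X \<subseteq> W d" "submod Ocl scf X"
    and full: "z \<in> Z - {0}" "\<forall>f\<in>W d. (\<forall>j<d. f j \<in> Ocl) \<longrightarrow> scf z f \<in> X"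
    and bdd: "z' \<in> Z - {0}" "\<forall>f\<in>X. \<forall>j<d. z' * f j \<in> Ocl"
    and j: "j < d"
  shows "frac u ((\<lambda>f. f j) ` X)"
  unfolding frac_iff[OF idem]
proof (intro conjI submodI)
  note S = submodD[OF X(2)]
  have "(0 :: nat \<Rightarrow> 'a) j \<in> (\<lambda>f. f j) ` X" using S(1) by (rule imageI)
  then show "0 \<in> (\<lambda>f. f j) ` X" by simp
  show "x + y \<in> (\<lambda>f. f j) ` X" if xy: "x \<in> (\<lambda>f. f j) ` X" "y \<in> (\<lambda>f. f j) ` X" for x y
  proof -
    obtain f g where "x = f j" "f \<in> X" "y = g j" "g \<in> X" using xy by blast
    then have "x + y = (f + g) j" "f + g \<in> X" using S(2) by auto
    then show ?thesis by blast
  qed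
  show "r * x \<in> (\<lambda>f. f j) ` X" if rx: "r \<in> Ocl" "x \<in> (\<lambda>f. f j) ` X" for r x
  proof -
    obtain f where "x = f j" "f \<in> X" using rx by blast
    then have "r * x = scf r f j" "scf r f \<in> X" using S(3)[OF rx(1)] by (auto simp: scf_def)
    then show ?thesis by blast
  qed
  show "\<forall>x\<in>(\<lambda>f. f j) ` X. u * x = x" using X(1) W_all by blast
  have "scf z (\<lambda>i. if i = j then u else 0) \<in> X"
    by (rule full(2)[rule_format]) (use j idem u_Ocl Ocl_rules in \<open>auto simp: W_def\<close>)
  then have "scf z (\<lambda>i. if i = j then u else 0) j \<in> (\<lambda>f. f j) ` X" by blast
  then show "\<exists>z\<in>Z - {0}. z * u \<in> (\<lambda>f. f j) ` X" using full(1) by (auto simp: scf_def)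
  show "\<exists>z\<in>Z - {0}. \<forall>x\<in>(\<lambda>f. f j) ` X. z * x \<in> Ocl" using bdd j by blast
qed

lemma scf_submod_sum:
  assumes "submod Ocl scf X" "\<And>k. k < m \<Longrightarrow> c k \<in> Ocl" "\<And>k. k < m \<Longrightarrow> f k \<in> X"
  shows "(\<lambda>j. \<Sum>k<m::nat. c k * f k j) \<in> X"
proof -
  have "(\<Sum>k<m. scf (c k) (f k)) \<in> X"
    by (rule submod_sum[OF assms(1)]) (use assms submodD(3)[OF assms(1)] in auto)
  moreover have "(\<Sum>k<m. scf (c k) (f k)) = (\<lambda>j. \<Sum>k<m. c k * f k j)"
    by (rule ext) (induction m, auto simp: scf_def)
  ultimately show ?thesis by simp
qed

text \<open>Splitting off the last coordinate: its values form an invertible ideal \<open>A\<close>, and multiplication by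
  \<open>y\<close> is a section of the projection to \<open>A\<close>.\<close>

lemma last_coordinate_section:
  assumes X: "X \<subseteq> W (Suc d)" "submod Ocl scf X" and A: "frac u ((\<lambda>f. f d) ` X)" (is "frac u ?A")
  obtains y where "y \<in> W (Suc d)" "y d = u" "\<And>a. a \<in> ?A \<Longrightarrow> scf a y \<in> X"
proof -
  obtain m a b where ab: "u = (\<Sum>k<m::nat. a k * b k)" "\<forall>k<m. a k \<in> ?A \<and> b k \<in> inv_ideal ?A"
    by (rule ideal_prodE[OF frac_invertible[OF A]])
  then have ab2: "\<And>k. k < m \<Longrightarrow> a k \<in> ?A" and ab3: "\<And>k. k < m \<Longrightarrow> b k \<in> inv_ideal ?A" by auto
  have "\<forall>k\<in>{..<m}. \<exists>f. f \<in> X \<and> f d = a k" 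
  proof
    fix k assume "k \<in> {..<m}"
    then have "a k \<in> ?A" using ab2 by simp
    then show "\<exists>f. f \<in> X \<and> f d = a k" by (elim imageE) auto
  qed
  from bchoice[OF this] obtain f where f: "\<forall>k\<in>{..<m}. f k \<in> X \<and> f k d = a k" ..
  let ?y = "\<lambda>j. \<Sum>k<m. b k * f k j"
  have "?y d = u" using ab(1) f by (simp add: mult.commute)
  moreover have "?y \<in> W (Suc d)"
  proof -
    have "u * (b k * f k j) = b k * f k j" if "k < m" for k j
      using ab3[OF that] u_right by (auto simp: inv_ideal_def)
    moreover have "f k j = 0" if "k < m" "j \<ge> Suc d" for k j
      using f X(1) that unfolding W_def by blast
    ultimately show ?thesis by (auto simp: W_def sum_distrib_left)
  qed
  moreover have "scf c ?y \<in> X" if "c \<in> ?A" for c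
  proof -
    have "(\<lambda>j. \<Sum>k<m. (b k * c) * f k j) \<in> X"
      by (rule scf_submod_sum[OF X(2)]) (use ab3 f that in \<open>auto simp: inv_ideal_def\<close>)
    moreover have "scf c ?y = (\<lambda>j. \<Sum>k<m. (b k * c) * f k j)"
      by (auto simp: scf_def sum_distrib_left ac_simps)
    ultimately show ?thesis by simp
  qed
  ultimately show thesis using that by blast
qed

lemma lin_pair_shear:
  assumes y: "y \<in> W (Suc d)"
  shows "lin_pair scf (W (Suc d)) (\<lambda>f j. if j < d then f j - f d * y j else f j)
    (\<lambda>f j. if j < d then f j + f d * y j else f j)"
proof -
  have "u * (f d * y j) = f d * y j" for f :: "nat \<Rightarrow> 'a" and j using u_left W_all[OF y] by blast
  note uy = this
  show ?thesis unfolding lin_pair_def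
  proof (intro conjI ballI allI)
    fix f assume f: "f \<in> W (Suc d)"
    show "(\<lambda>j. if j < d then f j - f d * y j else f j) \<in> W (Suc d)"
      "(\<lambda>j. if j < d then f j + f d * y j else f j) \<in> W (Suc d)"
      using f uy[of f] unfolding W_def by (auto simp: right_diff_distrib distrib_left)
  qed (auto simp: fun_eq_iff scf_def algebra_simps)
qed

lemma lin_pair_extend:
  assumes T: "lin_pair scf (W d) T T'"
  shows "lin_pair scf (W (Suc d)) (\<lambda>f. (T (f(d := 0)))(d := f d)) (\<lambda>f. (T' (f(d := 0)))(d := f d))"
proof -
  have W0: "f(d := 0) \<in> W d" if "f \<in> W (Suc d)" for f
    using that by (rule W_truncate)
  have Wu: "g(d := x) \<in> W (Suc d)" if "g \<in> W d" "u * x = x" for g x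
    using that by (rule W_extend)
  have Ws: "(g(d := x))(d := 0) = g" if "g \<in> W d" for g x
    using that unfolding W_def by (auto simp: fun_eq_iff)
  have id: "(f(d := 0))(d := f d) = f" for f :: "nat \<Rightarrow> 'a" by auto
  have add: "(f + g)(d := 0) = f(d := 0) + g(d := 0)" for f g :: "nat \<Rightarrow> 'a" by (auto simp: fun_eq_iff)
  have scale: "(scf c f)(d := 0) = scf c (f(d := 0))" for c f by (auto simp: fun_eq_iff scf_def)
  note D = lin_pairD[OF T]
  show ?thesis unfolding lin_pair_def
  proof (intro conjI ballI allI)
    fix f assume f: "f \<in> W (Suc d)"
    show "(T (f(d := 0)))(d := f d) \<in> W (Suc d)" "(T' (f(d := 0)))(d := f d) \<in> W (Suc d)"
      using Wu D(1,2) W0[OF f] W_all[OF f] by blast+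
    show "(T' (((T (f(d := 0)))(d := f d))(d := 0)))(d := ((T (f(d := 0)))(d := f d)) d) = f"
      using Ws[OF D(1)[OF W0[OF f]]] D(3)[OF W0[OF f]] id by simp
    show "(T (((T' (f(d := 0)))(d := f d))(d := 0)))(d := ((T' (f(d := 0)))(d := f d)) d) = f"
      using Ws[OF D(2)[OF W0[OF f]]] D(4)[OF W0[OF f]] id by simp
    show "(T ((scf c f)(d := 0)))(d := scf c f d) = scf c ((T (f(d := 0)))(d := f d))" for c
      unfolding scale D(6)[OF W0[OF f]] by (auto simp: scf_def fun_eq_iff)
    fix g assume g: "g \<in> W (Suc d)"
    show "(T ((f + g)(d := 0)))(d := (f + g) d) = (T (f(d := 0)))(d := f d) + (T (g(d := 0)))(d := g d)"
      unfolding add D(5)[OF W0[OF f] W0[OF g]] by (auto simp: fun_eq_iff)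
  qed
qed

text \<open>The matrix with rows \<open>(a', b')\<close> and \<open>(- b, a)\<close> has determinant
  \<open>u\<close>, and the second map is its adjugate. The condition \<open>d > 0\<close> keeps the
  two coordinates apart.\<close>

lemma lin_pair_two_by_two:
  assumes "a * a' + b * b' = u" "u * a = a" "u * b = b" "u * a' = a'" "u * b' = b'" "d > 0"
  shows "lin_pair scf (W (Suc d)) (\<lambda>f. f(d - 1 := a' * f (d - 1) + b' * f d, d := a * f d - b * f (d - 1)))
    (\<lambda>f. f(d - 1 := a * f (d - 1) - b' * f d, d := b * f (d - 1) + a' * f d))"
proof -
  have 1: "a * (a' * x + b' * y) - b' * (a * y - b * x) = x" 
    "b * (a' * x + b' * y) + a' * (a * y - b * x) = y"
    "a' * (a * x - b' * y) + b' * (b * x + a' * y) = x"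
    "a * (b * x + a' * y) - b * (a * x - b' * y) = y" if "u * x = x" "u * y = y" for x y
  proof -
    have "a * (a' * x + b' * y) - b' * (a * y - b * x) = (a * a' + b * b') * x" by (simp add: algebra_simps)
    then show "a * (a' * x + b' * y) - b' * (a * y - b * x) = x" using assms(1) that by simp
    have "b * (a' * x + b' * y) + a' * (a * y - b * x) = (a * a' + b * b') * y" by (simp add: algebra_simps)
    then show "b * (a' * x + b' * y) + a' * (a * y - b * x) = y" using assms(1) that by simp
    have "a' * (a * x - b' * y) + b' * (b * x + a' * y) = (a * a' + b * b') * x" by (simp add: algebra_simps)
    then show "a' * (a * x - b' * y) + b' * (b * x + a' * y) = x" using assms(1) that by simp
    have "a * (b * x + a' * y) - b * (a * x - b' * y) = (a * a' + b * b') * y" by (simp add: algebra_simps)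
    then show "a * (b * x + a' * y) - b * (a * x - b' * y) = y" using assms(1) that by simp
  qed
  have d: "d \<noteq> d - 1" "d - 1 \<noteq> d" "d - Suc 0 \<noteq> d" "d \<noteq> d - Suc 0" using assms(6) by auto
  have uu: "u * (c * x) = c * x" if "c \<in> {a, a', b, b'}" for c x
    using that assms u_right by blast
  show ?thesis unfolding lin_pair_def
  proof (intro conjI ballI allI)
    fix f assume f: "f \<in> W (Suc d)"
    have f0: "f j = 0" if "j \<ge> Suc d" for j using f that by (auto simp: W_def)
    note fu = W_all[OF f]
    show "f(d - 1 := a' * f (d - 1) + b' * f d, d := a * f d - b * f (d - 1)) \<in> W (Suc d)"
      unfolding W_def using f0 fu uu by (auto simp: distrib_left right_diff_distrib)
    show "f(d - 1 := a * f (d - 1) - b' * f d, d := b * f (d - 1) + a' * f d) \<in> W (Suc d)"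
      unfolding W_def using f0 fu uu by (auto simp: distrib_left right_diff_distrib)
    show "(f(d - 1 := a' * f (d - 1) + b' * f d, d := a * f d - b * f (d - 1)))
        (d - 1 := a * (f(d - 1 := a' * f (d - 1) + b' * f d, d := a * f d - b * f (d - 1))) (d - 1) -
           b' * (f(d - 1 := a' * f (d - 1) + b' * f d, d := a * f d - b * f (d - 1))) d,
         d := b * (f(d - 1 := a' * f (d - 1) + b' * f d, d := a * f d - b * f (d - 1))) (d - 1) +
           a' * (f(d - 1 := a' * f (d - 1) + b' * f d, d := a * f d - b * f (d - 1))) d) = f"
      using d 1(1,2)[OF fu fu] by (auto simp: fun_eq_iff)
    show "(f(d - 1 := a * f (d - 1) - b' * f d, d := b * f (d - 1) + a' * f d))
        (d - 1 := a' * (f(d - 1 := a * f (d - 1) - b' * f d, d := b * f (d - 1) + a' * f d)) (d - 1) +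
           b' * (f(d - 1 := a * f (d - 1) - b' * f d, d := b * f (d - 1) + a' * f d)) d,
         d := a * (f(d - 1 := a * f (d - 1) - b' * f d, d := b * f (d - 1) + a' * f d)) d -
           b * (f(d - 1 := a * f (d - 1) - b' * f d, d := b * f (d - 1) + a' * f d)) (d - 1)) = f"
      using d 1(3,4)[OF fu fu] by (auto simp: fun_eq_iff)
  qed (auto simp: fun_eq_iff scf_def algebra_simps)
qed

text \<open>Induction on the rank. \<open>S1\<close> splits off the last coordinate along the
  section \<open>y\<close>, \<open>S2\<close> brings the remaining lattice into normal form, and
  \<open>S3\<close> merges the two ideals into the last coordinate, leaving the maximal order in the
  one before. Membership is stated as an equivalence, which covers the inverse map as well.\<close>

theorem steinitz:
  assumes "d > 0" and X: "X \<subseteq> W d" "submod Ocl scf X"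
    and full: "z \<in> Z - {0}" "\<forall>f\<in>W d. (\<forall>j<d. f j \<in> Ocl) \<longrightarrow> scf z f \<in> X"
    and bdd: "z' \<in> Z - {0}" "\<forall>f\<in>X. \<forall>j<d. z' * f j \<in> Ocl"
  shows "\<exists>T T' I. lin_pair scf (W d) T T' \<and> frac u I \<and> (\<forall>f\<in>W d. f \<in> X \<longleftrightarrow> T f \<in> block d I)"
  using assms
proof (induction d arbitrary: X rule: nat_induct_non_zero)
  case 1
  let ?I = "(\<lambda>f. f 0) ` X"
  have "frac u ?I" by (rule coordinate_frac[OF 1]) simp
  moreover have "lin_pair scf (W 1) id id" by (auto simp: lin_pair_def)
  moreover have "f \<in> X \<longleftrightarrow> id f \<in> block 1 ?I" if f: "f \<in> W 1" for f
  proof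
    assume "id f \<in> block 1 ?I"
    then obtain g where g: "g \<in> X" "f 0 = g 0" by (auto simp: block_def)
    have "g \<in> W 1" using g 1 by blast
    have "f = g"
    proof
      fix j show "f j = g j" using g(2) f \<open>g \<in> W 1\<close> by (cases j) (auto simp: W_def)
    qed
    then show "f \<in> X" using g by simp
  qed (use f in \<open>auto simp: block_def\<close>)
  ultimately show ?case by blast
next
  case (Suc d)
  let ?A = "(\<lambda>f. f d) ` X"
  note S = submodD[OF Suc.prems(2)]
  have A: "frac u ?A" by (rule coordinate_frac[OF Suc.prems]) simp
  obtain y where y: "y \<in> W (Suc d)" "y d = u" "\<And>a. a \<in> ?A \<Longrightarrow> scf a y \<in> X"
    using last_coordinate_section[OF Suc.prems(1,2) A] by blast
  let ?X = "{f \<in> X. f d = 0}"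
  have XW: "?X \<subseteq> W d" using Suc.prems(1) W_zero by blast
  have "\<exists>T T' I. lin_pair scf (W d) T T' \<and> frac u I \<and> (\<forall>f\<in>W d. f \<in> ?X \<longleftrightarrow> T f \<in> block d I)"
  proof (rule Suc.IH[OF XW _ Suc.prems(3) _ Suc.prems(5)])
    show "submod Ocl scf ?X"
      using S by (auto intro!: submodI simp: scf_def)
    show "\<forall>f\<in>W d. (\<forall>j<d. f j \<in> Ocl) \<longrightarrow> scf z f \<in> ?X"
    proof (intro ballI impI)
      fix f assume f: "f \<in> W d" "\<forall>j<d. f j \<in> Ocl"
      have fs: "f d = 0" using f(1) by (auto simp: W_def)
      have "f \<in> W (Suc d)" using f(1) fs by (auto simp: W_def less_Suc_eq)
      then have "scf z f \<in> X" using Suc.prems(4) f(2) fs Ocl_rules(2) by (auto simp: less_Suc_eq)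
      then show "scf z f \<in> ?X" using fs by (simp add: scf_def)
    qed
  qed (use Suc.prems(6) in auto)
  then obtain T T' I where T: "lin_pair scf (W d) T T'" and I: "frac u I" and
    TX: "\<And>f. f \<in> W d \<Longrightarrow> f \<in> ?X \<longleftrightarrow> T f \<in> block d I" by blast
  obtain a a' b b' where ab: "a \<in> I" "a' \<in> inv_ideal I" "b \<in> ?A" "b' \<in> inv_ideal ?A" "a * a' + b * b' = u"
    using bezout_ideals[OF I A] .
  define S1 where "S1 = (\<lambda>f j. if j < d then f j - f d * y j else f j)"
  define S2 where "S2 = (\<lambda>f. (T (f(d := 0)))(d := f d))"
  define S3 where "S3 = (\<lambda>f. f(d - 1 := a' * f (d - 1) + b' * f d, d := a * f d - b * f (d - 1)))"
  obtain S1' where S1: "lin_pair scf (W (Suc d)) S1 S1'" unfolding S1_def using lin_pair_shear[OF y(1)] by blast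
  obtain S2' where S2: "lin_pair scf (W (Suc d)) S2 S2'" unfolding S2_def using lin_pair_extend[OF T] by blast
  have uab: "u * a = a" "u * a' = a'" "u * b = b" "u * b' = b'"
    using ab fracD(2)[OF idem I] fracD(2)[OF idem A] by (auto simp: inv_ideal_def)
  obtain S3' where S3: "lin_pair scf (W (Suc d)) S3 S3'"
    unfolding S3_def using lin_pair_two_by_two[OF ab(5) uab(1,3,2,4) Suc.hyps(1)] by blast
  have LP: "lin_pair scf (W (Suc d)) (S3 \<circ> (S2 \<circ> S1)) ((S1' \<circ> S2') \<circ> S3')"
    by (rule lin_pair_comp[OF lin_pair_comp[OF S1 S2] S3])
  let ?B = "ideal_prod I ?A"
  have "f \<in> X \<longleftrightarrow> (S3 \<circ> (S2 \<circ> S1)) f \<in> block (Suc d) ?B" if f: "f \<in> W (Suc d)" for f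
  proof -
    let ?g = "S2 (S1 f)"
    have S1W: "S1 f \<in> W (Suc d)" using lin_pairD(1)[OF S1 f] .
    have gW: "?g \<in> W (Suc d)" using lin_pairD(1)[OF S2 S1W] .
    let ?h = "(S1 f)(d := 0)"
    have hW: "?h \<in> W d" by (rule W_truncate[OF S1W])
    have h: "?h = f + scf (- f d) y"
    proof
      fix j show "?h j = (f + scf (- f d) y) j"
      proof (cases "j < d")
        case False
        then show ?thesis using f y(1,2) W_all[OF f, of d]
          by (cases "j = d") (auto simp: S1_def scf_def W_def mult.commute)
      qed (auto simp: S1_def scf_def)
    qed
    have gs: "?g d = f d" by (simp add: S2_def S1_def)
    have gj: "?g j = T ?h j" if "j < d" for j using that by (simp add: S2_def)
    have 1: "f \<in> X \<longleftrightarrow> f d \<in> ?A \<and> ?h \<in> ?X"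
    proof
      assume fX: "f \<in> X"
      then have fs: "f d \<in> ?A" by blast
      have "scf (-1) (scf (f d) y) \<in> X" by (rule S(3)[OF _ y(3)[OF fs]]) (use Ocl_rules(1,3) in auto)
      moreover have "scf (-1) (scf (f d) y) = scf (- f d) y" by (auto simp: scf_def)
      ultimately have "?h \<in> X" unfolding h using S(2)[OF fX] by simp
      then show "f d \<in> ?A \<and> ?h \<in> ?X" using fs by simp
    next
      assume r: "f d \<in> ?A \<and> ?h \<in> ?X"
      then have "?h + scf (f d) y \<in> X" using S(2) y(3) by blast
      moreover have "?h + scf (f d) y = f" unfolding h by (auto simp: scf_def fun_eq_iff)
      ultimately show "f \<in> X" by simp
    qed
    have sp: "d > 0" by (rule Suc.hyps)
    have 2: "?h \<in> ?X \<longleftrightarrow> (\<forall>j<d - 1. ?g j \<in> Ocl) \<and> ?g (d - 1) \<in> I"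
      using TX[OF hW] gj lin_pairD(1)[OF T hW] sp by (auto simp: block_def)
    let ?x = "?g (d - 1)" and ?y = "?g d"
    note SI = submodD[OF fracD(1)[OF idem I]] and SA = submodD[OF fracD(1)[OF idem A]]
    \<comment> \<open>The converse applies the inverse matrix; \<open>b'\<close> and
      \<open>a'\<close> take the product ideal into \<open>I\<close> and into the ideal of last
      coordinates, respectively.\<close>
    have 3: "?x \<in> I \<and> ?y \<in> ?A \<longleftrightarrow> a' * ?x + b' * ?y \<in> Ocl \<and> a * ?y - b * ?x \<in> ?B"
    proof
      assume xy: "?x \<in> I \<and> ?y \<in> ?A"
      then have "a' * ?x \<in> Ocl" "b' * ?y \<in> Ocl" using ab by (auto simp: inv_ideal_def)
      moreover have "a * ?y \<in> ?B" using ab xy by (intro ideal_prod_mult) auto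
      moreover have "?x * b \<in> ?B" using ab xy by (intro ideal_prod_mult) auto
      ultimately show "a' * ?x + b' * ?y \<in> Ocl \<and> a * ?y - b * ?x \<in> ?B"
        using Ocl_rules(4) submod_Ocl_diff[OF ideal_prod_submod[OF fracD(1)[OF idem I]], of "a * ?y" ?A "?x * b"]
        by (auto simp: mult.commute)
    next
      assume r: "a' * ?x + b' * ?y \<in> Ocl \<and> a * ?y - b * ?x \<in> ?B"
      let ?v = "a' * ?x + b' * ?y" and ?w = "a * ?y - b * ?x"
      have "?B \<subseteq> {w. b' * w \<in> I \<and> a' * w \<in> ?A}"
      proof (rule ideal_prod_sub)
        fix i j assume ij: "i \<in> I" "j \<in> ?A"
        then have "b' * j \<in> Ocl" "a' * i \<in> Ocl" using ab by (auto simp: inv_ideal_def)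
        then have "(b' * j) * i \<in> I" "(a' * i) * j \<in> ?A" using SI(3) SA(3) ij by blast+
        then show "i * j \<in> {w. b' * w \<in> I \<and> a' * w \<in> ?A}" by (simp add: ac_simps)
      qed (use SI(1,2) SA(1,2) in \<open>auto simp: distrib_left\<close>)
      then have bw: "b' * ?w \<in> I" "a' * ?w \<in> ?A" using r by blast+
      have av: "?v * a \<in> I" "?v * b \<in> ?A" using r SI(3) SA(3) ab by blast+
      have "?v * a - b' * ?w = (a * a' + b * b') * ?x" by (simp add: algebra_simps)
      then have "?v * a - b' * ?w = ?x" using ab(5) W_all[OF gW] by simp
      moreover have "?v * b + a' * ?w = (a * a' + b * b') * ?y" by (simp add: algebra_simps)
      then have "?v * b + a' * ?w = ?y" using ab(5) W_all[OF gW] by simp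
      ultimately show "?x \<in> I \<and> ?y \<in> ?A"
        using submod_Ocl_diff[OF fracD(1)[OF idem I] av(1) bw(1)] SA(2)[OF av(2) bw(2)] by simp
    qed
    have S3g: "S3 ?g (d - 1) = a' * ?x + b' * ?y" "S3 ?g d = a * ?y - b * ?x" "\<And>j. j < d - 1 \<Longrightarrow> S3 ?g j = ?g j"
      using sp by (auto simp: S3_def)
    have "(S3 \<circ> (S2 \<circ> S1)) f \<in> block (Suc d) ?B \<longleftrightarrow> (\<forall>j<d. S3 ?g j \<in> Ocl) \<and> S3 ?g d \<in> ?B"
      using lin_pairD(1)[OF LP f] unfolding block_def by simp
    also have "(\<forall>j<d. S3 ?g j \<in> Ocl) \<longleftrightarrow> (\<forall>j<d - 1. S3 ?g j \<in> Ocl) \<and> S3 ?g (d - 1) \<in> Ocl"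
    proof -
      have "j < d \<longleftrightarrow> j < d - 1 \<or> j = d - 1" for j using sp by linarith
      then show ?thesis by blast
    qed
    also have "(\<forall>j<d - 1. S3 ?g j \<in> Ocl) \<longleftrightarrow> (\<forall>j<d - 1. ?g j \<in> Ocl)" using S3g(3) by simp
    finally have "(S3 \<circ> (S2 \<circ> S1)) f \<in> block (Suc d) ?B \<longleftrightarrow> (\<forall>j<d - 1. ?g j \<in> Ocl) \<and> (?x \<in> I \<and> ?y \<in> ?A)"
      unfolding 3 S3g(1,2) by (simp only: conj_assoc)
    then show ?thesis unfolding 1 2 gs by (simp only: conj_ac)
  qed
  then show ?case using LP frac_prod[OF I A] by blast
qed

end

section \<open>Determinants\<close>

lemma signof_subring: "is_subring S \<Longrightarrow> signof p \<in> S"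
  by (auto simp: sign_def is_subringD)

text \<open>In the Leibniz formula a permutation moving some \<open>j \<in> A\<close> contributes a product in \<open>J\<close> because of
  column \<open>j\<close>, and one fixing \<open>A\<close> pointwise because of column \<open>k\<close>, as it maps \<open>k\<close> to some \<open>i \<notin> A\<close>.\<close>

lemma det_mem_of_column:
  assumes G: "G \<in> carrier_mat d d" and S: "is_subring S" and J: "submod S (*) J"
    and ent: "\<And>i j. i < d \<Longrightarrow> j < d \<Longrightarrow> G $$ (i,j) \<in> S"
    and A: "\<And>i j. j \<in> A \<Longrightarrow> i < d \<Longrightarrow> i \<noteq> j \<Longrightarrow> G $$ (i,j) \<in> J" "A \<subseteq> {..<d}"
    and k: "k < d" "k \<notin> A" "\<And>i. i < d \<Longrightarrow> i \<notin> A \<Longrightarrow> G $$ (i,k) \<in> J"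
  shows "det G \<in> J"
proof -
  have one: "signof p * (\<Prod>j<d. G $$ (p j, j)) \<in> J" if p: "p permutes {0..<d}" for p
  proof -
    have pl: "p j < d" if "j < d" for j using permutes_in_image[OF p, of j] that by auto
    have "\<exists>j<d. G $$ (p j, j) \<in> J"
    proof (cases "\<forall>j\<in>A. p j = j")
      case True
      have "p k \<notin> A"
      proof
        assume "p k \<in> A"
        then have "p (p k) = p k" using True by blast
        then have "p k = k" using permutes_inj[OF p] by (simp add: inj_eq)
        then show False using \<open>p k \<in> A\<close> k(2) by simp
      qed
      then show ?thesis using k pl by blast
    next
      case False
      then show ?thesis using A pl by blast
    qed
    then obtain j where j: "j < d" "G $$ (p j, j) \<in> J" by blast
    have "(\<Prod>j<d. G $$ (p j, j)) = (\<Prod>i\<in>{..<d} - {j}. G $$ (p i, i)) * G $$ (p j, j)"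
      using j(1) by (subst prod.remove[of _ j]) (auto simp: mult.commute)
    moreover have "(\<Prod>i\<in>{..<d} - {j}. G $$ (p i, i)) \<in> S"
      by (rule is_subring_prod[OF S]) (use ent pl in auto)
    ultimately have "(\<Prod>j<d. G $$ (p j, j)) \<in> J" using submodD(3)[OF J] j(2) by simp
    then show ?thesis using submodD(3)[OF J signof_subring[OF S]] by blast
  qed
  show ?thesis unfolding det_col[OF G] by (rule submod_sum[OF J]) (use one in auto)
qed

text \<open>Every Leibniz term has exactly one factor from row \<open>k\<close>. That row is exempt
  from the integrality assumption since \<open>J\<close> will be a fractional ideal.\<close>

lemma det_mem_of_row:
  assumes G: "G \<in> carrier_mat d d" and S: "is_subring S" and J: "submod S (*) J"
    and ent: "\<And>i j. i < d \<Longrightarrow> i \<noteq> k \<Longrightarrow> j < d \<Longrightarrow> G $$ (i,j) \<in> S"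
    and k: "k < d" "\<And>j. j < d \<Longrightarrow> G $$ (k,j) \<in> J"
  shows "det G \<in> J"
proof -
  have one: "signof p * (\<Prod>i = 0..<d. G $$ (i, p i)) \<in> J" if p: "p permutes {0..<d}" for p
  proof -
    have pl: "p j < d" if "j < d" for j using permutes_in_image[OF p, of j] that by auto
    have "(\<Prod>i = 0..<d. G $$ (i, p i)) = (\<Prod>i\<in>{0..<d} - {k}. G $$ (i, p i)) * G $$ (k, p k)"
      using k(1) by (subst prod.remove[of _ k]) (auto simp: mult.commute)
    moreover have "(\<Prod>i\<in>{0..<d} - {k}. G $$ (i, p i)) \<in> S"
      by (rule is_subring_prod[OF S]) (use ent pl in auto)
    ultimately have "(\<Prod>i = 0..<d. G $$ (i, p i)) \<in> J" using submodD(3)[OF J] k pl by simp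
    then show ?thesis using submodD(3)[OF J signof_subring[OF S]] by blast
  qed
  show ?thesis unfolding det_def'[OF G] by (rule submod_sum[OF J]) (use one in auto)
qed

lemma prod_cong_mod:
  assumes S: "is_subring S" and J: "submod S (*) J" and "finite A"
    and "\<And>i. i \<in> A \<Longrightarrow> f i \<in> S" "\<And>i. i \<in> A \<Longrightarrow> g i \<in> S" "\<And>i. i \<in> A \<Longrightarrow> f i - g i \<in> J"
  shows "prod f A - prod g A \<in> J"
  using assms(3-)
proof (induction A rule: finite_induct)
  case empty
  then show ?case using submodD(1)[OF J] by simp
next
  case (insert a A)
  have "prod f (insert a A) - prod g (insert a A) = f a * (prod f A - prod g A) + prod g A * (f a - g a)"
    using insert.hyps by (simp add: algebra_simps)
  moreover have "f a * (prod f A - prod g A) \<in> J" using submodD(3)[OF J] insert by simp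
  moreover have "prod g A \<in> S" using is_subring_prod[OF S] insert.prems(2) by blast
  then have "prod g A * (f a - g a) \<in> J" using submodD(3)[OF J] insert.prems(3) by blast
  ultimately show ?case using submodD(2)[OF J] by simp
qed

lemma det_cong_mod:
  assumes G: "G \<in> carrier_mat d d" and G': "G' \<in> carrier_mat d d" and S: "is_subring S" and J: "submod S (*) J"
    and ent: "\<And>i j. i < d \<Longrightarrow> j < d \<Longrightarrow> G $$ (i,j) \<in> S" "\<And>i j. i < d \<Longrightarrow> j < d \<Longrightarrow> G' $$ (i,j) \<in> S"
    and cong: "\<And>i j. i < d \<Longrightarrow> j < d \<Longrightarrow> G $$ (i,j) - G' $$ (i,j) \<in> J"
  shows "det G - det G' \<in> J"
  unfolding det_def'[OF G] det_def'[OF G'] sum_subtractf[symmetric]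
proof (rule submod_sum[OF J])
  fix p assume "p \<in> {p. p permutes {0..<d}}"
  then have p: "p permutes {0..<d}" by simp
  have pl: "p j < d" if "j < d" for j using permutes_in_image[OF p, of j] that by auto
  have "(\<Prod>i = 0..<d. G $$ (i, p i)) - (\<Prod>i = 0..<d. G' $$ (i, p i)) \<in> J"
    by (rule prod_cong_mod[OF S J]) (use ent cong pl in auto)
  then have "signof p * ((\<Prod>i = 0..<d. G $$ (i, p i)) - (\<Prod>i = 0..<d. G' $$ (i, p i))) \<in> J"
    using submodD(3)[OF J signof_subring[OF S]] by blast
  then show "signof p * (\<Prod>i = 0..<d. G $$ (i, p i)) - signof p * (\<Prod>i = 0..<d. G' $$ (i, p i)) \<in> J"
    by (simp only: right_diff_distrib)
qed

context idempotent_setting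
begin

section \<open>Matrices of linear maps\<close>

definition unit_fun :: "nat \<Rightarrow> nat \<Rightarrow> 'a" where
  "unit_fun k = (\<lambda>j. if j = k then u else 0)"

text \<open>The unit vectors of the component have entry \<open>u\<close>, so the identity map gets
  the matrix \<open>u \<cdot>\<^sub>m 1\<^sub>m d\<close>, and determinants of automorphisms are
  invertible relative to \<open>u\<close> instead of \<open>1\<close>.\<close>

definition mat_of :: "nat \<Rightarrow> ((nat \<Rightarrow> 'a) \<Rightarrow> nat \<Rightarrow> 'a) \<Rightarrow> 'a mat" where
  "mat_of d T = mat d d (\<lambda>(j,k). T (unit_fun k) j)"

definition mat_apply :: "nat \<Rightarrow> 'a mat \<Rightarrow> (nat \<Rightarrow> 'a) \<Rightarrow> nat \<Rightarrow> 'a" where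
  "mat_apply d G f = (\<lambda>j. if j < d then \<Sum>k<d. G $$ (j,k) * f k else 0)"

lemma mat_of_carrier [simp]: "mat_of d T \<in> carrier_mat d d"
  by (simp add: mat_of_def)

lemma mat_of_dim [simp]: "dim_row (mat_of d T) = d" "dim_col (mat_of d T) = d"
  by (simp_all add: mat_of_def)

lemma mat_of_index [simp]: "j < d \<Longrightarrow> k < d \<Longrightarrow> mat_of d T $$ (j,k) = T (unit_fun k) j"
  by (simp add: mat_of_def)

lemma unit_fun_W: "k < d \<Longrightarrow> unit_fun k \<in> W d"
  by (auto simp: unit_fun_def W_def idem)

lemma zero_W: "0 \<in> W d" by (auto simp: W_def)

lemma lin_pair_sum:
  assumes T: "lin_pair scf (W d) T T'" and "\<And>k. k < m \<Longrightarrow> b k \<in> W d"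
  shows "(\<Sum>k<m::nat. scf (c k) (b k)) \<in> W d \<and> T (\<Sum>k<m. scf (c k) (b k)) = (\<Sum>k<m. scf (c k) (T (b k)))"
  using assms(2)
proof (induction m)
  case 0
  have "T (scf 0 0) = scf 0 (T 0)" by (rule lin_pairD(6)[OF T zero_W])
  moreover have "scf 0 f = 0" for f :: "nat \<Rightarrow> 'a" by (auto simp: scf_def)
  ultimately have "T 0 = 0" by simp
  then show ?case using zero_W by (simp only: lessThan_0 sum.empty simp_thms)
next
  case (Suc m)
  then have IH: "(\<Sum>k<m. scf (c k) (b k)) \<in> W d" "T (\<Sum>k<m. scf (c k) (b k)) = (\<Sum>k<m. scf (c k) (T (b k)))"
    by simp_all
  have bm: "b m \<in> W d" "scf (c m) (b m) \<in> W d" using Suc.prems W_closed by auto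
  show ?case using lin_pairD(5)[OF T IH(1) bm(2)] lin_pairD(6)[OF T bm(1)] IH W_closed(1)[OF IH(1) bm(2)]
    by (simp only: sum.lessThan_Suc simp_thms)
qed

lemma W_expand: "f \<in> W d \<Longrightarrow> f = (\<Sum>k<d. scf (f k) (unit_fun k))"
proof
  fix j assume f: "f \<in> W d"
  have "(\<Sum>k<d. scf (f k) (unit_fun k)) j = (\<Sum>k<d. f k * unit_fun k j)"
    by (induction d) (auto simp: scf_def)
  also have "\<dots> = (\<Sum>k<d. if k = j then f j * u else 0)"
    by (rule sum.cong) (auto simp: unit_fun_def)
  also have "\<dots> = f j" using f W_all[OF f, of j] by (auto simp: W_def mult.commute)
  finally show "f j = (\<Sum>k<d. scf (f k) (unit_fun k)) j" by simp
qed

lemma mat_apply_mat_of: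
  assumes T: "lin_pair scf (W d) T T'" and f: "f \<in> W d"
  shows "T f = mat_apply d (mat_of d T) f"
proof
  fix j
  have "T f = (\<Sum>k<d. scf (f k) (T (unit_fun k)))"
    using lin_pair_sum[OF T, of d unit_fun f] unit_fun_W W_expand[OF f] by simp
  then have 1: "T f j = (\<Sum>k<d. scf (f k) (T (unit_fun k))) j" by simp
  have 2: "(\<Sum>k<m. scf (f k) (T (unit_fun k))) j = (\<Sum>k<m. T (unit_fun k) j * f k)" for m
    by (induction m) (auto simp: scf_def mult.commute)
  show "T f j = mat_apply d (mat_of d T) f j"
  proof (cases "j < d")
    case True
    then show ?thesis unfolding 1 2 by (simp add: mat_apply_def)
  next
    case False
    then show ?thesis using lin_pairD(1)[OF T f] by (simp add: mat_apply_def W_def)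
  qed
qed

lemma mat_mult_index:
  "A \<in> carrier_mat d d \<Longrightarrow> B \<in> carrier_mat d d \<Longrightarrow> j < d \<Longrightarrow> k < d \<Longrightarrow>
    (A * B) $$ (j,k) = (\<Sum>l<d. A $$ (j,l) * B $$ (l,k))"
  by (auto simp: scalar_prod_def lessThan_atLeast0 intro!: sum.cong)

lemma mat_of_inverse:
  assumes T: "lin_pair scf (W d) T T'"
  shows "mat_of d T * mat_of d T' = u \<cdot>\<^sub>m 1\<^sub>m d"
proof (rule eq_matI)
  fix j k assume "j < dim_row (u \<cdot>\<^sub>m 1\<^sub>m d :: 'a mat)" "k < dim_col (u \<cdot>\<^sub>m 1\<^sub>m d :: 'a mat)"
  then have jk: "j < d" "k < d" by auto
  have "T (T' (unit_fun k)) j = mat_apply d (mat_of d T) (T' (unit_fun k)) j"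
    using mat_apply_mat_of[OF T lin_pairD(2)[OF T unit_fun_W[OF jk(2)]]] by simp
  also have "\<dots> = (mat_of d T * mat_of d T') $$ (j,k)"
    unfolding mat_mult_index[OF mat_of_carrier mat_of_carrier jk] using jk by (simp add: mat_apply_def)
  finally have "(mat_of d T * mat_of d T') $$ (j,k) = unit_fun k j"
    using lin_pairD(4)[OF T unit_fun_W[OF jk(2)]] by simp
  then show "(mat_of d T * mat_of d T') $$ (j,k) = (u \<cdot>\<^sub>m 1\<^sub>m d) $$ (j,k)" using jk by (simp add: unit_fun_def)
qed auto

lemma lin_pair_W_sym: "lin_pair scf (W d) T T' \<Longrightarrow> lin_pair scf (W d) T' T"
  by (rule lin_pair_sym) (auto intro: W_closed)

lemma u_power: "d > 0 \<Longrightarrow> u ^ d = u"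
  by (induction d rule: nat_induct_non_zero) (auto simp: idem)

lemma det_mat_of:
  assumes T: "lin_pair scf (W d) T T'" and d: "d > 0"
  shows "det (mat_of d T) * det (mat_of d T') = u" "u * det (mat_of d T) = det (mat_of d T)"
proof -
  have "det (mat_of d T) * det (mat_of d T') = det (u \<cdot>\<^sub>m 1\<^sub>m d)"
    unfolding mat_of_inverse[OF T, symmetric] by (rule det_mult[of _ d, symmetric]) auto
  then show "det (mat_of d T) * det (mat_of d T') = u" using u_power[OF d] by simp
  have "u \<cdot>\<^sub>m mat_of d T = mat_of d T"
    by (rule eq_matI) (auto simp: mat_of_def W_all[OF lin_pairD(1)[OF T unit_fun_W]])
  then have "det (u \<cdot>\<^sub>m mat_of d T) = det (mat_of d T)" by simp
  then show "u * det (mat_of d T) = det (mat_of d T)" using u_power[OF d] by (simp add: mat_of_def)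
qed

text \<open>Multiplying the last column by \<open>x\<close> in \<open>I\<close> makes every column
  the image of a vector of \<open>block d I\<close>. Such images have integral entries except for
  the last one, which is in \<open>J\<close>; hence so is the determinant.\<close>

lemma det_block:
  assumes T: "lin_pair scf (W d) T T'" and d: "d > 0" and I: "frac u I" and J: "frac u J"
    and TB: "\<And>f. f \<in> block d I \<Longrightarrow> T f \<in> block d J" and x: "x \<in> I"
  shows "det (mat_of d T) * x \<in> J"
proof -
  let ?G = "mat_of d T"
  let ?H = "mat d d (\<lambda>(j,k). if k = d - 1 then x * ?G $$ (j,k) else ?G $$ (j,k))"
  note SI = submodD[OF fracD(1)[OF idem I]]
  have ux: "u * x = x" by (rule fracD(2)[OF idem I x])
  have b1: "unit_fun k \<in> block d I" if "k < d - 1" for k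
    using that unit_fun_W[of k d] SI(1) u_Ocl Ocl_rules(2) by (auto simp: block_def unit_fun_def)
  have b2: "scf x (unit_fun (d - 1)) \<in> block d I"
    using d x ux W_closed(2)[OF unit_fun_W[of "d - 1" d], of x] Ocl_rules(2)
    by (auto simp: block_def unit_fun_def scf_def mult.commute)
  have Tx: "T (scf x (unit_fun (d - 1))) j = x * T (unit_fun (d - 1)) j" for j
    using lin_pairD(6)[OF T unit_fun_W[of "d - 1" d]] d by (simp add: scf_def)
  have ent: "?H $$ (j,k) \<in> (if j = d - 1 then J else Ocl)" if "j < d" "k < d" for j k
  proof (cases "k = d - 1")
    case True
    then have "?H $$ (j,k) = T (scf x (unit_fun (d - 1))) j" using that Tx by simp
    then show ?thesis using TB[OF b2] that by (auto simp: block_def)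
  next
    case False
    then have "?H $$ (j,k) = T (unit_fun k) j" using that by simp
    moreover have "k < d - 1" using False that by simp
    ultimately show ?thesis using TB[OF b1[of k]] that by (auto simp: block_def)
  qed
  have "det ?H \<in> J"
  proof (rule det_mem_of_row[OF _ Ocl_subring fracD(1)[OF idem J], where k = "d - 1"])
    show "?H $$ (i,j) \<in> Ocl" if "i < d" "i \<noteq> d - 1" "j < d" for i j using ent[of i j] that by simp
    show "?H $$ (d - 1,j) \<in> J" if "j < d" for j using ent[of "d - 1" j] that d by simp
  qed (use d in auto)
  moreover have "det ?H = x * det ?G"
  proof -
    have "det ?H = det (transpose_mat ?H)" by (rule det_transpose[symmetric]) auto
    also have "transpose_mat ?H = multrow (d - 1) x (transpose_mat ?G)" by (rule eq_matI) auto
    also have "det \<dots> = x * det (transpose_mat ?G)" by (rule det_multrow[of _ d]) (use d in auto)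
    finally show ?thesis by (simp add: det_transpose[of _ d])
  qed
  ultimately show ?thesis by (simp add: mult.commute)
qed

text \<open>The two inclusions are \<open>det_block\<close> for the map and for its inverse: the
  factor between the ideals is the determinant.\<close>

theorem steinitz_unique:
  assumes T: "lin_pair scf (W d) T T'" and d: "d > 0" and I: "frac u I" and J: "frac u J"
    and TB: "\<And>f. f \<in> block d I \<Longrightarrow> T f \<in> block d J" "\<And>f. f \<in> block d J \<Longrightarrow> T' f \<in> block d I"
  obtains c c' where "u * c = c" "u * c' = c'" "c * c' = u" "J = (*) c ` I"
proof -
  let ?c = "det (mat_of d T)" and ?c' = "det (mat_of d T')"
  note T' = lin_pair_W_sym[OF T]
  have c: "?c * ?c' = u" "u * ?c = ?c" "u * ?c' = ?c'"
    using det_mat_of[OF T d] det_mat_of(2)[OF T' d] by auto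
  have "J = (*) ?c ` I"
  proof
    show "(*) ?c ` I \<subseteq> J" using det_block[OF T d I J TB(1)] by blast
    show "J \<subseteq> (*) ?c ` I"
    proof
      fix y assume y: "y \<in> J"
      have "?c' * y \<in> I" by (rule det_block[OF T' d J I TB(2) y])
      moreover have "y = ?c * (?c' * y)" using c(1) fracD(2)[OF idem J y] by (simp add: mult.assoc[symmetric])
      ultimately show "y \<in> (*) ?c ` I" by blast
    qed
  qed
  then show thesis using that c by blast
qed

text \<open>The determinant multiplies \<open>J\<close> into itself, hence is integral; used for the
  inverse map too, this will make it a unit.\<close>

lemma det_unit:
  assumes T: "lin_pair scf (W d) T T'" and d: "d > 0" and J: "frac u J"
    and TB: "\<And>f. f \<in> block d J \<Longrightarrow> T f \<in> block d J"
  shows "det (mat_of d T) \<in> proj u Ocl"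
  unfolding mem_O
  using stable_integral[OF idem J det_mat_of(2)[OF T d] det_block[OF T d J J TB]] det_mat_of(2)[OF T d] by blast

section \<open>Lifting matrices modulo an ideal\<close>

definition Omat :: "nat \<Rightarrow> 'a mat set" where
  "Omat d = {G \<in> carrier_mat d d. \<forall>i<d. \<forall>j<d. G $$ (i,j) \<in> proj u Ocl}"

text \<open>The off-diagonal entries of the last row must lie in \<open>J\<close> for
  \<open>block d J\<close> to be preserved. The condition is imposed on every off-diagonal entry
  because it is then stable under all row and column operations with coefficients in
  \<open>J\<close>.\<close>

definition Jmat :: "nat \<Rightarrow> 'a set \<Rightarrow> 'a mat set" where
  "Jmat d J = {H \<in> Omat d. \<forall>i<d. \<forall>j<d. i \<noteq> j \<longrightarrow> H $$ (i,j) \<in> J}"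

definition liftable :: "nat \<Rightarrow> 'a set \<Rightarrow> 'a set \<Rightarrow> 'a mat \<Rightarrow> bool" where
  "liftable d J C G \<longleftrightarrow> (\<exists>H\<in>Jmat d J. \<exists>H'\<in>Jmat d J. H * H' = u \<cdot>\<^sub>m 1\<^sub>m d \<and> H' * H = u \<cdot>\<^sub>m 1\<^sub>m d \<and>
     (\<forall>i<d. \<forall>j<d. H $$ (i,j) - G $$ (i,j) \<in> C))"

text \<open>Liftability is pulled back along each row operation, so the elementary factors need not
  be collected.\<close>

definition row_reduces :: "nat \<Rightarrow> 'a set \<Rightarrow> 'a set \<Rightarrow> 'a mat \<Rightarrow> 'a mat \<Rightarrow> bool" where
  "row_reduces d J C G G' \<longleftrightarrow> G' \<in> Omat d \<and> det G' = det G \<and> (liftable d J C G' \<longrightarrow> liftable d J C G)"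

lemma row_reduces_trans: "row_reduces d J C G G' \<Longrightarrow> row_reduces d J C G' G'' \<Longrightarrow> row_reduces d J C G G''"
  by (auto simp: row_reduces_def)

text \<open>The coefficient \<open>r\<close> is replaced by \<open>r * a\<close>, which lies in
  \<open>J\<close> and agrees with \<open>r\<close> modulo \<open>C\<close>. The lift of the reduced
  matrix is multiplied by the elementary matrix with coefficient \<open>- (r * a)\<close>, which
  undoes the operation modulo \<open>C\<close> without leaving \<open>Jmat\<close>.\<close>

lemma row_reduces_addrow:
  assumes J: "ideal J" and C: "ideal C" and a: "a \<in> J" "u - a \<in> C"
    and G: "G \<in> Omat d" and r: "r \<in> proj u Ocl" and kl: "k < d" "l < d" "k \<noteq> l"
  shows "row_reduces d J C G (addrow r k l G)"
  unfolding row_reduces_def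
proof (intro conjI impI)
  have Gc: "G \<in> carrier_mat d d" and GO: "\<And>i j. i < d \<Longrightarrow> j < d \<Longrightarrow> G $$ (i,j) \<in> proj u Ocl"
    using G by (auto simp: Omat_def)
  have rO: "r \<in> Ocl" "u * r = r" using r mem_O by auto
  show "addrow r k l G \<in> Omat d" unfolding Omat_def
    using Gc kl GO O_closed(3) O_closed(5)[OF _ rO(1)] by auto
  show "det (addrow r k l G) = det G" by (rule det_addrow[OF kl(2,3) Gc])
  assume "liftable d J C (addrow r k l G)"
  then obtain H H' where H: "H \<in> Jmat d J" "H' \<in> Jmat d J" "H * H' = u \<cdot>\<^sub>m 1\<^sub>m d" "H' * H = u \<cdot>\<^sub>m 1\<^sub>m d"
    and HG: "\<And>i j. i < d \<Longrightarrow> j < d \<Longrightarrow> H $$ (i,j) - addrow r k l G $$ (i,j) \<in> C"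
    unfolding liftable_def by blast
  let ?r = "r * a"
  have rJ: "?r \<in> J" using idealD(6)[OF J rO(1) a(1)] .
  then have rJ': "- ?r \<in> J" using idealD(8)[OF J idealD(4)[OF J], of ?r] by simp
  have rr: "?r \<in> Ocl" "- ?r \<in> Ocl" using idealD(2)[OF J] rJ rJ' by auto
  have Hc: "H \<in> carrier_mat d d" "H' \<in> carrier_mat d d"
    and HO: "\<And>i j. i < d \<Longrightarrow> j < d \<Longrightarrow> H $$ (i,j) \<in> proj u Ocl" "\<And>i j. i < d \<Longrightarrow> j < d \<Longrightarrow> H' $$ (i,j) \<in> proj u Ocl"
    and HJ: "\<And>i j. i < d \<Longrightarrow> j < d \<Longrightarrow> i \<noteq> j \<Longrightarrow> H $$ (i,j) \<in> J" "\<And>i j. i < d \<Longrightarrow> j < d \<Longrightarrow> i \<noteq> j \<Longrightarrow> H' $$ (i,j) \<in> J"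
    using H(1,2) by (auto simp: Jmat_def Omat_def)
  let ?E = "addrow_mat d (- ?r) k l" and ?E' = "addrow_mat d ?r k l"
  have E: "?E \<in> carrier_mat d d" "?E' \<in> carrier_mat d d" by auto
  have EE: "?E * ?E' = 1\<^sub>m d" "?E' * ?E = 1\<^sub>m d"
    using addrow_mat_inv[OF kl, of "- ?r"] addrow_mat_inv[OF kl, of ?r] by auto
  let ?H = "addrow (- ?r) k l H" and ?H' = "addcol ?r l k H'"
  have H1: "?H = ?E * H" by (rule addrow_mat[OF Hc(1) kl(2)])
  have H2: "?H' = H' * ?E'" by (rule addcol_mat[OF Hc(2) kl(1)])
  have "?H * ?H' = ?E * (H * H') * ?E'" unfolding H1 H2 using E Hc
    by (simp add: assoc_mult_mat[of _ d d _ d _ d])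
  also have "\<dots> = u \<cdot>\<^sub>m (?E * ?E')" unfolding H(3) using E
    by (simp add: mult_smult_distrib[of _ d d _ d] mult_smult_assoc_mat[of _ d d _ d])
  finally have prod1: "?H * ?H' = u \<cdot>\<^sub>m 1\<^sub>m d" unfolding EE .
  have "?H' * ?H = H' * (?E' * (?E * H))" unfolding H1 H2
    by (rule assoc_mult_mat[OF Hc(2) E(2) mult_carrier_mat[OF E(1) Hc(1)]])
  also have "?E' * (?E * H) = (?E' * ?E) * H" by (rule assoc_mult_mat[OF E(2,1) Hc(1), symmetric])
  also have "H' * (?E' * ?E * H) = u \<cdot>\<^sub>m 1\<^sub>m d" unfolding EE using Hc H(4) by simp
  finally have prod2: "?H' * ?H = u \<cdot>\<^sub>m 1\<^sub>m d" .
  have mem1: "?H \<in> Jmat d J" unfolding Jmat_def Omat_def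
  proof (intro CollectI conjI allI impI)
    show "?H \<in> carrier_mat d d" using Hc by simp
    fix i j assume ij: "i < d" "j < d"
    show "?H $$ (i,j) \<in> proj u Ocl"
      using Hc ij kl HO(1) O_closed(3)[OF O_closed(5)[OF HO(1) rr(2)] HO(1)] by auto
    show "?H $$ (i,j) \<in> J" if "i \<noteq> j"
    proof (cases "i = k")
      case True
      have "- ?r * H $$ (l,j) \<in> J" using idealD(7)[OF J _ rJ'] HO(1)[OF kl(2) ij(2)] mem_O by blast
      from idealD(5)[OF J this HJ(1)[OF ij that]] show ?thesis using True Hc ij by simp
    next
      case False
      then show ?thesis using Hc ij HJ(1)[OF ij that] by simp
    qed
  qed
  have mem2: "?H' \<in> Jmat d J" unfolding Jmat_def Omat_def
  proof (intro CollectI conjI allI impI)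
    show "?H' \<in> carrier_mat d d" using Hc unfolding mat_addcol_def by auto
    fix i j assume ij: "i < d" "j < d"
    show "?H' $$ (i,j) \<in> proj u Ocl"
      using Hc ij kl HO(2) O_closed(3)[OF O_closed(5)[OF HO(2) rr(1)] HO(2)] by auto
    show "?H' $$ (i,j) \<in> J" if "i \<noteq> j"
    proof (cases "j = l")
      case True
      have "?r * H' $$ (i,k) \<in> J" using idealD(7)[OF J _ rJ] HO(2)[OF ij(1) kl(1)] mem_O by blast
      from idealD(5)[OF J this HJ(2)[OF ij that]] show ?thesis using True Hc ij by simp
    next
      case False
      then show ?thesis using Hc ij HJ(2)[OF ij that] by simp
    qed
  qed
  have "?H $$ (i,j) - G $$ (i,j) \<in> C" if ij: "i < d" "j < d" for i j
  proof (cases "i = k")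
    case True
    have 1: "H $$ (k,j) - (r * G $$ (l,j) + G $$ (k,j)) \<in> C" using HG[OF kl(1) ij(2)] Gc kl ij by simp
    have 2: "H $$ (l,j) - G $$ (l,j) \<in> C" using HG[OF kl(2) ij(2)] Gc kl ij by simp
    have 3: "(r * G $$ (l,j)) * (u - a) \<in> C"
      using idealD(6)[OF C _ a(2)] Ocl_rules(6)[OF rO(1)] GO[OF kl(2) ij(2)] mem_O by blast
    have 4: "?r * (H $$ (l,j) - G $$ (l,j)) \<in> C" using idealD(6)[OF C rr(1) 2] .
    have ug: "r * G $$ (l,j) * u = r * G $$ (l,j)" using u_right[OF rO(2)] by (metis mult.commute)
    \<comment> \<open>The error splits into the errors of the given lift in rows \<open>k\<close>
      and \<open>l\<close> and the one caused by replacing \<open>r\<close> with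
      \<open>r * a\<close>.\<close>
    have eq: "?H $$ (k,j) - G $$ (k,j) = (H $$ (k,j) - (r * G $$ (l,j) + G $$ (k,j)))
        + (r * G $$ (l,j)) * (u - a) - ?r * (H $$ (l,j) - G $$ (l,j))"
      using Hc kl ij ug by (simp add: algebra_simps)
    show ?thesis unfolding True eq by (rule idealD(8)[OF C idealD(5)[OF C 1 3] 4])
  next
    case False
    then show ?thesis using HG[OF ij] Hc Gc ij by simp
  qed
  then show "liftable d J C G" unfolding liftable_def using mem1 mem2 prod1 prod2 by blast
qed

section \<open>Gaussian elimination modulo an ideal\<close>

lemma OmatD: "G \<in> Omat d \<Longrightarrow> G \<in> carrier_mat d d" "G \<in> Omat d \<Longrightarrow> i < d \<Longrightarrow> j < d \<Longrightarrow> G $$ (i,j) \<in> proj u Ocl"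
  by (auto simp: Omat_def)

lemma row_reduces_combine:
  assumes J: "ideal J" and C: "ideal C" and a: "a \<in> J" "u - a \<in> C"
    and G: "G \<in> Omat d" and k: "k < d" and B: "finite B" "B \<subseteq> {..<d} - {k}" and t: "\<And>l. t l \<in> proj u Ocl"
  shows "row_reduces d J C G (mat d d (\<lambda>(i,j). if i = k then G $$ (k,j) + (\<Sum>l\<in>B. t l * G $$ (l,j)) else G $$ (i,j)))"
  using B
proof (induction B rule: finite_induct)
  case empty
  have "mat d d (\<lambda>(i,j). if i = k then G $$ (k,j) + (\<Sum>l\<in>{}. t l * G $$ (l,j)) else G $$ (i,j)) = G"
    by (rule eq_matI) (use OmatD(1)[OF G] in auto)
  then show ?case using G by (simp add: row_reduces_def)
next
  case (insert l B)
  let ?G = "mat d d (\<lambda>(i,j). if i = k then G $$ (k,j) + (\<Sum>l\<in>B. t l * G $$ (l,j)) else G $$ (i,j))"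
  have red: "row_reduces d J C G ?G" using insert by blast
  then have "?G \<in> Omat d" by (simp add: row_reduces_def)
  moreover have l: "l < d" "k \<noteq> l" using insert.prems by auto
  ultimately have red2: "row_reduces d J C ?G (addrow (t l) k l ?G)"
    using row_reduces_addrow[OF J C a _ t k] by blast
  have "addrow (t l) k l ?G =
    mat d d (\<lambda>(i,j). if i = k then G $$ (k,j) + (\<Sum>l\<in>insert l B. t l * G $$ (l,j)) else G $$ (i,j))"
    by (rule eq_matI) (use l insert.hyps in \<open>auto simp: algebra_simps\<close>)
  then show ?case using row_reduces_trans[OF red red2] by simp
qed

lemma row_reduces_clear:
  assumes J: "ideal J" and C: "ideal C" and a: "a \<in> J" "u - a \<in> C"
    and G: "G \<in> Omat d" and k: "k < d" and B: "finite B" "B \<subseteq> {..<d} - {k}"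
    and t: "\<And>l. l < d \<Longrightarrow> t l \<in> proj u Ocl"
  shows "row_reduces d J C G (mat d d (\<lambda>(i,j). if i \<in> B then t i * G $$ (k,j) + G $$ (i,j) else G $$ (i,j)))"
  using B
proof (induction B rule: finite_induct)
  case empty
  have "mat d d (\<lambda>(i,j). if i \<in> {} then t i * G $$ (k,j) + G $$ (i,j) else G $$ (i,j)) = G"
    by (rule eq_matI) (use OmatD(1)[OF G] in auto)
  then show ?case using G by (simp add: row_reduces_def)
next
  case (insert l B)
  let ?G = "mat d d (\<lambda>(i,j). if i \<in> B then t i * G $$ (k,j) + G $$ (i,j) else G $$ (i,j))"
  have red: "row_reduces d J C G ?G" using insert by blast
  then have "?G \<in> Omat d" by (simp add: row_reduces_def)
  moreover have l: "l < d" "l \<noteq> k" using insert.prems by auto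
  ultimately have red2: "row_reduces d J C ?G (addrow (t l) l k ?G)"
    using row_reduces_addrow[OF J C a _ t[OF l(1)] l(1) k] by blast
  have "addrow (t l) l k ?G =
    mat d d (\<lambda>(i,j). if i \<in> insert l B then t i * G $$ (k,j) + G $$ (i,j) else G $$ (i,j))"
    by (rule eq_matI) (use l k insert.prems insert.hyps in auto)
  then show ?case using row_reduces_trans[OF red red2] by simp
qed

definition cols_reduced :: "nat \<Rightarrow> 'a set \<Rightarrow> nat \<Rightarrow> 'a mat \<Rightarrow> bool" where
  "cols_reduced d C m G \<longleftrightarrow> (\<forall>j<m. \<forall>i<d. G $$ (i,j) - (if i = j then u else 0) \<in> C)"

text \<open>Suppose a prime above \<open>C\<close> contained the pivot and all entries below it. As
  the first \<open>k\<close> columns are those of the identity modulo \<open>C\<close>,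
  \<open>det_mem_of_column\<close> would put the determinant, and with it the unit \<open>c\<close>,
  into that prime. Prime avoidance therefore yields a combination that is invertible modulo
  \<open>C\<close>, with inverse \<open>i\<close>.\<close>

lemma unimodular_pivot:
  assumes C: "frac u C" "C \<subseteq> Ocl" and c: "c \<in> proj u Ocl" "c' \<in> proj u Ocl" "c * c' = u"
    and G: "G \<in> Omat d" "det G - c \<in> C" and red: "cols_reduced d C k G" and k: "k < d"
  obtains t i where "\<forall>l. t l \<in> proj u Ocl" "i \<in> proj u Ocl"
    "u - (G $$ (k,k) + (\<Sum>l\<in>{k<..<d}. t l * G $$ (l,k))) * i \<in> C"
proof -
  note GO = OmatD(2)[OF G(1)]
  \<comment> \<open>The pivot is moved to index \<open>0\<close>, where the coefficient is
    \<open>u\<close>; indices that do not belong to an entry below the pivot get the value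
    \<open>0\<close>.\<close>
  define x where "x m = (if m = 0 then G $$ (k,k) else if k < m \<and> m < d then G $$ (m,k) else 0)" for m
  have xO: "x m \<in> proj u Ocl" for m using GO k O_closed(2) by (auto simp: x_def)
  have xinv: "x m \<in> inv_ideal (proj u Ocl)" for m
    using xO[of m] Ocl_rules(6) mem_O by (auto simp: inv_ideal_def)
  obtain t i \<gamma> where t: "\<And>l. t l \<in> proj u Ocl" "t 0 = u" "i \<in> proj u Ocl" "\<gamma> \<in> C" "u = (\<Sum>m\<le>d. t m * x m) * i + \<gamma>"
  proof (rule coprime_combination[OF C frac_O xinv, of d])
    fix P assume P: "prime_ideal P" "C \<subseteq> P"
    have iP: "ideal P" and uP: "u \<notin> P" using P(1) by (auto simp: prime_ideal_def)
    show "\<exists>m\<le>d. \<exists>i\<in>proj u Ocl. x m * i \<notin> P"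
    proof (rule ccontr)
      assume no: "\<not> (\<exists>m\<le>d. \<exists>i\<in>proj u Ocl. x m * i \<notin> P)"
      have xP: "x m \<in> P" if "m \<le> d" for m
      proof -
        have "x m * u \<in> P" using no that O_closed(1) by blast
        then show ?thesis using xO[of m] mem_O by (simp add: mult.commute)
      qed
      have "G $$ (m,k) \<in> P" if "k \<le> m" "m < d" for m
        using xP[of m] xP[of 0] that by (cases "m = k") (auto simp: x_def split: if_splits)
      moreover have "G $$ (i,j) \<in> P" if "j < k" "i < d" "i \<noteq> j" for i j
        using red that P(2) unfolding cols_reduced_def by force
      ultimately have "det G \<in> P"
        by (intro det_mem_of_column[OF OmatD(1)[OF G(1)] Ocl_subring idealD(1)[OF iP], of "{..<k}" k])
          (use GO mem_O k in auto)
      then have "det G - (det G - c) \<in> P" using G(2) P(2) idealD(8)[OF iP] by blast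
      then have "c \<in> P" by simp
      then have "u \<in> P" using idealD(7)[OF iP, of c' c] c mem_O by auto
      then show False using uP by blast
    qed
  qed blast+
  have "(\<Sum>m\<le>d. t m * x m) = t 0 * x 0 + (\<Sum>m\<in>{..d} - {0}. t m * x m)" by (rule sum.remove) auto
  also have "(\<Sum>m\<in>{..d} - {0}. t m * x m) = (\<Sum>l\<in>{k<..<d}. t l * G $$ (l,k))"
    by (rule sum.mono_neutral_cong_right) (auto simp: x_def)
  also have "t 0 * x 0 = G $$ (k,k)" using t(2) GO[OF k k] mem_O by (simp add: x_def)
  finally have "u - (G $$ (k,k) + (\<Sum>l\<in>{k<..<d}. t l * G $$ (l,k))) * i = \<gamma>" using t(5) by (metis add_diff_cancel_left')
  then show thesis using that[of t i] t by simp
qed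

text \<open>An invertible pivot cannot simply be scaled to \<open>u\<close>, as scaling a row
  changes the determinant. The next row is first given an entry congruent to \<open>u\<close>, and
  the pivot is then corrected by it. This needs a row below, so the last column is left to the
  determinant.\<close>

lemma cols_reduced_step:
  assumes J: "ideal J" and a: "a \<in> J" "u - a \<in> C" and C: "frac u C" "C \<subseteq> Ocl"
    and c: "c \<in> proj u Ocl" "c' \<in> proj u Ocl" "c * c' = u"
    and G: "G \<in> Omat d" "det G - c \<in> C" and red: "cols_reduced d C k G" and k: "Suc k < d"
  shows "\<exists>G'. row_reduces d J C G G' \<and> cols_reduced d C (Suc k) G'"
proof -
  have iC: "ideal C" by (rule frac_integral_ideal[OF C])
  have kd: "k < d" using k by simp
  have Gj: "G $$ (i,j) \<in> C" if "j < k" "i < d" "i \<noteq> j" for i j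
    using red that unfolding cols_reduced_def by force
  have Gjj: "G $$ (j,j) - u \<in> C" if "j < k" for j
  proof -
    have "j < d" using that kd by simp
    then have "G $$ (j,j) - (if j = j then u else 0) \<in> C" using red that unfolding cols_reduced_def by blast
    then show ?thesis by simp
  qed
  obtain t i where tO: "\<forall>l. t l \<in> proj u Ocl" and ti: "i \<in> proj u Ocl"
    "u - (G $$ (k,k) + (\<Sum>l\<in>{k<..<d}. t l * G $$ (l,k))) * i \<in> C"
    by (rule unimodular_pivot[OF C c G red kd])
  define G1 where "G1 = mat d d (\<lambda>(i,j). if i = k then G $$ (k,j) + (\<Sum>l\<in>{k<..<d}. t l * G $$ (l,j)) else G $$ (i,j))"
  have r1: "row_reduces d J C G G1"
    unfolding G1_def by (rule row_reduces_combine[OF J iC a G(1) kd _ _ tO[rule_format]]) auto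
  then have O1: "G1 \<in> Omat d" by (simp add: row_reduces_def)
  define p where "p = G1 $$ (k,k)"
  have pi: "u - p * i \<in> C" using ti(2) kd by (simp add: p_def G1_def)
  have pO: "p \<in> proj u Ocl" unfolding p_def by (rule OmatD(2)[OF O1 kd kd])
  have 1: "G1 $$ (k,j) \<in> C" if "j < k" for j
  proof -
    have "(\<Sum>l\<in>{k<..<d}. t l * G $$ (l,j)) \<in> C"
      by (rule submod_sum[OF idealD(1)[OF iC]], rule idealD(6)[OF iC]) (use tO mem_O Gj that in auto)
    then show ?thesis using Gj[of j k] that kd idealD(5)[OF iC] by (simp add: G1_def)
  qed
  have G1r: "G1 $$ (i,j) = G $$ (i,j)" if "i < d" "j < d" "i \<noteq> k" for i j using that by (simp add: G1_def)
  let ?g = "G1 $$ (Suc k,k)"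
  have gO: "?g \<in> proj u Ocl" by (rule OmatD(2)[OF O1 k kd])
  \<comment> \<open>Since \<open>p * i\<close> is \<open>u\<close> modulo \<open>C\<close>, this
    makes the entry just below the pivot congruent to \<open>u\<close>.\<close>
  define G2 where "G2 = addrow (i * (u - ?g)) (Suc k) k G1"
  have iug: "i * (u - ?g) \<in> proj u Ocl" using O_closed(4)[OF O_closed(1) gO] ti(1) O_closed(5) mem_O by blast
  have r2: "row_reduces d J C G1 G2"
    unfolding G2_def by (rule row_reduces_addrow[OF J iC a O1 iug k kd]) simp
  then have O2: "G2 \<in> Omat d" by (simp add: row_reduces_def)
  note d1 = OmatD(1)[OF O1]
  have 2: "G2 $$ (r,j) = (if r = Suc k then i * (u - ?g) * G1 $$ (k,j) + G1 $$ (Suc k,j) else G1 $$ (r,j))"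
    if "r < d" "j < d" for r j using that d1 by (simp add: G2_def)
  have g2: "G2 $$ (Suc k,k) - u \<in> C"
  proof -
    have "G2 $$ (Suc k,k) - u = - ((u - ?g) * (u - p * i)) + ((u - ?g) * u - (u - ?g))"
      using 2[OF k kd] by (simp add: p_def algebra_simps)
    also have "(u - ?g) * u - (u - ?g) = 0" using O_closed(4)[OF O_closed(1) gO] mem_O by (simp add: mult.commute)
    finally have eq: "G2 $$ (Suc k,k) - u = 0 - (u - ?g) * (u - p * i)" by simp
    have "u - ?g \<in> Ocl" using gO mem_O u_Ocl Ocl_rules(5) by blast
    then show ?thesis unfolding eq using idealD(8)[OF iC idealD(4)[OF iC] idealD(6)[OF iC _ pi]] by blast
  qed
  \<comment> \<open>Adding \<open>u - p\<close> times a row whose entry is \<open>u\<close> modulo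
    \<open>C\<close> turns the pivot \<open>p\<close> into \<open>u\<close> modulo
    \<open>C\<close>.\<close>
  define G3 where "G3 = addrow (u - p) k (Suc k) G2"
  have up: "u - p \<in> proj u Ocl" using O_closed(4)[OF O_closed(1) pO] .
  have r3: "row_reduces d J C G2 G3"
    unfolding G3_def by (rule row_reduces_addrow[OF J iC a O2 up kd k]) simp
  then have O3: "G3 \<in> Omat d" by (simp add: row_reduces_def)
  note d2 = OmatD(1)[OF O2]
  have 3: "G3 $$ (r,j) = (if r = k then (u - p) * G2 $$ (Suc k,j) + G2 $$ (k,j) else G2 $$ (r,j))"
    if "r < d" "j < d" for r j using that d2 by (simp add: G3_def)
  have g3: "G3 $$ (k,k) - u \<in> C"
  proof -
    have "G3 $$ (k,k) - u = (u - p) * (G2 $$ (Suc k,k) - u) + ((u - p) * u - (u - p))"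
      using 3[OF kd kd] 2[OF kd kd] by (simp add: p_def algebra_simps)
    also have "(u - p) * u - (u - p) = 0" using up mem_O by (simp add: mult.commute)
    finally have eq: "G3 $$ (k,k) - u = (u - p) * (G2 $$ (Suc k,k) - u)" by simp
    show ?thesis unfolding eq using idealD(6)[OF iC _ g2] up mem_O by blast
  qed
  have row1: "G1 $$ (Suc k,j) \<in> C" if "j < k" for j using G1r[of "Suc k" j] Gj[of j "Suc k"] that k by simp
  have row2: "G2 $$ (Suc k,j) \<in> C" if "j < k" for j
    using 2[OF k, of j] that kd idealD(5)[OF iC idealD(6)[OF iC _ 1[OF that]] row1[OF that]] iug mem_O by auto
  have row3: "G3 $$ (k,j) \<in> C" if "j < k" for j
    using 3[OF kd, of j] 2[OF kd, of j] that kd idealD(5)[OF iC idealD(6)[OF iC _ row2[OF that]] 1[OF that]] up mem_O by auto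
  have col3: "G3 $$ (r,j) - (if r = j then u else 0) \<in> C" if "j < k" "r < d" for r j
  proof -
    consider "r = k" | "r = Suc k" | "r \<noteq> k" "r \<noteq> Suc k" by blast
    then show ?thesis
    proof cases
      case 1 then show ?thesis using row3[OF that(1)] that by simp
    next
      case 2 then show ?thesis using row2[OF that(1)] 3[of r j] that kd by simp
    next
      case other: 3
      then have "G3 $$ (r,j) = G $$ (r,j)" using 3[of r j] 2[of r j] G1r[of r j] that kd by simp
      then show ?thesis using Gj[of j r] Gjj[of j] that by auto
    qed
  qed
  define G4 where "G4 = mat d d (\<lambda>(r,j). if r \<in> {..<d} - {k} then (- G3 $$ (r,k)) * G3 $$ (k,j) + G3 $$ (r,j) else G3 $$ (r,j))"
  have negO: "- G3 $$ (r,k) \<in> proj u Ocl" if "r < d" for r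
    using O_closed(4)[OF O_closed(2) OmatD(2)[OF O3 that kd]] by simp
  have r4: "row_reduces d J C G3 G4"
    unfolding G4_def by (rule row_reduces_clear[OF J iC a O3 kd _ _ negO]) auto
  have "cols_reduced d C (Suc k) G4" unfolding cols_reduced_def
  proof (intro allI impI)
    fix j r assume jr: "j < Suc k" "r < d"
    have jd: "j < d" using jr kd by simp
    have rO: "G3 $$ (r,k) \<in> Ocl" "u * G3 $$ (r,k) = G3 $$ (r,k)" using OmatD(2)[OF O3 jr(2) kd] mem_O by auto
    show "G4 $$ (r,j) - (if r = j then u else 0) \<in> C"
    proof (cases "r = k")
      case True
      then have "G4 $$ (r,j) = G3 $$ (k,j)" using jd kd by (simp add: G4_def)
      then show ?thesis using True g3 col3[of j k] jr kd by (cases "j = k") auto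
    next
      case False
      then have e: "G4 $$ (r,j) = (- G3 $$ (r,k)) * G3 $$ (k,j) + G3 $$ (r,j)" using jd jr(2) by (simp add: G4_def)
      show ?thesis
      proof (cases "j = k")
        case True
        have "G4 $$ (r,j) = 0 - G3 $$ (r,k) * (G3 $$ (k,k) - u)"
          using e rO(2) unfolding True by (simp add: algebra_simps)
        then show ?thesis using False True idealD(8)[OF iC idealD(4)[OF iC] idealD(6)[OF iC rO(1) g3]] by simp
      next
        case False
        then have jk: "j < k" using jr by simp
        have eq: "G4 $$ (r,j) - (if r = j then u else 0) = (G3 $$ (r,j) - (if r = j then u else 0)) - G3 $$ (r,k) * G3 $$ (k,j)"
          unfolding e by simp
        show ?thesis
          unfolding eq by (rule idealD(8)[OF iC col3[OF jk jr(2)] idealD(6)[OF iC rO(1) row3[OF jk]]])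
      qed
    qed
  qed
  then show ?thesis
    using row_reduces_trans[OF row_reduces_trans[OF row_reduces_trans[OF r1 r2] r3] r4] by blast
qed

text \<open>With all columns but the last reduced, the last diagonal entry is the determinant modulo
  \<open>C\<close>, hence congruent to \<open>c\<close>. Clearing the last column leaves, modulo
  \<open>C\<close>, a diagonal matrix with entries \<open>u\<close> and a final \<open>c\<close>.
  The exact diagonal matrix is a lift, as \<open>c\<close> is a unit.\<close>

lemma liftable_reduced:
  assumes J: "ideal J" and a: "a \<in> J" "u - a \<in> C" and C: "frac u C" "C \<subseteq> Ocl"
    and c: "c \<in> proj u Ocl" "c' \<in> proj u Ocl" "c * c' = u"
    and G: "G \<in> Omat d" "det G - c \<in> C" and red: "cols_reduced d C (d - 1) G" and d: "d > 0"
  shows "liftable d J C G"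
proof -
  have iC: "ideal C" by (rule frac_integral_ideal[OF C])
  note GO = OmatD(2)[OF G(1)] and Gc = OmatD(1)[OF G(1)]
  let ?e = "d - 1"
  have e: "?e < d" using d by simp
  have Gij: "G $$ (i,j) - (if i = j then u else 0) \<in> C" if "i < d" "j < ?e" for i j
    using red that unfolding cols_reduced_def by blast
  let ?g = "G $$ (?e,?e)"
  \<comment> \<open>Congruent to \<open>G\<close> modulo \<open>C\<close> and upper triangular, so
    that its determinant \<open>?g\<close> is read off from the diagonal.\<close>
  let ?U = "mat d d (\<lambda>(i,j). if j = ?e then G $$ (i,j) else if i = j then u else 0)"
  have gO: "?g \<in> proj u Ocl" by (rule GO[OF e e])
  have "det G - det ?U \<in> C"
  proof (rule det_cong_mod[OF Gc _ Ocl_subring idealD(1)[OF iC]])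
    show "G $$ (i,j) - ?U $$ (i,j) \<in> C" if "i < d" "j < d" for i j
      using Gij[of i j] that idealD(4)[OF iC] by (cases "j = ?e") auto
    show "?U $$ (i,j) \<in> Ocl" if "i < d" "j < d" for i j
      using GO that mem_O u_Ocl Ocl_rules(2) by simp
  qed (use GO mem_O in auto)
  moreover have "det ?U = ?g"
  proof -
    have "upper_triangular ?U" by (rule upper_triangularI) auto
    then have "det ?U = prod_list (diag_mat ?U)" by (rule det_upper_triangular[of _ d]) simp
    also have "\<dots> = (\<Prod>i = 0..<d. ?U $$ (i,i))" by (simp add: prod_list_diag_prod)
    also have "{0..<d} = insert ?e {0..<?e}" using d by auto
    also have "(\<Prod>i\<in>insert ?e {0..<?e}. ?U $$ (i,i)) = ?g * (\<Prod>i = 0..<?e. ?U $$ (i,i))" using d by simp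
    also have "(\<Prod>i = 0..<?e. ?U $$ (i,i)) = (\<Prod>i = 0..<?e. u)" by (rule prod.cong) auto
    also have "\<dots> = u ^ ?e" by simp
    also have "?g * u ^ ?e = ?g" using u_power[of ?e] gO mem_O by (cases "?e = 0") (auto simp: mult.commute)
    finally show ?thesis .
  qed
  ultimately have "det G - ?g \<in> C" by simp
  from idealD(8)[OF iC G(2) this] have gc: "?g - c \<in> C" by simp
  define G' where "G' = mat d d (\<lambda>(i,j). if i \<in> {..<?e} then (- (G $$ (i,?e) * c')) * G $$ (?e,j) + G $$ (i,j) else G $$ (i,j))"
  have cO: "c' \<in> Ocl" "u * c' = c'" "c \<in> Ocl" "u * c = c" using c mem_O by auto
  have tO: "- (G $$ (i,?e) * c') \<in> proj u Ocl" if "i < d" for i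
    using O_closed(4)[OF O_closed(2) O_closed(6)[OF GO[OF that e] cO(1)]] by simp
  have "row_reduces d J C G G'"
    unfolding G'_def by (rule row_reduces_clear[OF J iC a G(1) e _ _ tO]) auto
  moreover have "liftable d J C G'"
  proof -
    define D where "D x = mat d d (\<lambda>(i,j). if i = j then if i = ?e then x else u else 0)" for x :: 'a
    have DJ: "D x \<in> Jmat d J" if "x \<in> proj u Ocl" for x
      using that O_closed(1,2) idealD(4)[OF J] by (auto simp: Jmat_def Omat_def D_def)
    have DD: "D x * D y = u \<cdot>\<^sub>m 1\<^sub>m d" if "x * y = u" for x y
    proof (rule eq_matI)
      fix i j assume "i < dim_row (u \<cdot>\<^sub>m 1\<^sub>m d :: 'a mat)" "j < dim_col (u \<cdot>\<^sub>m 1\<^sub>m d :: 'a mat)"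
      then have ij: "i < d" "j < d" by auto
      have "(D x * D y) $$ (i,j) = (\<Sum>l<d. D x $$ (i,l) * D y $$ (l,j))"
        by (rule mat_mult_index) (use ij in \<open>auto simp: D_def\<close>)
      also have "\<dots> = (\<Sum>l<d. if l = i then (if i = j then u else 0) else 0)"
        by (rule sum.cong) (use ij that idem in \<open>auto simp: D_def\<close>)
      also have "\<dots> = (if i = j then u else 0)" using ij by simp
      finally show "(D x * D y) $$ (i,j) = (u \<cdot>\<^sub>m 1\<^sub>m d) $$ (i,j)" using ij by simp
    qed (auto simp: D_def)
    have "D c $$ (i,j) - G' $$ (i,j) \<in> C" if ij: "i < d" "j < d" for i j
    proof (cases "i = ?e")
      case True
      then have G'e: "G' $$ (i,j) = G $$ (?e,j)" using ij by (simp add: G'_def)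
      show ?thesis
      proof (cases "j = ?e")
        case True
        then have "D c $$ (i,j) - G' $$ (i,j) = 0 - (?g - c)" using \<open>i = ?e\<close> G'e ij by (simp add: D_def)
        then show ?thesis using idealD(8)[OF iC idealD(4)[OF iC] gc] by simp
      next
        case False
        then have "D c $$ (i,j) - G' $$ (i,j) = 0 - G $$ (?e,j)" using \<open>i = ?e\<close> G'e ij by (simp add: D_def)
        moreover have "G $$ (?e,j) \<in> C" using Gij[of ?e j] e False ij by auto
        ultimately show ?thesis using idealD(8)[OF iC idealD(4)[OF iC]] by simp
      qed
    next
      case False
      then have G'i: "G' $$ (i,j) = (- (G $$ (i,?e) * c')) * G $$ (?e,j) + G $$ (i,j)" using ij by (simp add: G'_def)
      have giO: "G $$ (i,?e) \<in> Ocl" "u * G $$ (i,?e) = G $$ (i,?e)" using GO[OF ij(1) e] mem_O by auto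
      have gic: "G $$ (i,?e) * c' \<in> Ocl" using giO(1) cO(1) by (rule Ocl_rules(6))
      show ?thesis
      proof (cases "j = ?e")
        case True
        have "G $$ (i,?e) * c' * (?g - c) \<in> C" by (rule idealD(6)[OF iC gic gc])
        moreover have "G $$ (i,?e) * c' * (?g - c) = G $$ (i,?e) * c' * ?g - G $$ (i,?e) * (c * c')"
          by (simp add: algebra_simps)
        then have "G $$ (i,?e) * c' * (?g - c) = G $$ (i,?e) * c' * ?g - G $$ (i,?e)"
          using c(3) giO(2) by (simp add: mult.commute)
        ultimately show ?thesis using True False ij G'i by (simp add: D_def)
      next
        case jF: False
        have 1: "G $$ (?e,j) \<in> C" using Gij[of ?e j] e jF ij by auto
        have 2: "G $$ (i,j) - (if i = j then u else 0) \<in> C" using Gij[of i j] jF ij by auto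
        have "D c $$ (i,j) - G' $$ (i,j) = (G $$ (i,?e) * c') * G $$ (?e,j) - (G $$ (i,j) - (if i = j then u else 0))"
          using False jF ij G'i by (simp add: D_def)
        then show ?thesis using idealD(8)[OF iC idealD(6)[OF iC gic 1] 2] by simp
      qed
    qed
    moreover have "c' * c = u" using c(3) by (simp add: mult.commute)
    ultimately show ?thesis unfolding liftable_def
      using DJ[OF c(1)] DJ[OF c(2)] DD[OF c(3)] DD[of c' c] by blast
  qed
  ultimately show ?thesis by (simp add: row_reduces_def)
qed

theorem liftable_det_unit:
  assumes J: "ideal J" and a: "a \<in> J" "u - a \<in> C" and C: "frac u C" "C \<subseteq> Ocl"
    and c: "c \<in> proj u Ocl" "c' \<in> proj u Ocl" "c * c' = u"
    and G: "G \<in> Omat d" "det G - c \<in> C" and d: "d > 0"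
  shows "liftable d J C G"
proof -
  have "m \<le> d - 1 \<Longrightarrow> \<exists>G'. row_reduces d J C G G' \<and> cols_reduced d C m G'" for m
  proof (induction m)
    case 0
    have "row_reduces d J C G G" using G by (simp add: row_reduces_def)
    then show ?case by (auto simp: cols_reduced_def)
  next
    case (Suc m)
    then obtain G' where G': "row_reduces d J C G G'" "cols_reduced d C m G'" by auto
    have "G' \<in> Omat d" "det G' - c \<in> C" using G'(1) G(2) by (auto simp: row_reduces_def)
    moreover have "Suc m < d" using Suc.prems d by linarith
    ultimately obtain G'' where "row_reduces d J C G' G''" "cols_reduced d C (Suc m) G''"
      using cols_reduced_step[OF J a C c _ _ G'(2)] by blast
    then show ?case using row_reduces_trans[OF G'(1)] by blast
  qed
  then obtain G' where G': "row_reduces d J C G G'" "cols_reduced d C (d - 1) G'" by blast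
  have "G' \<in> Omat d" "det G' - c \<in> C" using G'(1) G(2) by (auto simp: row_reduces_def)
  then have "liftable d J C G'" using liftable_reduced[OF J a C c _ _ G'(2) d] by blast
  then show ?thesis using G'(1) by (simp add: row_reduces_def)
qed

section \<open>Transfer of automorphisms between ideals\<close>

lemma lin_pair_mat_apply:
  assumes H: "H \<in> Omat d" "H' \<in> Omat d" "H * H' = u \<cdot>\<^sub>m 1\<^sub>m d" "H' * H = u \<cdot>\<^sub>m 1\<^sub>m d"
  shows "lin_pair scf (W d) (mat_apply d H) (mat_apply d H')"
proof -
  have inv: "mat_apply d H (mat_apply d H' f) = f"
    if H: "H \<in> Omat d" "H' \<in> Omat d" "H * H' = u \<cdot>\<^sub>m 1\<^sub>m d" and f: "f \<in> W d" for H H' f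
  proof
    fix j
    show "mat_apply d H (mat_apply d H' f) j = f j"
    proof (cases "j < d")
      case True
      have "mat_apply d H (mat_apply d H' f) j = (\<Sum>k<d. H $$ (j,k) * (\<Sum>l<d. H' $$ (k,l) * f l))"
        using True by (auto simp: mat_apply_def intro!: sum.cong)
      also have "\<dots> = (\<Sum>k<d. \<Sum>l<d. H $$ (j,k) * H' $$ (k,l) * f l)"
        by (simp add: sum_distrib_left mult.assoc)
      also have "\<dots> = (\<Sum>l<d. \<Sum>k<d. H $$ (j,k) * H' $$ (k,l) * f l)" by (rule sum.swap)
      also have "\<dots> = (\<Sum>l<d. (H * H') $$ (j,l) * f l)"
        by (rule sum.cong[OF refl])
          (simp add: mat_mult_index[OF OmatD(1)[OF H(1)] OmatD(1)[OF H(2)] True] sum_distrib_right del: index_mult_mat)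
      also have "\<dots> = (\<Sum>l<d. if l = j then u * f j else 0)"
        unfolding H(3) by (rule sum.cong) (use True in auto)
      also have "\<dots> = f j" using True W_all[OF f] by simp
      finally show ?thesis .
    next
      case False
      then show ?thesis using f by (simp add: mat_apply_def W_def)
    qed
  qed
  have mem: "mat_apply d H f \<in> W d" if "H \<in> Omat d" for H f
  proof -
    have "u * (H $$ (j,k) * x) = H $$ (j,k) * x" if "j < d" "k < d" for j k x
      using OmatD(2)[OF \<open>H \<in> Omat d\<close> that] mem_O u_right by blast
    then show ?thesis by (auto simp: W_def mat_apply_def sum_distrib_left)
  qed
  show ?thesis unfolding lin_pair_def
    using inv[OF H(1,2,3)] inv[OF H(2,1,4)] mem[OF H(1)] mem[OF H(2)]
    by (auto simp: mat_apply_def scf_def fun_eq_iff algebra_simps sum.distrib sum_distrib_left)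
qed

lemma mat_apply_mem:
  assumes H: "H \<in> Omat d" and C: "submod Ocl (*) C" and f: "\<And>j. j < d \<Longrightarrow> f j \<in> C"
  shows "mat_apply d H f j \<in> C"
  using OmatD(2)[OF H] mem_O submodD(1,3)[OF C] f
  by (auto simp: mat_apply_def intro!: submod_sum[OF C])

text \<open>In the last coordinate the diagonal entry meets an element of \<open>J\<close>, and
  every other entry of the row is itself in \<open>J\<close>.\<close>

lemma mat_apply_block:
  assumes H: "H \<in> Jmat d J" and lin: "mat_apply d H f \<in> W d" and J: "ideal J" and f: "f \<in> block d J" and d: "d > 0"
  shows "mat_apply d H f \<in> block d J"
proof -
  have HO: "H \<in> Omat d" and HJ: "\<And>i j. i < d \<Longrightarrow> j < d \<Longrightarrow> i \<noteq> j \<Longrightarrow> H $$ (i,j) \<in> J" using H by (auto simp: Jmat_def)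
  have f1: "f k \<in> Ocl" if "k < d" for k
    using f idealD(2)[OF J] that by (cases "k = d - 1") (auto simp: block_def)
  have "mat_apply d H f j \<in> Ocl" for j
    by (rule mat_apply_mem[OF HO]) (use f1 Ocl_rules in \<open>auto intro: submodI\<close>)
  moreover have "mat_apply d H f (d - 1) \<in> J"
  proof -
    have "H $$ (d - 1,k) * f k \<in> J" if "k < d" for k
    proof (cases "k = d - 1")
      case True
      then have "f k \<in> J" using f by (simp add: block_def)
      then show ?thesis using idealD(6)[OF J] OmatD(2)[OF HO, of "d - 1" k] that mem_O by auto
    next
      case False
      then show ?thesis using idealD(7)[OF J f1[OF that] HJ[of "d - 1" k]] that by simp
    qed
    then have "(\<Sum>k<d. H $$ (d - 1,k) * f k) \<in> J" by (intro submod_sum[OF idealD(1)[OF J]]) auto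
    then show ?thesis using d by (simp add: mat_apply_def)
  qed
  ultimately show ?thesis using lin by (simp add: block_def)
qed

text \<open>The determinant of an automorphism of \<open>block d J1\<close> is a unit, so the matrix of the automorphism
  can be lifted modulo \<open>C\<close> to an automorphism of \<open>block d J2\<close>.\<close>

theorem automorphism_transfer:
  assumes C: "frac u C" "C \<subseteq> Ocl" and d: "d > 0"
    and J1: "frac u J1" "J1 \<subseteq> Ocl" "a1 \<in> J1" "u - a1 \<in> C"
    and J2: "frac u J2" "J2 \<subseteq> Ocl" "a2 \<in> J2" "u - a2 \<in> C"
    and T: "lin_pair scf (W d) T T'" "\<And>f. f \<in> block d J1 \<Longrightarrow> T f \<in> block d J1" "\<And>f. f \<in> block d J1 \<Longrightarrow> T' f \<in> block d J1"
  shows "\<exists>S S'. lin_pair scf (W d) S S' \<and> (\<forall>f\<in>block d J2. S f \<in> block d J2 \<and> S' f \<in> block d J2) \<and>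
    (\<forall>f\<in>W d. (\<forall>j. f j \<in> C) \<longrightarrow> (\<forall>j. S f j \<in> C \<and> S' f j \<in> C)) \<and>
    (\<forall>f\<in>block d J1. \<forall>j. S f j - T f j \<in> C)"
proof -
  have iC: "ideal C" and i1: "ideal J1" and i2: "ideal J2"
    using frac_integral_ideal C J1 J2 by auto
  let ?c = "det (mat_of d T)" and ?c' = "det (mat_of d T')"
  note T' = lin_pair_W_sym[OF T(1)]
  have c: "?c \<in> proj u Ocl" "?c' \<in> proj u Ocl" "?c * ?c' = u"
    using det_unit[OF T(1) d J1(1) T(2)] det_unit[OF T' d J1(1) T(3)] det_mat_of(1)[OF T(1) d] by auto
  have a1: "a1 \<in> Ocl" "u * a1 = a1" using idealD(2,3)[OF i1 J1(3)] .
  \<comment> \<open>Entries in the last column of \<open>mat_of d T\<close> are known to be integral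
    only after multiplication by an element of \<open>J1\<close>; \<open>a1\<close> provides this
    and is congruent to \<open>u\<close> modulo \<open>C\<close>.\<close>
  define G where "G = mat d d (\<lambda>(j,k). if k = d - 1 then a1 * mat_of d T $$ (j,k) else mat_of d T $$ (j,k))"
  have Gc: "G \<in> carrier_mat d d" by (simp add: G_def)
  have blockO: "f j \<in> Ocl" if "f \<in> block d J1" "j < d" for f j
    using that idealD(2)[OF i1] by (cases "j = d - 1") (auto simp: block_def)
  have b1: "unit_fun k \<in> block d J1" if "k < d - 1" for k
    using that unit_fun_W[of k d] idealD(4)[OF i1] u_Ocl Ocl_rules(2) by (auto simp: block_def unit_fun_def)
  have b2: "scf a1 (unit_fun (d - 1)) \<in> block d J1"
    using d J1(3) a1 W_closed(2)[OF unit_fun_W[of "d - 1" d], of a1] Ocl_rules(2)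
    by (auto simp: block_def unit_fun_def scf_def mult.commute)
  have Tx: "T (scf a1 (unit_fun (d - 1))) j = a1 * T (unit_fun (d - 1)) j" for j
    using lin_pairD(6)[OF T(1) unit_fun_W[of "d - 1" d]] d by (simp add: scf_def)
  have GO: "G \<in> Omat d" unfolding Omat_def
  proof (intro CollectI conjI allI impI Gc)
    fix j k assume jk: "j < d" "k < d"
    obtain f where f: "f \<in> block d J1" "G $$ (j,k) = T f j"
    proof (cases "k = d - 1")
      case True
      then show thesis using that[OF b2] Tx jk by (simp add: G_def)
    next
      case False
      then show thesis using that[OF b1[of k]] jk by (simp add: G_def)
    qed
    have "T f j \<in> Ocl" "u * T f j = T f j"
      using blockO[OF T(2)[OF f(1)] jk(1)] W_all[of "T f" d j] T(2)[OF f(1)] by (auto simp: block_def)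
    then show "G $$ (j,k) \<in> proj u Ocl" using f(2) mem_O by simp
  qed
  have "det G = a1 * ?c"
  proof -
    have "det G = det (transpose_mat G)" by (rule det_transpose[OF Gc, symmetric])
    also have "transpose_mat G = multrow (d - 1) a1 (transpose_mat (mat_of d T))" by (rule eq_matI) (auto simp: G_def)
    also have "det \<dots> = a1 * det (transpose_mat (mat_of d T))" by (rule det_multrow[of _ d]) (use d in auto)
    finally show ?thesis by (simp add: det_transpose[of _ d])
  qed
  then have "det G - ?c = 0 - ?c * (u - a1)" using c(1) mem_O by (simp add: algebra_simps)
  then have "det G - ?c \<in> C"
    using idealD(8)[OF iC idealD(4)[OF iC] idealD(6)[OF iC _ J1(4)]] c(1) mem_O by auto
  then have "liftable d J2 C G" by (rule liftable_det_unit[OF i2 J2(3,4) C c GO _ d])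
  then obtain H H' where H: "H \<in> Jmat d J2" "H' \<in> Jmat d J2" "H * H' = u \<cdot>\<^sub>m 1\<^sub>m d" "H' * H = u \<cdot>\<^sub>m 1\<^sub>m d"
    and HG: "\<And>i j. i < d \<Longrightarrow> j < d \<Longrightarrow> H $$ (i,j) - G $$ (i,j) \<in> C"
    unfolding liftable_def by blast
  have HO: "H \<in> Omat d" "H' \<in> Omat d" using H(1,2) by (auto simp: Jmat_def)
  note lp = lin_pair_mat_apply[OF HO H(3,4)]
  have "mat_apply d H f \<in> block d J2 \<and> mat_apply d H' f \<in> block d J2" if f: "f \<in> block d J2" for f
  proof -
    have "f \<in> W d" using f by (simp add: block_def)
    then show ?thesis using mat_apply_block[OF H(1) _ i2 f d] mat_apply_block[OF H(2) _ i2 f d] lin_pairD(1,2)[OF lp] by blast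
  qed
  moreover have "mat_apply d H f j \<in> C \<and> mat_apply d H' f j \<in> C" if "\<forall>j. f j \<in> C" for f j
    using mat_apply_mem[OF HO(1) idealD(1)[OF iC], of f] mat_apply_mem[OF HO(2) idealD(1)[OF iC], of f] that by blast
  moreover have "mat_apply d H f j - T f j \<in> C" if f: "f \<in> block d J1" for f j
  proof (cases "j < d")
    case True
    have fW: "f \<in> W d" using f by (simp add: block_def)
    let ?x = "f (d - 1)"
    have xJ: "?x \<in> J1" using f by (simp add: block_def)
    have x: "u * ?x = ?x" by (rule W_all[OF fW])
    have b3: "scf ?x (unit_fun (d - 1)) \<in> block d J1"
      using d xJ x W_closed(2)[OF unit_fun_W[of "d - 1" d], of ?x] Ocl_rules(2)
      by (auto simp: block_def unit_fun_def scf_def mult.commute)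
    have "T (scf ?x (unit_fun (d - 1))) j = ?x * T (unit_fun (d - 1)) j"
      using lin_pairD(6)[OF T(1) unit_fun_W[of "d - 1" d]] d by (simp add: scf_def)
    then have xT: "?x * T (unit_fun (d - 1)) j \<in> Ocl" using blockO[OF T(2)[OF b3] True] by simp
    have 1: "(\<Sum>k<d. (H $$ (j,k) - G $$ (j,k)) * f k) \<in> C"
      by (rule submod_sum[OF idealD(1)[OF iC]], rule idealD(7)[OF iC]) (use HG True blockO[OF f] in auto)
    have 2: "(?x * T (unit_fun (d - 1)) j) * (u - a1) \<in> C" by (rule idealD(6)[OF iC xT J1(4)])
    \<comment> \<open>The two matrices differ only in the last column. There the factor
      \<open>?x\<close> from \<open>J1\<close> makes the product integral, so the difference is an
      integral multiple of \<open>u - a1\<close>.\<close>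
    have "(\<Sum>k<d. (mat_of d T $$ (j,k) - G $$ (j,k)) * f k)
        = (\<Sum>k<d. if k = d - 1 then (?x * T (unit_fun (d - 1)) j) * (u - a1) else 0)"
    proof (rule sum.cong[OF refl])
      fix k assume "k \<in> {..<d}"
      let ?t = "T (unit_fun (d - 1)) j"
      have "(?x * ?t) * (u - a1) = (?x * ?t) * u - a1 * ?t * ?x" by (simp add: algebra_simps)
      also have "(?x * ?t) * u = ?x * ?t" using u_right[OF x] by (metis mult.commute)
      finally have "(?x * ?t) * (u - a1) = (?t - a1 * ?t) * ?x" by (simp add: algebra_simps)
      then show "(mat_of d T $$ (j,k) - G $$ (j,k)) * f k
        = (if k = d - 1 then (?x * ?t) * (u - a1) else 0)"
        using True \<open>k \<in> {..<d}\<close> by (simp add: G_def)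
    qed
    also have "\<dots> = (?x * T (unit_fun (d - 1)) j) * (u - a1)" using d by simp
    finally have 3: "(\<Sum>k<d. (mat_of d T $$ (j,k) - G $$ (j,k)) * f k) \<in> C" using 2 by simp
    have "mat_apply d H f j - T f j = (\<Sum>k<d. (H $$ (j,k) - G $$ (j,k)) * f k) - (\<Sum>k<d. (mat_of d T $$ (j,k) - G $$ (j,k)) * f k)"
      unfolding mat_apply_mat_of[OF T(1) fW] using True
      by (simp add: mat_apply_def left_diff_distrib sum_subtractf)
    then show ?thesis using idealD(8)[OF iC 1 3] by simp
  next
    case False
    then show ?thesis using f lin_pairD(1)[OF T(1)] idealD(4)[OF iC] by (auto simp: mat_apply_def block_def W_def)
  qed
  ultimately show ?thesis using lp by blast
qed

end

section \<open>The ambient space and its lattices\<close>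

context order_setting
begin

lemma e_idem: "i < n \<Longrightarrow> e i * e i = e i"
  and e_orth: "i < n \<Longrightarrow> j < n \<Longrightarrow> i \<noteq> j \<Longrightarrow> e i * e j = 0"
  and e_sum: "(\<Sum>i<n. e i) = 1"
  and e_field: "i < n \<Longrightarrow> e i * x = x \<Longrightarrow> x \<noteq> 0 \<Longrightarrow> \<exists>y. e i * y = y \<and> x * y = e i"
proof -
  show id: "i < n \<Longrightarrow> e i * e i = e i" for i
    using decomposition unfolding sum_of_finite_extensions_def by auto
  show "i < n \<Longrightarrow> j < n \<Longrightarrow> i \<noteq> j \<Longrightarrow> e i * e j = 0" "(\<Sum>i<n. e i) = 1"
    using decomposition unfolding sum_of_finite_extensions_def by auto
  assume i: "i < n" and x: "e i * x = x" "x \<noteq> 0"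
  have "x \<in> proj (e i) UNIV" using proj_UNIV_iff[OF id[OF i]] x(1) by blast
  then obtain y where "y \<in> proj (e i) UNIV" "x * y = e i"
    using decomposition x(2) i unfolding sum_of_finite_extensions_def by blast
  then show "\<exists>y. e i * y = y \<and> x * y = e i" using proj_UNIV_iff[OF id[OF i]] by blast
qed

lemma component_setting: "i < n \<Longrightarrow> idempotent_setting Z Q n e s R (e i)"
  by (intro idempotent_setting.intro idempotent_setting_axioms.intro e_idem) (rule order_setting_axioms)

lemma total_setting: "idempotent_setting Z Q n e s R 1"
  by (intro idempotent_setting.intro idempotent_setting_axioms.intro) (auto intro: order_setting_axioms)

lemma proj_1 [simp]: "proj 1 A = A" for A :: "'k set"
  by (simp add: proj_def)

abbreviation comp_W :: "nat \<Rightarrow> (nat \<Rightarrow> 'k) set" where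
  "comp_W i \<equiv> idempotent_setting.W (e i) (s i)"

abbreviation comp_block :: "nat \<Rightarrow> 'k set \<Rightarrow> (nat \<Rightarrow> 'k) set" where
  "comp_block i I \<equiv> idempotent_setting.block Z (e i) (s i) I"

lemma comp_W_iff: "i < n \<Longrightarrow> f \<in> comp_W i \<longleftrightarrow> (\<forall>j<s i. e i * f j = f j) \<and> (\<forall>j\<ge>s i. f j = 0)"
proof -
  assume "i < n"
  then interpret I: idempotent_setting Z Q n e s R "e i" by (rule component_setting)
  show ?thesis unfolding I.W_def by blast
qed

lemma comp_W_fix: "i < n \<Longrightarrow> f \<in> comp_W i \<Longrightarrow> e i * f j = f j"
  using comp_W_iff by (cases "j < s i") auto

lemma comp_block_iff:
  "i < n \<Longrightarrow> f \<in> comp_block i I \<longleftrightarrow> f \<in> comp_W i \<and> (\<forall>j<s i - 1. f j \<in> Ocl) \<and> f (s i - 1) \<in> I"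
proof -
  assume "i < n"
  then interpret I: idempotent_setting Z Q n e s R "e i" by (rule component_setting)
  show ?thesis unfolding I.block_def by blast
qed

lemma V_iff: "v \<in> V \<longleftrightarrow> (\<forall>i<n. v i \<in> comp_W i) \<and> (\<forall>i\<ge>n. v i = 0)"
proof
  assume v: "v \<in> V"
  have "v i \<in> comp_W i" if i: "i < n" for i
    unfolding comp_W_iff[OF i]
  proof (intro conjI allI impI)
    fix j assume "j < s i"
    then have "j < s i - 1 \<or> j = s i - 1" by linarith
    then have "v i j \<in> proj (e i) UNIV" using v i unfolding V_def block_sum_def by blast
    then show "e i * v i j = v i j" using proj_UNIV_iff[OF e_idem[OF i]] by blast
  next
    fix j assume "s i \<le> j" then show "v i j = 0" using v unfolding V_def block_sum_def by auto
  qed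
  moreover have "v i = 0" if "i \<ge> n" for i using v that unfolding V_def block_sum_def by (auto simp: fun_eq_iff)
  ultimately show "(\<forall>i<n. v i \<in> comp_W i) \<and> (\<forall>i\<ge>n. v i = 0)" by blast
next
  assume v: "(\<forall>i<n. v i \<in> comp_W i) \<and> (\<forall>i\<ge>n. v i = 0)"
  have p: "v i j \<in> proj (e i) UNIV" if "i < n" for i j
    using comp_W_fix[OF that, of "v i" j] v that proj_UNIV_iff[OF e_idem[OF that]] by auto
  have z: "v i j = 0" if "\<not> (i < n \<and> j < s i)" for i j
    using v comp_W_iff[of i "v i"] that by (cases "i < n") auto
  show "v \<in> V" unfolding V_def block_sum_def using p z by auto
qed

lemma V_fix: "v \<in> V \<Longrightarrow> i < n \<Longrightarrow> e i * v i j = v i j"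
  using comp_W_fix V_iff by blast

lemma V_closed: "v \<in> V \<Longrightarrow> w \<in> V \<Longrightarrow> v + w \<in> V" "v \<in> V \<Longrightarrow> smult c v \<in> V" "0 \<in> V" "v \<in> V \<Longrightarrow> w \<in> V \<Longrightarrow> v - w \<in> V"
proof -
  have c: "e i * (c * x) = c * x" if "e i * x = x" for i c x using that by (metis mult.left_commute)
  show "v \<in> V \<Longrightarrow> w \<in> V \<Longrightarrow> v + w \<in> V" "v \<in> V \<Longrightarrow> smult c v \<in> V" "0 \<in> V" "v \<in> V \<Longrightarrow> w \<in> V \<Longrightarrow> v - w \<in> V"
    unfolding V_iff by (auto simp: comp_W_iff c distrib_left right_diff_distrib smult_def)
qed

lemma V_submod: "submod S smult V"
  by (rule submodI) (auto intro: V_closed)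

lemma frac_1_iff: "fractional_ideal Z Q 1 Ocl I \<longleftrightarrow> submod Ocl (*) I \<and>
    (\<exists>z\<in>Z - {0}. z \<in> I) \<and> (\<exists>z\<in>Z - {0}. \<forall>x\<in>I. z * x \<in> Ocl)"
  using frac_iff[of 1 I] by simp

lemma proj_mem_iff: "i < n \<Longrightarrow> submod Ocl (*) I \<Longrightarrow> x \<in> proj (e i) I \<longleftrightarrow> x \<in> I \<and> e i * x = x"
proof -
  assume i: "i < n" and I: "submod Ocl (*) I"
  have "e i * y \<in> I" "e i * (e i * y) = e i * y" if "y \<in> I" for y
    using submodD(3)[OF I idempotent_Ocl[OF e_idem[OF i]] that] e_idem[OF i] by (auto simp: mult.assoc[symmetric])
  then show ?thesis unfolding proj_def by (auto intro: rev_image_eqI)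
qed

lemma proj_frac:
  assumes i: "i < n" and I: "fractional_ideal Z Q 1 Ocl I"
  shows "frac (e i) (proj (e i) I)"
proof -
  have sub: "submod Ocl (*) I" using I frac_1_iff by blast
  obtain y z where yz: "y \<in> Z - {0}" "z \<in> Z - {0}" "y \<in> I" "\<forall>x\<in>I. z * x \<in> Ocl" using I frac_1_iff by blast
  show ?thesis unfolding frac_iff[OF e_idem[OF i]]
  proof (intro conjI)
    show "submod Ocl (*) (proj (e i) I)" by (rule proj_submod[OF sub])
    show "\<forall>x\<in>proj (e i) I. e i * x = x" using proj_mem_iff[OF i sub] by blast
    have "y * e i \<in> proj (e i) I" using yz(3) by (auto simp: proj_def mult.commute)
    then show "\<exists>z\<in>Z - {0}. z * e i \<in> proj (e i) I" using yz(1) by blast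
    show "\<exists>z\<in>Z - {0}. \<forall>x\<in>proj (e i) I. z * x \<in> Ocl" using yz proj_mem_iff[OF i sub] by blast
  qed
qed

lemma component_sum: "x = (\<Sum>i<n. e i * x)" for x :: 'k
  using e_sum by (simp add: sum_distrib_right[symmetric])

lemma mem_of_components: "submod Ocl (*) I \<Longrightarrow> (\<And>i. i < n \<Longrightarrow> e i * x \<in> I) \<Longrightarrow> x \<in> I"
  by (subst component_sum[of x]) (rule submod_sum, auto)

lemma Ocl_frac: "fractional_ideal Z Q 1 Ocl Ocl"
  unfolding frac_1_iff
proof (intro conjI)
  show "submod Ocl (*) Ocl" using Ocl_rules by (auto intro: submodI)
  show "\<exists>z\<in>Z - {0}. z \<in> Ocl" "\<exists>z\<in>Z - {0}. \<forall>x\<in>Ocl. z * x \<in> Ocl"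
    using one_nonzero Ocl_rules by (auto intro!: bexI[of _ 1])
qed

lemma cond_sub_R: "cond \<subseteq> R"
  using Ocl_rules(1) unfolding cond_def by force

lemma cond_frac: "fractional_ideal Z Q 1 Ocl cond"
  unfolding frac_1_iff
proof (intro conjI)
  show "submod Ocl (*) cond"
  proof (rule submodI)
    show "0 \<in> cond" using R_rules(2) by (simp add: cond_def)
    show "x + y \<in> cond" if "x \<in> cond" "y \<in> cond" for x y using that R_rules(4) by (auto simp: cond_def distrib_right)
    show "r * x \<in> cond" if "r \<in> Ocl" "x \<in> cond" for r x unfolding cond_def
    proof (intro CollectI ballI)
      fix y assume "y \<in> Ocl"
      then have "x * (r * y) \<in> R" using that Ocl_rules(6) by (auto simp: cond_def)
      then show "r * x * y \<in> R" by (simp only: ac_simps)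
    qed
  qed
  obtain z where z: "z \<in> Z - {0}" "\<forall>m\<in>Ocl. z * m \<in> R"
    using K.common_denominator[OF Ocl_fin_gen R_submod_Z] denominator_R by blast
  then show "\<exists>z\<in>Z - {0}. z \<in> cond" by (auto simp: cond_def)
  show "\<exists>z\<in>Z - {0}. \<forall>x\<in>cond. z * x \<in> Ocl"
    by (rule bexI[of _ 1]) (use one_nonzero cond_sub_R R_sub_Ocl in auto)
qed

lemmas cond_submod = cond_frac[unfolded frac_1_iff, THEN conjunct1]

lemma proj_cond_sub: "i < n \<Longrightarrow> proj (e i) cond \<subseteq> Ocl"
  using proj_mem_iff[OF _ cond_submod] cond_sub_R R_sub_Ocl by blast

lemma Num_iff:
  assumes J: "submod Ocl (*) J"
  shows "v \<in> Num J \<longleftrightarrow> v \<in> V \<and> (\<forall>i<n. (\<forall>j<s i - 1. v i j \<in> Ocl) \<and> v i (s i - 1) \<in> J)"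
proof
  have OO: "submod Ocl (*) Ocl" using Ocl_frac frac_1_iff by blast
  {
    assume v: "v \<in> Num J"
    have 1: "v i j \<in> Ocl \<and> e i * v i j = v i j" if "i < n" "j < s i - 1" for i j
      using v that proj_mem_iff[OF that(1) OO] unfolding Num_def block_sum_def by blast
    have 2: "v i (s i - 1) \<in> J \<and> e i * v i (s i - 1) = v i (s i - 1)" if "i < n" for i
      using v that proj_mem_iff[OF that J] unfolding Num_def block_sum_def by blast
    have 3: "v i j = 0" if "\<not> (i < n \<and> j < s i)" for i j
      using v that unfolding Num_def block_sum_def by blast
    have "e i * v i j = v i j" if "i < n" "j < s i" for i j
    proof (cases "j < s i - 1")
      case False
      then have "j = s i - 1" using that by simp
      then show ?thesis using 2[OF that(1)] by simp
    qed (use 1 that in blast)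
    then have "v \<in> V" unfolding V_iff using 3 by (simp add: comp_W_iff fun_eq_iff)
    then show "v \<in> V \<and> (\<forall>i<n. (\<forall>j<s i - 1. v i j \<in> Ocl) \<and> v i (s i - 1) \<in> J)" using 1 2 by blast
  }
  assume v: "v \<in> V \<and> (\<forall>i<n. (\<forall>j<s i - 1. v i j \<in> Ocl) \<and> v i (s i - 1) \<in> J)"
  have "v i j = 0" if "\<not> (i < n \<and> j < s i)" for i j
    using v that unfolding V_def block_sum_def by blast
  then show "v \<in> Num J"
    unfolding Num_def block_sum_def using v V_fix[of v] by (simp add: proj_mem_iff OO J)
qed

lemma Num_iff_block:
  assumes J: "submod Ocl (*) J"
  shows "v \<in> Num J \<longleftrightarrow> (\<forall>i<n. v i \<in> comp_block i (proj (e i) J)) \<and> (\<forall>i\<ge>n. v i = 0)"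
  unfolding Num_iff[OF J] V_iff
  by (auto simp: comp_block_iff proj_mem_iff[OF _ J] comp_W_fix)

lemma Num_closed:
  assumes J: "submod Ocl (*) J"
  shows "submod Ocl smult (Num J)"
proof (rule submodI)
  show "0 \<in> Num J" unfolding Num_iff[OF J] using V_closed(3) Ocl_rules(2) submodD(1)[OF J] by simp
  show "v + w \<in> Num J" if "v \<in> Num J" "w \<in> Num J" for v w
    using that unfolding Num_iff[OF J] using V_closed(1) Ocl_rules(4) submodD(2)[OF J] by simp
  show "smult r v \<in> Num J" if "r \<in> Ocl" "v \<in> Num J" for r v
    using that unfolding Num_iff[OF J] using V_closed(2) Ocl_rules(6) submodD(3)[OF J] by (simp add: smult_def)
qed

section \<open>Numerators and denominators for coprime ideals\<close>

definition coprime_ideal :: "'k set \<Rightarrow> bool" where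
  "coprime_ideal J \<longleftrightarrow> fractional_ideal Z Q 1 Ocl J \<and> coprime_to_cond J"

lemma coprime_idealD:
  assumes "coprime_ideal J"
  shows "submod Ocl (*) J" "J \<subseteq> Ocl" "fractional_ideal Z Q 1 Ocl J" "\<exists>a\<in>J. 1 - a \<in> cond"
proof -
  show "submod Ocl (*) J" "J \<subseteq> Ocl" "fractional_ideal Z Q 1 Ocl J"
    using assms frac_1_iff unfolding coprime_ideal_def coprime_to_cond_def by blast+
  have "1 \<in> J + cond" using assms Ocl_rules(1) unfolding coprime_ideal_def coprime_to_cond_def by blast
  then obtain a b where "a \<in> J" "b \<in> cond" "1 = a + b" by (elim set_plus_elim)
  moreover from this have "1 - a = b" by (metis add_diff_cancel_left')
  ultimately show "\<exists>a\<in>J. 1 - a \<in> cond" by blast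
qed

lemma Ocl_coprime: "coprime_ideal Ocl"
proof -
  have "x \<in> Ocl" if x: "x \<in> Ocl + cond" for x
  proof -
    obtain a b where "x = a + b" "a \<in> Ocl" "b \<in> cond" using x by (elim set_plus_elim)
    then show ?thesis using cond_sub_R R_sub_Ocl Ocl_rules(4) by blast
  qed
  moreover have "x \<in> Ocl + cond" if "x \<in> Ocl" for x
    using set_plus_intro[OF that submodD(1)[OF cond_submod]] by simp
  ultimately show ?thesis using Ocl_frac unfolding coprime_ideal_def coprime_to_cond_def by blast
qed

text \<open>For coprime ideals product and intersection agree, so in each component the product of
  the conductor with \<open>J\<close> is cut out of \<open>J\<close> by membership in the conductor.
  Denominators for different \<open>J\<close> can then be compared entrywise.\<close>

lemma Den_iff:
  assumes J: "coprime_ideal J"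
  shows "v \<in> Den J \<longleftrightarrow> v \<in> Num J \<and> (\<forall>i j. v i j \<in> cond)"
proof -
  note Js = coprime_idealD(1)[OF J]
  obtain a where a: "a \<in> J" "1 - a \<in> cond" using coprime_idealD(4)[OF J] by blast
  have prod: "ideal_prod (proj (e i) cond) (proj (e i) J) = {x \<in> proj (e i) J. x \<in> cond}" if i: "i < n" for i
  proof
    show "ideal_prod (proj (e i) cond) (proj (e i) J) \<subseteq> {x \<in> proj (e i) J. x \<in> cond}"
    proof (rule ideal_prod_sub)
      fix x y assume "x \<in> proj (e i) cond" "y \<in> proj (e i) J"
      then have xy: "x \<in> cond" "y \<in> J" "e i * y = y" using proj_mem_iff[OF i] cond_submod Js by blast+
      have "x \<in> Ocl" "y \<in> Ocl" using xy cond_sub_R R_sub_Ocl coprime_idealD(2)[OF J] by auto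
      then have "x * y \<in> J" "y * x \<in> cond" "e i * (x * y) = x * y"
        using xy submodD(3)[OF Js] submodD(3)[OF cond_submod] by (auto simp: mult.left_commute)
      then show "x * y \<in> {x \<in> proj (e i) J. x \<in> cond}" using proj_mem_iff[OF i Js] by (simp add: mult.commute)
    qed (use submodD[OF cond_submod] submodD[OF proj_submod[OF Js]] in auto)
    show "{x \<in> proj (e i) J. x \<in> cond} \<subseteq> ideal_prod (proj (e i) cond) (proj (e i) J)"
    proof clarify
      fix x assume x: "x \<in> proj (e i) J" "x \<in> cond"
      have ex: "e i * x = x" using x(1) proj_mem_iff[OF i Js] by blast
      have "x \<in> proj (e i) cond" using x(2) ex proj_mem_iff[OF i cond_submod] by blast
      moreover have "e i * a \<in> proj (e i) J" using a(1) by (auto simp: proj_def)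
      ultimately have 1: "x * (e i * a) \<in> ideal_prod (proj (e i) cond) (proj (e i) J)" by (rule ideal_prod_mult)
      have "e i * (1 - a) \<in> proj (e i) cond" using a(2) by (auto simp: proj_def)
      then have 2: "e i * (1 - a) * x \<in> ideal_prod (proj (e i) cond) (proj (e i) J)" using x(1) by (rule ideal_prod_mult)
      \<comment> \<open>The first summand takes its factor in \<open>J\<close> from
        \<open>a\<close>, the second its factor in the conductor from \<open>1 - a\<close>.\<close>
      have "x * (e i * a) + e i * (1 - a) * x = e i * x" by (simp add: algebra_simps)
      then have "x = x * (e i * a) + e i * (1 - a) * x" using ex by simp
      then show "x \<in> ideal_prod (proj (e i) cond) (proj (e i) J)" using ideal_prod_add[OF 1 2] by simp
    qed
  qed
  show ?thesis
  proof
    assume v: "v \<in> Den J"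
    have z: "v i j = 0" if "\<not> (i < n \<and> j < s i)" for i j using v that unfolding Den_def block_sum_def by blast
    have 1: "v i j \<in> cond \<and> e i * v i j = v i j" if "i < n" "j < s i - 1" for i j
      using v that proj_mem_iff[OF that(1) cond_submod] unfolding Den_def block_sum_def by blast
    have 2: "v i (s i - 1) \<in> cond \<and> v i (s i - 1) \<in> proj (e i) J" if "i < n" for i
      using v that prod[OF that] unfolding Den_def block_sum_def by blast
    have c: "v i j \<in> cond" for i j
    proof (cases "i < n \<and> j < s i")
      case True
      then have "j < s i - 1 \<or> j = s i - 1" by linarith
      then show ?thesis using 1 2 True by blast
    next
      case False
      then show ?thesis using z submodD(1)[OF cond_submod] by simp
    qed
    have "v i j \<in> proj (e i) Ocl" if "i < n" "j < s i - 1" for i j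
      using 1[OF that] proj_mem_iff[OF that(1)] Ocl_frac frac_1_iff cond_sub_R R_sub_Ocl by blast
    then have "v \<in> Num J" unfolding Num_def block_sum_def using 2 z by blast
    then show "v \<in> Num J \<and> (\<forall>i j. v i j \<in> cond)" using c by blast
  next
    assume v: "v \<in> Num J \<and> (\<forall>i j. v i j \<in> cond)"
    then have vV: "v \<in> V" using Num_iff[OF Js] by blast
    have "v i j = 0" if "\<not> (i < n \<and> j < s i)" for i j using v that unfolding Num_def block_sum_def by blast
    moreover have "v i j \<in> proj (e i) cond" if "i < n" for i j
      using v V_fix[OF vV that] proj_mem_iff[OF that cond_submod] by blast
    moreover have "v i (s i - 1) \<in> proj (e i) J" if "i < n" for i
      using v that unfolding Num_def block_sum_def by blast
    ultimately show "v \<in> Den J" unfolding Den_def block_sum_def using v prod by blast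
  qed
qed

text \<open>Injectivity of the map from \<open>Quot J\<close> to \<open>Quot Ocl\<close> induced by
  the inclusion; \<open>Num_approx\<close> is its surjectivity.\<close>

lemma Den_Int_Num:
  assumes J: "coprime_ideal J"
  shows "Den J = Den Ocl \<inter> Num J" "Num J \<subseteq> Num Ocl"
proof -
  show sub: "Num J \<subseteq> Num Ocl"
    using coprime_idealD(2)[OF J] Num_iff[OF coprime_idealD(1)[OF J]] Num_iff[OF coprime_idealD(1)[OF Ocl_coprime]] by blast
  show "Den J = Den Ocl \<inter> Num J" using sub Den_iff[OF J] Den_iff[OF Ocl_coprime] by blast
qed

lemma Den_submod: "coprime_ideal J \<Longrightarrow> submod Ocl smult (Den J)"
proof -
  assume J: "coprime_ideal J"
  note N = submodD[OF Num_closed[OF coprime_idealD(1)[OF J]]] and c = submodD[OF cond_submod]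
  show ?thesis
    by (rule submodI) (use N c in \<open>auto simp: Den_iff[OF J] smult_def\<close>)
qed

text \<open>Multiplication by an element \<open>a\<close> of \<open>J\<close> with
  \<open>1 - a\<close> in the conductor moves a vector into \<open>Num J\<close> and changes it only
  by an element of \<open>Den Ocl\<close>.\<close>

lemma Num_approx:
  assumes J: "coprime_ideal J" and v: "v \<in> Num Ocl"
  obtains w where "w \<in> Num J" "v - w \<in> Den Ocl"
proof -
  obtain a where a: "a \<in> J" "1 - a \<in> cond" using coprime_idealD(4)[OF J] by blast
  note Js = coprime_idealD(1)[OF J] and Os = coprime_idealD(1)[OF Ocl_coprime]
  have aO: "a \<in> Ocl" using a coprime_idealD(2)[OF J] by blast
  have vV: "v \<in> V" and vO: "\<And>i j. i < n \<Longrightarrow> j < s i \<Longrightarrow> v i j \<in> Ocl"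
  proof -
    show "v \<in> V" using v Num_iff[OF Os] by blast
    fix i j assume ij: "i < n" "j < s i"
    then have "j < s i - 1 \<or> j = s i - 1" by linarith
    then show "v i j \<in> Ocl" using v ij Num_iff[OF Os] by blast
  qed
  have "smult a v \<in> Num J" unfolding Num_iff[OF Js]
  proof (intro conjI allI impI)
    show "smult a v \<in> V" by (rule V_closed(2)[OF vV])
    fix i assume i: "i < n"
    show "smult a v i j \<in> Ocl" if "j < s i - 1" for j
      using Ocl_rules(6)[OF aO vO[OF i, of j]] that by (simp add: smult_def)
    have "v i (s i - 1) * a \<in> J" using submodD(3)[OF Js vO[OF i, of "s i - 1"] a(1)] s_pos[OF i] by simp
    then show "smult a v i (s i - 1) \<in> J" by (simp add: smult_def mult.commute)
  qed
  moreover have "v - smult a v \<in> Den Ocl"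
  proof -
    have eq: "(v - smult a v) i j = v i j * (1 - a)" for i j by (simp add: smult_def algebra_simps)
    have "v i j * (1 - a) \<in> cond" for i j
    proof (cases "i < n \<and> j < s i")
      case True
      then show ?thesis using submodD(3)[OF cond_submod vO a(2)] by blast
    next
      case False
      then have "v i j = 0" using v unfolding Num_def block_sum_def by blast
      then show ?thesis using submodD(1)[OF cond_submod] by simp
    qed
    moreover have "smult (1 - a) v \<in> Num Ocl"
      using submodD(3)[OF Num_closed[OF Os] _ v] Ocl_rules(1,5) aO by blast
    moreover have "smult (1 - a) v = v - smult a v" by (auto simp: smult_def fun_eq_iff algebra_simps)
    ultimately show ?thesis unfolding Den_iff[OF Ocl_coprime] eq by simp
  qed
  ultimately show thesis using that by blast
qed

section \<open>The reference lattice\<close>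

definition single :: "nat \<Rightarrow> nat \<Rightarrow> 'k \<Rightarrow> 'k vec" where
  "single i j x = (\<lambda>i' j'. if i' = i \<and> j' = j then x else 0)"

lemma V_expand: "v \<in> V \<Longrightarrow> v = (\<Sum>i<n. \<Sum>j<s i. single i j (v i j))"
proof (intro ext)
  fix i' j' assume v: "v \<in> V"
  have app: "sum f A a = (\<Sum>x\<in>A. f x a)" for f :: "nat \<Rightarrow> 'x \<Rightarrow> 'y::comm_monoid_add" and A a
    by (induction A rule: infinite_finite_induct) auto
  have "(\<Sum>i<n. \<Sum>j<s i. single i j (v i j)) i' j' = (\<Sum>i<n. \<Sum>j<s i. single i j (v i j) i' j')"
    by (simp add: app)
  also have "\<dots> = (\<Sum>i<n. \<Sum>j<s i. if j = j' then (if i = i' then v i' j' else 0) else 0)"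
    by (intro sum.cong refl) (auto simp: single_def)
  also have "\<dots> = (\<Sum>i<n. if i = i' then (if j' < s i' then v i' j' else 0) else 0)"
    by (intro sum.cong refl) auto
  also have "\<dots> = (if i' < n \<and> j' < s i' then v i' j' else 0)" by simp
  also have "\<dots> = v i' j'" using v unfolding V_def block_sum_def by auto
  finally show "v i' j' = (\<Sum>i<n. \<Sum>j<s i. single i j (v i j)) i' j'" by simp
qed

lemma Num_Ocl_iff: "v \<in> Num Ocl \<longleftrightarrow> v \<in> V \<and> (\<forall>i j. v i j \<in> Ocl)"
proof -
  note Os = coprime_idealD(1)[OF Ocl_coprime]
  have "v i j \<in> Ocl" if v: "v \<in> Num Ocl" for i j
  proof (cases "i < n \<and> j < s i")
    case True
    then have "j < s i - 1 \<or> j = s i - 1" by linarith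
    then show ?thesis using v True Num_iff[OF Os] by blast
  next
    case False
    then have "v i j = 0" using v unfolding Num_def block_sum_def by blast
    then show ?thesis using Ocl_rules(2) by simp
  qed
  then show ?thesis using Num_iff[OF Os] by blast
qed

text \<open>This lattice plays the role of \<open>L0\<close> in \<open>full_lattice_iff\<close>. Its
  generators are those of \<open>Ocl\<close>, cut down to a component and placed in each of its
  coordinates.\<close>

lemma Num_Ocl_lattice: "full_lattice Z Q smult V (Num Ocl)"
  unfolding full_lattice_def
proof (intro conjI)
  note Os = coprime_idealD(1)[OF Ocl_coprime]
  show NV: "Num Ocl \<subseteq> V" using Num_iff[OF Os] by blast
  show sub: "submod Z smult (Num Ocl)" by (rule submod_mono[OF Z_sub_Ocl Num_closed[OF Os]])
  show "submod Q smult hull (Num Ocl) = V"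
  proof (rule Vm.hull_eqI[OF V_submod NV])
    fix v assume v: "v \<in> V"
    let ?S = "(\<lambda>(i,j). v i j) ` (SIGMA i:{..<n}. {..<s i})"
    have "\<exists>z\<in>Z - {0}. \<forall>m\<in>submod Z (*) hull ?S. z * m \<in> Ocl"
    proof (rule K.common_denominator[OF fin_gen_hull Ocl_submod_Z])
      show "finite ?S" by simp
      show "\<exists>z\<in>Z - {0}. z * m \<in> Ocl" for m by (rule denominator_Ocl)
    qed
    then obtain z where z: "z \<in> Z - {0}" "\<forall>m\<in>submod Z (*) hull ?S. z * m \<in> Ocl" by blast
    have z2: "z * v i j \<in> Ocl" if "i < n" "j < s i" for i j
    proof -
      have "v i j \<in> ?S" by (rule image_eqI[of _ _ "(i,j)"]) (use that in auto)
      from z(2)[rule_format, OF hull_inc[OF this]] show ?thesis .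
    qed
    have "z * v i j \<in> Ocl" for i j
      using z2[of i j] v Ocl_rules(2) unfolding V_def block_sum_def by (cases "i < n \<and> j < s i") auto
    then have "smult z v \<in> Num Ocl" using V_closed(2)[OF v] by (simp add: Num_Ocl_iff smult_def)
    then show "\<exists>z\<in>Z - {0}. smult z v \<in> Num Ocl" using z(1) by blast
  qed
  obtain B where B: "finite B" "Ocl = submod Z (*) hull B" using Ocl_fin_gen unfolding fin_gen_def by blast
  let ?B = "(\<lambda>((i,j),b). single i j (e i * b)) ` ((SIGMA i:{..<n}. {..<s i}) \<times> B)"
  let ?H = "submod Z smult hull ?B"
  note H = submodD[OF submod_hull[of Z smult ?B]]
  have BO: "B \<subseteq> Ocl" unfolding B(2) by (rule hull_subset)
  have singleV: "single i j (e i * x) \<in> V" if "i < n" "j < s i" for i j x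
    unfolding V_iff using that by (auto simp: comp_W_iff single_def fun_eq_iff e_idem mult.assoc[symmetric])
  have "?H \<subseteq> Num Ocl"
  proof (rule hull_minimal)
    show "submod Z smult (Num Ocl)" by (rule sub)
    have "single i j (e i * b) \<in> Num Ocl" if ij: "i < n" "j < s i" and b: "b \<in> B" for i j b
    proof -
      have "e i * b \<in> Ocl" using Ocl_rules(6) idempotent_Ocl[OF e_idem[OF ij(1)]] b BO by blast
      then show ?thesis unfolding Num_Ocl_iff using singleV[OF ij] Ocl_rules(2) by (simp add: single_def)
    qed
    then show "?B \<subseteq> Num Ocl" by auto
  qed
  moreover have "Num Ocl \<subseteq> ?H"
  proof
    fix v assume v: "v \<in> Num Ocl"
    have "single i j (e i * x) \<in> ?H" if ij: "i < n" "j < s i" and x: "x \<in> Ocl" for i j x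
    proof -
      have add: "single i j (e i * (x + y)) = single i j (e i * x) + single i j (e i * y)" for x y
        by (auto simp: single_def fun_eq_iff distrib_left)
      have scale: "single i j (e i * (r * x)) = smult r (single i j (e i * x))" for r x
        by (auto simp: single_def smult_def fun_eq_iff)
      have zero: "single i j (e i * 0) = 0" by (auto simp: single_def fun_eq_iff)
      have "submod Z (*) hull B \<subseteq> {x. single i j (e i * x) \<in> ?H}"
      proof (rule hull_minimal)
        show "B \<subseteq> {x. single i j (e i * x) \<in> ?H}"
        proof
          fix b assume "b \<in> B"
          then have "single i j (e i * b) \<in> ?B" using ij by (intro image_eqI[of _ _ "((i,j),b)"]) auto
          then show "b \<in> {x. single i j (e i * x) \<in> ?H}" using hull_inc[of _ ?B "submod Z smult"] by blast
        qed
        show "submod Z (*) {x. single i j (e i * x) \<in> ?H}"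
        proof (rule submodI)
          show "0 \<in> {x. single i j (e i * x) \<in> ?H}" unfolding mem_Collect_eq zero by (rule H(1))
          show "x + y \<in> {x. single i j (e i * x) \<in> ?H}"
            if "x \<in> {x. single i j (e i * x) \<in> ?H}" "y \<in> {x. single i j (e i * x) \<in> ?H}" for x y
            unfolding mem_Collect_eq add by (rule H(2)) (use that in blast)+
          show "r * x \<in> {x. single i j (e i * x) \<in> ?H}"
            if "r \<in> Z" "x \<in> {x. single i j (e i * x) \<in> ?H}" for r x
            unfolding mem_Collect_eq scale by (rule H(3)) (use that in blast)+
        qed
      qed
      then show ?thesis using x B(2) by blast
    qed
    note * = this
    have vV: "v \<in> V" and vO: "\<And>i j. v i j \<in> Ocl" using v Num_Ocl_iff by blast+
    have "single i j (v i j) \<in> ?H" if "i < n" "j < s i" for i j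
      using *[OF that vO[of i j]] unfolding V_fix[OF vV that(1)] .
    then have "(\<Sum>i<n. \<Sum>j<s i. single i j (v i j)) \<in> ?H"
      by (intro submod_sum[OF submod_hull]) auto
    then show "v \<in> ?H" by (subst V_expand[OF vV])
  qed
  ultimately have "Num Ocl = ?H" by blast
  moreover have "finite ?B" using B(1) by auto
  ultimately show "fin_gen Z smult (Num Ocl)" unfolding fin_gen_def by blast
qed

lemma lattices_iff: "M \<in> lattices \<longleftrightarrow> submod R smult M \<and> M \<subseteq> V \<and>
    (\<exists>z\<in>Z - {0}. \<forall>v\<in>Num Ocl. smult z v \<in> M) \<and> (\<exists>z\<in>Z - {0}. \<forall>v\<in>M. smult z v \<in> Num Ocl)"
  unfolding lattices_def mem_Collect_eq Vm.full_lattice_iff[OF Num_Ocl_lattice V_submod]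
  using submod_mono[OF Z_sub_R] by blast

lemma lattice_denominator: "M \<in> lattices \<Longrightarrow> v \<in> V \<Longrightarrow> \<exists>z\<in>Z - {0}. smult z v \<in> M"
  using Vm.denominators[of M v] unfolding lattices_def full_lattice_def by auto

end

section \<open>Isomorphisms of lattices\<close>

context order_setting
begin

lemma smult_rules: "smult a (smult b v) = smult (a * b) v" "smult 1 v = v" "smult a (v + w) = smult a v + smult a w"
  "smult a (v - w) = smult a v - smult a w"
  by (auto simp: smult_def fun_eq_iff algebra_simps)

lemma smult_cancel: "z \<in> Z - {0} \<Longrightarrow> smult z v = smult z w \<Longrightarrow> v = w"
  by (metis nonzero_Z_inverse smult_rules(1,2) mult.commute)

lemma lin_pair_V_sym: "lin_pair smult V \<theta> \<theta>' \<Longrightarrow> lin_pair smult V \<theta>' \<theta>"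
  by (rule lin_pair_sym) (auto intro: V_closed)

text \<open>A vector \<open>v\<close> goes to the value of \<open>\<phi>\<close> at a multiple
  \<open>smult z v\<close> in \<open>M\<close>, divided by \<open>z\<close>. Linearity over
  \<open>R\<close> extends to all of \<open>K\<close> because every scalar is carried into
  \<open>R\<close> by some nonzero element of \<open>Z\<close>.\<close>

lemma extend_linear:
  assumes M: "M \<in> lattices" and \<phi>: "\<And>x. x \<in> M \<Longrightarrow> \<phi> x \<in> V" "\<And>x y. x \<in> M \<Longrightarrow> y \<in> M \<Longrightarrow> \<phi> (x + y) = \<phi> x + \<phi> y"
    "\<And>r x. r \<in> R \<Longrightarrow> x \<in> M \<Longrightarrow> \<phi> (smult r x) = smult r (\<phi> x)"
  shows "\<exists>\<theta>. (\<forall>v\<in>V. \<theta> v \<in> V) \<and> (\<forall>v\<in>V. \<forall>w\<in>V. \<theta> (v + w) = \<theta> v + \<theta> w) \<and>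
    (\<forall>c. \<forall>v\<in>V. \<theta> (smult c v) = smult c (\<theta> v)) \<and> (\<forall>v\<in>M. \<theta> v = \<phi> v)"
proof -
  have MR: "submod R smult M" and MV: "M \<subseteq> V" using M lattices_iff by blast+
  note MS = submodD[OF MR]
  have "\<forall>v\<in>V. \<exists>w. \<exists>z\<in>Z - {0}. smult z v \<in> M \<and> w \<in> V \<and> smult z w = \<phi> (smult z v)"
  proof
    fix v assume v: "v \<in> V"
    obtain z where z: "z \<in> Z - {0}" "smult z v \<in> M" using lattice_denominator[OF M v] by blast
    obtain y where y: "z * y = 1" using nonzero_Z_inverse[OF z(1)] .
    have "smult y (\<phi> (smult z v)) \<in> V" using V_closed(2) \<phi>(1)[OF z(2)] by blast
    moreover have "smult z (smult y (\<phi> (smult z v))) = \<phi> (smult z v)" by (simp add: smult_rules y)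
    ultimately show "\<exists>w. \<exists>z\<in>Z - {0}. smult z v \<in> M \<and> w \<in> V \<and> smult z w = \<phi> (smult z v)" using z by blast
  qed
  from bchoice[OF this] obtain \<theta> where \<theta>:
    "\<forall>v\<in>V. \<exists>z\<in>Z - {0}. smult z v \<in> M \<and> \<theta> v \<in> V \<and> smult z (\<theta> v) = \<phi> (smult z v)" ..
  \<comment> \<open>Independence of the denominator: the values for \<open>z\<close> and
    \<open>y\<close> are compared after multiplying by both.\<close>
  have key: "smult z (\<theta> v) = \<phi> (smult z v)" if v: "v \<in> V" and z: "z \<in> Z - {0}" "smult z v \<in> M" for v z
  proof -
    obtain y where y: "y \<in> Z - {0}" "smult y v \<in> M" "smult y (\<theta> v) = \<phi> (smult y v)" using \<theta> v by blast
    have zR: "z \<in> R" "y \<in> R" using z y Z_sub_R by blast+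
    have "smult y (smult z (\<theta> v)) = smult z (smult y (\<theta> v))" by (simp add: smult_rules mult.commute)
    also have "\<dots> = \<phi> (smult z (smult y v))" unfolding y(3) by (rule \<phi>(3)[OF zR(1) y(2), symmetric])
    also have "smult z (smult y v) = smult y (smult z v)" by (simp add: smult_rules mult.commute)
    also have "\<phi> (smult y (smult z v)) = smult y (\<phi> (smult z v))" by (rule \<phi>(3)[OF zR(2) z(2)])
    finally show ?thesis by (rule smult_cancel[OF y(1)])
  qed
  have "\<theta> (v + w) = \<theta> v + \<theta> w" if vw: "v \<in> V" "w \<in> V" for v w
  proof -
    obtain a b where ab: "a \<in> Z - {0}" "smult a v \<in> M" "b \<in> Z - {0}" "smult b w \<in> M"
      using lattice_denominator[OF M] vw by meson
    have abR: "a \<in> R" "b \<in> R" using ab Z_sub_R by blast+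
    have 1: "smult (a * b) v \<in> M" "smult (a * b) w \<in> M"
      using MS(3)[OF abR(2) ab(2)] MS(3)[OF abR(1) ab(4)] by (simp_all add: smult_rules mult.commute)
    then have 2: "smult (a * b) (v + w) \<in> M" using MS(2) by (simp add: smult_rules)
    note nz = nonzero_mult[OF ab(1,3)]
    have "smult (a * b) (\<theta> (v + w)) = \<phi> (smult (a * b) v + smult (a * b) w)"
      using key[OF V_closed(1)[OF vw] nz 2] by (simp add: smult_rules)
    also have "\<dots> = smult (a * b) (\<theta> v + \<theta> w)"
      unfolding \<phi>(2)[OF 1] key[OF vw(1) nz 1(1), symmetric] key[OF vw(2) nz 1(2), symmetric] by (simp add: smult_rules)
    finally show ?thesis by (rule smult_cancel[OF nz])
  qed
  moreover have "\<theta> (smult c v) = smult c (\<theta> v)" if v: "v \<in> V" for c v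
  proof -
    obtain a where a: "a \<in> Z - {0}" "smult a v \<in> M" using lattice_denominator[OF M v] by blast
    obtain b where b: "b \<in> Z - {0}" "b * c \<in> R" using denominator_R by blast
    have e: "smult (a * b) (smult c v) = smult (b * c) (smult a v)" by (simp add: smult_rules ac_simps)
    then have m: "smult (a * b) (smult c v) \<in> M" using MS(3)[OF b(2) a(2)] by simp
    note nz = nonzero_mult[OF a(1) b(1)]
    have "smult (a * b) (\<theta> (smult c v)) = \<phi> (smult (b * c) (smult a v))"
      using key[OF V_closed(2)[OF v] nz m] e by simp
    also have "\<dots> = smult (b * c) (smult a (\<theta> v))" unfolding \<phi>(3)[OF b(2) a(2)] key[OF v a] ..
    also have "\<dots> = smult (a * b) (smult c (\<theta> v))" by (simp add: smult_rules ac_simps)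
    finally show ?thesis by (rule smult_cancel[OF nz])
  qed
  moreover have "\<theta> v = \<phi> v" if "v \<in> M" for v
    using key[OF _ one_nonzero, of v] that MV by (auto simp: smult_rules)
  ultimately show ?thesis using \<theta> by blast
qed

text \<open>Both the isomorphism and its inverse are extended; the extensions are inverse to each
  other on the lattices, hence on \<open>V\<close> after clearing denominators.\<close>

lemma R_iso_extends:
  assumes M: "M \<in> lattices" and N: "N \<in> lattices" and iso: "R_iso M N"
  obtains \<theta> \<theta>' where "lin_pair smult V \<theta> \<theta>'" "\<theta> ` M = N"
proof -
  obtain \<phi> where \<phi>: "bij_betw \<phi> M N" "\<And>x y. x \<in> M \<Longrightarrow> y \<in> M \<Longrightarrow> \<phi> (x + y) = \<phi> x + \<phi> y"
    "\<And>r x. r \<in> R \<Longrightarrow> x \<in> M \<Longrightarrow> \<phi> (smult r x) = smult r (\<phi> x)"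
    using iso unfolding R_iso_def mod_iso_def by blast
  have MR: "submod R smult M" and MV: "M \<subseteq> V" and NR: "submod R smult N" and NV: "N \<subseteq> V"
    using M N lattices_iff by blast+
  let ?\<psi> = "inv_into M \<phi>"
  have im: "\<phi> ` M = N" and inj: "inj_on \<phi> M" using \<phi>(1) by (auto simp: bij_betw_def)
  have \<psi>: "?\<psi> y \<in> M" "\<phi> (?\<psi> y) = y" if "y \<in> N" for y using that im by (auto simp: inv_into_into f_inv_into_f)
  have \<psi>\<phi>: "?\<psi> (\<phi> x) = x" if "x \<in> M" for x using inv_into_f_f[OF inj that] .
  obtain \<theta> where \<theta>: "\<forall>v\<in>V. \<theta> v \<in> V" "\<forall>v\<in>V. \<forall>w\<in>V. \<theta> (v + w) = \<theta> v + \<theta> w"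
    "\<forall>c. \<forall>v\<in>V. \<theta> (smult c v) = smult c (\<theta> v)" "\<forall>v\<in>M. \<theta> v = \<phi> v"
    using extend_linear[OF M, of \<phi>] \<phi>(2,3) im NV by blast
  have 1: "?\<psi> (x + y) = ?\<psi> x + ?\<psi> y" if xy: "x \<in> N" "y \<in> N" for x y
  proof -
    have "\<phi> (?\<psi> x + ?\<psi> y) = x + y" using \<phi>(2)[OF \<psi>(1)[OF xy(1)] \<psi>(1)[OF xy(2)]] \<psi>(2) xy by simp
    moreover have "?\<psi> x + ?\<psi> y \<in> M" using submodD(2)[OF MR] \<psi>(1) xy by blast
    ultimately show ?thesis using \<psi>\<phi> by metis
  qed
  have 2: "?\<psi> (smult r x) = smult r (?\<psi> x)" if rx: "r \<in> R" "x \<in> N" for r x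
  proof -
    have "\<phi> (smult r (?\<psi> x)) = smult r x" using \<phi>(3)[OF rx(1) \<psi>(1)[OF rx(2)]] \<psi>(2)[OF rx(2)] by simp
    moreover have "smult r (?\<psi> x) \<in> M" using submodD(3)[OF MR rx(1)] \<psi>(1) rx by blast
    ultimately show ?thesis using \<psi>\<phi> by metis
  qed
  obtain \<theta>' where \<theta>': "\<forall>v\<in>V. \<theta>' v \<in> V" "\<forall>v\<in>V. \<forall>w\<in>V. \<theta>' (v + w) = \<theta>' v + \<theta>' w"
    "\<forall>c. \<forall>v\<in>V. \<theta>' (smult c v) = smult c (\<theta>' v)" "\<forall>v\<in>N. \<theta>' v = ?\<psi> v"
    using extend_linear[OF N, of ?\<psi>] \<psi>(1) MV 1 2 by blast
  have "\<theta>' (\<theta> v) = v" if v: "v \<in> V" for v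
  proof -
    obtain z where z: "z \<in> Z - {0}" "smult z v \<in> M" using lattice_denominator[OF M v] by blast
    have "smult z (\<theta>' (\<theta> v)) = \<theta>' (\<theta> (smult z v))" using \<theta> \<theta>' v by simp
    also have "\<dots> = smult z v" using \<theta>(4) \<theta>'(4) z(2) im \<psi>\<phi> by (metis imageI)
    finally show ?thesis by (rule smult_cancel[OF z(1)])
  qed
  moreover have "\<theta> (\<theta>' v) = v" if v: "v \<in> V" for v
  proof -
    obtain z where z: "z \<in> Z - {0}" "smult z v \<in> N" using lattice_denominator[OF N v] by blast
    have "smult z (\<theta> (\<theta>' v)) = \<theta> (\<theta>' (smult z v))" using \<theta> \<theta>' v by simp
    also have "\<dots> = smult z v" using \<theta>(4) \<theta>'(4) z(2) \<psi> by metis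
    finally show ?thesis by (rule smult_cancel[OF z(1)])
  qed
  ultimately have "lin_pair smult V \<theta> \<theta>'" unfolding lin_pair_def using \<theta> \<theta>' by blast
  moreover have "\<theta> ` M = N" using \<theta>(4) im by (metis image_cong)
  ultimately show thesis using that by blast
qed

lemma lin_pair_R_iso:
  assumes \<theta>: "lin_pair smult V \<theta> \<theta>'" and M: "M \<subseteq> V" "\<theta> ` M = N"
  shows "R_iso M N"
proof -
  note D = lin_pairD[OF \<theta>]
  have "inj_on \<theta> M" by (rule inj_on_inverseI[of _ \<theta>']) (use D(3) M(1) in blast)
  then have "bij_betw \<theta> M N" using M(2) by (simp add: bij_betw_def)
  then show ?thesis unfolding R_iso_def mod_iso_def using D(5,6) M(1) by blast
qed

lemma R_iso_sym:
  assumes "M \<in> lattices" "N \<in> lattices" "R_iso M N"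
  shows "R_iso N M"
proof -
  obtain \<theta> \<theta>' where \<theta>: "lin_pair smult V \<theta> \<theta>'" "\<theta> ` M = N" using R_iso_extends[OF assms] .
  have MV: "M \<subseteq> V" "N \<subseteq> V" using assms lattices_iff by blast+
  have "\<theta>' (\<theta> v) = v" if "v \<in> M" for v using lin_pairD(3)[OF \<theta>(1)] MV(1) that by blast
  then have "\<theta>' ` N = M" unfolding \<theta>(2)[symmetric] image_image by simp
  then show ?thesis using lin_pair_R_iso[OF lin_pair_V_sym[OF \<theta>(1)] MV(2)] by blast
qed

lemma R_iso_trans:
  assumes "R_iso L M" "R_iso M N"
  shows "R_iso L N"
proof -
  obtain \<phi> where \<phi>: "bij_betw \<phi> L M" "\<And>x y. x \<in> L \<Longrightarrow> y \<in> L \<Longrightarrow> \<phi> (x + y) = \<phi> x + \<phi> y"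
    "\<And>r x. r \<in> R \<Longrightarrow> x \<in> L \<Longrightarrow> \<phi> (smult r x) = smult r (\<phi> x)"
    using assms(1) unfolding R_iso_def mod_iso_def by blast
  obtain \<psi> where \<psi>: "bij_betw \<psi> M N" "\<And>x y. x \<in> M \<Longrightarrow> y \<in> M \<Longrightarrow> \<psi> (x + y) = \<psi> x + \<psi> y"
    "\<And>r x. r \<in> R \<Longrightarrow> x \<in> M \<Longrightarrow> \<psi> (smult r x) = smult r (\<psi> x)"
    using assms(2) unfolding R_iso_def mod_iso_def by blast
  have mem: "\<phi> x \<in> M" if "x \<in> L" for x using \<phi>(1) that by (auto simp: bij_betw_def)
  have "bij_betw (\<psi> \<circ> \<phi>) L N" by (rule bij_betw_trans[OF \<phi>(1) \<psi>(1)])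
  moreover have "\<forall>x\<in>L. \<forall>y\<in>L. (\<psi> \<circ> \<phi>) (x + y) = (\<psi> \<circ> \<phi>) x + (\<psi> \<circ> \<phi>) y" using \<phi>(2) \<psi>(2) mem by simp
  moreover have "\<forall>r\<in>R. \<forall>x\<in>L. (\<psi> \<circ> \<phi>) (smult r x) = smult r ((\<psi> \<circ> \<phi>) x)" using \<phi>(3) \<psi>(3) mem by simp
  ultimately show ?thesis unfolding R_iso_def mod_iso_def by blast
qed

section \<open>Components of vectors and of linear maps\<close>

definition emb :: "nat \<Rightarrow> (nat \<Rightarrow> 'k) \<Rightarrow> 'k vec" where
  "emb i f = (\<lambda>i'. if i' = i then f else 0)"

lemma emb_at [simp]: "emb i f i = f"
  by (simp add: emb_def)

lemma emb_linear: "emb i (f + g) = emb i f + emb i g" "emb i (scf c f) = smult c (emb i f)"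
  by (auto simp: emb_def fun_eq_iff scf_def smult_def)

lemma zero_comp_W: "i < n \<Longrightarrow> (\<lambda>_. 0) \<in> comp_W i"
  by (simp add: comp_W_iff)

lemma emb_V: "i < n \<Longrightarrow> f \<in> comp_W i \<Longrightarrow> emb i f \<in> V"
  unfolding V_iff emb_def using comp_W_iff by (auto simp: zero_fun_def)

text \<open>Projection to a component is itself a scalar multiplication, so every map commuting with
  scalars respects the decomposition of \<open>V\<close>.\<close>

lemma smult_e:
  assumes v: "v \<in> V" and i: "i < n"
  shows "smult (e i) v = emb i (v i)"
proof (intro ext)
  fix k j
  show "smult (e i) v k j = emb i (v i) k j"
  proof (cases "k = i")
    case True
    then show ?thesis using V_fix[OF v i] by (simp add: smult_def)
  next
    case False
    have "e i * v k j = 0"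
    proof (cases "k < n")
      case True
      have "e i * v k j = e i * (e k * v k j)" using V_fix[OF v True] by simp
      then show ?thesis using e_orth[OF i True] False by (simp add: mult.assoc[symmetric])
    next
      case False
      then show ?thesis using v unfolding V_iff by simp
    qed
    then show ?thesis using False by (simp add: smult_def emb_def)
  qed
qed

definition comp_map :: "('k vec \<Rightarrow> 'k vec) \<Rightarrow> nat \<Rightarrow> (nat \<Rightarrow> 'k) \<Rightarrow> nat \<Rightarrow> 'k" where
  "comp_map \<theta> i f = \<theta> (emb i f) i"

definition asm_map :: "(nat \<Rightarrow> (nat \<Rightarrow> 'k) \<Rightarrow> nat \<Rightarrow> 'k) \<Rightarrow> 'k vec \<Rightarrow> 'k vec" where
  "asm_map T v = (\<lambda>i. if i < n then T i (v i) else 0)"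

lemma comp_map_emb:
  assumes \<theta>: "lin_pair smult V \<theta> \<theta>'" and i: "i < n" and f: "f \<in> comp_W i"
  shows "\<theta> (emb i f) = emb i (comp_map \<theta> i f)"
proof -
  note V = emb_V[OF i f]
  have "\<theta> (emb i f) = \<theta> (smult (e i) (emb i f))" using smult_e[OF V i] by simp
  also have "\<dots> = smult (e i) (\<theta> (emb i f))" by (rule lin_pairD(6)[OF \<theta> V])
  also have "\<dots> = emb i (\<theta> (emb i f) i)" by (rule smult_e[OF lin_pairD(1)[OF \<theta> V] i])
  finally show ?thesis by (simp add: comp_map_def)
qed

lemma comp_map_apply:
  assumes \<theta>: "lin_pair smult V \<theta> \<theta>'" and i: "i < n" and v: "v \<in> V"
  shows "\<theta> v i = comp_map \<theta> i (v i)"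
proof -
  have "emb i (\<theta> v i) = smult (e i) (\<theta> v)" by (rule smult_e[OF lin_pairD(1)[OF \<theta> v] i, symmetric])
  also have "\<dots> = \<theta> (emb i (v i))" using lin_pairD(6)[OF \<theta> v, of "e i"] smult_e[OF v i] by simp
  finally have "emb i (\<theta> v i) i = \<theta> (emb i (v i)) i" by simp
  then show ?thesis by (simp add: comp_map_def)
qed

lemma comp_lin_pair:
  assumes \<theta>: "lin_pair smult V \<theta> \<theta>'" and i: "i < n"
  shows "lin_pair scf (comp_W i) (comp_map \<theta> i) (comp_map \<theta>' i)"
proof -
  have mem: "comp_map \<theta> i f \<in> comp_W i" if "f \<in> comp_W i" "lin_pair smult V \<theta> \<theta>'" for f \<theta> \<theta>'
    using lin_pairD(1)[OF that(2) emb_V[OF i that(1)]] i unfolding comp_map_def V_iff by blast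
  have inv: "comp_map \<theta>' i (comp_map \<theta> i f) = f" if f: "f \<in> comp_W i" and \<theta>: "lin_pair smult V \<theta> \<theta>'" for f \<theta> \<theta>'
    using lin_pairD(3)[OF \<theta> emb_V[OF i f]] comp_map_emb[OF \<theta> i f] by (simp add: comp_map_def[of \<theta>'])
  note \<theta>' = lin_pair_V_sym[OF \<theta>]
  show ?thesis unfolding lin_pair_def
  proof (intro conjI ballI allI)
    fix f assume f: "f \<in> comp_W i"
    show "comp_map \<theta> i f \<in> comp_W i" "comp_map \<theta>' i f \<in> comp_W i"
      "comp_map \<theta>' i (comp_map \<theta> i f) = f" "comp_map \<theta> i (comp_map \<theta>' i f) = f"
      using mem inv f \<theta> \<theta>' by blast+
    show "comp_map \<theta> i (scf c f) = scf c (comp_map \<theta> i f)" for c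
      unfolding comp_map_def emb_linear lin_pairD(6)[OF \<theta> emb_V[OF i f]] by (simp add: scf_def smult_def)
    show "comp_map \<theta> i (f + g) = comp_map \<theta> i f + comp_map \<theta> i g" if g: "g \<in> comp_W i" for g
      unfolding comp_map_def emb_linear lin_pairD(5)[OF \<theta> emb_V[OF i f] emb_V[OF i g]] by simp
  qed
qed

lemma asm_lin_pair:
  assumes T: "\<And>i. i < n \<Longrightarrow> lin_pair scf (comp_W i) (T i) (T' i)"
  shows "lin_pair smult V (asm_map T) (asm_map T')"
proof -
  have comp: "v i \<in> comp_W i" if "v \<in> V" "i < n" for v i using that V_iff by blast
  have zero: "v i = 0" if "v \<in> V" "\<not> i < n" for v i using that unfolding V_iff by simp
  show ?thesis unfolding lin_pair_def
  proof (intro conjI ballI allI)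
    fix v assume v: "v \<in> V"
    show "asm_map T v \<in> V" "asm_map T' v \<in> V"
      unfolding V_iff asm_map_def using lin_pairD(1,2)[OF T] comp[OF v] by simp_all
    show "asm_map T' (asm_map T v) = v" "asm_map T (asm_map T' v) = v"
      unfolding asm_map_def using lin_pairD(3,4)[OF T] comp[OF v] zero[OF v] by (auto simp: fun_eq_iff)
    show "asm_map T (smult c v) = smult c (asm_map T v)" for c
    proof
      fix i
      show "asm_map T (smult c v) i = smult c (asm_map T v) i"
      proof (cases "i < n")
        case True
        have "smult c v i = scf c (v i)" by (simp add: smult_def scf_def)
        then show ?thesis using True lin_pairD(6)[OF T[OF True] comp[OF v True], of c]
          by (simp add: asm_map_def smult_def scf_def)
      next
        case False
        then show ?thesis by (auto simp: asm_map_def smult_def)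
      qed
    qed
    show "asm_map T (v + w) = asm_map T v + asm_map T w" if w: "w \<in> V" for w
    proof
      fix i
      show "asm_map T (v + w) i = (asm_map T v + asm_map T w) i"
        using lin_pairD(5)[OF T comp[OF v] comp[OF w]] by (auto simp: asm_map_def plus_fun_def)
    qed
  qed
qed

text \<open>Linear isomorphisms of lattices carry this module over the maximal order along, which
  makes its Steinitz classes invariants of \<open>M\<close>.\<close>

definition ohull :: "'k vec set \<Rightarrow> 'k vec set" where
  "ohull M = submod Ocl smult hull M"

lemma lin_pair_hull:
  assumes \<theta>: "lin_pair smult V \<theta> \<theta>'" and M: "M \<subseteq> V" "\<theta> ` M \<subseteq> N" and N: "submod Ocl smult N"
  shows "\<theta> ` ohull M \<subseteq> N" "ohull M \<subseteq> V"
proof -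
  have zero: "\<theta> 0 = 0" using lin_pairD(6)[OF \<theta> V_closed(3), of 0] by (simp add: smult_def zero_fun_def)
  have "ohull M \<subseteq> {v \<in> V. \<theta> v \<in> N}" unfolding ohull_def
  proof (rule hull_minimal)
    show "M \<subseteq> {v \<in> V. \<theta> v \<in> N}" using M by blast
    show "submod Ocl smult {v \<in> V. \<theta> v \<in> N}"
      by (rule submodI) (use V_closed submodD[OF N] lin_pairD(5,6)[OF \<theta>] zero in auto)
  qed
  then show "\<theta> ` ohull M \<subseteq> N" "ohull M \<subseteq> V" by blast+
qed

lemma iso_Num:
  assumes M: "M \<in> lattices" "ohull M = Num J1" and N: "N \<in> lattices" "ohull N = Num J2"
    and J: "submod Ocl (*) J1" "submod Ocl (*) J2" and iso: "R_iso M N"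
  obtains \<theta> \<theta>' where "lin_pair smult V \<theta> \<theta>'" "\<theta> ` M = N" "\<theta>' ` N = M" "\<theta> ` Num J1 \<subseteq> Num J2" "\<theta>' ` Num J2 \<subseteq> Num J1"
proof -
  obtain \<theta> \<theta>' where \<theta>: "lin_pair smult V \<theta> \<theta>'" "\<theta> ` M = N" using R_iso_extends[OF M(1) N(1) iso] .
  have MV: "M \<subseteq> V" "N \<subseteq> V" using M(1) N(1) lattices_iff by blast+
  have "\<theta>' (\<theta> v) = v" if "v \<in> M" for v using lin_pairD(3)[OF \<theta>(1)] MV(1) that by blast
  then have im: "\<theta>' ` N = M" unfolding \<theta>(2)[symmetric] image_image by simp
  have MM: "M \<subseteq> Num J1" "N \<subseteq> Num J2" using M(2) N(2) hull_subset[of M "submod Ocl smult"] hull_subset[of N "submod Ocl smult"]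
    unfolding ohull_def by simp_all
  have "\<theta> ` Num J1 \<subseteq> Num J2" unfolding M(2)[symmetric]
    by (rule lin_pair_hull(1)[OF \<theta>(1) MV(1) _ Num_closed[OF J(2)]]) (use \<theta>(2) MM in simp)
  moreover have "\<theta>' ` Num J2 \<subseteq> Num J1" unfolding N(2)[symmetric]
    by (rule lin_pair_hull(1)[OF lin_pair_V_sym[OF \<theta>(1)] MV(2) _ Num_closed[OF J(1)]]) (use im MM in simp)
  ultimately show thesis using that \<theta> im by blast
qed

lemma comp_block_Num:
  assumes J: "submod Ocl (*) J" and i: "i < n" and f: "f \<in> comp_block i (proj (e i) J)"
  shows "emb i f \<in> Num J"
  unfolding Num_iff_block[OF J]
proof (intro conjI allI impI)
  fix k assume k: "k < n"
  show "emb i f k \<in> comp_block k (proj (e k) J)"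
  proof (cases "k = i")
    case False
    have "0 \<in> proj (e k) J" using proj_mem_iff[OF k J] submodD(1)[OF J] by simp
    then show ?thesis using False k zero_comp_W[OF k] Ocl_rules(2) by (simp add: emb_def comp_block_iff zero_fun_def)
  qed (use f in simp)
qed (use i in \<open>auto simp: emb_def\<close>)

lemma comp_map_block:
  assumes \<theta>: "lin_pair smult V \<theta> \<theta>'" and J: "submod Ocl (*) J1" "submod Ocl (*) J2" and sub: "\<theta> ` Num J1 \<subseteq> Num J2"
    and i: "i < n" and f: "f \<in> comp_block i (proj (e i) J1)"
  shows "comp_map \<theta> i f \<in> comp_block i (proj (e i) J2)"
proof -
  have "\<theta> (emb i f) \<in> Num J2" using comp_block_Num[OF J(1) i f] sub by blast
  then show ?thesis unfolding Num_iff_block[OF J(2)] comp_map_def using i by blast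
qed

lemma iso_Num_ideal_class:
  assumes \<theta>: "lin_pair smult V \<theta> \<theta>'" and J: "fractional_ideal Z Q 1 Ocl J1" "fractional_ideal Z Q 1 Ocl J2"
    and sub: "\<theta> ` Num J1 \<subseteq> Num J2" "\<theta>' ` Num J2 \<subseteq> Num J1" and i: "i < n"
  shows "\<exists>c c'. e i * c = c \<and> e i * c' = c' \<and> c * c' = e i \<and> proj (e i) J2 = (*) c ` proj (e i) J1"
proof -
  interpret I: idempotent_setting Z Q n e s R "e i" by (rule component_setting[OF i])
  have Js: "submod Ocl (*) J1" "submod Ocl (*) J2" using J frac_1_iff by blast+
  show ?thesis
    by (rule I.steinitz_unique[OF comp_lin_pair[OF \<theta> i] s_pos[OF i] proj_frac[OF i J(1)] proj_frac[OF i J(2)]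
      comp_map_block[OF \<theta> Js sub(1) i] comp_map_block[OF lin_pair_V_sym[OF \<theta>] Js(2,1) sub(2) i]]) blast+
qed

section \<open>Lattices between the denominator and the numerator\<close>

text \<open>These are the preimages of the submodules listed by the algorithm, namely those that
  generate the whole quotient over the maximal order; the correspondence is given by
  \<open>mid_of_quot\<close> and \<open>quot_of_mid\<close>.\<close>

definition mid :: "'k vec set \<Rightarrow> bool" where
  "mid M \<longleftrightarrow> submod R smult M \<and> Den Ocl \<subseteq> M \<and> M \<subseteq> Num Ocl \<and> ohull M = Num Ocl"

lemma V_diff: "submod R smult M \<Longrightarrow> v \<in> M \<Longrightarrow> w \<in> M \<Longrightarrow> v - w \<in> M"
  using Vm.submod_diff submod_mono[OF Z_sub_R] by blast

lemma Den_Ocl_iff: "v \<in> Den Ocl \<longleftrightarrow> v \<in> V \<and> (\<forall>i j. v i j \<in> cond)"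
  unfolding Den_iff[OF Ocl_coprime] Num_Ocl_iff using cond_sub_R R_sub_Ocl by blast

lemma mid_lattice:
  assumes M: "submod R smult M" "Den Ocl \<subseteq> M" and J: "coprime_ideal J"
  shows "M \<inter> Num J \<in> lattices"
  unfolding lattices_iff
proof (intro conjI)
  note Js = coprime_idealD(1)[OF J]
  show "submod R smult (M \<inter> Num J)" by (rule submod_Int[OF M(1) submod_mono[OF R_sub_Ocl Num_closed[OF Js]]])
  show "M \<inter> Num J \<subseteq> V" using Num_iff[OF Js] by blast
  obtain z where z: "z \<in> Z - {0}" "z \<in> cond" using cond_frac frac_1_iff by blast
  obtain y where y: "y \<in> Z - {0}" "y \<in> J" using coprime_idealD(3)[OF J] frac_1_iff by blast
  \<comment> \<open>The factor \<open>z\<close> in the conductor puts the multiple into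
    \<open>Den Ocl\<close>, the factor \<open>y\<close> in \<open>J\<close> puts it into
    \<open>Num J\<close>.\<close>
  have "smult (y * z) v \<in> M \<inter> Num J" if v: "v \<in> Num Ocl" for v
  proof -
    have vV: "v \<in> V" and vO: "\<And>i j. v i j \<in> Ocl" using v Num_Ocl_iff by blast+
    have yO: "y \<in> Ocl" "z \<in> Ocl" using y z Z_sub_Ocl by blast+
    have "(v i j * y) * z \<in> cond" for i j using submodD(3)[OF cond_submod Ocl_rules(6)[OF vO yO(1)] z(2)] .
    moreover have "(v i j * z) * y \<in> J" for i j using submodD(3)[OF Js Ocl_rules(6)[OF vO yO(2)] y(2)] .
    ultimately have ent: "y * z * v i j \<in> cond" "y * z * v i j \<in> J" for i j
      by (metis mult.commute mult.left_commute)+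
    have "smult (y * z) v \<in> Den Ocl" unfolding Den_Ocl_iff using ent(1) V_closed(2)[OF vV] by (simp add: smult_def)
    moreover have "smult (y * z) v \<in> Num J" unfolding Num_iff[OF Js]
      using ent(2) coprime_idealD(2)[OF J] V_closed(2)[OF vV] by (auto simp: smult_def)
    ultimately show ?thesis using M(2) by blast
  qed
  then show "\<exists>z\<in>Z - {0}. \<forall>v\<in>Num Ocl. smult z v \<in> M \<inter> Num J" using nonzero_mult[OF y(1) z(1)] by blast
  show "\<exists>z\<in>Z - {0}. \<forall>v\<in>M \<inter> Num J. smult z v \<in> Num Ocl"
    by (rule bexI[of _ 1]) (use one_nonzero Den_Int_Num(2)[OF J] in \<open>auto simp: smult_rules\<close>)
qed

text \<open>By \<open>Num_approx\<close> the modules \<open>M\<close> and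
  \<open>M \<inter> Num J\<close> agree modulo \<open>Den Ocl\<close>. So the hull of the latter
  reaches any vector of \<open>Num J\<close> up to an error in
  \<open>Den Ocl \<inter> Num J\<close>, which lies in \<open>M \<inter> Num J\<close>
  anyway.\<close>

lemma mid_hull:
  assumes M: "mid M" and J: "coprime_ideal J"
  shows "ohull (M \<inter> Num J) = Num J"
proof
  note Js = coprime_idealD(1)[OF J]
  have MR: "submod R smult M" and DM: "Den Ocl \<subseteq> M" and MN: "M \<subseteq> Num Ocl" and MO: "ohull M = Num Ocl"
    using M by (auto simp: mid_def)
  show "ohull (M \<inter> Num J) \<subseteq> Num J" unfolding ohull_def
    by (rule hull_minimal) (use Num_closed[OF Js] in auto)
  let ?H = "ohull (M \<inter> Num J)"
  have Hs: "submod Ocl smult ?H" unfolding ohull_def by (rule submod_hull)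
  have "ohull M \<subseteq> ?H + Den Ocl" unfolding ohull_def[of M]
  proof (rule hull_minimal)
    show "submod Ocl smult (?H + Den Ocl)"
    proof (rule subring_module.submod_plus[OF _ Hs Den_submod[OF Ocl_coprime]])
      show "subring_module (smult :: 'k \<Rightarrow> 'k vec \<Rightarrow> 'k vec) Ocl"
        by (intro subring_module.intro Vm.module_sc Ocl_subring)
    qed
    show "M \<subseteq> ?H + Den Ocl"
    proof
      fix v assume v: "v \<in> M"
      obtain w where w: "w \<in> Num J" "v - w \<in> Den Ocl" using Num_approx[OF J] v MN by blast
      have "v - (v - w) \<in> M" by (rule V_diff[OF MR v]) (use w DM in blast)
      then have "w \<in> M \<inter> Num J" using w by simp
      then have "w \<in> ?H" unfolding ohull_def by (rule hull_inc)
      then have "w + (v - w) \<in> ?H + Den Ocl" using w(2) by (rule set_plus_intro)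
      then show "v \<in> ?H + Den Ocl" by simp
    qed
  qed
  note sub = this
  show "Num J \<subseteq> ?H"
  proof
    fix v assume v: "v \<in> Num J"
    then have "v \<in> ?H + Den Ocl" using sub MO Den_Int_Num(2)[OF J] by blast
    then obtain h d where hd: "v = h + d" "h \<in> ?H" "d \<in> Den Ocl" by (elim set_plus_elim)
    have hN: "h \<in> Num J" using hd(2) \<open>?H \<subseteq> Num J\<close> by blast
    have "v - h \<in> Num J" by (rule V_diff[OF submod_mono[OF R_sub_Ocl Num_closed[OF Js]] v hN])
    then have "d \<in> Num J" using hd(1) by simp
    then have "d \<in> M \<inter> Num J" using hd(3) DM by blast
    then have "d \<in> ?H" unfolding ohull_def by (rule hull_inc)
    then show "v \<in> ?H" using submodD(2)[OF Hs hd(2)] hd(1) by simp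
  qed
qed

text \<open>The isomorphism comes from an automorphism \<open>\<theta>\<close> of
  \<open>Num J1\<close>. Transferred component by component, it becomes a map that preserves
  \<open>Num J2\<close> and \<open>Den Ocl\<close> and is congruent to \<open>\<theta>\<close> on
  \<open>Num J1\<close>. As \<open>M\<close> and \<open>N\<close> contain \<open>Den Ocl\<close>,
  only congruence classes matter, and the new map still takes \<open>M\<close> to
  \<open>N\<close>.\<close>

theorem mid_transfer:
  assumes J: "coprime_ideal J1" "coprime_ideal J2" and M: "mid M" and N: "mid N"
    and iso: "R_iso (M \<inter> Num J1) (N \<inter> Num J1)"
  shows "R_iso (M \<inter> Num J2) (N \<inter> Num J2)"
proof -
  note Js = coprime_idealD(1)[OF J(1)] coprime_idealD(1)[OF J(2)]
  have MR: "submod R smult M" "submod R smult N" and DM: "Den Ocl \<subseteq> M" "Den Ocl \<subseteq> N"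
    using M N by (auto simp: mid_def)
  obtain \<theta> \<theta>' where \<theta>: "lin_pair smult V \<theta> \<theta>'" "\<theta> ` (M \<inter> Num J1) = N \<inter> Num J1" "\<theta>' ` (N \<inter> Num J1) = M \<inter> Num J1"
    "\<theta> ` Num J1 \<subseteq> Num J1" "\<theta>' ` Num J1 \<subseteq> Num J1"
    using iso_Num[OF mid_lattice[OF MR(1) DM(1) J(1)] mid_hull[OF M J(1)]
      mid_lattice[OF MR(2) DM(2) J(1)] mid_hull[OF N J(1)] Js(1) Js(1) iso] .
  define good where "good i S S' \<longleftrightarrow> lin_pair scf (comp_W i) S S' \<and>
    (\<forall>f\<in>comp_block i (proj (e i) J2). S f \<in> comp_block i (proj (e i) J2) \<and> S' f \<in> comp_block i (proj (e i) J2)) \<and>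
    (\<forall>f\<in>comp_W i. (\<forall>j. f j \<in> proj (e i) cond) \<longrightarrow> (\<forall>j. S f j \<in> proj (e i) cond \<and> S' f j \<in> proj (e i) cond)) \<and>
    (\<forall>f\<in>comp_block i (proj (e i) J1). \<forall>j. S f j - comp_map \<theta> i f j \<in> proj (e i) cond)" for i S S'
  have ex: "\<exists>S S'. good i S S'" if i: "i < n" for i
  proof -
    interpret I: idempotent_setting Z Q n e s R "e i" by (rule component_setting[OF i])
    have sub: "proj (e i) J \<subseteq> Ocl" if "coprime_ideal J" for J
      using proj_mem_iff[OF i coprime_idealD(1)[OF that]] coprime_idealD(2)[OF that] by blast
    have cop: "\<exists>a\<in>proj (e i) J. e i - a \<in> proj (e i) cond" if J: "coprime_ideal J" for J
    proof -
      obtain a where a: "a \<in> J" "1 - a \<in> cond" using coprime_idealD(4)[OF J] by blast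
      have "e i - e i * a = e i * (1 - a)" by (simp add: algebra_simps)
      then have "e i - e i * a \<in> proj (e i) cond" using a(2) by (auto simp: proj_def)
      moreover have "e i * a \<in> proj (e i) J" using a(1) by (auto simp: proj_def)
      ultimately show ?thesis by blast
    qed
    obtain a1 where a1: "a1 \<in> proj (e i) J1" "e i - a1 \<in> proj (e i) cond" using cop[OF J(1)] by blast
    obtain a2 where a2: "a2 \<in> proj (e i) J2" "e i - a2 \<in> proj (e i) cond" using cop[OF J(2)] by blast
    show ?thesis unfolding good_def
      by (rule I.automorphism_transfer[OF proj_frac[OF i cond_frac] proj_cond_sub[OF i] s_pos[OF i]
        proj_frac[OF i coprime_idealD(3)[OF J(1)]] sub[OF J(1)] a1
        proj_frac[OF i coprime_idealD(3)[OF J(2)]] sub[OF J(2)] a2 comp_lin_pair[OF \<theta>(1) i]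
        comp_map_block[OF \<theta>(1) Js(1,1) \<theta>(4) i] comp_map_block[OF lin_pair_V_sym[OF \<theta>(1)] Js(1,1) \<theta>(5) i]])
  qed
  have "\<forall>i\<in>{..<n}. \<exists>p. good i (fst p) (snd p)"
  proof
    fix i assume "i \<in> {..<n}"
    then obtain S S' where "good i S S'" using ex[of i] by blast
    then show "\<exists>p. good i (fst p) (snd p)" by (intro exI[of _ "(S,S')"]) simp
  qed
  from bchoice[OF this] obtain p where p: "\<forall>i\<in>{..<n}. good i (fst (p i)) (snd (p i))" ..
  define S where "S i = fst (p i)" for i
  define S' where "S' i = snd (p i)" for i
  have good: "good i (S i) (S' i)" if "i < n" for i using p that by (simp add: S_def S'_def)
  have good1: "lin_pair scf (comp_W i) (S i) (S' i)"
    and good2: "\<And>f. f \<in> comp_block i (proj (e i) J2) \<Longrightarrow> S i f \<in> comp_block i (proj (e i) J2) \<and> S' i f \<in> comp_block i (proj (e i) J2)"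
    and good3: "\<And>f j. f \<in> comp_W i \<Longrightarrow> (\<forall>j. f j \<in> proj (e i) cond) \<Longrightarrow> S i f j \<in> proj (e i) cond \<and> S' i f j \<in> proj (e i) cond"
    and good4: "\<And>f j. f \<in> comp_block i (proj (e i) J1) \<Longrightarrow> S i f j - comp_map \<theta> i f j \<in> proj (e i) cond"
    if "i < n" for i using good[OF that] unfolding good_def by blast+
  let ?\<sigma> = "asm_map S" and ?\<sigma>' = "asm_map S'"
  have \<sigma>: "lin_pair smult V ?\<sigma> ?\<sigma>'" by (rule asm_lin_pair) (rule good1)
  note \<sigma>' = lin_pair_V_sym[OF \<sigma>]
  have at: "?\<sigma> v i = S i (v i)" "?\<sigma>' v i = S' i (v i)" if "i < n" for v i using that by (auto simp: asm_map_def)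
  have N2: "?\<sigma> v \<in> Num J2" "?\<sigma>' v \<in> Num J2" if v: "v \<in> Num J2" for v
    using v good2 unfolding Num_iff_block[OF Js(2)] by (simp_all add: asm_map_def)
  have D: "?\<sigma> v \<in> Den Ocl \<and> ?\<sigma>' v \<in> Den Ocl" if v: "v \<in> Den Ocl" for v
  proof -
    have vV: "v \<in> V" and vc: "\<And>i j. v i j \<in> cond" using v Den_Ocl_iff by blast+
    have "S i (v i) j \<in> cond \<and> S' i (v i) j \<in> cond" if i: "i < n" for i j
    proof -
      have "\<forall>j. v i j \<in> proj (e i) cond" using proj_mem_iff[OF i cond_submod] vc V_fix[OF vV i] by blast
      moreover have "v i \<in> comp_W i" using vV i V_iff by blast
      ultimately have "S i (v i) j \<in> proj (e i) cond \<and> S' i (v i) j \<in> proj (e i) cond" using good3[OF i] by blast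
      then show ?thesis using proj_mem_iff[OF i cond_submod] by blast
    qed
    then have "?\<sigma> v i j \<in> cond \<and> ?\<sigma>' v i j \<in> cond" for i j
      using submodD(1)[OF cond_submod] by (simp add: asm_map_def)
    then show ?thesis unfolding Den_Ocl_iff using lin_pairD(1,2)[OF \<sigma> vV] by blast
  qed
  have cong: "?\<sigma> v - \<theta> v \<in> Den Ocl" if v: "v \<in> Num J1" for v
  proof -
    have vV: "v \<in> V" using v Num_iff[OF Js(1)] by blast
    have "(?\<sigma> v - \<theta> v) i j \<in> cond" for i j
    proof (cases "i < n")
      case True
      have "v i \<in> comp_block i (proj (e i) J1)" using v True unfolding Num_iff_block[OF Js(1)] by blast
      then have "S i (v i) j - comp_map \<theta> i (v i) j \<in> proj (e i) cond" by (rule good4[OF True])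
      then show ?thesis using proj_mem_iff[OF True cond_submod] comp_map_apply[OF \<theta>(1) True vV] at(1)[OF True] by simp
    next
      case False
      have "\<theta> v i = 0" using lin_pairD(1)[OF \<theta>(1) vV] False unfolding V_iff by simp
      then show ?thesis using False submodD(1)[OF cond_submod] by (simp add: asm_map_def)
    qed
    then show ?thesis unfolding Den_Ocl_iff using V_closed(4) lin_pairD(1)[OF \<sigma> vV] lin_pairD(1)[OF \<theta>(1) vV] by blast
  qed
  have DV: "Den Ocl \<subseteq> V" using Den_Ocl_iff by blast
  \<comment> \<open>Vectors of \<open>Num J2\<close> are replaced by congruent ones in
    \<open>Num J1\<close>, where the congruence with \<open>\<theta>\<close> is available;
    membership in \<open>L\<close> is not affected.\<close>
  have near: "\<exists>w. w \<in> L \<inter> Num J1 \<and> v - w \<in> Den Ocl \<and> w \<in> V \<and> v \<in> V" if L: "submod R smult L" "Den Ocl \<subseteq> L" and v: "v \<in> L \<inter> Num J2" for L v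
  proof -
    obtain w where w: "w \<in> Num J1" "v - w \<in> Den Ocl" using Num_approx[OF J(1)] v Den_Int_Num(2)[OF J(2)] by blast
    have "v - (v - w) \<in> L" by (rule V_diff[OF L(1)]) (use v w L(2) in auto)
    then show ?thesis using w v Num_iff[OF Js(1)] Num_iff[OF Js(2)] by auto
  qed
  have "?\<sigma> v \<in> N \<inter> Num J2" if v: "v \<in> M \<inter> Num J2" for v
  proof -
    obtain w where w: "w \<in> M \<inter> Num J1" "v - w \<in> Den Ocl" "w \<in> V" "v \<in> V" using near[OF MR(1) DM(1) v] by blast
    have "\<theta> w \<in> N" using w(1) \<theta>(2) by blast
    moreover have "?\<sigma> (v - w) \<in> N" "?\<sigma> w - \<theta> w \<in> N" using D[OF w(2)] cong w(1) DM(2) by blast+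
    ultimately have "?\<sigma> (v - w) + ((?\<sigma> w - \<theta> w) + \<theta> w) \<in> N" using submodD(2)[OF MR(2)] by blast
    moreover have "?\<sigma> ((v - w) + w) = ?\<sigma> (v - w) + ?\<sigma> w" by (rule lin_pairD(5)[OF \<sigma>]) (use w DV in auto)
    ultimately have "?\<sigma> v \<in> N" by simp
    then show ?thesis using N2 v by blast
  qed
  note \<sigma>N = this
  have "?\<sigma>' v \<in> M \<inter> Num J2" if v: "v \<in> N \<inter> Num J2" for v
  proof -
    obtain w where w: "w \<in> N \<inter> Num J1" "v - w \<in> Den Ocl" "w \<in> V" "v \<in> V" using near[OF MR(2) DM(2) v] by blast
    obtain x where x: "x \<in> M \<inter> Num J1" "w = \<theta> x" using w(1) \<theta>(2) by blast
    have xV: "x \<in> V" using x Num_iff[OF Js(1)] by blast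
    \<comment> \<open>The congruence concerns only the forward maps, so \<open>w\<close> is first
      written as the image of \<open>x\<close> under \<open>\<theta>\<close>.\<close>
    have d: "?\<sigma> x - w \<in> Den Ocl" using cong x by blast
    have "?\<sigma>' ((?\<sigma> x - w) + w) = ?\<sigma>' (?\<sigma> x - w) + ?\<sigma>' w" by (rule lin_pairD(5)[OF \<sigma>']) (use d w DV in auto)
    then have "x = ?\<sigma>' (?\<sigma> x - w) + ?\<sigma>' w" using lin_pairD(3)[OF \<sigma> xV] by simp
    then have "?\<sigma>' w = x - ?\<sigma>' (?\<sigma> x - w)" by (metis add_diff_cancel_left')
    moreover have "?\<sigma>' (?\<sigma> x - w) \<in> M" using D[OF d] DM(1) by blast
    ultimately have "?\<sigma>' w \<in> M" using V_diff[OF MR(1)] x(1) by simp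
    moreover have "?\<sigma>' (v - w) \<in> M" using D[OF w(2)] DM(1) by blast
    moreover have "?\<sigma>' ((v - w) + w) = ?\<sigma>' (v - w) + ?\<sigma>' w" by (rule lin_pairD(5)[OF \<sigma>']) (use w DV in auto)
    ultimately have "?\<sigma>' v \<in> M" using submodD(2)[OF MR(1)] by simp
    then show ?thesis using N2 v by blast
  qed
  note \<sigma>M = this
  have NV: "N \<inter> Num J2 \<subseteq> V" "M \<inter> Num J2 \<subseteq> V" using Num_iff[OF Js(2)] by blast+
  have "?\<sigma> ` (M \<inter> Num J2) = N \<inter> Num J2"
  proof (intro subset_antisym image_subsetI subsetI)
    show "?\<sigma> v \<in> N \<inter> Num J2" if "v \<in> M \<inter> Num J2" for v by (rule \<sigma>N[OF that])
    fix v assume v: "v \<in> N \<inter> Num J2"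
    have "v = ?\<sigma> (?\<sigma>' v)" using lin_pairD(4)[OF \<sigma>, of v] v NV(1) by auto
    then show "v \<in> ?\<sigma> ` (M \<inter> Num J2)" using \<sigma>M[OF v] by (rule image_eqI)
  qed
  then show ?thesis by (rule lin_pair_R_iso[OF \<sigma> NV(2)])
qed

end

section \<open>Quotients\<close>

context order_setting
begin

lemma plus_set_Den: "coprime_ideal J \<Longrightarrow> Den J + Den J = Den J"
proof -
  assume J: "coprime_ideal J"
  note D = submodD[OF Den_submod[OF J]]
  have "x \<in> Den J" if "x \<in> Den J + Den J" for x
    using that D(2) by (elim set_plus_elim) simp
  moreover have "x \<in> Den J + Den J" if "x \<in> Den J" for x
    using set_plus_intro[OF that D(1)] by simp
  ultimately show ?thesis by blast
qed

lemma q_eq_iff: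
  assumes J: "coprime_ideal J"
  shows "q J v = q J w \<longleftrightarrow> v - w \<in> Den J"
proof
  note D = submodD[OF Den_submod[OF J]]
  assume "q J v = q J w"
  moreover have "v + 0 \<in> q J v" unfolding q_def by (rule set_plus_intro2[OF D(1)])
  ultimately have "v \<in> w +o Den J" by (simp add: q_def)
  then show "v - w \<in> Den J" by (auto simp: elt_set_plus_def)
next
  note D = submodD[OF Den_submod[OF J]]
  assume d: "v - w \<in> Den J"
  have neg: "w - v \<in> Den J"
    using Vm.submod_neg[OF submod_mono[OF Z_sub_Ocl Den_submod[OF J]] d] by simp
  have "v + x \<in> q J w" if "x \<in> Den J" for x
  proof -
    have "w + ((v - w) + x) \<in> w +o Den J" by (rule set_plus_intro2) (rule D(2)[OF d that])
    then show ?thesis by (simp add: q_def algebra_simps)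
  qed
  moreover have "w + x \<in> q J v" if "x \<in> Den J" for x
  proof -
    have "v + ((w - v) + x) \<in> v +o Den J" by (rule set_plus_intro2) (rule D(2)[OF neg that])
    then show ?thesis by (simp add: q_def algebra_simps)
  qed
  ultimately show "q J v = q J w" unfolding q_def by (auto simp: elt_set_plus_def)
qed

lemma q_add: "coprime_ideal J \<Longrightarrow> q J v + q J w = q J (v + w)"
  unfolding q_def by (simp add: set_plus_rearrange plus_set_Den)

lemma q_scale:
  assumes J: "coprime_ideal J" and r: "r \<in> Ocl"
  shows "coset_scale (Den J) r (q J v) = q J (smult r v)"
proof
  note D = submodD[OF Den_submod[OF J]]
  show "coset_scale (Den J) r (q J v) \<subseteq> q J (smult r v)"
  proof
    fix x assume "x \<in> coset_scale (Den J) r (q J v)"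
    then obtain a b where ab: "x = a + b" "a \<in> smult r ` q J v" "b \<in> Den J"
      unfolding coset_scale_def by (elim set_plus_elim)
    then obtain d where d: "a = smult r (v + d)" "d \<in> Den J" unfolding q_def elt_set_plus_def by blast
    have "smult r v + (smult r d + b) \<in> q J (smult r v)" unfolding q_def
      by (rule set_plus_intro2) (rule D(2)[OF D(3)[OF r d(2)] ab(3)])
    then show "x \<in> q J (smult r v)" using ab(1) d(1) by (simp add: smult_rules add.assoc)
  qed
  show "q J (smult r v) \<subseteq> coset_scale (Den J) r (q J v)"
  proof
    fix x assume "x \<in> q J (smult r v)"
    then obtain d where d: "x = smult r v + d" "d \<in> Den J" unfolding q_def elt_set_plus_def by blast
    have "v + 0 \<in> q J v" unfolding q_def by (rule set_plus_intro2[OF D(1)])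
    then have "smult r v \<in> smult r ` q J v" by simp
    then show "x \<in> coset_scale (Den J) r (q J v)" unfolding coset_scale_def d(1) using d(2) by (rule set_plus_intro)
  qed
qed

lemma q_zero: "q J 0 = Den J"
  by (simp add: q_def elt_set_plus_def)

lemma q_Den: "coprime_ideal J \<Longrightarrow> v \<in> Den J \<Longrightarrow> q J v = Den J"
  using q_eq_iff[of J v 0] by (simp add: q_zero)

text \<open>Needed for two rings of scalars: \<open>R\<close> for the listed submodules, and
  \<open>Ocl\<close> for the condition that they generate the quotient.\<close>

lemma quot_submod_image:
  assumes S: "S \<subseteq> Ocl" and H: "submod S smult H" "H \<subseteq> Num Ocl"
  shows "quot_submod S (Den Ocl) (Quot Ocl) (q Ocl ` H)"
  unfolding quot_submod_def
proof (intro conjI ballI)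
  note C = Ocl_coprime and D = submodD[OF H(1)]
  show "q Ocl ` H \<subseteq> Quot Ocl" unfolding Quot_def using H(2) by blast
  have "q Ocl 0 \<in> q Ocl ` H" using D(1) by (rule imageI)
  then show "Den Ocl \<in> q Ocl ` H" by (simp add: q_zero)
  fix A assume "A \<in> q Ocl ` H"
  then obtain v where v: "A = q Ocl v" "v \<in> H" by blast
  show "A + B \<in> q Ocl ` H" if B: "B \<in> q Ocl ` H" for B
  proof -
    obtain w where w: "B = q Ocl w" "w \<in> H" using B by (elim imageE)
    show ?thesis unfolding v(1) w(1) q_add[OF C] using D(2)[OF v(2) w(2)] by (rule imageI)
  qed
  show "coset_scale (Den Ocl) r A \<in> q Ocl ` H" if "r \<in> S" for r
  proof -
    have r: "r \<in> Ocl" using that S by blast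
    show ?thesis unfolding v(1) q_scale[OF C r] using D(3)[OF that v(2)] by (rule imageI)
  qed
qed

lemma q_preimage_submod:
  assumes S: "S \<subseteq> Ocl" and X: "quot_submod S (Den Ocl) (Quot Ocl) X"
  shows "submod S smult (q_preimage Ocl X)"
proof (rule submodI)
  note C = Ocl_coprime and N = submodD[OF Num_closed[OF coprime_idealD(1)[OF Ocl_coprime]]]
  have X0: "Den Ocl \<in> X" and X1: "\<And>A B. A \<in> X \<Longrightarrow> B \<in> X \<Longrightarrow> A + B \<in> X"
    and X2: "\<And>r A. r \<in> S \<Longrightarrow> A \<in> X \<Longrightarrow> coset_scale (Den Ocl) r A \<in> X"
    using X unfolding quot_submod_def by blast+
  show "0 \<in> q_preimage Ocl X" unfolding q_preimage_def using N(1) X0 by (simp add: q_zero)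
  show "v + w \<in> q_preimage Ocl X" if "v \<in> q_preimage Ocl X" "w \<in> q_preimage Ocl X" for v w
    using that N(2) X1[of "q Ocl v" "q Ocl w"] unfolding q_preimage_def q_add[OF C] by blast
  show "smult r v \<in> q_preimage Ocl X" if "r \<in> S" "v \<in> q_preimage Ocl X" for r v
  proof -
    have r: "r \<in> Ocl" using that S by blast
    have v: "v \<in> Num Ocl" "q Ocl v \<in> X" using that(2) unfolding q_preimage_def by blast+
    show ?thesis unfolding q_preimage_def using N(3)[OF r v(1)] X2[OF that(1) v(2)] unfolding q_scale[OF C r] by blast
  qed
qed

lemma q_preimage_image:
  assumes M: "submod R smult M" "Den Ocl \<subseteq> M" "M \<subseteq> Num Ocl"
  shows "q_preimage Ocl (q Ocl ` M) = M"
proof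
  show "M \<subseteq> q_preimage Ocl (q Ocl ` M)" unfolding q_preimage_def using M(3) by blast
  show "q_preimage Ocl (q Ocl ` M) \<subseteq> M"
  proof
    fix v assume "v \<in> q_preimage Ocl (q Ocl ` M)"
    then obtain m where m: "m \<in> M" "q Ocl v = q Ocl m" unfolding q_preimage_def by blast
    then have "v - m \<in> M" using q_eq_iff[OF Ocl_coprime] M(2) by blast
    then have "m + (v - m) \<in> M" by (rule submodD(2)[OF M(1) m(1)])
    then show "v \<in> M" by simp
  qed
qed

text \<open>Generation of the quotient lifts to generation of \<open>Num Ocl\<close> because the
  preimage contains the kernel \<open>Den Ocl\<close>.\<close>

lemma mid_of_quot:
  assumes W: "quot_submod R (Den Ocl) (Quot Ocl) W" and hull: "(quot_submod Ocl (Den Ocl) (Quot Ocl) hull W) = Quot Ocl"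
  shows "mid (q_preimage Ocl W)"
  unfolding mid_def
proof (intro conjI)
  let ?M = "q_preimage Ocl W"
  note Os = coprime_idealD(1)[OF Ocl_coprime]
  show "submod R smult ?M" by (rule q_preimage_submod[OF R_sub_Ocl W])
  show DM: "Den Ocl \<subseteq> ?M" unfolding q_preimage_def
    using q_Den[OF Ocl_coprime] Den_Int_Num(1)[OF Ocl_coprime] W unfolding quot_submod_def by auto
  show MN: "?M \<subseteq> Num Ocl" unfolding q_preimage_def by blast
  show "ohull ?M = Num Ocl"
  proof
    show HN: "ohull ?M \<subseteq> Num Ocl" unfolding ohull_def by (rule hull_minimal) (use MN Num_closed[OF Os] in auto)
    have Hs: "submod Ocl smult (ohull ?M)" unfolding ohull_def by (rule submod_hull)
    have MH: "?M \<subseteq> ohull ?M" unfolding ohull_def by (rule hull_subset)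
    have "W \<subseteq> q Ocl ` ohull ?M"
    proof
      fix A assume A: "A \<in> W"
      then have "A \<in> Quot Ocl" using W unfolding quot_submod_def by blast
      then obtain v where v: "A = q Ocl v" "v \<in> Num Ocl" unfolding Quot_def by blast
      then have "v \<in> ?M" using A unfolding q_preimage_def by blast
      then show "A \<in> q Ocl ` ohull ?M" using v(1) MH by blast
    qed
    then have "quot_submod Ocl (Den Ocl) (Quot Ocl) hull W \<subseteq> q Ocl ` ohull ?M"
      by (rule hull_minimal) (rule quot_submod_image[OF subset_refl Hs HN])
    then have QH: "Quot Ocl \<subseteq> q Ocl ` ohull ?M" unfolding hull .
    show "Num Ocl \<subseteq> ohull ?M"
    proof
      fix v assume "v \<in> Num Ocl"
      then have "q Ocl v \<in> q Ocl ` ohull ?M" using QH unfolding Quot_def by blast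
      then obtain h where h: "h \<in> ohull ?M" "q Ocl v = q Ocl h" by blast
      then have "v - h \<in> ohull ?M" using q_eq_iff[OF Ocl_coprime] DM MH by blast
      then have "h + (v - h) \<in> ohull ?M" by (rule submodD(2)[OF Hs h(1)])
      then show "v \<in> ohull ?M" by simp
    qed
  qed
qed

lemma quot_of_mid:
  assumes M: "mid M"
  shows "quot_submod R (Den Ocl) (Quot Ocl) (q Ocl ` M)"
    "(quot_submod Ocl (Den Ocl) (Quot Ocl) hull (q Ocl ` M)) = Quot Ocl"
proof -
  note Os = coprime_idealD(1)[OF Ocl_coprime]
  have MR: "submod R smult M" and DM: "Den Ocl \<subseteq> M" and MN: "M \<subseteq> Num Ocl" and MO: "ohull M = Num Ocl"
    using M by (auto simp: mid_def)
  show "quot_submod R (Den Ocl) (Quot Ocl) (q Ocl ` M)" by (rule quot_submod_image[OF R_sub_Ocl MR MN])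
  show "(quot_submod Ocl (Den Ocl) (Quot Ocl) hull (q Ocl ` M)) = Quot Ocl"
  proof (rule hull_unique)
    show "q Ocl ` M \<subseteq> Quot Ocl" unfolding Quot_def using MN by blast
    show "quot_submod Ocl (Den Ocl) (Quot Ocl) (Quot Ocl)"
      using quot_submod_image[OF subset_refl Num_closed[OF Os] subset_refl] unfolding Quot_def .
    fix X assume X: "q Ocl ` M \<subseteq> X" "quot_submod Ocl (Den Ocl) (Quot Ocl) X"
    have "M \<subseteq> q_preimage Ocl X" unfolding q_preimage_def using X(1) MN by blast
    then have "ohull M \<subseteq> q_preimage Ocl X" unfolding ohull_def
      by (rule hull_minimal) (rule q_preimage_submod[OF subset_refl X(2)])
    then show "Quot Ocl \<subseteq> X" unfolding MO Quot_def q_preimage_def by blast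
  qed
qed

text \<open>Every coset has a representative in \<open>Num J\<close> by \<open>Num_approx\<close>,
  and two of them differ by an element of \<open>Den J\<close> by \<open>Den_Int_Num\<close>. So the
  isomorphism demanded by the algorithm can always be found.\<close>

lemma induced_iso_exists:
  assumes J: "coprime_ideal J"
  shows "\<exists>\<psi>. induced_iso J \<psi>"
proof -
  note C = Ocl_coprime and Js = coprime_idealD(1)[OF J] and NS = submodD[OF Num_closed[OF coprime_idealD(1)[OF J]]]
  define \<psi> where "\<psi> A = q J (SOME v. v \<in> Num J \<and> q Ocl v = A)" for A
  have \<psi>: "\<psi> (q Ocl v) = q J v" if v: "v \<in> Num J" for v
  proof -
    let ?w = "SOME w. w \<in> Num J \<and> q Ocl w = q Ocl v"
    have w: "?w \<in> Num J \<and> q Ocl ?w = q Ocl v" by (rule someI[of _ v]) (use v in simp)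
    have "?w - v \<in> Den Ocl" using w q_eq_iff[OF C] by blast
    moreover have "?w - v \<in> Num J" by (rule V_diff[OF submod_mono[OF R_sub_Ocl Num_closed[OF Js]]]) (use w v in auto)
    ultimately have "?w - v \<in> Den J" using Den_Int_Num(1)[OF J] by blast
    then show ?thesis unfolding \<psi>_def using q_eq_iff[OF J] by blast
  qed
  have rep: "\<exists>v\<in>Num J. A = q Ocl v" if A: "A \<in> Quot Ocl" for A
  proof -
    obtain v where v: "v \<in> Num Ocl" "A = q Ocl v" using A unfolding Quot_def by blast
    obtain w where "w \<in> Num J" "v - w \<in> Den Ocl" using Num_approx[OF J v(1)] .
    then show ?thesis using v(2) q_eq_iff[OF C] by blast
  qed
  have "bij_betw \<psi> (Quot Ocl) (Quot J)" unfolding bij_betw_def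
  proof
    show "inj_on \<psi> (Quot Ocl)"
    proof (rule inj_onI)
      fix A B assume AB: "A \<in> Quot Ocl" "B \<in> Quot Ocl" "\<psi> A = \<psi> B"
      obtain v w where vw: "v \<in> Num J" "A = q Ocl v" "w \<in> Num J" "B = q Ocl w" using rep AB(1,2) by blast
      then have "v - w \<in> Den J" using AB(3) \<psi> q_eq_iff[OF J] by simp
      then show "A = B" using vw q_eq_iff[OF C] Den_Int_Num(1)[OF J] by simp
    qed
    show "\<psi> ` Quot Ocl = Quot J"
    proof (intro subset_antisym subsetI)
      fix B assume "B \<in> \<psi> ` Quot Ocl"
      then obtain A where A: "A \<in> Quot Ocl" "B = \<psi> A" by blast
      then obtain v where "v \<in> Num J" "A = q Ocl v" using rep by blast
      then show "B \<in> Quot J" using A(2) \<psi> unfolding Quot_def by blast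
    next
      fix B assume "B \<in> Quot J"
      then obtain v where v: "v \<in> Num J" "B = q J v" unfolding Quot_def by blast
      have "q Ocl v \<in> Quot Ocl" unfolding Quot_def using v(1) Den_Int_Num(2)[OF J] by blast
      then show "B \<in> \<psi> ` Quot Ocl" using \<psi>[OF v(1)] v(2) by (metis imageI)
    qed
  qed
  moreover have "\<psi> (A + B) = \<psi> A + \<psi> B" if AB: "A \<in> Quot Ocl" "B \<in> Quot Ocl" for A B
  proof -
    obtain v w where vw: "v \<in> Num J" "A = q Ocl v" "w \<in> Num J" "B = q Ocl w" using rep AB by blast
    show ?thesis unfolding vw(2,4) q_add[OF C] \<psi>[OF vw(1)] \<psi>[OF vw(3)] \<psi>[OF NS(2)[OF vw(1,3)]] q_add[OF J] ..
  qed
  moreover have "\<psi> (coset_scale (Den Ocl) r A) = coset_scale (Den J) r (\<psi> A)" if r: "r \<in> R" and A: "A \<in> Quot Ocl" for r A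
  proof -
    obtain v where v: "v \<in> Num J" "A = q Ocl v" using rep A by blast
    have rO: "r \<in> Ocl" using r R_sub_Ocl by blast
    show ?thesis unfolding v(2) q_scale[OF C rO] \<psi>[OF v(1)] \<psi>[OF NS(3)[OF rO v(1)]] q_scale[OF J rO] ..
  qed
  ultimately have "induced_iso J \<psi>" unfolding induced_iso_def using \<psi> by blast
  then show ?thesis by blast
qed

text \<open>The coset of a vector of \<open>Num J\<close> is taken by \<open>\<psi>\<close> to the
  coset of the same vector, so pulling back along \<open>q J\<close> recovers just the elements of
  \<open>M\<close> that lie in \<open>Num J\<close>.\<close>

lemma output_module:
  assumes J: "coprime_ideal J" and \<psi>: "induced_iso J \<psi>" and M: "mid M"
  shows "q_preimage J (\<psi> ` (q Ocl ` M)) = M \<inter> Num J"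
proof -
  have MR: "submod R smult M" and DM: "Den Ocl \<subseteq> M" and MN: "M \<subseteq> Num Ocl" using M by (auto simp: mid_def)
  have inj: "inj_on \<psi> (Quot Ocl)" and \<psi>q: "\<And>v. v \<in> Num J \<Longrightarrow> \<psi> (q Ocl v) = q J v"
    using \<psi> unfolding induced_iso_def bij_betw_def by blast+
  have "q J v \<in> \<psi> ` (q Ocl ` M) \<longleftrightarrow> v \<in> M" if v: "v \<in> Num J" for v
  proof
    assume "q J v \<in> \<psi> ` (q Ocl ` M)"
    then obtain m where m: "m \<in> M" "\<psi> (q Ocl v) = \<psi> (q Ocl m)" using \<psi>q[OF v] by (auto elim!: imageE)
    moreover have "q Ocl v \<in> Quot Ocl" "q Ocl m \<in> Quot Ocl"
      unfolding Quot_def using v Den_Int_Num(2)[OF J] m(1) MN by blast+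
    ultimately have "q Ocl v = q Ocl m" using inj by (auto dest: inj_onD)
    then have "v - m \<in> M" using q_eq_iff[OF Ocl_coprime] DM by blast
    then have "m + (v - m) \<in> M" by (rule submodD(2)[OF MR m(1)])
    then show "v \<in> M" by simp
  next
    assume "v \<in> M"
    then show "q J v \<in> \<psi> ` (q Ocl ` M)" using \<psi>q[OF v] by (metis imageI)
  qed
  then show ?thesis unfolding q_preimage_def by blast
qed

end

section \<open>Ideal classes\<close>

context order_setting
begin

lemma common_nonzero:
  assumes "\<And>i. i < m \<Longrightarrow> \<exists>z\<in>Z - {0}. P i z" "\<And>i y z. y \<in> Z - {0} \<Longrightarrow> P i z \<Longrightarrow> P i (y * z)"
  shows "\<exists>z\<in>Z - {0}. \<forall>i<m::nat. P i z"
  using assms(1)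
proof (induction m)
  case 0
  then show ?case using one_nonzero by blast
next
  case (Suc m)
  then obtain y where y: "y \<in> Z - {0}" "\<forall>i<m. P i y" by auto
  obtain z where z: "z \<in> Z - {0}" "P m z" using Suc.prems[of m] by auto
  have "P i (z * y)" if "i < Suc m" for i
  proof (cases "i = m")
    case True
    then show ?thesis using assms(2)[OF y(1) z(2)] by (simp add: mult.commute)
  next
    case False
    then show ?thesis using assms(2)[OF z(1)] y(2) that by simp
  qed
  then show ?case using nonzero_mult[OF z(1) y(1)] by blast
qed

lemma e_component:
  assumes x: "\<And>k. k < n \<Longrightarrow> e k * x k = x k" and i: "i < n"
  shows "e i * (\<Sum>k<n. x k) = x i"
proof -
  have "e i * x k = (if k = i then x i else 0)" if "k < n" for k
  proof (cases "k = i")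
    case False
    have "e i * x k = (e i * e k) * x k" using x[OF that] by (simp add: mult.assoc)
    then show ?thesis using e_orth[OF i that] False by simp
  qed (use x[OF i] in simp)
  then have "(\<Sum>k<n. e i * x k) = (\<Sum>k<n. if k = i then x i else 0)" by (intro sum.cong) auto
  then show ?thesis using i by (simp add: sum_distrib_left)
qed

lemma direct_sum_frac:
  assumes I: "\<And>i. i < n \<Longrightarrow> frac (e i) (Is ! i)"
  shows "fractional_ideal Z Q 1 Ocl (direct_sum Is)" "i < n \<Longrightarrow> proj (e i) (direct_sum Is) = Is ! i"
proof -
  note F = fracD[OF e_idem I]
  have mem: "x \<in> direct_sum Is \<longleftrightarrow> (\<forall>i<n. e i * x \<in> Is ! i)" for x by (simp add: direct_sum_def)
  have sub: "submod Ocl (*) (direct_sum Is)"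
  proof (rule submodI)
    show "0 \<in> direct_sum Is" unfolding mem using submodD(1)[OF F(1)] by simp
    show "x + y \<in> direct_sum Is" if "x \<in> direct_sum Is" "y \<in> direct_sum Is" for x y
      using that submodD(2)[OF F(1)] unfolding mem by (simp add: distrib_left)
    show "r * x \<in> direct_sum Is" if "r \<in> Ocl" "x \<in> direct_sum Is" for r x
      using that submodD(3)[OF F(1)] unfolding mem by (simp add: mult.left_commute[of _ r])
  qed
  \<comment> \<open>The guard \<open>i < n\<close> is part of the predicate because
    \<open>common_nonzero\<close> asks for closure under multiples at every index.\<close>
  have "\<exists>z\<in>Z - {0}. \<forall>i<n. i < n \<longrightarrow> z * e i \<in> Is ! i"
  proof (rule common_nonzero)
    fix i y z assume "y \<in> Z - {0}" "i < n \<longrightarrow> z * e i \<in> Is ! i"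
    then show "i < n \<longrightarrow> y * z * e i \<in> Is ! i" using submodD(3)[OF F(1), of i y "z * e i"] Z_sub_Ocl by (auto simp: mult.assoc)
  qed (use F(3) in blast)
  then obtain z where z: "z \<in> Z - {0}" "\<forall>i<n. z * e i \<in> Is ! i" by blast
  have "\<exists>z\<in>Z - {0}. \<forall>i<n. \<forall>x\<in>Is ! i. z * x \<in> Ocl"
  proof (rule common_nonzero)
    fix i y z assume "y \<in> Z - {0}" "\<forall>x\<in>Is ! i. z * x \<in> Ocl"
    then show "\<forall>x\<in>Is ! i. y * z * x \<in> Ocl" using Ocl_rules(6) Z_sub_Ocl by (auto simp: mult.assoc)
  qed (rule F(4))
  then obtain y where y: "y \<in> Z - {0}" "\<forall>i<n. \<forall>x\<in>Is ! i. y * x \<in> Ocl" by blast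
  have "y * x \<in> Ocl" if "x \<in> direct_sum Is" for x
  proof (rule mem_of_components)
    show "submod Ocl (*) Ocl" using coprime_idealD(1)[OF Ocl_coprime] .
    fix i assume "i < n"
    then have "y * (e i * x) \<in> Ocl" using y(2) that unfolding mem by blast
    then show "e i * (y * x) \<in> Ocl" by (simp only: mult.left_commute)
  qed
  moreover have "z \<in> direct_sum Is" unfolding mem using z(2) by (simp add: mult.commute)
  ultimately show "fractional_ideal Z Q 1 Ocl (direct_sum Is)" unfolding frac_1_iff using sub y(1) z(1) by blast
  assume i: "i < n"
  show "proj (e i) (direct_sum Is) = Is ! i"
  proof
    show "proj (e i) (direct_sum Is) \<subseteq> Is ! i" unfolding proj_def mem_Collect_eq direct_sum_def using i by blast
    show "Is ! i \<subseteq> proj (e i) (direct_sum Is)"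
    proof
      fix x assume x: "x \<in> Is ! i"
      have ex: "e i * x = x" using F(2)[OF i i x] .
      have "e k * x \<in> Is ! k" if k: "k < n" for k
      proof (cases "k = i")
        case False
        have "e k * x = (e k * e i) * x" using ex by (simp add: mult.assoc)
        then show ?thesis using e_orth[OF k i] False submodD(1)[OF F(1)[OF k k]] by simp
      qed (use ex x in simp)
      then have "x \<in> direct_sum Is" unfolding mem by blast
      then show "x \<in> proj (e i) (direct_sum Is)" using proj_mem_iff[OF i sub] ex by blast
    qed
  qed
qed

section \<open>Equivalence of fractional ideals\<close>

lemma pic_rel_iff:
  assumes u: "u * u = u"
  shows "(I, J) \<in> pic_rel Z Q u (proj u Ocl) \<longleftrightarrow> frac u I \<and> frac u J \<and>
    (\<exists>x y. u * x = x \<and> u * y = y \<and> x * y = u \<and> J = (*) x ` I)"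
proof -
  interpret U: idempotent_setting Z Q n e s R u by unfold_locales (rule u)
  have "(\<exists>x\<in>proj u UNIV. \<exists>y\<in>proj u UNIV. x * y = u \<and> J = (\<lambda>z. x * z) ` I) \<longleftrightarrow>
    (\<exists>x y. u * x = x \<and> u * y = y \<and> x * y = u \<and> J = (*) x ` I)"
    using proj_UNIV_iff[OF u] by blast
  then show ?thesis unfolding pic_rel_def U.invertible_ideals_eq by simp
qed

lemma pic_rel_refl: "u * u = u \<Longrightarrow> frac u I \<Longrightarrow> (I, I) \<in> pic_rel Z Q u (proj u Ocl)"
proof -
  assume u: "u * u = u" and I: "frac u I"
  have "(*) u ` I = id ` I" by (rule image_cong) (use fracD(2)[OF u I] in auto)
  then show ?thesis unfolding pic_rel_iff[OF u] using u I by (intro conjI exI[of _ u]) auto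
qed

lemma pic_rel_sym: "u * u = u \<Longrightarrow> (I, J) \<in> pic_rel Z Q u (proj u Ocl) \<Longrightarrow> (J, I) \<in> pic_rel Z Q u (proj u Ocl)"
proof -
  assume u: "u * u = u" and IJ: "(I, J) \<in> pic_rel Z Q u (proj u Ocl)"
  then obtain x y where xy: "frac u I" "frac u J" "u * x = x" "u * y = y" "x * y = u" "J = (*) x ` I"
    unfolding pic_rel_iff[OF u] by blast
  have yx: "y * x = u" using xy(5) by (simp add: mult.commute)
  have "(*) y ` J = id ` I" unfolding xy(6) image_image
    by (rule image_cong) (use yx fracD(2)[OF u xy(1)] in \<open>auto simp: mult.assoc[symmetric]\<close>)
  then show ?thesis unfolding pic_rel_iff[OF u] using xy yx by (intro conjI exI[of _ y] exI[of _ x]) auto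
qed

lemma pic_rel_trans:
  "u * u = u \<Longrightarrow> (I, J) \<in> pic_rel Z Q u (proj u Ocl) \<Longrightarrow> (J, L) \<in> pic_rel Z Q u (proj u Ocl) \<Longrightarrow>
    (I, L) \<in> pic_rel Z Q u (proj u Ocl)"
proof -
  assume u: "u * u = u" and IJ: "(I, J) \<in> pic_rel Z Q u (proj u Ocl)" "(J, L) \<in> pic_rel Z Q u (proj u Ocl)"
  then obtain x y x' y' where xy: "frac u I" "u * x = x" "u * y = y" "x * y = u" "J = (*) x ` I"
    "frac u L" "u * x' = x'" "u * y' = y'" "x' * y' = u" "L = (*) x' ` J"
    unfolding pic_rel_iff[OF u] by blast
  have 1: "L = (*) (x' * x) ` I" unfolding xy(5,10) image_image by (simp add: mult.assoc)
  have "(x' * x) * (y' * y) = (x' * y') * (x * y)" by (simp only: ac_simps)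
  then have 2: "(x' * x) * (y' * y) = u" using xy u by simp
  have 3: "u * (x' * x) = x' * x" "u * (y' * y) = y' * y" using xy by (simp_all add: mult.assoc[symmetric])
  show ?thesis unfolding pic_rel_iff[OF u] using xy(1,6) 1 2 3 by blast
qed

lemma pic_rel_component:
  assumes IJ: "(I, J) \<in> pic_rel Z Q 1 Ocl" and i: "i < n"
  shows "(proj (e i) I, proj (e i) J) \<in> pic_rel Z Q (e i) (proj (e i) Ocl)"
proof -
  obtain x y where xy: "fractional_ideal Z Q 1 Ocl I" "fractional_ideal Z Q 1 Ocl J" "x * y = 1" "J = (*) x ` I"
    using IJ pic_rel_iff[of 1 I J] by auto
  note ee = e_idem[OF i]
  have "e i * (x * a) = (e i * x) * (e i * a)" for a
    using ee by (metis mult.assoc mult.left_commute)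
  then have "proj (e i) J = (*) (e i * x) ` proj (e i) I"
    unfolding proj_def xy(4) image_image by simp
  moreover have "(e i * x) * (e i * y) = (e i * e i) * (x * y)" by (simp only: ac_simps)
  then have "(e i * x) * (e i * y) = e i" using ee xy(3) by simp
  moreover have "e i * (e i * x) = e i * x" "e i * (e i * y) = e i * y" using ee by (simp_all add: mult.assoc[symmetric])
  ultimately show ?thesis unfolding pic_rel_iff[OF ee] using proj_frac[OF i] xy(1,2) by blast
qed

text \<open>To stay in the ideal class, the multiplier must be invertible in the field, which
  \<open>coprime_multiplier\<close> alone does not ensure.\<close>

lemma component_coprime_multiplier:
  assumes i: "i < n" and I: "frac (e i) I"
  shows "\<exists>x y a. e i * x = x \<and> e i * y = y \<and> x * y = e i \<and> (\<forall>b\<in>I. x * b \<in> Ocl) \<and> a \<in> I \<and> e i - x * a \<in> cond"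
proof -
  interpret U: idempotent_setting Z Q n e s R "e i" by (rule component_setting[OF i])
  obtain x a c where x: "x \<in> U.inv_ideal I" "a \<in> I" "c \<in> proj (e i) cond" "e i = x * a + c"
    by (rule U.coprime_multiplier[OF proj_frac[OF i cond_frac] proj_cond_sub[OF i] I])
  have xe: "e i * x = x" and xI: "\<forall>b\<in>I. x * b \<in> Ocl" using x(1) by (auto simp: U.inv_ideal_def)
  have c: "c \<in> cond" using x(3) proj_mem_iff[OF i cond_submod] by blast
  show ?thesis
  proof (cases "x = 0")
    case False
    then obtain y where y: "e i * y = y" "x * y = e i" using e_field[OF i xe] by blast
    have "e i - x * a = c" using x(4) by (metis add_diff_cancel_left')
    then have "e i - x * a \<in> cond" using c by simp
    then show ?thesis using xe y xI x(2) by blast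
  next
    \<comment> \<open>A zero multiplier means that the conductor contains \<open>e i\<close>.
      Coprimality is then automatic in this component, and any \<open>z * e i\<close> in the inverse
      ideal with \<open>z\<close> nonzero will do.\<close>
    case True
    then have ec: "e i \<in> cond" using x(4) c by simp
    obtain z where z: "z \<in> Z - {0}" "z * e i \<in> U.inv_ideal I" using fracD(3)[OF e_idem[OF i] U.inv_ideal_frac[OF I]] by blast
    obtain w where w: "z * w = 1" using nonzero_Z_inverse[OF z(1)] .
    have "(z * e i) * (w * e i) = (z * w) * (e i * e i)" by (simp only: ac_simps)
    then have "(z * e i) * (w * e i) = e i" using w e_idem[OF i] by simp
    moreover have "e i * (z * e i) = z * e i" "e i * (w * e i) = w * e i" by (rule U.u_left[OF e_idem[OF i]])+
    moreover have "0 \<in> I" using submodD(1)[OF fracD(1)[OF e_idem[OF i] I]] .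
    moreover have "e i - (z * e i) * 0 \<in> cond" using ec by simp
    moreover have "\<forall>b\<in>I. z * e i * b \<in> Ocl" using z(2) by (auto simp: U.inv_ideal_def)
    ultimately show ?thesis by blast
  qed
qed

text \<open>The multipliers of the components, their inverses and the witnesses of coprimality are
  added up; orthogonality of the idempotents makes the sums behave as tuples.\<close>

lemma coprime_representative:
  assumes I: "fractional_ideal Z Q 1 Ocl I"
  shows "\<exists>J. (I, J) \<in> pic_rel Z Q 1 Ocl \<and> coprime_to_cond J"
proof -
  have sub: "submod Ocl (*) I" using I frac_1_iff by blast
  let ?P = "\<lambda>i p. e i * fst p = fst p \<and> e i * fst (snd p) = fst (snd p) \<and> fst p * fst (snd p) = e i \<and>
    (\<forall>b\<in>proj (e i) I. fst p * b \<in> Ocl) \<and> snd (snd p) \<in> proj (e i) I \<and> e i - fst p * snd (snd p) \<in> cond"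
  have "\<forall>i\<in>{..<n}. \<exists>p. ?P i p"
  proof
    fix i assume "i \<in> {..<n}"
    then have i: "i < n" by simp
    obtain x y a where "e i * x = x \<and> e i * y = y \<and> x * y = e i \<and> (\<forall>b\<in>proj (e i) I. x * b \<in> Ocl) \<and> a \<in> proj (e i) I \<and> e i - x * a \<in> cond"
      using component_coprime_multiplier[OF i proj_frac[OF i I]] by blast
    then show "\<exists>p. ?P i p" by (intro exI[of _ "(x, y, a)"]) simp
  qed
  from bchoice[OF this] obtain p where p: "\<forall>i\<in>{..<n}. ?P i (p i)" ..
  define x y a where "x i = fst (p i)" and "y i = fst (snd (p i))" and "a i = snd (snd (p i))" for i
  have ex: "e i * x i = x i" and ey: "e i * y i = y i" and xy: "x i * y i = e i" and xI: "b \<in> proj (e i) I \<Longrightarrow> x i * b \<in> Ocl"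
    and aI: "a i \<in> proj (e i) I" and xa: "e i - x i * a i \<in> cond" if "i < n" for i b
    using p that by (auto simp: x_def y_def a_def)
  define X where "X = (\<Sum>i<n. x i)"
  define Y where "Y = (\<Sum>i<n. y i)"
  define A where "A = (\<Sum>i<n. a i)"
  have eX: "e i * X = x i" "e i * Y = y i" if "i < n" for i
    unfolding X_def Y_def using e_component[of x] e_component[of y] ex ey that by blast+
  have aI': "a i \<in> I" "e i * a i = a i" if "i < n" for i using aI[OF that] proj_mem_iff[OF that sub] by blast+
  have eA: "e i * A = a i" if "i < n" for i unfolding A_def using e_component[of a] aI' that by blast
  have split: "e i * (b * c) = (e i * b) * (e i * c)" if "i < n" for i b c
    using e_idem[OF that] by (metis mult.assoc mult.left_commute)
  have "X * Y = (\<Sum>i<n. e i * (X * Y))" by (rule component_sum)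
  also have "\<dots> = (\<Sum>i<n. e i)" by (rule sum.cong) (use split eX xy in auto)
  finally have XY: "X * Y = 1" using e_sum by simp
  let ?J = "(*) X ` I"
  have JO: "?J \<subseteq> Ocl"
  proof clarify
    fix b assume b: "b \<in> I"
    show "X * b \<in> Ocl"
    proof (rule mem_of_components[OF coprime_idealD(1)[OF Ocl_coprime]])
      fix i assume i: "i < n"
      have "e i * b \<in> proj (e i) I" using b by (auto simp: proj_def)
      then show "e i * (X * b) \<in> Ocl" unfolding split[OF i] eX[OF i] by (rule xI[OF i])
    qed
  qed
  have J: "fractional_ideal Z Q 1 Ocl ?J"
    using idempotent_setting.frac_scale[OF total_setting, of I X Y] I XY by simp
  have rel: "(I, ?J) \<in> pic_rel Z Q 1 Ocl"
    using pic_rel_iff[of 1 I ?J] I J XY by auto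
  have AI: "A \<in> I" unfolding A_def by (rule submod_sum[OF sub]) (use aI' in auto)
  have "1 - X * A \<in> cond"
  proof (rule mem_of_components[OF cond_submod])
    fix i assume i: "i < n"
    have "e i * (1 - X * A) = e i - x i * a i" using split[OF i, of X A] eX(1)[OF i] eA[OF i] by (simp add: right_diff_distrib)
    then show "e i * (1 - X * A) \<in> cond" using xa[OF i] by simp
  qed
  note one = this
  have Jsub: "submod Ocl (*) ?J" using J frac_1_iff by blast
  have "?J + cond = Ocl"
  proof
    show "?J + cond \<subseteq> Ocl"
    proof
      fix b assume "b \<in> ?J + cond"
      then obtain c d where "b = c + d" "c \<in> ?J" "d \<in> cond" by (elim set_plus_elim)
      then show "b \<in> Ocl" using JO cond_sub_R R_sub_Ocl Ocl_rules(4) by blast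
    qed
    show "Ocl \<subseteq> ?J + cond"
    proof
      fix b assume b: "b \<in> Ocl"
      have "b * (X * A) + b * (1 - X * A) \<in> ?J + cond"
        by (rule set_plus_intro[OF submodD(3)[OF Jsub b] submodD(3)[OF cond_submod b one]]) (use AI in blast)
      then show "b \<in> ?J + cond" by (simp add: algebra_simps)
    qed
  qed
  then have "coprime_to_cond ?J" unfolding coprime_to_cond_def using JO by blast
  then show ?thesis using rel by blast
qed

lemma pic_rel_coprime_ideal: "(I, J) \<in> pic_rel Z Q 1 Ocl \<Longrightarrow> coprime_to_cond J \<Longrightarrow> coprime_ideal J"
  using pic_rel_iff[of 1 I J] unfolding coprime_ideal_def by simp

end

section \<open>The algorithm\<close>

lemma sieve_subset: "set (sieve t kept xs) \<subseteq> set kept \<union> set xs"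
proof (induction xs arbitrary: kept)
  case (Cons x xs)
  show ?case using Cons.IH[of kept] Cons.IH[of "kept @ [x]"] by auto
qed simp

lemma sieve_kept: "set kept \<subseteq> set (sieve t kept xs)"
proof (induction xs arbitrary: kept)
  case (Cons x xs)
  show ?case using Cons.IH[of kept] Cons.IH[of "kept @ [x]"] by auto
qed simp

lemma sieve_complete: "(\<And>x. x \<in> set xs \<Longrightarrow> t x x) \<Longrightarrow> x \<in> set xs \<Longrightarrow> \<exists>y\<in>set (sieve t kept xs). t y x"
proof (induction xs arbitrary: kept)
  case (Cons a xs)
  let ?k = "if \<exists>y\<in>set kept. t y a then kept else kept @ [a]"
  show ?case
  proof (cases "x \<in> set xs")
    case True
    then show ?thesis using Cons.IH[of ?k] Cons.prems(1) by simp
  next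
    case False
    then have "x = a" using Cons.prems(2) by simp
    then have "\<exists>y\<in>set ?k. t y x" using Cons.prems(1)[of a] by auto
    then show ?thesis using sieve_kept[of ?k t xs] unfolding sieve.simps by blast
  qed
qed simp

text \<open>Entries are compared only with later ones, since the test \<open>t\<close> is arbitrary
  here; symmetry holds for lattices and is supplied once the output is assembled.\<close>

lemma sieve_pairwise:
  "sorted_wrt (\<lambda>x y. \<not> t x y) kept \<Longrightarrow> sorted_wrt (\<lambda>x y. \<not> t x y) (sieve t kept xs)"
proof (induction xs arbitrary: kept)
  case (Cons a xs)
  have "sorted_wrt (\<lambda>x y. \<not> t x y) (if \<exists>y\<in>set kept. t y a then kept else kept @ [a])"
    using Cons.prems by (auto simp: sorted_wrt_append)
  then show ?case using Cons.IH by simp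
qed simp

lemma sorted_wrt_concat:
  assumes "\<And>xs. xs \<in> set xss \<Longrightarrow> sorted_wrt P xs" "sorted_wrt (\<lambda>xs ys. \<forall>x\<in>set xs. \<forall>y\<in>set ys. P x y) xss"
  shows "sorted_wrt P (concat xss)"
  using assms by (induction xss) (auto simp: sorted_wrt_append)

context order_setting
begin

section \<open>The base list\<close>

lemma R_iso_refl: "R_iso M M"
  unfolding R_iso_def mod_iso_def by (rule exI[of _ id]) auto

lemma mid_Int: "mid M \<Longrightarrow> M \<inter> Num Ocl = M"
  by (auto simp: mid_def)

lemma mid_in_lattices: "mid M \<Longrightarrow> coprime_ideal J \<Longrightarrow> M \<inter> Num J \<in> lattices"
  using mid_lattice by (auto simp: mid_def)

lemma mid_lattices: "mid M \<Longrightarrow> M \<in> lattices"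
  using mid_in_lattices[OF _ Ocl_coprime] mid_Int by metis

text \<open>The sieve only meets modules satisfying \<open>mid\<close>; these are lattices, so the
  isomorphism test answers correctly for them.\<close>

lemma base_list_spec:
  assumes B: "submods_subroutine subm" and C: "iso_subroutine isot"
  shows "M \<in> set (base_list subm isot) \<Longrightarrow> mid M"
    and "mid M \<Longrightarrow> \<exists>N\<in>set (base_list subm isot). R_iso N M"
    and "sorted_wrt (\<lambda>M N. \<not> R_iso M N) (base_list subm isot)"
proof -
  let ?Ws = "filter (\<lambda>W. (quot_submod Ocl (Den Ocl) (Quot Ocl) hull W) = Quot Ocl) (subm Ocl)"
  let ?Ms = "map (q_preimage Ocl) ?Ws"
  have subm: "set (subm Ocl) = {W. quot_submod R (Den Ocl) (Quot Ocl) W}"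
    using B Ocl_frac unfolding submods_subroutine_def by blast
  have 1: "mid M" if "M \<in> set ?Ms" for M
    using that mid_of_quot subm by auto
  have 2: "M \<in> set ?Ms" if M: "mid M" for M
  proof -
    have "q Ocl ` M \<in> set ?Ws" using quot_of_mid[OF M] subm by simp
    then have "q_preimage Ocl (q Ocl ` M) \<in> set ?Ms" by (simp only: set_map) (rule imageI)
    then show ?thesis using q_preimage_image M by (simp add: mid_def)
  qed
  have BL: "base_list subm isot = sieve isot [] ?Ms" by (simp add: base_list_def)
  have 3: "mid M" if "M \<in> set (base_list subm isot)" for M
    using that sieve_subset[of isot "[]" ?Ms] 1 unfolding BL by auto
  then show "M \<in> set (base_list subm isot) \<Longrightarrow> mid M" .
  have isot: "isot M N \<longleftrightarrow> R_iso M N" if "mid M" "mid N" for M N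
    using C mid_lattices[OF that(1)] mid_lattices[OF that(2)] unfolding iso_subroutine_def by blast
  show "\<exists>N\<in>set (base_list subm isot). R_iso N M" if M: "mid M"
  proof -
    have "\<exists>N\<in>set (sieve isot [] ?Ms). isot N M"
      by (rule sieve_complete) (use 1 2[OF M] isot R_iso_refl in blast)+
    then show ?thesis using 3 isot M unfolding BL by blast
  qed
  have "sorted_wrt (\<lambda>M N. \<not> isot M N) (base_list subm isot)" unfolding BL by (rule sieve_pairwise) simp
  then show "sorted_wrt (\<lambda>M N. \<not> R_iso M N) (base_list subm isot)"
    by (rule sorted_wrt_mono_rel[rotated]) (use 3 isot in blast)
qed

section \<open>Normal forms of lattices\<close>

lemma lin_pair_scale_last:
  assumes i: "i < n" and c: "e i * c = c" "e i * c' = c'" "c * c' = e i"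
  shows "lin_pair scf (comp_W i) (\<lambda>f. f(s i - 1 := c * f (s i - 1))) (\<lambda>f. f(s i - 1 := c' * f (s i - 1)))"
proof -
  have s: "s i - 1 < s i" using s_pos[OF i] by simp
  have mem: "f(s i - 1 := d * f (s i - 1)) \<in> comp_W i" if "f \<in> comp_W i" "e i * d = d" for f d
    using that s unfolding comp_W_iff[OF i] by (auto simp: mult.assoc[symmetric])
  have inv: "(f(s i - 1 := d * f (s i - 1)))(s i - 1 := d' * (f(s i - 1 := d * f (s i - 1))) (s i - 1)) = f"
    if "f \<in> comp_W i" "d' * d = e i" for f d d'
    using comp_W_fix[OF i that(1), of "s i - 1"] that(2) by (simp add: mult.assoc[symmetric])
  have cc: "c' * c = e i" using c(3) by (simp add: mult.commute)
  show ?thesis unfolding lin_pair_def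
  proof (intro conjI ballI allI)
    fix f assume f: "f \<in> comp_W i"
    show "f(s i - 1 := c * f (s i - 1)) \<in> comp_W i" "f(s i - 1 := c' * f (s i - 1)) \<in> comp_W i"
      using mem[OF f] c by blast+
    show "(f(s i - 1 := c * f (s i - 1)))(s i - 1 := c' * (f(s i - 1 := c * f (s i - 1))) (s i - 1)) = f"
      by (rule inv[OF f cc])
    show "(f(s i - 1 := c' * f (s i - 1)))(s i - 1 := c * (f(s i - 1 := c' * f (s i - 1))) (s i - 1)) = f"
      by (rule inv[OF f c(3)])
  qed (auto simp: fun_eq_iff scf_def algebra_simps)
qed

text \<open>The idempotents are integral, hence among the scalars of \<open>L\<close>.\<close>

lemma hull_component:
  assumes L: "submod Ocl smult L" "L \<subseteq> V" and v: "v \<in> V"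
  shows "v \<in> L \<longleftrightarrow> (\<forall>i<n. emb i (v i) \<in> L)"
proof
  assume "v \<in> L"
  then show "\<forall>i<n. emb i (v i) \<in> L"
    using smult_e[OF v] submodD(3)[OF L(1) idempotent_Ocl[OF e_idem]] by metis
next
  assume all: "\<forall>i<n. emb i (v i) \<in> L"
  have "(\<Sum>i<n. smult (e i) v) \<in> L" by (rule submod_sum[OF L(1)]) (use all smult_e[OF v] in auto)
  moreover have "(\<Sum>i<n. smult (e i) v) = smult (\<Sum>i<n. e i) v"
    by (induction n) (auto simp: smult_def fun_eq_iff distrib_right)
  ultimately have "smult (\<Sum>i<n. e i) v \<in> L" by simp
  then show "v \<in> L" by (simp only: e_sum smult_rules(2))
qed

text \<open>Steinitz' theorem for one component of \<open>ohull M\<close>. The bound on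
  \<open>M\<close> is inherited by the hull, since the vectors that \<open>z'\<close> moves into
  \<open>Num Ocl\<close> form an \<open>Ocl\<close>-module.\<close>

lemma component_normal_form:
  assumes M: "M \<in> lattices" and i: "i < n"
  shows "\<exists>T T' I. lin_pair scf (comp_W i) T T' \<and> frac (e i) I \<and>
    (\<forall>f\<in>comp_W i. emb i f \<in> ohull M \<longleftrightarrow> T f \<in> comp_block i I)"
proof -
  interpret U: idempotent_setting Z Q n e s R "e i" by (rule component_setting[OF i])
  note M' = M[unfolded lattices_iff, THEN conjunct2, THEN conjunct2]
  obtain z where z: "z \<in> Z - {0}" "\<forall>v\<in>Num Ocl. smult z v \<in> M" using M'[THEN conjunct1] ..
  obtain z' where z': "z' \<in> Z - {0}" "\<forall>v\<in>M. smult z' v \<in> Num Ocl" using M'[THEN conjunct2] ..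
  have Ls: "submod Ocl smult (ohull M)" unfolding ohull_def by (rule submod_hull)
  have MH: "M \<subseteq> ohull M" unfolding ohull_def by (rule hull_subset)
  note NS = submodD[OF Num_closed[OF coprime_idealD(1)[OF Ocl_coprime]]]
  have "ohull M \<subseteq> {v. smult z' v \<in> Num Ocl}" unfolding ohull_def
  proof (rule hull_minimal)
    show "M \<subseteq> {v. smult z' v \<in> Num Ocl}" using z'(2) by blast
    show "submod Ocl smult {v. smult z' v \<in> Num Ocl}"
    proof (rule submodI)
      show "0 \<in> {v. smult z' v \<in> Num Ocl}" using NS(1) by (simp add: smult_def zero_fun_def)
      show "v + w \<in> {v. smult z' v \<in> Num Ocl}" if "v \<in> {v. smult z' v \<in> Num Ocl}" "w \<in> {v. smult z' v \<in> Num Ocl}" for v w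
        using that NS(2) by (simp add: smult_rules)
      show "smult r v \<in> {v. smult z' v \<in> Num Ocl}" if "r \<in> Ocl" "v \<in> {v. smult z' v \<in> Num Ocl}" for r v
        using NS(3)[OF that(1), of "smult z' v"] that(2) by (simp add: smult_rules mult.commute)
    qed
  qed
  note bdd = this
  let ?X = "{f \<in> comp_W i. emb i f \<in> ohull M}"
  have X1: "?X \<subseteq> comp_W i" by blast
  have "submod Ocl scf ?X"
  proof (rule submodI)
    have "emb i 0 = 0" by (auto simp: emb_def fun_eq_iff)
    then show "0 \<in> ?X" using submodD(1)[OF Ls] U.zero_W by simp
    show "f + g \<in> ?X" if "f \<in> ?X" "g \<in> ?X" for f g
      using that submodD(2)[OF Ls] U.W_closed(1) by (simp add: emb_linear)
    show "scf r f \<in> ?X" if "r \<in> Ocl" "f \<in> ?X" for r f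
      using that submodD(3)[OF Ls] U.W_closed(2) by (simp add: emb_linear)
  qed
  moreover have "\<forall>f\<in>comp_W i. (\<forall>j<s i. f j \<in> Ocl) \<longrightarrow> scf z f \<in> ?X"
  proof (intro ballI impI)
    fix f assume f: "f \<in> comp_W i" "\<forall>j<s i. f j \<in> Ocl"
    have "f j \<in> Ocl" for j using f Ocl_rules(2) comp_W_iff[OF i, of f] by (cases "j < s i") auto
    then have "emb i f \<in> Num Ocl" unfolding Num_Ocl_iff using emb_V[OF i f(1)] Ocl_rules(2) by (simp add: emb_def)
    then have "smult z (emb i f) \<in> ohull M" using z(2) MH by blast
    then show "scf z f \<in> ?X" using U.W_closed(2)[OF f(1)] by (simp add: emb_linear)
  qed
  moreover have "\<forall>f\<in>?X. \<forall>j<s i. z' * f j \<in> Ocl"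
  proof (intro ballI allI impI)
    fix f j assume "f \<in> ?X"
    then have "smult z' (emb i f) \<in> Num Ocl" using bdd by blast
    then have "smult z' (emb i f) i j \<in> Ocl" using Num_Ocl_iff by blast
    then show "z' * f j \<in> Ocl" by (simp add: smult_def)
  qed
  ultimately have "\<exists>T T' I. lin_pair scf (comp_W i) T T' \<and> frac (e i) I \<and>
    (\<forall>f\<in>comp_W i. f \<in> ?X \<longleftrightarrow> T f \<in> comp_block i I)"
    by (intro U.steinitz[OF s_pos[OF i] X1 _ z(1) _ z'(1)])
  then show ?thesis by auto
qed

text \<open>In each component the ideal from Steinitz' theorem is equivalent to a listed
  representative, hence to the component of \<open>J\<close>, and scaling the last coordinate
  realises this. The list \<open>Is\<close> is fixed before \<open>J\<close>, because
  \<open>J\<close> is a choice of the algorithm.\<close>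

lemma lattice_normal_form:
  assumes A: "pic_subroutine pic" and M: "M \<in> lattices"
  obtains Is where "Is \<in> set (product_lists (map pic [0..<n]))"
    "\<And>J. (direct_sum Is, J) \<in> pic_rel Z Q 1 Ocl \<Longrightarrow>
      \<exists>\<sigma> \<sigma>'. lin_pair smult V \<sigma> \<sigma>' \<and> (\<forall>v\<in>V. v \<in> ohull M \<longleftrightarrow> \<sigma> v \<in> Num J)"
proof -
  have MV: "M \<subseteq> V" using M lattices_iff by blast
  have Ls: "submod Ocl smult (ohull M)" unfolding ohull_def by (rule submod_hull)
  have LV: "ohull M \<subseteq> V" unfolding ohull_def by (rule hull_minimal[OF MV]) (rule V_submod)
  define nf where "nf i p \<longleftrightarrow> lin_pair scf (comp_W i) (fst p) (fst (snd p)) \<and>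
    (\<exists>I. frac (e i) I \<and> (I, snd (snd p)) \<in> pic_rel Z Q (e i) (proj (e i) Ocl) \<and>
    snd (snd p) \<in> set (pic i) \<and>
    (\<forall>f\<in>comp_W i. emb i f \<in> ohull M \<longleftrightarrow> fst p f \<in> comp_block i I))" for i p
  have "\<forall>i\<in>{..<n}. \<exists>p. nf i p"
  proof
    fix i assume "i \<in> {..<n}"
    then have i: "i < n" by simp
    interpret U: idempotent_setting Z Q n e s R "e i" by (rule component_setting[OF i])
    obtain T T' I where T: "lin_pair scf (comp_W i) T T'" and I: "frac (e i) I"
      and TI: "\<forall>f\<in>comp_W i. emb i f \<in> ohull M \<longleftrightarrow> T f \<in> comp_block i I"
      using component_normal_form[OF M i] by blast
    have "pic_rel Z Q (e i) (proj (e i) Ocl) `` {I} \<in> Pic Z Q (e i) (proj (e i) Ocl)"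
      unfolding Pic_def by (rule quotientI) (use I U.invertible_ideals_eq in simp)
    then have "\<exists>!k. k < length (pic i) \<and> pic i ! k \<in> pic_rel Z Q (e i) (proj (e i) Ocl) `` {I}"
      using A i unfolding pic_subroutine_def by blast
    then obtain k where k: "k < length (pic i)" "(I, pic i ! k) \<in> pic_rel Z Q (e i) (proj (e i) Ocl)" by auto
    have "nf i (T, T', pic i ! k)" unfolding nf_def using T I TI k nth_mem[OF k(1)] by auto
    then show "\<exists>p. nf i p" by blast
  qed
  from bchoice[OF this] obtain p where p: "\<forall>i\<in>{..<n}. nf i (p i)" ..
  define Is where "Is = map (\<lambda>i. snd (snd (p i))) [0..<n]"
  have Isi: "Is ! i = snd (snd (p i))" if "i < n" for i using that by (simp add: Is_def)
  have "Is ! i \<in> set (pic i)" if "i < n" for i using p that Isi unfolding nf_def by auto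
  then have "Is \<in> set (product_lists (map pic [0..<n]))"
    unfolding product_lists_set by (simp add: list_all2_conv_all_nth Is_def)
  moreover have "\<exists>\<sigma> \<sigma>'. lin_pair smult V \<sigma> \<sigma>' \<and> (\<forall>v\<in>V. v \<in> ohull M \<longleftrightarrow> \<sigma> v \<in> Num J)"
    if J: "(direct_sum Is, J) \<in> pic_rel Z Q 1 Ocl" for J
  proof -
    have Isf: "frac (e i) (Is ! i)" if i: "i < n" for i
    proof -
      have "nf i (p i)" using p i by simp
      then obtain I where "(I, Is ! i) \<in> pic_rel Z Q (e i) (proj (e i) Ocl)" unfolding nf_def Isi[OF i] by blast
      then show ?thesis unfolding pic_rel_iff[OF e_idem[OF i]] by blast
    qed
    have Js: "submod Ocl (*) J" using J pic_rel_iff[of 1 "direct_sum Is" J] frac_1_iff by simp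
    define st where "st i q \<longleftrightarrow> lin_pair scf (comp_W i) (fst q) (snd q) \<and>
      (\<forall>f\<in>comp_W i. emb i f \<in> ohull M \<longleftrightarrow> fst q f \<in> comp_block i (proj (e i) J))" for i q
    have "\<forall>i\<in>{..<n}. \<exists>q. st i q"
    proof
      fix i assume "i \<in> {..<n}"
      then have i: "i < n" by simp
      let ?T = "fst (p i)" and ?T' = "fst (snd (p i))"
      have "nf i (p i)" using p i by simp
      then obtain I where T: "lin_pair scf (comp_W i) ?T ?T'" and I: "frac (e i) I"
        and rel: "(I, Is ! i) \<in> pic_rel Z Q (e i) (proj (e i) Ocl)"
        and TI: "\<forall>f\<in>comp_W i. emb i f \<in> ohull M \<longleftrightarrow> ?T f \<in> comp_block i I"
        unfolding nf_def Isi[OF i] by blast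
      have "(Is ! i, proj (e i) J) \<in> pic_rel Z Q (e i) (proj (e i) Ocl)"
        using pic_rel_component[OF J i] direct_sum_frac(2)[of Is i, OF Isf i] by simp
      then have "(I, proj (e i) J) \<in> pic_rel Z Q (e i) (proj (e i) Ocl)"
        by (rule pic_rel_trans[OF e_idem[OF i] rel])
      then obtain c c' where c: "e i * c = c" "e i * c' = c'" "c * c' = e i" "proj (e i) J = (*) c ` I"
        unfolding pic_rel_iff[OF e_idem[OF i]] by blast
      let ?D = "\<lambda>f. f(s i - 1 := c * f (s i - 1))" and ?D' = "\<lambda>f. f(s i - 1 := c' * f (s i - 1))"
      have D: "lin_pair scf (comp_W i) ?D ?D'" by (rule lin_pair_scale_last[OF i c(1-3)])
      have DD: "g \<in> comp_block i I \<longleftrightarrow> ?D g \<in> comp_block i (proj (e i) J)" if g: "g \<in> comp_W i" for g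
      proof -
        have DW: "?D g \<in> comp_W i" by (rule lin_pairD(1)[OF D g])
        have "g (s i - 1) \<in> I \<longleftrightarrow> c * g (s i - 1) \<in> (*) c ` I"
        proof
          assume "c * g (s i - 1) \<in> (*) c ` I"
          then obtain a where a: "a \<in> I" "c * g (s i - 1) = c * a" by blast
          have "(c' * c) * g (s i - 1) = (c' * c) * a" using a(2) by (simp add: mult.assoc)
          moreover have "c' * c = e i" using c(3) by (simp add: mult.commute)
          ultimately have "g (s i - 1) = a"
            using comp_W_fix[OF i g] fracD(2)[OF e_idem[OF i] I a(1)] by simp
          then show "g (s i - 1) \<in> I" using a(1) by simp
        qed (rule imageI)
        then show ?thesis unfolding comp_block_iff[OF i] using g DW c(4) by simp
      qed
      have "lin_pair scf (comp_W i) (?D \<circ> ?T) (?T' \<circ> ?D')" by (rule lin_pair_comp[OF T D])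
      moreover have "emb i f \<in> ohull M \<longleftrightarrow> (?D \<circ> ?T) f \<in> comp_block i (proj (e i) J)" if f: "f \<in> comp_W i" for f
        using TI f DD[OF lin_pairD(1)[OF T f]] by simp
      ultimately have "st i (?D \<circ> ?T, ?T' \<circ> ?D')" unfolding st_def by simp
      then show "\<exists>q. st i q" by blast
    qed
    from bchoice[OF this] obtain q where q: "\<forall>i\<in>{..<n}. st i (q i)" ..
    let ?\<sigma> = "asm_map (\<lambda>i. fst (q i))" and ?\<sigma>' = "asm_map (\<lambda>i. snd (q i))"
    have \<sigma>: "lin_pair smult V ?\<sigma> ?\<sigma>'" by (rule asm_lin_pair) (use q in \<open>auto simp: st_def\<close>)
    have "v \<in> ohull M \<longleftrightarrow> ?\<sigma> v \<in> Num J" if v: "v \<in> V" for v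
    proof -
      have comp: "v i \<in> comp_W i" if "i < n" for i using v that V_iff by blast
      have "v \<in> ohull M \<longleftrightarrow> (\<forall>i<n. emb i (v i) \<in> ohull M)" by (rule hull_component[OF Ls LV v])
      also have "\<dots> \<longleftrightarrow> (\<forall>i<n. fst (q i) (v i) \<in> comp_block i (proj (e i) J))"
        using q comp by (auto simp: st_def)
      also have "\<dots> \<longleftrightarrow> ?\<sigma> v \<in> Num J" unfolding Num_iff_block[OF Js] by (simp add: asm_map_def)
      finally show ?thesis .
    qed
    then show ?thesis using \<sigma> by blast
  qed
  ultimately show thesis using that by blast
qed

text \<open>The image of \<open>M\<close> contains \<open>Den J\<close>, because the conductor
  multiplies \<open>ohull M\<close> into \<open>M\<close>. Adding \<open>Den Ocl\<close> therefore
  yields nothing new inside \<open>Num J\<close>.\<close>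

lemma lattice_iso_mid:
  assumes M: "M \<in> lattices" and J: "coprime_ideal J" and \<sigma>: "lin_pair smult V \<sigma> \<sigma>'"
    and \<sigma>J: "\<And>v. v \<in> V \<Longrightarrow> v \<in> ohull M \<longleftrightarrow> \<sigma> v \<in> Num J"
  obtains N where "mid N" "\<sigma> ` M = N \<inter> Num J"
proof -
  note Js = coprime_idealD(1)[OF J]
  have MR: "submod R smult M" and MV: "M \<subseteq> V" using M lattices_iff by blast+
  have MH: "M \<subseteq> ohull M" unfolding ohull_def by (rule hull_subset)
  let ?M = "\<sigma> ` M"
  have MN: "?M \<subseteq> Num J" using \<sigma>J MH MV by blast
  note D = lin_pairD[OF \<sigma>]
  have MR': "submod R smult ?M"
  proof (rule submodI)
    have "\<sigma> 0 = 0" using D(6)[OF V_closed(3), of 0] by (simp add: smult_def zero_fun_def)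
    then show "0 \<in> ?M" using submodD(1)[OF MR] by (metis imageI)
    show "x + y \<in> ?M" if "x \<in> ?M" "y \<in> ?M" for x y
    proof -
      have "\<exists>a b. a \<in> M \<and> b \<in> M \<and> x = \<sigma> a \<and> y = \<sigma> b" using that by blast
      then obtain a b where ab: "a \<in> M" "b \<in> M" "x = \<sigma> a" "y = \<sigma> b" by blast
      have "\<sigma> (a + b) = x + y" using D(5)[of a b] ab MV by auto
      then show ?thesis using submodD(2)[OF MR ab(1,2)] by (metis imageI)
    qed
    show "smult r x \<in> ?M" if "r \<in> R" "x \<in> ?M" for r x
    proof -
      have "\<exists>a. a \<in> M \<and> x = \<sigma> a" using that by blast
      then obtain a where a: "a \<in> M" "x = \<sigma> a" by blast
      have "\<sigma> (smult r a) = smult r x" using D(6)[of a r] a MV by auto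
      then show ?thesis using submodD(3)[OF MR that(1) a(1)] by (metis imageI)
    qed
  qed
  \<comment> \<open>As the conductor is an \<open>Ocl\<close>-module inside \<open>R\<close>, the
    vectors that it multiplies into \<open>M\<close> form an \<open>Ocl\<close>-module containing
    \<open>M\<close>.\<close>
  have condL: "ohull M \<subseteq> {v \<in> V. \<forall>c\<in>cond. smult c v \<in> M}" unfolding ohull_def
  proof (rule hull_minimal)
    show "M \<subseteq> {v \<in> V. \<forall>c\<in>cond. smult c v \<in> M}" using submodD(3)[OF MR] cond_sub_R MV by blast
    show "submod Ocl smult {v \<in> V. \<forall>c\<in>cond. smult c v \<in> M}"
    proof (rule submodI)
      have "smult c 0 = 0" for c :: 'k by (simp add: smult_def zero_fun_def)
      then show "0 \<in> {v \<in> V. \<forall>c\<in>cond. smult c v \<in> M}" using V_closed(3) submodD(1)[OF MR] by simp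
      show "v + w \<in> {v \<in> V. \<forall>c\<in>cond. smult c v \<in> M}"
        if "v \<in> {v \<in> V. \<forall>c\<in>cond. smult c v \<in> M}" "w \<in> {v \<in> V. \<forall>c\<in>cond. smult c v \<in> M}" for v w
        using that V_closed(1) submodD(2)[OF MR] by (simp add: smult_rules)
      show "smult r v \<in> {v \<in> V. \<forall>c\<in>cond. smult c v \<in> M}"
        if "r \<in> Ocl" "v \<in> {v \<in> V. \<forall>c\<in>cond. smult c v \<in> M}" for r v
        using that V_closed(2) submodD(3)[OF cond_submod that(1)] by (simp add: smult_rules mult.commute)
    qed
  qed
  have condN: "smult c v \<in> ?M" if c: "c \<in> cond" and v: "v \<in> Num J" for c v
  proof -
    have vV: "v \<in> V" using v Num_iff[OF Js] by blast
    have "\<sigma> (\<sigma>' v) = v" by (rule D(4)[OF vV])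
    then have "\<sigma>' v \<in> ohull M" using \<sigma>J[OF D(2)[OF vV]] v by simp
    then have "smult c (\<sigma>' v) \<in> M" using condL c by blast
    moreover have "\<sigma> (smult c (\<sigma>' v)) = smult c v" using D(6)[OF D(2)[OF vV]] D(4)[OF vV] by simp
    ultimately show ?thesis by (metis imageI)
  qed
  obtain a where a: "a \<in> J" "1 - a \<in> cond" using coprime_idealD(4)[OF J] by blast
  \<comment> \<open>A vector \<open>v\<close> of \<open>Den J\<close> is split by \<open>a\<close>:
    \<open>smult (1 - a) v\<close> is a conductor multiple of a vector of \<open>Num J\<close>, and
    \<open>smult a v\<close> is a sum of such multiples, with the entries of \<open>v\<close> as
    conductor factors and \<open>a\<close> placing the coordinate vectors in
    \<open>Num J\<close>.\<close>
  have DJ: "Den J \<subseteq> ?M"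
  proof
    fix v assume v: "v \<in> Den J"
    have vN: "v \<in> Num J" and vc: "\<And>i j. v i j \<in> cond" using v Den_iff[OF J] by blast+
    have vV: "v \<in> V" using vN Num_iff[OF Js] by blast
    have "single i j (a * v i j) \<in> ?M" if ij: "i < n" "j < s i" for i j
    proof -
      have "e i * a \<in> J" using submodD(3)[OF Js idempotent_Ocl[OF e_idem[OF ij(1)]] a(1)] .
      moreover have "single i j (e i * a) \<in> V"
        unfolding V_iff using ij by (auto simp: comp_W_iff single_def fun_eq_iff e_idem mult.assoc[symmetric])
      ultimately have "single i j (e i * a) \<in> Num J"
        unfolding Num_iff[OF Js] using coprime_idealD(2)[OF J] submodD(1)[OF Js] Ocl_rules(2) by (auto simp: single_def)
      from condN[OF vc this] have "smult (v i j) (single i j (e i * a)) \<in> ?M" .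
      moreover have "v i j * (e i * a) = a * v i j" using V_fix[OF vV ij(1), of j] by (metis mult.assoc mult.commute)
      then have "smult (v i j) (single i j (e i * a)) = single i j (a * v i j)"
        by (auto simp: smult_def single_def fun_eq_iff)
      ultimately show ?thesis by simp
    qed
    then have "(\<Sum>i<n. \<Sum>j<s i. single i j (smult a v i j)) \<in> ?M"
      by (intro submod_sum[OF MR']) (auto simp: smult_def)
    then have 1: "smult a v \<in> ?M" by (subst V_expand[OF V_closed(2)[OF vV]])
    have 2: "smult (1 - a) v \<in> ?M" by (rule condN[OF a(2) vN])
    have "smult a v + smult (1 - a) v = v" by (auto simp: smult_def fun_eq_iff algebra_simps)
    then show "v \<in> ?M" using submodD(2)[OF MR' 1 2] by simp
  qed
  let ?N = "?M + Den Ocl"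
  have NS: "submod R smult ?N"
  proof (rule subring_module.submod_plus[OF _ MR' submod_mono[OF R_sub_Ocl Den_submod[OF Ocl_coprime]]])
    show "subring_module (smult :: 'k \<Rightarrow> 'k vec \<Rightarrow> 'k vec) R"
      by (intro subring_module.intro Vm.module_sc R_subring)
  qed
  have MsubN: "?M \<subseteq> ?N"
    using set_plus_intro[OF _ submodD(1)[OF Den_submod[OF Ocl_coprime]], of _ ?M] by auto
  have DsubN: "Den Ocl \<subseteq> ?N" using set_plus_intro[OF submodD(1)[OF MR'], of _ "Den Ocl"] by auto
  note OS = Num_closed[OF coprime_idealD(1)[OF Ocl_coprime]]
  have NN: "?N \<subseteq> Num Ocl"
  proof
    fix v assume "v \<in> ?N"
    then obtain m d where "v = m + d" "m \<in> ?M" "d \<in> Den Ocl" by (elim set_plus_elim)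
    then show "v \<in> Num Ocl" using MN Den_Int_Num[OF J] Den_Int_Num[OF Ocl_coprime] submodD(2)[OF OS] by blast
  qed
  have Hs: "submod Ocl smult (ohull ?N)" unfolding ohull_def by (rule submod_hull)
  have NH: "?N \<subseteq> ohull ?N" unfolding ohull_def by (rule hull_subset)
  have "\<sigma> ` ohull M \<subseteq> ohull ?N"
    by (rule lin_pair_hull(1)[OF \<sigma> MV _ Hs]) (use MsubN NH in blast)
  then have NJ: "v \<in> ohull ?N" if v: "v \<in> Num J" for v
  proof -
    assume sub: "\<sigma> ` ohull M \<subseteq> ohull ?N"
    have vV: "v \<in> V" using v Num_iff[OF Js] by blast
    have "\<sigma>' v \<in> ohull M" using \<sigma>J[OF D(2)[OF vV]] v D(4)[OF vV] by simp
    then have "\<sigma> (\<sigma>' v) \<in> ohull ?N" using sub by blast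
    then show ?thesis using D(4)[OF vV] by simp
  qed
  have "ohull ?N = Num Ocl"
  proof
    show "ohull ?N \<subseteq> Num Ocl" unfolding ohull_def by (rule hull_minimal) (use NN OS in auto)
    show "Num Ocl \<subseteq> ohull ?N"
    proof
      fix v assume "v \<in> Num Ocl"
      then obtain w where w: "w \<in> Num J" "v - w \<in> Den Ocl" using Num_approx[OF J] by blast
      have "w + (v - w) \<in> ohull ?N" by (rule submodD(2)[OF Hs NJ[OF w(1)]]) (use w(2) DsubN NH in blast)
      then show "v \<in> ohull ?N" by simp
    qed
  qed
  then have "mid ?N" unfolding mid_def using NS DsubN NN by blast
  moreover have "?M = ?N \<inter> Num J"
  proof
    show "?M \<subseteq> ?N \<inter> Num J" using MsubN MN by blast
    show "?N \<inter> Num J \<subseteq> ?M"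
    proof
      fix v assume v: "v \<in> ?N \<inter> Num J"
      then have "v \<in> ?N" by blast
      then obtain m d where md: "v = m + d" "m \<in> ?M" "d \<in> Den Ocl" by (elim set_plus_elim)
      have "v - m \<in> Num J" by (rule V_diff[OF submod_mono[OF R_sub_Ocl Num_closed[OF Js]]]) (use v md MN in auto)
      then have "d \<in> Den J" using md Den_Int_Num(1)[OF J] by simp
      then have "d \<in> ?M" using DJ by blast
      then show "v \<in> ?M" using submodD(2)[OF MR' md(2)] md(1) by simp
    qed
  qed
  ultimately show thesis using that by blast
qed

text \<open>The specification counts positions, not ideals: each class is met at exactly one index.
  So equal entries at two positions are excluded as well as equivalent ones.\<close>

lemma pic_subroutineD:
  assumes A: "pic_subroutine pic" and i: "i < n"
  shows "I \<in> set (pic i) \<Longrightarrow> frac (e i) I" "distinct (pic i)"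
    "I \<in> set (pic i) \<Longrightarrow> J \<in> set (pic i) \<Longrightarrow> (I, J) \<in> pic_rel Z Q (e i) (proj (e i) Ocl) \<Longrightarrow> I = J"
proof -
  interpret U: idempotent_setting Z Q n e s R "e i" by (rule component_setting[OF i])
  note spec = A[unfolded pic_subroutine_def, THEN spec, THEN mp, OF i]
  have sub: "set (pic i) \<subseteq> {I. frac (e i) I}"
    using spec[THEN conjunct1] unfolding U.invertible_ideals_eq .
  have uniq: "\<exists>!k. k < length (pic i) \<and> pic i ! k \<in> C" if "C \<in> Pic Z Q (e i) (proj (e i) Ocl)" for C
    by (rule spec[THEN conjunct2, THEN bspec, OF that])
  show fr: "frac (e i) I" if "I \<in> set (pic i)" for I using sub that by blast
  have idx: "k = l" if kl: "k < length (pic i)" "l < length (pic i)" "(pic i ! k, pic i ! l) \<in> pic_rel Z Q (e i) (proj (e i) Ocl)" for k l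
  proof -
    have f: "frac (e i) (pic i ! k)" using fr nth_mem[OF kl(1)] by blast
    have "pic_rel Z Q (e i) (proj (e i) Ocl) `` {pic i ! k} \<in> Pic Z Q (e i) (proj (e i) Ocl)"
      unfolding Pic_def by (rule quotientI) (use f U.invertible_ideals_eq in simp)
    from uniq[OF this] show ?thesis using kl pic_rel_refl[OF e_idem[OF i] f] by blast
  qed
  show "distinct (pic i)" unfolding distinct_conv_nth
  proof (intro allI impI)
    fix k l assume kl: "k < length (pic i)" "l < length (pic i)" "k \<noteq> l"
    show "pic i ! k \<noteq> pic i ! l"
    proof
      assume "pic i ! k = pic i ! l"
      then have "(pic i ! k, pic i ! l) \<in> pic_rel Z Q (e i) (proj (e i) Ocl)"
        using pic_rel_refl[OF e_idem[OF i] fr[OF nth_mem[OF kl(1)]]] by simp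
      then show False using idx kl by blast
    qed
  qed
  show "I = J" if "I \<in> set (pic i)" "J \<in> set (pic i)" "(I, J) \<in> pic_rel Z Q (e i) (proj (e i) Ocl)" for I J
    using that idx by (metis in_set_conv_nth)
qed

lemma product_listsD:
  assumes "Is \<in> set (product_lists (map pic [0..<n]))"
  shows "length Is = n" "i < n \<Longrightarrow> Is ! i \<in> set (pic i)"
  using assms unfolding product_lists_set by (auto simp: list_all2_conv_all_nth)

text \<open>An isomorphism extends to one of the numerators, so uniqueness in Steinitz' theorem
  makes \<open>J\<close> and \<open>J'\<close> equivalent in each component, and with them the
  listed representatives.\<close>

lemma pic_class_unique:
  assumes A: "pic_subroutine pic"
    and Is: "Is \<in> set (product_lists (map pic [0..<n]))" "Is' \<in> set (product_lists (map pic [0..<n]))"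
    and J: "(direct_sum Is, J) \<in> pic_rel Z Q 1 Ocl" "(direct_sum Is', J') \<in> pic_rel Z Q 1 Ocl"
    and cop: "coprime_ideal J" "coprime_ideal J'" and M: "mid M" "mid M'"
    and iso: "R_iso (M \<inter> Num J) (M' \<inter> Num J')"
  shows "Is = Is'"
proof (rule nth_equalityI)
  show "length Is = length Is'" using product_listsD(1) Is by metis
  fix i assume "i < length Is"
  then have i: "i < n" using product_listsD(1)[OF Is(1)] by simp
  note ee = e_idem[OF i]
  obtain \<theta> \<theta>' where \<theta>: "lin_pair smult V \<theta> \<theta>'" "\<theta> ` (M \<inter> Num J) = M' \<inter> Num J'"
    "\<theta>' ` (M' \<inter> Num J') = M \<inter> Num J" "\<theta> ` Num J \<subseteq> Num J'" "\<theta>' ` Num J' \<subseteq> Num J"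
    using iso_Num[OF mid_in_lattices[OF M(1) cop(1)] mid_hull[OF M(1) cop(1)]
      mid_in_lattices[OF M(2) cop(2)] mid_hull[OF M(2) cop(2)] coprime_idealD(1)[OF cop(1)] coprime_idealD(1)[OF cop(2)] iso] .
  have 1: "(proj (e i) J, proj (e i) J') \<in> pic_rel Z Q (e i) (proj (e i) Ocl)"
    unfolding pic_rel_iff[OF ee]
    using iso_Num_ideal_class[OF \<theta>(1) coprime_idealD(3)[OF cop(1)] coprime_idealD(3)[OF cop(2)] \<theta>(4,5) i]
      proj_frac[OF i coprime_idealD(3)[OF cop(1)]] proj_frac[OF i coprime_idealD(3)[OF cop(2)]] by blast
  have ds: "proj (e i) (direct_sum Is) = Is ! i" if "Is \<in> set (product_lists (map pic [0..<n]))" for Is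
    by (rule direct_sum_frac(2)[OF _ i]) (use pic_subroutineD(1)[OF A] product_listsD(2)[OF that] in blast)
  have 2: "(Is ! i, proj (e i) J) \<in> pic_rel Z Q (e i) (proj (e i) Ocl)"
    using pic_rel_component[OF J(1) i] ds[OF Is(1)] by simp
  have 3: "(proj (e i) J', Is' ! i) \<in> pic_rel Z Q (e i) (proj (e i) Ocl)"
    using pic_rel_sym[OF ee pic_rel_component[OF J(2) i]] ds[OF Is(2)] by simp
  show "Is ! i = Is' ! i"
    by (rule pic_subroutineD(3)[OF A i product_listsD(2)[OF Is(1) i] product_listsD(2)[OF Is(2) i]
      pic_rel_trans[OF ee pic_rel_trans[OF ee 2 1] 3]])
qed

text \<open>Guards the correctness statement against vacuity: a coprime ideal and an induced
  isomorphism can be chosen for each representative, whatever the other two subroutines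
  return.\<close>

lemma algorithm_output_exists:
  assumes A: "pic_subroutine pic"
  shows "\<exists>out. algorithm_output pic subm isot out"
proof -
  let ?P = "\<lambda>I (J, \<psi>). (I, J) \<in> pic_rel Z Q 1 Ocl \<and> coprime_to_cond J \<and> induced_iso J \<psi>"
  have "\<exists>c. ?P I c" if I: "I \<in> set (pic_reps pic)" for I
  proof -
    obtain Is where Is: "Is \<in> set (product_lists (map pic [0..<n]))" "I = direct_sum Is"
      using I unfolding pic_reps_def by auto
    have "fractional_ideal Z Q 1 Ocl I" unfolding Is(2)
      by (rule direct_sum_frac(1)) (use pic_subroutineD(1)[OF A] product_listsD(2)[OF Is(1)] in blast)
    then obtain J where J: "(I, J) \<in> pic_rel Z Q 1 Ocl" "coprime_to_cond J" using coprime_representative by blast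
    obtain \<psi> where "induced_iso J \<psi>" using induced_iso_exists[OF pic_rel_coprime_ideal[OF J]] by blast
    then have "?P I (J, \<psi>)" using J by simp
    then show ?thesis by blast
  qed
  then have "\<forall>I\<in>set (pic_reps pic). \<exists>c. ?P I c" by blast
  from bchoice[OF this] obtain c where c: "\<forall>I\<in>set (pic_reps pic). ?P I (c I)" ..
  have "list_all2 ?P (pic_reps pic) (map c (pic_reps pic))"
    using c by (simp add: list_all2_conv_all_nth)
  then show ?thesis unfolding algorithm_output_def by blast
qed

lemma algorithm_output_correct:
  assumes A: "pic_subroutine pic" and B: "submods_subroutine subm" and C: "iso_subroutine isot"
    and out: "algorithm_output pic subm isot out"
  shows "minimal_representatives out"
proof -
  let ?BL = "base_list subm isot" and ?Ls = "product_lists (map pic [0..<n])"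
  note BL = base_list_spec[OF B C]
  obtain choices where ch: "list_all2 (\<lambda>I (J, \<psi>). (I, J) \<in> pic_rel Z Q 1 Ocl \<and> coprime_to_cond J \<and> induced_iso J \<psi>)
       (pic_reps pic) choices" and
    out0: "out = concat (map (\<lambda>(J, \<psi>). map (\<lambda>M. q_preimage J (\<psi> ` (q Ocl ` M))) ?BL) choices)"
    using out unfolding algorithm_output_def by blast
  have len: "length choices = length ?Ls" using list_all2_lengthD[OF ch] by (simp add: pic_reps_def)
  define J where "J k = fst (choices ! k)" for k
  have chk: "(direct_sum (?Ls ! k), J k) \<in> pic_rel Z Q 1 Ocl \<and> coprime_to_cond (J k) \<and> induced_iso (J k) (snd (choices ! k))"
    if "k < length ?Ls" for k
    using list_all2_nthD[OF ch, of k] that by (auto simp: pic_reps_def J_def split: prod.splits)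
  have cop: "coprime_ideal (J k)" if "k < length ?Ls" for k using chk[OF that] pic_rel_coprime_ideal by blast
  \<comment> \<open>Both the cosets and the chosen isomorphisms disappear here: the output depends
    only on the ideals \<open>J k\<close>.\<close>
  have out1: "out = concat (map (\<lambda>k. map (\<lambda>M. M \<inter> Num (J k)) ?BL) [0..<length ?Ls])"
  proof -
    have "map (\<lambda>(J, \<psi>). map (\<lambda>M. q_preimage J (\<psi> ` (q Ocl ` M))) ?BL) choices
      = map (\<lambda>k. map (\<lambda>M. M \<inter> Num (J k)) ?BL) [0..<length ?Ls]"
    proof (rule nth_equalityI)
      fix k assume "k < length (map (\<lambda>(J, \<psi>). map (\<lambda>M. q_preimage J (\<psi> ` (q Ocl ` M))) ?BL) choices)"
      then have k: "k < length ?Ls" using len by simp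
      have "map (\<lambda>M. q_preimage (J k) (snd (choices ! k) ` (q Ocl ` M))) ?BL = map (\<lambda>M. M \<inter> Num (J k)) ?BL"
        by (rule map_cong[OF refl]) (use output_module[OF cop[OF k]] chk[OF k] BL(1) in blast)
      then show "map (\<lambda>(J, \<psi>). map (\<lambda>M. q_preimage J (\<psi> ` (q Ocl ` M))) ?BL) choices ! k
        = map (\<lambda>k. map (\<lambda>M. M \<inter> Num (J k)) ?BL) [0..<length ?Ls] ! k"
        using k len by (simp add: J_def split_beta)
    qed (simp add: len)
    then show ?thesis unfolding out0 by simp
  qed
  have set_out: "set out = {M \<inter> Num (J k) | M k. M \<in> set ?BL \<and> k < length ?Ls}"
    unfolding out1 by (auto, blast)
  have lat: "set out \<subseteq> lattices" unfolding set_out using mid_in_lattices BL(1) cop by blast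
  have distinct: "distinct ?Ls"
    by (rule distinct_product_lists) (use pic_subroutineD(2)[OF A] in auto)
  have "sorted_wrt (\<lambda>M N. \<not> R_iso M N) out" unfolding out1
  proof (rule sorted_wrt_concat)
    fix xs assume "xs \<in> set (map (\<lambda>k. map (\<lambda>M. M \<inter> Num (J k)) ?BL) [0..<length ?Ls])"
    then obtain k where k: "k < length ?Ls" "xs = map (\<lambda>M. M \<inter> Num (J k)) ?BL" by auto
    \<comment> \<open>An isomorphism of the intersections would transfer back to the case of
      \<open>Ocl\<close>, where intersecting changes nothing.\<close>
    have "\<not> R_iso (M \<inter> Num (J k)) (N \<inter> Num (J k))" if "M \<in> set ?BL" "N \<in> set ?BL" "\<not> R_iso M N" for M N
      using mid_transfer[OF cop[OF k(1)] Ocl_coprime BL(1)[OF that(1)] BL(1)[OF that(2)]] that(3)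
        mid_Int[OF BL(1)[OF that(1)]] mid_Int[OF BL(1)[OF that(2)]] by auto
    then show "sorted_wrt (\<lambda>M N. \<not> R_iso M N) xs" unfolding k(2) sorted_wrt_map
      by (intro sorted_wrt_mono_rel[OF _ BL(3)])
  next
    show "sorted_wrt (\<lambda>xs ys. \<forall>M\<in>set xs. \<forall>N\<in>set ys. \<not> R_iso M N) (map (\<lambda>k. map (\<lambda>M. M \<inter> Num (J k)) ?BL) [0..<length ?Ls])"
      unfolding sorted_wrt_iff_nth_less
    proof (intro allI impI ballI)
      fix k l M N
      assume kl: "k < l" "l < length (map (\<lambda>k. map (\<lambda>M. M \<inter> Num (J k)) ?BL) [0..<length ?Ls])"
        and M: "M \<in> set (map (\<lambda>k. map (\<lambda>M. M \<inter> Num (J k)) ?BL) [0..<length ?Ls] ! k)"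
        and N: "N \<in> set (map (\<lambda>k. map (\<lambda>M. M \<inter> Num (J k)) ?BL) [0..<length ?Ls] ! l)"
      have k: "k < length ?Ls" and l: "l < length ?Ls" using kl by auto
      obtain M0 where M0: "M0 \<in> set ?BL" "M = M0 \<inter> Num (J k)" using M k by auto
      obtain N0 where N0: "N0 \<in> set ?BL" "N = N0 \<inter> Num (J l)" using N l by auto
      show "\<not> R_iso M N"
      proof
        assume "R_iso M N"
        then have "?Ls ! k = ?Ls ! l"
          using pic_class_unique[OF A nth_mem[OF k] nth_mem[OF l] _ _ cop[OF k] cop[OF l] BL(1)[OF M0(1)] BL(1)[OF N0(1)]]
            chk[OF k] chk[OF l] M0(2) N0(2) by blast
        then show False using distinct k l kl(1) by (simp add: nth_eq_iff_index_eq)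
      qed
    qed
  qed
  \<comment> \<open>Sorting gives only the pairs in order of position; the others follow by
    \<open>R_iso_sym\<close>, as all outputs are lattices.\<close>
  then have lt: "\<not> R_iso (out ! k) (out ! l)" if "k < l" "l < length out" for k l
    using that unfolding sorted_wrt_iff_nth_less by blast
  have "\<not> R_iso (out ! k) (out ! l)" if "k < length out" "l < length out" "k \<noteq> l" for k l
  proof (cases "k < l")
    case False
    then have "\<not> R_iso (out ! l) (out ! k)" using lt that by simp
    then show ?thesis using R_iso_sym lat nth_mem[OF that(1)] nth_mem[OF that(2)] by blast
  qed (use lt that in blast)
  moreover have "\<exists>N\<in>set out. R_iso M N" if M: "M \<in> lattices" for M
  proof -
    obtain Is where Is: "Is \<in> set ?Ls" "\<And>J. (direct_sum Is, J) \<in> pic_rel Z Q 1 Ocl \<Longrightarrow>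
      \<exists>\<sigma> \<sigma>'. lin_pair smult V \<sigma> \<sigma>' \<and> (\<forall>v\<in>V. v \<in> ohull M \<longleftrightarrow> \<sigma> v \<in> Num J)"
      using lattice_normal_form[OF A M] by blast
    obtain k where k: "k < length ?Ls" "?Ls ! k = Is" using Is(1) by (metis in_set_conv_nth)
    have "(direct_sum Is, J k) \<in> pic_rel Z Q 1 Ocl" using chk[OF k(1)] k(2) by simp
    from Is(2)[OF this] obtain \<sigma> \<sigma>' where \<sigma>: "lin_pair smult V \<sigma> \<sigma>'" "\<And>v. v \<in> V \<Longrightarrow> v \<in> ohull M \<longleftrightarrow> \<sigma> v \<in> Num (J k)"
      by blast
    obtain N where N: "mid N" "\<sigma> ` M = N \<inter> Num (J k)" using lattice_iso_mid[OF M cop[OF k(1)] \<sigma>] .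
    obtain B where B: "B \<in> set ?BL" "R_iso B N" using BL(2)[OF N(1)] by blast
    note mB = BL(1)[OF B(1)]
    \<comment> \<open>The base list represents \<open>N\<close> up to isomorphism; writing both
      modules as intersections with \<open>Num Ocl\<close> brings the isomorphism into the form in
      which it can be moved to \<open>J k\<close>.\<close>
    have "R_iso (B \<inter> Num Ocl) (N \<inter> Num Ocl)" using B(2) mid_Int[OF mB] mid_Int[OF N(1)] by simp
    then have "R_iso (B \<inter> Num (J k)) (N \<inter> Num (J k))" by (rule mid_transfer[OF Ocl_coprime cop[OF k(1)] mB N(1)])
    then have "R_iso (N \<inter> Num (J k)) (B \<inter> Num (J k))"
      by (rule R_iso_sym[OF mid_in_lattices[OF mB cop[OF k(1)]] mid_in_lattices[OF N(1) cop[OF k(1)]]])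
    moreover have "R_iso M (N \<inter> Num (J k))"
      by (rule lin_pair_R_iso[OF \<sigma>(1) _ N(2)]) (use M lattices_iff in blast)
    ultimately have "R_iso M (B \<inter> Num (J k))" by (rule R_iso_trans[rotated])
    moreover have "B \<inter> Num (J k) \<in> set out" unfolding set_out using B(1) k(1) by blast
    ultimately show ?thesis by blast
  qed
  ultimately show ?thesis unfolding minimal_representatives_def using lat by blast
qed

end

theorem theorem3p6:
  fixes Z Q R :: "'k::comm_ring_1 set"
    and n :: nat and e :: "nat \<Rightarrow> 'k" and s :: "nat \<Rightarrow> nat"
    and pic :: "nat \<Rightarrow> 'k set list"
    and subm :: "'k set \<Rightarrow> 'k vec set set list"
    and isot :: "'k vec set \<Rightarrow> 'k vec set \<Rightarrow> bool"
  assumes "order_setting Z Q n e s R"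
    and A: "order_setting.pic_subroutine Z Q n e pic"
    and B: "order_setting.submods_subroutine Z Q n e s R subm"
    and C: "order_setting.iso_subroutine Z Q n e s R isot"
  shows "(\<exists>out. order_setting.algorithm_output Z Q n e s R pic subm isot out) \<and>
    (\<forall>out. order_setting.algorithm_output Z Q n e s R pic subm isot out \<longrightarrow>
      order_setting.minimal_representatives Z Q n e s R out)"
proof -
  interpret order_setting Z Q n e s R by fact
  show ?thesis using algorithm_output_exists[OF A] algorithm_output_correct[OF A B C] by blast
qed

end
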